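(* Let $m\in\mathbb{Z}_{\geq 0}$ and let $P^{(m)}\subset\mathbb{R}^{2m+6}$ be the convex hull of the vectors $v_S=\sum_{r\in S}e_r$ for $S\subset\{0,1,\ldots,2m+5\}$ with $|S|=m+1$, and $w_{ij}=\rho^{(m)}-e_i-e_j$ for $0\leq i<j\leq 2m+5$, where $\rho^{(m)}=\frac12\sum_{r=0}^{2m+5}e_r$. Then for every $\alpha\in P^{(m)}$ and every $u\in\tilde{\mathcal H}_m$ the limit \[B^m_\alpha(u)=\lim_{p\to 0}E^m(u\cdot p^{\alpha})\] exists. Moreover, if $\alpha$ and $\beta$ lie in the same open face (relative interior of a face, the polytope itself included) of $P^{(m)}$, then $B^m_\alpha(u)=B^m_\beta(u)$ for all $u\in\tilde{\mathcal H}_m$.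
   Context: Fix $q\in\mathbb{C}$ with $|q|<1$; $p\in\mathbb{C}$ with $|p|<1$ is a variable. Notation: $(x;q)=\prod_{j\geq0}(1-xq^j)$, $(a_1,\ldots,a_n;q)=\prod_i(a_i;q)$, $(xz^{\pm1};q)=(xz;q)(xz^{-1};q)$; $(z;p,q)=\prod_{j,k\geq0}(1-p^jq^kz)$; the elliptic gamma function is $\Gamma(z)=\prod_{j,k\geq 0}\frac{1-p^{j+1}q^{k+1}/z}{1-p^jq^kz}$, and $\Gamma(a_1,\dots,a_n)=\prod\Gamma(a_i)$, $\Gamma(az^{\pm1})=\Gamma(az)\Gamma(a/z)$. Let $\mathcal H_m=\{t\in\mathbb{C}^{2m+6}:\prod_r t_r=(pq)^{m+1}\}/(t\sim -t)$. For $t\in\mathcal H_m$, \[E^m(t)=\Big(\prod_{0\le r<s\le 2m+5}(t_rt_s;p,q)\Big)\frac{(p;p)(q;q)}{2}\int_{\mathcal C}\frac{\prod_{r=0}^{2m+5}\Gamma(t_rz^{\pm1})}{\Gamma(z^{\pm2})}\frac{dz}{2\pi i z},\] where $\mathcal C$ circles the origin once positively and separates the poles $z=t_rp^jq^k$ ($j,k\ge0$) from $z=t_r^{-1}p^{-j}q^{-k}$; when no such contour exists, $E^m$ is defined by analytic continuation (it is analytic on all of $\mathcal H_m$). Let $\tilde{\mathcal H}_m=\{u\in\mathbb{C}^{2m+6}:\prod_ru_r=q^{m+1}\}/(u\sim-u)$. For $\alpha\in\mathbb{R}^{2m+6}$ with $\sum_r\alpha_r=m+1$, $u\cdot p^\alpha=(u_0p^{\alpha_0},\ldots,u_{2m+5}p^{\alpha_{2m+5}})\in\mathcal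 H_m$. $e_0,\dots,e_{2m+5}$ is the standard basis of $\mathbb{R}^{2m+6}$. *)

theory Defs
  imports "HOL-Complex_Analysis.Complex_Analysis"
begin

text \<open>Conventions. The index set {0,...,2m+5} is modelled by a finite type 'n with
  CARD('n) = 2m+6; vectors in C^(2m+6) are complex^'n, vectors in R^(2m+6) are real^'n.\<close>

definition qpoch :: "complex \<Rightarrow> complex \<Rightarrow> complex" where
  "qpoch x q = prodinf (\<lambda>j. 1 - x * q ^ j)"

definition qpoch2 :: "complex \<Rightarrow> complex \<Rightarrow> complex \<Rightarrow> complex" where
  "qpoch2 z p q = prodinf (\<lambda>j. prodinf (\<lambda>k. 1 - p ^ j * q ^ k * z))"

definition egamma :: "complex \<Rightarrow> complex \<Rightarrow> complex \<Rightarrow> complex" where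
  "egamma p q z = qpoch2 (p * q / z) p q / qpoch2 z p q"

definition E_integrand :: "complex \<Rightarrow> complex \<Rightarrow> complex ^ 'n::finite \<Rightarrow> complex \<Rightarrow> complex" where
  "E_integrand p q t z =
     (\<Prod>r\<in>UNIV. egamma p q (t $ r * z) * egamma p q (t $ r / z))
     / (egamma p q (z ^ 2) * egamma p q (1 / z ^ 2))"

text \<open>Admissible contours: closed valid paths circling the origin once positively,
  separating the poles t_r p^j q^k (inside) from t_r^{-1} p^{-j} q^{-k} (outside), and
  avoiding every point where the product formula of the integrand has a vanishing
  denominator (a discrete set, so this is no restriction on the value of the integral).\<close>
definition E_admissible :: "complex \<Rightarrow> complex \<Rightarrow> complex ^ 'n::finite \<Rightarrow> (real \<Rightarrow> complex) \<Rightarrow> bool" where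
  "E_admissible p q t \<gamma> \<longleftrightarrow>
     valid_path \<gamma> \<and> pathfinish \<gamma> = pathstart \<gamma> \<and> 0 \<notin> path_image \<gamma> \<and>
     winding_number \<gamma> 0 = 1 \<and>
     (\<forall>z\<in>path_image \<gamma>.
        (\<forall>r. qpoch2 (t $ r * z) p q \<noteq> 0 \<and> qpoch2 (t $ r / z) p q \<noteq> 0) \<and>
        qpoch2 (z ^ 2) p q \<noteq> 0 \<and> qpoch2 (1 / z ^ 2) p q \<noteq> 0 \<and>
        qpoch2 (p * q / z ^ 2) p q \<noteq> 0 \<and> qpoch2 (p * q * z ^ 2) p q \<noteq> 0) \<and>
     (\<forall>r j k. winding_number \<gamma> (t $ r * p ^ j * q ^ k) = 1 \<and>
              winding_number \<gamma> (1 / (t $ r * p ^ j * q ^ k)) = 0)"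

definition H_m :: "nat \<Rightarrow> complex \<Rightarrow> complex \<Rightarrow> (complex ^ 'n::finite) set" where
  "H_m m p q = {t. (\<Prod>r\<in>UNIV. t $ r) = (p * q) ^ (m + 1)}"

definition Htilde_m :: "nat \<Rightarrow> complex \<Rightarrow> (complex ^ 'n::finite) set" where
  "Htilde_m m q = {u. (\<Prod>r\<in>UNIV. u $ r) = q ^ (m + 1)}"

text \<open>The integral representation, valid whenever an admissible contour exists.\<close>
definition E_int :: "complex \<Rightarrow> complex \<Rightarrow> complex ^ 'n::finite \<Rightarrow> complex" where
  "E_int p q t =
     (\<Prod>P\<in>{P::'n set. card P = 2}. qpoch2 (\<Prod>r\<in>P. t $ r) p q)
     * qpoch p p * qpoch q q / 2
     * contour_integral (SOME \<gamma>. E_admissible p q t \<gamma>)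
         (\<lambda>z. E_integrand p q t z / (2 * of_real pi * \<i> * z))"

text \<open>Analyticity of a function on the complex manifold H_m, via the charts obtained by
  solving prod_r t_r = (pq)^(m+1) for one coordinate k: the resulting function of the
  remaining coordinates (ranging over nonzero complex numbers) must be holomorphic,
  i.e. continuous and holomorphic in each variable separately (Osgood's lemma).\<close>
definition analytic_on_H :: "nat \<Rightarrow> complex \<Rightarrow> complex \<Rightarrow> (complex ^ 'n::finite \<Rightarrow> complex) \<Rightarrow> bool" where
  "analytic_on_H m p q F \<longleftrightarrow>
     (\<forall>k::'n.
        let D = {s::complex ^ 'n. \<forall>r. r \<noteq> k \<longrightarrow> s $ r \<noteq> 0};
            G = (\<lambda>s. F (\<chi> r. if r = k then (p * q) ^ (m + 1) / (\<Prod>r'\<in>- {k}. s $ r') else s $ r))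
        in continuous_on D G \<and>
           (\<forall>s\<in>D. \<forall>i. i \<noteq> k \<longrightarrow>
              (\<lambda>w. G (\<chi> r. if r = i then w else s $ r)) field_differentiable at (s $ i)))"

definition E_m :: "nat \<Rightarrow> complex \<Rightarrow> complex \<Rightarrow> complex ^ 'n::finite \<Rightarrow> complex" where
  "E_m m p q = (SOME F. analytic_on_H m p q F \<and>
       (\<forall>t\<in>H_m m p q. (\<exists>\<gamma>. E_admissible p q t \<gamma>) \<longrightarrow> F t = E_int p q t))"

text \<open>u . p^alpha, with p^a = p powr a (principal branch of the logarithm).\<close>
definition pscale :: "complex ^ 'n::finite \<Rightarrow> complex \<Rightarrow> real ^ 'n \<Rightarrow> complex ^ 'n" where
  "pscale u p \<alpha> = (\<chi> r. u $ r * p powr of_real (\<alpha> $ r))"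

definition rho :: "real ^ 'n::finite" where
  "rho = (\<chi> r. 1 / 2)"

definition vS :: "'n::finite set \<Rightarrow> real ^ 'n" where
  "vS S = (\<chi> r. if r \<in> S then 1 else 0)"

definition wij :: "'n::finite \<Rightarrow> 'n \<Rightarrow> real ^ 'n" where
  "wij i j = rho - axis i 1 - axis j 1"

definition polytope_P :: "nat \<Rightarrow> (real ^ 'n::finite) set" where
  "polytope_P m = convex hull ({vS S | S. card S = m + 1} \<union> {wij i j | i j. i \<noteq> j})"

definition same_open_face :: "(real ^ 'n::finite) set \<Rightarrow> real ^ 'n \<Rightarrow> real ^ 'n \<Rightarrow> bool" where
  "same_open_face P \<alpha> \<beta> \<longleftrightarrow>
     (\<exists>F. F face_of P \<and> \<alpha> \<in> rel_interior F \<and> \<beta> \<in> rel_interior F)"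

end

theory Submission
  imports Defs
begin

text \<open>
  On \<open>\<H>\<^sub>m\<close> the function \<open>E\<^sup>m\<close> is an everywhere convergent Laurent series \<open>\<Sum>\<^sub>\<kappa> c\<^sub>\<kappa>(p) t\<^sup>\<kappa>\<close> in
  all but one of the coordinates, so \<open>E\<^sup>m(u p\<^sup>\<alpha>) = \<Sum>\<^sub>\<kappa> c\<^sub>\<kappa>(p) p\<^sup>\<kappa>\<^sup>\<alpha> u\<^sup>\<kappa>\<close>. The exponents \<open>\<alpha>\<close> for which the
  coefficients \<open>c\<^sub>\<kappa>(p) p\<^sup>\<kappa>\<^sup>\<alpha>\<close> converge and decay faster than exponentially in \<open>\<kappa>\<close>, uniformly for small \<open>p\<close>,
  form a convex set, which reduces the existence of the limit to the vertices of the polytope. There the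
  integral, for \<open>w\<^sub>i\<^sub>j\<close> after symmetrising with the theta addition formula and rescaling by \<open>p\<^sup>1\<^sup>/\<^sup>2\<close>, is
  continuous up to \<open>p = 0\<close>. Within an open face, a coefficient either has the same exponent at both points, or
  prolonging the segment beyond its end points inside the face shows that both limits vanish.
\<close>

section \<open>Infinite products\<close>

text \<open>\<open>E_m\<close> selects some analytic continuation, so one has to be constructed
  first. Its Laurent coefficients are read off on a torus with all |t_r| < 1, where the unit circle
  is a contour. Decay faster than exponential needs the same coefficients on tori with one very
  large or very small radius, and between such tori the contour is pinched at the resonances t_r t_s
  p^j q^k = 1. For r \<noteq> s the prefactor vanishes there and removes the pole. For r = s it does
  not; the balancing condition then makes the residues cancel in pairs. The argument runs along
  curves in one complex variable on which, for generic p and radii with independent logarithms,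
  every resonance is met alone; other p follow by continuity of the coefficients. At w_ij rescaling
  alone fails: with z = p^(-1/2) y the outer poles of t_i and t_j tend to 0 with p. The addition
  formula replaces t_i, t_j by p t_i, p t_j in the outer poles only.\<close>

lemma prodinf_uniform_limit:
 fixes f :: "nat => 'a::topological_space => complex"
 assumes cont: "!!n. continuous_on A (f n)" and A: "compact A"
  and bd: "!!n x. x \<in> A ==> norm (f n x - 1) <= M n" and M: "summable M"
 shows "uniform_limit A (%N x. \<Prod>n<N. f n x) (%x. prodinf (%n. f n x)) sequentially"
proof -
 have uc: "uniformly_convergent_on A (%N x. \<Prod>n<N. f n x)"
 proof (rule uniformly_convergent_on_prod'[OF cont A])
  show "uniformly_convergent_on A (%N x. \<Sum>n<N. norm (f n x - 1))"
   by (rule Weierstrass_m_test'[OF _ M]) (use bd in auto)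
 qed
 have lim: "lim (%N. \<Prod>n<N. f n x) = prodinf (%n. f n x)" if "x \<in> A" for x
 proof -
  have "summable (%n. norm (f n x - 1))"
   by (rule summable_comparison_test'[OF M, of 0]) (use bd that in auto)
  hence "convergent_prod (%n. f n x)"
   by (intro abs_convergent_prod_imp_convergent_prod summable_imp_abs_convergent_prod)
  hence "(%N. \<Prod>n\<le>N. f n x) \<longlonglongrightarrow> prodinf (%n. f n x)"
   by (rule convergent_prod_LIMSEQ)
  hence "(%N. \<Prod>n<N. f n x) \<longlonglongrightarrow> prodinf (%n. f n x)"
   using LIMSEQ_lessThan_iff_atMost by blast
  thus ?thesis by (rule limI)
 qed
 have "uniform_limit A (%N x. \<Prod>n<N. f n x) (%x. lim (%N. \<Prod>n<N. f n x)) sequentially"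
  using uc uniformly_convergent_uniform_limit_iff by blast
 thus ?thesis
  by (rule uniform_limit_cong'[THEN iffD1, rotated -1]) (use lim in auto)
qed

lemma summable_geometric_scaled:
 fixes q :: complex
 assumes "norm q < 1"
 shows "summable (%j. C * norm q ^ j)"
 using assms by (intro summable_mult summable_geometric) auto

lemma convergent_prod_qpoch:
 assumes q: "norm q < 1"
 shows "convergent_prod (%j. 1 - x * q ^ j :: complex)"
proof (intro abs_convergent_prod_imp_convergent_prod summable_imp_abs_convergent_prod)
 show "summable (%n. norm (1 - x * q ^ n - 1))"
  using summable_geometric_scaled[OF q, of "norm x"] by (simp add: norm_mult norm_power)
qed

lemma qpoch_has_prod: "norm q < 1 ==> (%j. 1 - x * q ^ j) has_prod qpoch x q"
 unfolding qpoch_def by (intro convergent_prod_has_prod convergent_prod_qpoch)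

lemma qpoch_eq_0_iff: "norm q < 1 ==> qpoch x q = 0 \<longleftrightarrow> (\<exists>k. x * q ^ k = 1)"
 using has_prod_eq_0_iff[OF qpoch_has_prod[of q x]] by auto

lemma qpoch_0_left [simp]: "qpoch 0 q = 1"
 by (simp add: qpoch_def)

lemma norm_qpoch_minus_1_le:
 assumes q: "norm q < 1"
 shows "norm (qpoch y q - 1) <= exp (norm y / (1 - norm q)) - 1"
proof -
 have "(%N. \<Prod>j<N. 1 - y * q ^ j) \<longlonglongrightarrow> qpoch y q"
  using convergent_prod_LIMSEQ[OF convergent_prod_qpoch[OF q, of y]]
  unfolding qpoch_def LIMSEQ_lessThan_iff_atMost .
 hence "(%N. norm ((\<Prod>j<N. 1 - y * q ^ j) - 1)) \<longlonglongrightarrow> norm (qpoch y q - 1)"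
  by (intro tendsto_intros)
 moreover have "norm ((\<Prod>j<N. 1 - y * q ^ j) - 1) <= exp (norm y / (1 - norm q)) - 1" for N
 proof -
  have "norm ((\<Prod>j<N. 1 + (- (y * q ^ j))) - 1) <= (\<Prod>j<N. 1 + norm (- (y * q ^ j))) - 1"
   by (rule norm_prod_minus1_le_prod_minus1)
  also have "(\<Prod>j<N. 1 + norm (- (y * q ^ j))) <= exp (\<Sum>j<N. norm (- (y * q ^ j)))"
   by (rule prod_le_exp_sum) auto
  also have "(\<Sum>j<N. norm (- (y * q ^ j))) = (\<Sum>j<N. norm y * norm q ^ j)"
   by (simp add: norm_mult norm_power)
  also have "... <= (\<Sum>j. norm y * norm q ^ j)"
   by (rule sum_le_suminf[OF summable_geometric_scaled[OF q]]) auto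
  also have "... = norm y / (1 - norm q)"
   using q by (subst suminf_mult) (auto simp: suminf_geometric divide_simps)
  finally show ?thesis by simp
 qed
 ultimately show ?thesis
  by (intro LIMSEQ_le_const2) auto
qed

text \<open>With \<open>s = r ^ j\<close> this is a geometric majorant for the \<open>j\<close>-th
  factor of the double product, with a constant that is uniform for arguments in a compact
  set.\<close>

lemma norm_qpoch_minus_1_le_linear:
 assumes q: "norm q < 1" and R: "R > 0" and y: "norm y <= R * s" and s: "0 <= s" "s <= 1"
 shows "norm (qpoch y q - 1) <= (R / (1 - norm q)) * exp (R / (1 - norm q)) * s"
proof -
 define c where "c = R / (1 - norm q)"
 have c: "c > 0" using R q by (simp add: c_def)
 have "norm (qpoch y q - 1) <= exp (norm y / (1 - norm q)) - 1"
  by (rule norm_qpoch_minus_1_le[OF q])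
 also have "norm y / (1 - norm q) <= c * s"
  using y q by (simp add: c_def divide_right_mono)
 hence "exp (norm y / (1 - norm q)) - 1 <= exp (c * s) - 1" by simp
 also have "exp (c * s) - 1 <= (c * s) * exp (c * s)"
 proof -
  have "1 - c * s <= exp (- (c * s))" using exp_ge_add_one_self[of "- (c * s)"] by simp
  hence "(1 - c * s) * exp (c * s) <= exp (- (c * s)) * exp (c * s)"
   by (intro mult_right_mono) auto
  also have "... = 1" by (simp flip: exp_add)
  finally show ?thesis by (simp add: algebra_simps)
 qed
 also have "... <= (c * s) * exp c"
  using c s by (intro mult_left_mono) (auto simp: mult_left_le)
 finally show ?thesis by (simp add: c_def mult_ac)
qed

lemma uniform_limit_qpoch:
 assumes q: "norm q < 1" and K: "compact K"
 shows "uniform_limit K (%N x. \<Prod>j<N. 1 - x * q ^ j) (%x. qpoch x q) sequentially"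
proof -
 obtain R where R: "!!x. x \<in> K ==> norm x <= R"
  using compact_imp_bounded[OF K] by (auto simp: bounded_iff)
 show ?thesis unfolding qpoch_def
 proof (rule prodinf_uniform_limit[OF _ K])
  show "summable (%j. R * norm q ^ j)" by (rule summable_geometric_scaled[OF q])
 qed (auto intro!: continuous_intros mult_right_mono simp: norm_mult norm_power R)
qed

lemma holomorphic_qpoch:
 assumes q: "norm q < 1"
 shows "(%x. qpoch x q) holomorphic_on A"
proof -
 have "(%x. qpoch x q) holomorphic_on UNIV"
 proof (rule holomorphic_uniform_sequence[where f = "%N x. \<Prod>j<N. 1 - x * q ^ j"])
  fix x :: complex
  show "\<exists>d>0. cball x d \<subseteq> UNIV & uniform_limit (cball x d) (%N x. \<Prod>j<N. 1 - x * q ^ j) (%x. qpoch x q) sequentially"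
   using uniform_limit_qpoch[OF q compact_cball] by (intro exI[of _ 1]) auto
 qed (auto intro!: holomorphic_intros)
 thus ?thesis by (rule holomorphic_on_subset) auto
qed

lemma holomorphic_qpoch_compose [holomorphic_intros]:
 assumes "norm q < 1" "f holomorphic_on A"
 shows "(%x. qpoch (f x) q) holomorphic_on A"
 using holomorphic_on_compose[OF assms(2) holomorphic_qpoch[OF assms(1)]] by (simp add: o_def)

lemma continuous_on_qpoch [continuous_intros]:
 assumes "norm q < 1" "continuous_on A f"
 shows "continuous_on A (%x. qpoch (f x) q)"
 using continuous_on_compose2[OF holomorphic_on_imp_continuous_on[OF holomorphic_qpoch[OF assms(1), of UNIV]] assms(2)]
 by auto

lemma qpoch2_altdef: "qpoch2 z p q = prodinf (%j. qpoch (p ^ j * z) q)"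
 by (simp add: qpoch2_def qpoch_def mult_ac)

text \<open>The base \<open>g x\<close> varies together with the argument, so that the double
  product becomes jointly continuous in both, including \<open>p = 0\<close>, the point at which all
  limits are taken.\<close>

lemma qpoch2_unif_lim:
 assumes q: "norm q < 1" and r: "r < 1" and A: "compact A" "continuous_on A f" "continuous_on A g"
  and g: "!!x. x \<in> A ==> norm (g x) <= r"
 shows "uniform_limit A (%N x. \<Prod>j<N. qpoch (g x ^ j * f x) q) (%x. qpoch2 (f x) (g x) q) sequentially"
proof (cases "A = {}")
 case False
 then obtain x0 where "x0 \<in> A" by auto
 hence r0: "r >= 0" using g[of x0] norm_ge_zero[of "g x0"] by linarith
 obtain R0 where R0: "!!x. x \<in> A ==> norm (f x) <= R0"
  using compact_imp_bounded[OF compact_continuous_image[OF A(2,1)]] by (auto simp: bounded_iff)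
 define R where "R = max R0 1"
 have R: "R > 0" "!!x. x \<in> A ==> norm (f x) <= R" using R0 by (auto simp: R_def intro: max.coboundedI1)
 define C where "C = (R / (1 - norm q)) * exp (R / (1 - norm q))"
 show ?thesis unfolding qpoch2_altdef
 proof (rule prodinf_uniform_limit[OF _ A(1)])
  show "summable (%j. C * r ^ j)" using r r0 by (intro summable_mult summable_geometric) auto
  show "norm (qpoch (g x ^ n * f x) q - 1) <= C * r ^ n" if "x \<in> A" for n x
   unfolding C_def
  proof (rule norm_qpoch_minus_1_le_linear[OF q R(1)])
   have "norm (g x ^ n * f x) <= r ^ n * R"
    unfolding norm_mult norm_power
    by (intro mult_mono power_mono g R that) (use r0 in auto)
   thus "norm (g x ^ n * f x) <= R * r ^ n" by (simp add: mult_ac)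
  qed (use r r0 in \<open>auto intro: power_le_one\<close>)
 qed (intro continuous_intros q A)
qed (auto simp: uniform_limit_iff)

lemma isCont_qpoch2:
 assumes q: "norm q < 1" and p: "norm p < 1"
 shows "isCont (%(z, p). qpoch2 z p q) (z, p)"
proof -
 obtain r where r: "norm p < r" "r < 1" using p dense by blast
 define A where "A = cball z 1 \<times> cball (0::complex) r"
 have A: "compact A" unfolding A_def by (intro compact_Times) auto
 have ul: "uniform_limit A (%N x. \<Prod>j<N. qpoch (snd x ^ j * fst x) q) (%x. qpoch2 (fst x) (snd x) q) sequentially"
  by (rule qpoch2_unif_lim[OF q r(2) A]) (auto simp: A_def intro!: continuous_intros)
 have "continuous_on A (%x. qpoch2 (fst x) (snd x) q)"
  by (rule uniform_limit_theorem[OF _ ul]) (auto intro!: always_eventually continuous_intros q)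
 moreover have "(z, p) \<in> interior A"
 proof (rule interiorI[where T = "ball z 1 \<times> ball 0 r"])
  show "open (ball z 1 \<times> ball (0::complex) r)" by (intro open_Times) auto
  show "(z, p) \<in> ball z 1 \<times> ball 0 r" using r by simp
  show "ball z 1 \<times> ball 0 r \<subseteq> A" unfolding A_def by (intro Sigma_mono) auto
 qed
 ultimately have "isCont (%x. qpoch2 (fst x) (snd x) q) (z, p)"
  by (rule continuous_on_interior)
 thus ?thesis by (simp add: case_prod_beta')
qed

lemma continuous_on_qpoch2 [continuous_intros]:
 assumes "norm q < 1" "continuous_on A f" "continuous_on A g" "!!x. x \<in> A ==> norm (g x) < 1"
 shows "continuous_on A (%x. qpoch2 (f x) (g x) q)"
proof -
 have "continuous_on {y. norm (snd y) < 1} (%y. (%(z, p). qpoch2 z p q) y)"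
  using isCont_qpoch2[OF assms(1)] by (intro continuous_at_imp_continuous_on ballI) auto
 from continuous_on_compose2[OF this continuous_on_Pair[OF assms(2,3)]]
 show ?thesis using assms(4) by (simp add: image_subset_iff)
qed

lemma holomorphic_qpoch2:
 assumes q: "norm q < 1" and p: "norm p < 1"
 shows "(%x. qpoch2 x p q) holomorphic_on A"
proof -
 have "(%x. qpoch2 x p q) holomorphic_on UNIV"
 proof (rule holomorphic_uniform_sequence[where f = "%N x. \<Prod>j<N. qpoch (p ^ j * x) q"])
  fix x :: complex
  have "uniform_limit (cball x 1) (%N x. \<Prod>j<N. qpoch (p ^ j * x) q) (%x. qpoch2 x p q) sequentially"
   by (rule qpoch2_unif_lim[OF q p]) (auto intro!: continuous_intros)
  thus "\<exists>d>0. cball x d \<subseteq> UNIV & uniform_limit (cball x d) (%N x. \<Prod>j<N. qpoch (p ^ j * x) q) (%x. qpoch2 x p q) sequentially"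
   by (intro exI[of _ 1]) auto
 qed (auto intro!: holomorphic_intros q)
 thus ?thesis by (rule holomorphic_on_subset) auto
qed

lemma holomorphic_qpoch2_compose [holomorphic_intros]:
 assumes "norm q < 1" "norm p < 1" "f holomorphic_on A"
 shows "(%x. qpoch2 (f x) p q) holomorphic_on A"
 using holomorphic_on_compose[OF assms(3) holomorphic_qpoch2[OF assms(1,2)]] by (simp add: o_def)

lemma convergent_prod_qpoch2:
 assumes q: "norm q < 1" and p: "norm p < 1"
 shows "convergent_prod (%j. qpoch (p ^ j * z) q)"
proof (intro abs_convergent_prod_imp_convergent_prod summable_imp_abs_convergent_prod)
 define R where "R = max (norm z) 1"
 show "summable (%n. norm (qpoch (p ^ n * z) q - 1))"
 proof (rule summable_comparison_test'[where N = 0])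
  show "summable (%n. ((R / (1 - norm q)) * exp (R / (1 - norm q))) * norm p ^ n)"
   by (rule summable_geometric_scaled[OF p])
  show "norm (norm (qpoch (p ^ n * z) q - 1)) <= ((R / (1 - norm q)) * exp (R / (1 - norm q))) * norm p ^ n" for n
   unfolding real_norm_def abs_norm_cancel
  proof (rule norm_qpoch_minus_1_le_linear[OF q])
   show "norm (p ^ n * z) <= R * norm p ^ n"
    by (auto simp: norm_mult norm_power R_def mult.commute intro!: mult_right_mono)
  qed (use p in \<open>auto simp: R_def intro: power_le_one\<close>)
 qed
qed

lemma qpoch2_has_prod:
 "norm q < 1 ==> norm p < 1 ==> (%j. qpoch (p ^ j * z) q) has_prod qpoch2 z p q"
 unfolding qpoch2_altdef by (intro convergent_prod_has_prod convergent_prod_qpoch2)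

lemma qpoch2_eq_0_iff:
 assumes "norm q < 1" "norm p < 1"
 shows "qpoch2 z p q = 0 \<longleftrightarrow> (\<exists>j k. p ^ j * q ^ k * z = 1)"
proof -
 have "qpoch2 z p q = 0 \<longleftrightarrow> (\<exists>j. qpoch (p ^ j * z) q = 0)"
  using has_prod_eq_0_iff[OF qpoch2_has_prod[OF assms, of z]] by (metis (no_types, lifting) rangeE rangeI)
 also have "... \<longleftrightarrow> (\<exists>j k. p ^ j * q ^ k * z = 1)"
  unfolding qpoch_eq_0_iff[OF assms(1)] by (simp add: mult_ac)
 finally show ?thesis .
qed

lemma qpoch2_0_left [simp]: "qpoch2 0 p q = 1"
 by (simp add: qpoch2_altdef)

lemma qpoch_shift: "norm q < 1 ==> qpoch x q = (1 - x) * qpoch (x * q) q"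
proof -
 assume q: "norm q < 1"
 have "(%j. 1 - x * q ^ Suc j) has_prod qpoch (x * q) q"
  using qpoch_has_prod[OF q, of "x * q"] by (simp add: mult_ac)
 from has_prod_Suc_imp[OF this] show ?thesis
  using has_prod_unique2[OF qpoch_has_prod[OF q, of x]] by (simp add: mult_ac)
qed

lemma qpoch2_shift_p:
 assumes "norm q < 1" "norm p < 1"
 shows "qpoch2 x p q = qpoch x q * qpoch2 (p * x) p q"
proof -
 have "(%j. qpoch (p ^ Suc j * x) q) has_prod qpoch2 (p * x) p q"
  using qpoch2_has_prod[OF assms, of "p * x"] by (simp add: mult_ac)
 from has_prod_Suc_imp[OF this] show ?thesis
  using has_prod_unique2[OF qpoch2_has_prod[OF assms, of x]] by (simp add: mult_ac)
qed

lemma qpoch2_shift_q: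
 assumes "norm q < 1" "norm p < 1"
 shows "qpoch2 x p q = qpoch x p * qpoch2 (q * x) p q"
proof -
 have "qpoch x p * qpoch2 (q * x) p q = (\<Prod>j. (1 - x * p ^ j) * qpoch (p ^ j * (q * x)) q)"
  unfolding qpoch_def[of x p] qpoch2_altdef
  by (rule prodinf_mult[OF convergent_prod_qpoch convergent_prod_qpoch2]) (use assms in auto)
 also have "... = qpoch2 x p q"
  unfolding qpoch2_altdef by (rule prodinf_cong, subst qpoch_shift[OF assms(1)]) (simp add: mult_ac)
 finally show ?thesis ..
qed

lemma qpoch_split: "norm q < 1 ==> qpoch x q = (\<Prod>l<k. 1 - x * q ^ l) * qpoch (x * q ^ k) q"
proof (induction k)
 case (Suc k)
 thus ?case using qpoch_shift[of q "x * q ^ k"] by (simp add: mult_ac)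
qed auto

lemma qpoch2_split:
 assumes "norm q < 1" "norm p < 1"
 shows "qpoch2 x p q = (\<Prod>i<j. qpoch (p ^ i * x) q) * qpoch2 (p ^ j * x) p q"
proof (induction j)
 case (Suc j)
 thus ?case using qpoch2_shift_p[OF assms, of "p ^ j * x"] by (simp add: mult_ac)
qed auto

text \<open>The double product without its factor of index \<open>(j, k)\<close>. It is multiplied
  out rather than written as a quotient, because it is evaluated exactly at the zero of that
  factor.\<close>

definition qpoch2_cofactor :: "nat => nat => complex => complex => complex => complex" where
 "qpoch2_cofactor j k p q x = (\<Prod>i<j. qpoch (p ^ i * x) q) * (\<Prod>l<k. 1 - p ^ j * q ^ l * x)
  * qpoch (p ^ j * q ^ Suc k * x) q * qpoch2 (p ^ Suc j * x) p q"

lemma qpoch2_cofactor: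
 assumes "norm q < 1" "norm p < 1"
 shows "qpoch2 x p q = (1 - p ^ j * q ^ k * x) * qpoch2_cofactor j k p q x"
proof -
 have "qpoch2 x p q = (\<Prod>i<j. qpoch (p ^ i * x) q) * (qpoch (p ^ j * x) q * qpoch2 (p ^ Suc j * x) p q)"
  by (subst qpoch2_split[OF assms, of _ j], subst qpoch2_shift_p[OF assms, of "p ^ j * x"])
   (simp add: mult_ac)
 also have "qpoch (p ^ j * x) q = (\<Prod>l<Suc k. 1 - p ^ j * x * q ^ l) * qpoch (p ^ j * x * q ^ Suc k) q"
  by (rule qpoch_split[OF assms(1)])
 finally show ?thesis by (simp add: qpoch2_cofactor_def mult_ac)
qed

lemma qpoch2_cofactor_nonzero:
 assumes "norm q < 1" "norm p < 1"
  and "!!j' k'. p ^ j' * q ^ k' * x = 1 ==> j' = j & k' = k"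
 shows "qpoch2_cofactor j k p q x ~= 0"
proof
 assume "qpoch2_cofactor j k p q x = 0"
 then consider i where "i < j" "qpoch (p ^ i * x) q = 0" | l where "l < k" "p ^ j * q ^ l * x = 1"
  | "qpoch (p ^ j * q ^ Suc k * x) q = 0" | "qpoch2 (p ^ Suc j * x) p q = 0"
  by (auto simp: qpoch2_cofactor_def)
 thus False
 proof cases
  case 1
  then obtain l where "p ^ i * x * q ^ l = 1" using qpoch_eq_0_iff[OF assms(1)] by auto
  with assms(3)[of i l] 1 show False by (simp add: mult_ac)
 next
  case 2 with assms(3)[of j l] show False by simp
 next
  case 3
  then obtain l where "p ^ j * q ^ Suc k * x * q ^ l = 1" using qpoch_eq_0_iff[OF assms(1)] by auto
  with assms(3)[of j "Suc k + l"] show False by (simp add: mult_ac power_add)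
 next
  case 4
  then obtain i l where "p ^ i * q ^ l * (p ^ Suc j * x) = 1" using qpoch2_eq_0_iff[OF assms(1,2)] by auto
  with assms(3)[of "i + Suc j" l] show False by (simp add: mult_ac power_add)
 qed
qed

lemma continuous_on_qpoch2_cofactor [continuous_intros]:
 assumes "norm q < 1" "norm p < 1" "continuous_on A f"
 shows "continuous_on A (%x. qpoch2_cofactor j k p q (f x))"
 unfolding qpoch2_cofactor_def using assms by (intro continuous_intros) auto

lemma holomorphic_qpoch2_cofactor [holomorphic_intros]:
 assumes "norm q < 1" "norm p < 1" "f holomorphic_on A"
 shows "(%x. qpoch2_cofactor j k p q (f x)) holomorphic_on A"
 unfolding qpoch2_cofactor_def using assms by (intro holomorphic_intros) auto

section \<open>Theta functions \<theta>(x; q) = (x, q/x; q) and the shift of the elliptic gamma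
  function\<close>

definition qtheta :: "complex => complex => complex" where
 "qtheta x q = qpoch x q * qpoch (q / x) q"

lemma qtheta_shift:
 assumes "norm q < 1" "q ~= 0" "x ~= 0"
 shows "qtheta (q * x) q = - qtheta x q / x"
proof -
 have "qpoch (1 / x) q = (1 - 1 / x) * qpoch (q / x) q"
  using qpoch_shift[OF assms(1), of "1 / x"] by simp
 moreover have "qpoch x q = (1 - x) * qpoch (q * x) q"
  using qpoch_shift[OF assms(1), of x] by (simp add: mult.commute)
 ultimately have e: "qpoch (1 / x) q * x = (x - 1) * qpoch (q / x) q" "qpoch x q = (1 - x) * qpoch (q * x) q"
  using assms by (auto simp: field_simps)
 have "qtheta (q * x) q * x = qpoch (q * x) q * (qpoch (1 / x) q * x)"
  using assms by (simp add: qtheta_def)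
 also have "... = - qtheta x q" unfolding e qtheta_def by (simp add: algebra_simps)
 finally show ?thesis using assms by (simp add: field_simps)
qed

lemma qtheta_inverse:
 assumes "norm q < 1" "x ~= 0"
 shows "qtheta (1 / x) q = - qtheta x q / x"
proof -
 have "qpoch (1 / x) q = (1 - 1 / x) * qpoch (q / x) q"
  using qpoch_shift[OF assms(1), of "1 / x"] by simp
 moreover have "qpoch x q = (1 - x) * qpoch (q * x) q"
  using qpoch_shift[OF assms(1), of x] by (simp add: mult.commute)
 ultimately have e: "qpoch (1 / x) q * x = (x - 1) * qpoch (q / x) q" "qpoch x q = (1 - x) * qpoch (q * x) q"
  using assms by (auto simp: field_simps)
 have "qtheta (1 / x) q * x = qpoch (q * x) q * (qpoch (1 / x) q * x)"
  using assms by (simp add: qtheta_def)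
 also have "... = - qtheta x q" unfolding e qtheta_def by (simp add: algebra_simps)
 finally show ?thesis using assms by (simp add: field_simps)
qed

lemma qtheta_reflect: "q ~= 0 ==> x ~= 0 ==> qtheta (q / x) q = qtheta x q"
 by (simp add: qtheta_def mult.commute)

lemma qtheta_eq_0_norm:
 assumes "norm q < 1" "q ~= 0" "x ~= 0" "qtheta x q = 0"
 shows "\<exists>l::int. norm x = norm q powi l"
proof -
 from assms(4) consider k where "x * q ^ k = 1" | k where "q / x * q ^ k = 1"
  unfolding qtheta_def using qpoch_eq_0_iff[OF assms(1)] by auto
 thus ?thesis
 proof cases
  case 1
  hence "norm x * norm q ^ k = 1" by (metis norm_mult norm_power norm_one)
  hence "norm x = norm q powi (- int k)" using assms by (simp add: power_int_minus field_simps)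
  thus ?thesis by blast
 next
  case 2
  hence "x = q ^ Suc k" using assms by (simp add: field_simps)
  hence "norm x = norm q powi (int (Suc k))" by (simp only: norm_power power_int_of_nat)
  thus ?thesis by blast
 qed
qed

lemma holomorphic_qtheta [holomorphic_intros]:
 assumes "norm q < 1" "f holomorphic_on A" "!!x. x \<in> A ==> f x ~= 0"
 shows "(%x. qtheta (f x) q) holomorphic_on A"
 unfolding qtheta_def using assms by (intro holomorphic_intros) auto

lemma continuous_on_qtheta [continuous_intros]:
 assumes "norm q < 1" "continuous_on A f" "!!x. x \<in> A ==> f x ~= 0"
 shows "continuous_on A (%x. qtheta (f x) q)"
 unfolding qtheta_def using assms by (intro continuous_intros) auto

lemma egamma_shift:
 assumes q: "norm q < 1" and p: "norm p < 1" and p0: "p ~= 0" and z: "z ~= 0" "qpoch2 z p q ~= 0"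
 shows "egamma p q (p * z) = qtheta z q * egamma p q z"
proof -
 have "qpoch2 (q / z) p q = qpoch (q / z) q * qpoch2 (p * q / z) p q"
  using qpoch2_shift_p[OF q p, of "q / z"] by simp
 moreover have "qpoch2 z p q = qpoch z q * qpoch2 (p * z) p q" by (rule qpoch2_shift_p[OF q p])
 ultimately show ?thesis using z p0 by (simp add: egamma_def qtheta_def divide_simps)
qed

section \<open>Contours\<close>

text \<open>A detour along a path to a small circle around \<open>x\<close>, once around it and
  back: the two passages of the path cancel, and the disc contains no point outside \<open>U\<close>
  except \<open>x\<close>, so no other winding number changes. \<open>s\<close> is the
  orientation.\<close>

lemma winding_number_insert_loop:
 assumes U: "open U" "connected U" and g: "valid_path gm" "pathfinish gm = pathstart gm" "path_image gm \<subseteq> U"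
  and x: "x ~: U" "0 < e" "cball x e - {x} \<subseteq> U" and s: "s = 1 | s = -1"
 obtains gm' where "valid_path gm'" "pathfinish gm' = pathstart gm'" "path_image gm' \<subseteq> U"
  "!!w. w ~: U ==> winding_number gm' w = winding_number gm w + (if w = x then s else 0)"
proof -
 define c where "c = (if s = 1 then circlepath x e else reversepath (circlepath x e))"
 have ci: "path_image c = sphere x e" using x by (auto simp: c_def path_image_circlepath_minus)
 have cO: "path_image c \<subseteq> U" using x(2,3) unfolding ci by force
 have cv: "valid_path c" "pathfinish c = pathstart c" by (auto simp: c_def)
 have cw: "winding_number c w = (if w = x then s else 0)" if "w ~: U" for w
 proof (cases "w = x")
  case True
  thus ?thesis using x s by (auto simp: c_def winding_number_circlepath_centre winding_number_reversepath valid_path_imp_path)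
 next
  case False
  have "w ~: cball x e" using x(3) that False by auto
  hence "winding_number c w = 0"
   by (intro winding_number_zero_outside[of _ "cball x e"]) (use cv in \<open>auto simp: ci valid_path_imp_path\<close>)
  thus ?thesis using False by simp
 qed
 have "pathstart gm \<in> U" "pathstart c \<in> U" using g cO pathstart_in_path_image by blast+
 from connected_open_polynomial_connected[OF U this] obtain g where
  gg: "polynomial_function g" "path_image g \<subseteq> U" "pathstart g = pathstart gm" "pathfinish g = pathstart c" by auto
 have gv: "valid_path g" using gg valid_path_polynomial_function by blast
 define gm' where "gm' = gm +++ (g +++ (c +++ reversepath g))"
 show thesis
 proof (rule that)
  show "valid_path gm'" unfolding gm'_def using g gg gv cv by (intro valid_path_join) auto
  show "pathfinish gm' = pathstart gm'" using gg by (simp add: gm'_def)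
  show "path_image gm' \<subseteq> U" unfolding gm'_def using g gg gv cv cO by (subst path_image_join; auto simp: path_image_join)+
  fix w assume w: "w ~: U"
  have n: "w ~: path_image gm" "w ~: path_image g" "w ~: path_image c" using w g gg cO by auto
  have p: "path gm" "path g" "path c" using g gv cv valid_path_imp_path by auto
  have "winding_number gm' w = winding_number gm w + winding_number c w"
   unfolding gm'_def using n p gg g cv
   by (simp add: winding_number_join winding_number_reversepath path_image_join)
  thus "winding_number gm' w = winding_number gm w + (if w = x then s else 0)" using cw[OF w] by simp
 qed
qed

lemma winding_number_prescribed:
 assumes P: "finite P" and U: "open U" "connected U"
  and g: "valid_path gm" "pathfinish gm = pathstart gm" "path_image gm \<subseteq> U"
  and x: "!!x. x \<in> P ==> x ~: U & (\<exists>e>0. cball x e - {x} \<subseteq> U)" and s: "!!x. x \<in> P ==> s x = 1 | s x = -1"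
 shows "\<exists>gm'. valid_path gm' & pathfinish gm' = pathstart gm' & path_image gm' \<subseteq> U &
  (\<forall>w. w ~: U --> winding_number gm' w = winding_number gm w + (if w \<in> P then s w else 0))"
 using P x s
proof (induction P rule: finite_induct)
 case empty
 show ?case by (rule exI[of _ gm]) (use g in auto)
next
 case (insert y P)
 then obtain gm1 where 1: "valid_path gm1" "pathfinish gm1 = pathstart gm1" "path_image gm1 \<subseteq> U"
  "!!w. w ~: U ==> winding_number gm1 w = winding_number gm w + (if w \<in> P then s w else 0)" by auto
 obtain e where e: "y ~: U" "e > 0" "cball y e - {y} \<subseteq> U" using insert.prems(1)[of y] by auto
 have "s y = 1 | s y = -1" using insert.prems(2)[of y] by auto
 from winding_number_insert_loop[OF U 1(1-3) e this] obtain gm' where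
  "valid_path gm'" "pathfinish gm' = pathstart gm'" "path_image gm' \<subseteq> U"
  "!!w. w ~: U ==> winding_number gm' w = winding_number gm1 w + (if w = y then s y else 0)" by metis
 thus ?case using 1(4) insert.hyps(2) by (intro exI[of _ gm']) (auto)
qed

text \<open>\<open>A\<close> can accumulate only at 0 and \<open>B\<close> only at infinity. A
  circle through none of the points is therefore wrong at only finitely many of them, and each is
  corrected by one extra loop: positive around points of \<open>A\<close> outside the circle,
  negative around points of \<open>B\<close> inside. \<open>Z\<close> only has to be
  avoided.\<close>

lemma contour_separation:
 fixes A B Z :: "complex set"
 assumes A: "0 ~: A" "!!e. e > 0 ==> finite {x\<in>A. norm x >= e}"
  and B: "0 ~: B" "!!R. finite {x\<in>B. norm x <= R}"
  and Z: "0 ~: Z" "!!e R. e > 0 ==> finite {x\<in>Z. norm x >= e & norm x <= R}"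
  and AB: "A \<inter> B = {}"
 obtains gm where "polynomial_function gm" "pathfinish gm = pathstart gm" "path_image gm \<inter> insert 0 (A \<union> B \<union> Z) = {}"
  "!!x. x \<in> insert 0 A ==> winding_number gm x = 1" "!!x. x \<in> B ==> winding_number gm x = 0"
proof -
 define C where "C = A \<union> B \<union> Z"
 have C0: "0 ~: C" using A B Z by (auto simp: C_def)
 have Cfin: "finite {x\<in>C. norm x >= e & norm x <= R}" if "e > 0" for e R
 proof (rule finite_subset)
  show "{x\<in>C. norm x >= e & norm x <= R} \<subseteq> {x\<in>A. norm x >= e} \<union> {x\<in>B. norm x <= R} \<union> {x\<in>Z. norm x >= e & norm x <= R}"
   unfolding C_def by blast
  show "finite ({x\<in>A. norm x >= e} \<union> {x\<in>B. norm x <= R} \<union> {x\<in>Z. norm x >= e & norm x <= R})"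
   using A(2)[OF that] B(2) Z(2)[OF that] by simp
 qed
 have "countable C"
 proof (rule countable_subset)
  show "C \<subseteq> (\<Union>n::nat. {x\<in>C. norm x >= 1 / real (Suc n) & norm x <= real (Suc n)})"
  proof
   fix x assume x: "x \<in> C"
   hence nx: "norm x > 0" using C0 by auto
   obtain n1 :: nat where n1: "norm x <= real n1" using real_arch_simple by blast
   obtain n2 :: nat where n2: "1 / norm x <= real n2" using real_arch_simple by blast
   have "1 <= real (Suc (n1 + n2)) * norm x"
   proof -
    have "1 <= real n2 * norm x" using n2 nx by (simp add: field_simps)
    also have "... <= real (Suc (n1 + n2)) * norm x" using nx by (intro mult_right_mono) auto
    finally show ?thesis .
   qed
   hence "1 / real (Suc (n1 + n2)) <= norm x" by (simp add: field_simps)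
   thus "x \<in> (\<Union>n::nat. {x\<in>C. norm x >= 1 / real (Suc n) & norm x <= real (Suc n)})"
    using x n1 by (intro UN_I[of "n1 + n2"]) auto
  qed
  show "countable (\<Union>n::nat. {x\<in>C. norm x >= 1 / real (Suc n) & norm x <= real (Suc n)})"
   by (rule countable_UN[OF countableI_type], rule countable_finite, rule Cfin) (simp del: of_nat_Suc)
 qed
 \<comment> \<open>Only countably many moduli occur, so some radius between 1 and 2 meets no point
   of \<open>C\<close>.\<close>
 hence "countable (norm ` C)" by simp
 hence "\<not> {1<..<2::real} \<subseteq> norm ` C" using countable_subset[of "{1<..<2::real}"] uncountable_open_interval[of 1 "2::real"] by (meson one_less_numeral_iff semiring_norm(76))
 then obtain ro :: real where ro: "1 < ro" "ro ~: norm ` C"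
  unfolding subset_iff greaterThanLessThan_iff by blast
 \<comment> \<open>The points on the wrong side of the circle. They lie in the annulus between the
   radii \<delta> and \<open>R\<close> chosen next, which meets \<open>C\<close> in finitely many
   points; removing these leaves a connected open set to work in.\<close>
 define P where "P = {x\<in>A. norm x >= ro} \<union> {x\<in>B. norm x <= ro}"
 have P: "finite P" "P \<subseteq> C" unfolding P_def C_def using A(2)[of ro] B(2)[of ro] ro by auto
 define \<delta> where "\<delta> = Min (insert 1 (norm ` P)) / 2"
 define R where "R = Max (insert ro (norm ` P)) + 1"
 have \<delta>: "\<delta> > 0" "\<delta> < ro" "!!x. x \<in> P ==> \<delta> < norm x"
 proof -
  have m: "Min (insert 1 (norm ` P)) > 0" using P C0 by (subst Min_gr_iff) auto
  thus "\<delta> > 0" by (simp add: \<delta>_def)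
  have "Min (insert 1 (norm ` P)) <= 1" using P by (intro Min_le) auto
  thus "\<delta> < ro" using ro by (simp add: \<delta>_def)
  fix x assume "x \<in> P"
  hence "Min (insert 1 (norm ` P)) <= norm x" using P by (intro Min_le) auto
  thus "\<delta> < norm x" using m by (simp add: \<delta>_def)
 qed
 have R: "ro < R" "!!x. x \<in> P ==> norm x < R"
 proof -
  have "ro <= Max (insert ro (norm ` P))" using P by (intro Max_ge) auto
  thus "ro < R" by (simp add: R_def)
  fix x assume "x \<in> P"
  hence "norm x <= Max (insert ro (norm ` P))" using P by (intro Max_ge) auto
  thus "norm x < R" by (simp add: R_def)
 qed
 define X where "X = {x\<in>C. norm x >= \<delta> & norm x <= R}"
 have X: "finite X" unfolding X_def by (rule Cfin) (use \<delta> in auto)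
 define An where "An = {z::complex. \<delta> < norm (z - 0) & norm (z - 0) < R}"
 have An: "open An" "connected An"
 proof -
  have "An = ball 0 R - cball 0 \<delta>" by (auto simp: An_def)
  thus "open An" by (simp add: open_Diff)
  show "connected An" unfolding An_def by (rule connected_annulus) auto
 qed
 define D where "D = An - X"
 have D: "open D" "connected D"
  unfolding D_def using An X by (auto intro: open_Diff finite_imp_closed connected_open_diff_countable countable_finite)
 have CD: "x ~: D" if "x \<in> insert 0 C" for x using that \<delta> by (auto simp: D_def An_def X_def)
 define gm0 where "gm0 = circlepath (0::complex) ro"
 have g0: "valid_path gm0" "pathfinish gm0 = pathstart gm0" "path_image gm0 \<subseteq> D"
  using ro \<delta> R by (auto simp: gm0_def D_def An_def X_def)
 have iso: "\<exists>e>0. cball x e - {x} \<subseteq> D" if "x \<in> P" for x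
 proof -
  have "x \<in> An - (X - {x})" using that \<delta> R by (auto simp: An_def)
  moreover have "open (An - (X - {x}))" using An X by (intro open_Diff finite_imp_closed) auto
  ultimately obtain e where "e > 0" "cball x e \<subseteq> An - (X - {x})" using open_contains_cball by blast
  thus ?thesis by (intro exI[of _ e]) (auto simp: D_def)
 qed
 define s :: "complex => complex" where "s = (%x. if x \<in> A then 1 else -1)"
 have "\<exists>gm'. valid_path gm' & pathfinish gm' = pathstart gm' & path_image gm' \<subseteq> D &
  (\<forall>w. w ~: D --> winding_number gm' w = winding_number gm0 w + (if w \<in> P then s w else 0))"
  by (rule winding_number_prescribed[OF P(1) D g0]) (use CD P(2) iso in \<open>auto simp: s_def\<close>)
 then obtain gm1 where g1: "valid_path gm1" "pathfinish gm1 = pathstart gm1" "path_image gm1 \<subseteq> D"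
  "!!w. w ~: D ==> winding_number gm1 w = winding_number gm0 w + (if w \<in> P then s w else 0)" by auto
 have p1: "path gm1" using g1 valid_path_imp_path by auto
 obtain e where e: "e > 0" "!!x y. x \<in> path_image gm1 ==> y \<in> -D ==> e <= dist x y"
  using separate_compact_closed[of "path_image gm1" "- D"] compact_path_image[OF p1] D(1) g1(3) disjoint_eq_subset_Compl[of "path_image gm1" "- D"]
  by (auto simp: closed_Compl)
 \<comment> \<open>A polynomial loop has a continuous derivative, so that integrals over it are
   integrals of continuous functions over \<open>{0..1}\<close>. At distance less than
   \<open>e\<close> it is homotopic in \<open>D\<close> to the corrected loop.\<close>
 obtain g where g: "polynomial_function g" "pathstart g = pathstart gm1" "pathfinish g = pathfinish gm1"
  "!!t. t \<in> {0..1} ==> norm (g t - gm1 t) < e"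
  using path_approx_polynomial_function[OF p1 e(1)] by metis
 have hom: "homotopic_loops D gm1 g"
 proof (rule homotopic_loops_nearby_explicit)
  fix t x :: _ assume t: "t \<in> {0..1::real}" and "x ~: D"
  hence "e <= dist (gm1 t) x" by (intro e(2)) (auto simp: path_image_def)
  thus "norm (g t - gm1 t) < norm (gm1 t - x)" using g(4)[OF t] by (simp add: dist_norm)
 qed (use p1 g g1 in \<open>auto intro: valid_path_imp_path valid_path_polynomial_function\<close>)
 have wn: "winding_number g w = winding_number gm0 w + (if w \<in> P then s w else 0)" if "w ~: D" for w
 proof -
  have "homotopic_loops (- {w}) gm1 g" by (rule homotopic_loops_subset[OF hom]) (use that in auto)
  from winding_number_homotopic_loops[OF this] g1(4)[OF that] show ?thesis by simp
 qed
 have in0: "winding_number gm0 w = 1" if "norm w < ro" for w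
  unfolding gm0_def by (rule winding_number_circlepath) (use that in auto)
 have out0: "winding_number gm0 w = 0" if "norm w > ro" for w
  unfolding gm0_def using that ro
  by (intro winding_number_zero_outside[of _ "cball 0 ro"]) (auto simp: valid_path_imp_path)
 show thesis
 proof (rule that[of g])
  show "polynomial_function g" "pathfinish g = pathstart g" using g g1 by auto
  have "path_image g \<subseteq> D" using hom homotopic_loops_imp_subset by blast
  thus "path_image g \<inter> insert 0 (A \<union> B \<union> Z) = {}" using CD by (auto simp: C_def)
  show "winding_number g x = 1" if x: "x \<in> insert 0 A" for x
  proof -
   have "norm x ~= ro" using x ro by (auto simp: C_def)
   hence "norm x < ro | norm x > ro" by linarith
   thus ?thesis using x wn[OF CD, of x] in0[of x] out0[of x] AB A(1) B(1) ro
    by (auto simp: P_def s_def C_def)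
  qed
  show "winding_number g x = 0" if x: "x \<in> B" for x
  proof -
   have "norm x ~= ro" using x ro by (auto simp: C_def)
   hence "norm x < ro | norm x > ro" by linarith
   thus ?thesis using x wn[OF CD, of x] in0[of x] out0[of x] AB by (auto simp: P_def s_def C_def)
  qed
 qed
qed

text \<open>The residue theorem is applied to \<open>gm1\<close>, a connecting path,
  \<open>gm2\<close> backwards, and the path backwards; this loop does not wind around any point of
  the complement of \<open>D\<close>.\<close>

lemma contour_integral_homologous_residues:
 assumes D: "open D" "connected D" and X: "finite X" and f: "f holomorphic_on D - X"
  and g1: "valid_path gm1" "pathfinish gm1 = pathstart gm1" "path_image gm1 \<subseteq> D - X"
  and g2: "valid_path gm2" "pathfinish gm2 = pathstart gm2" "path_image gm2 \<subseteq> D - X"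
  and w: "!!w. w ~: D ==> winding_number gm1 w = winding_number gm2 w"
 shows "contour_integral gm1 f = contour_integral gm2 f
  + 2 * of_real pi * \<i> * (\<Sum>x\<in>X. (winding_number gm1 x - winding_number gm2 x) * residue f x)"
proof -
 have DX: "open (D - X)" "connected (D - X)"
  using D X by (auto intro: open_Diff finite_imp_closed connected_open_diff_countable countable_finite)
 have "pathstart gm1 \<in> D - X" "pathstart gm2 \<in> D - X" using g1 g2 pathstart_in_path_image by blast+
 from connected_open_polynomial_connected[OF DX this] obtain g where
  g: "polynomial_function g" "path_image g \<subseteq> D - X" "pathstart g = pathstart gm1" "pathfinish g = pathstart gm2" by auto
 have gv: "valid_path g" using g valid_path_polynomial_function by blast
 define h where "h = gm1 +++ (g +++ (reversepath gm2 +++ reversepath g))"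
 have wn: "winding_number h x = winding_number gm1 x - winding_number gm2 x" if x: "x ~: D - X" for x
 proof -
  have n: "x ~: path_image gm1" "x ~: path_image gm2" "x ~: path_image g" using x g1 g2 g by blast+
  have p: "path gm1" "path gm2" "path g" using g1 g2 gv valid_path_imp_path by auto
  show ?thesis unfolding h_def using n p g g1 g2
   by (simp add: winding_number_join winding_number_reversepath path_image_join)
 qed
 have "contour_integral h f = 2 * pi * \<i> * (\<Sum>x\<in>X. winding_number h x * residue f x)"
 proof (rule Residue_theorem[OF D X f])
  show "valid_path h" unfolding h_def using g1 g2 g gv by (intro valid_path_join) auto
  show "pathfinish h = pathstart h" using g by (simp add: h_def)
  show "path_image h \<subseteq> D - X" unfolding h_def using g1 g2 g by (subst path_image_join; auto simp: path_image_join)+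
  show "\<forall>z. z ~: D --> winding_number h z = 0" using wn w by auto
 qed
 also have "complex_of_real (2 * pi) = 2 * of_real pi" by simp
 also have "(\<Sum>x\<in>X. winding_number h x * residue f x) = (\<Sum>x\<in>X. (winding_number gm1 x - winding_number gm2 x) * residue f x)"
  by (rule sum.cong) (auto simp: wn)
 finally have 1: "contour_integral h f = 2 * of_real pi * \<i> * (\<Sum>x\<in>X. (winding_number gm1 x - winding_number gm2 x) * residue f x)" .
 have i: "f contour_integrable_on gm1" "f contour_integrable_on gm2" "f contour_integrable_on g"
  using contour_integrable_holomorphic_simple[OF f DX(1)] g1 g2 g gv by auto
 have "contour_integral h f = contour_integral gm1 f - contour_integral gm2 f"
  unfolding h_def using i g1 g2 g gv
  by (simp add: contour_integral_reversepath contour_integrable_reversepath)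
 with 1 show ?thesis by (simp add: algebra_simps)
qed

lemma contour_integral_eq_homologous:
 assumes D: "open D" "connected D" and f: "f holomorphic_on D"
  and g1: "valid_path gm1" "pathfinish gm1 = pathstart gm1" "path_image gm1 \<subseteq> D"
  and g2: "valid_path gm2" "pathfinish gm2 = pathstart gm2" "path_image gm2 \<subseteq> D"
  and w: "!!w. w ~: D ==> winding_number gm1 w = winding_number gm2 w"
 shows "contour_integral gm1 f = contour_integral gm2 f"
 using contour_integral_homologous_residues[OF D finite.emptyI, of f gm1 gm2] assms by simp

section \<open>Contours separating inner from outer poles\<close>

lemma mult_eq_1_imp_divide: "b * x = 1 ==> b ~= 0 & 1 / b = x" for b x :: complex
 by (metis mult_zero_left nonzero_mult_div_cancel_left zero_neq_one)

lemma open_Collect_preimage: "open S ==> continuous_on S f ==> open V ==> open {x\<in>S. f x \<in> V}"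
 using continuous_open_preimage[of S f V] by (simp add: vimage_def Int_def)

definition inner_region :: "(real => complex) => complex set" where
 "inner_region gm = {x. x ~: path_image gm & winding_number gm x = 1}"

text \<open>The reciprocals of the points around which \<open>gm\<close> does not wind; \<open>0\<close> stands for infinity.\<close>

definition outer_region :: "(real => complex) => complex set" where
 "outer_region gm = {y. y = 0 | (1 / y ~: path_image gm & winding_number gm (1 / y) = 0)}"

text \<open>\<open>a\<close> generates the poles to be enclosed, \<open>b\<close> the reciprocals of
  those to be left outside. The two families are kept apart because they differ after the rescaling
  at \<open>wij\<close>. Zero entries and \<open>p = 0\<close> are allowed; the corresponding points
  are 0 and infinity.\<close>

definition separates :: "complex => complex => ('n => complex) => ('n => complex) => (real => complex) => bool" where
 "separates p q a b gm \<longleftrightarrow> valid_path gm & pathfinish gm = pathstart gm & 0 \<in> inner_region gm &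
  (\<forall>i j k. a i * p ^ j * q ^ k \<in> inner_region gm) & (\<forall>i j k. b i * p ^ j * q ^ k \<in> outer_region gm)"

definition pole_free :: "complex => complex => ('n => complex) => ('n => complex) => complex set" where
 "pole_free p q a b = {z. z ~= 0 & (\<forall>i. qpoch2 (a i / z) p q ~= 0 & qpoch2 (b i * z) p q ~= 0)}"

text \<open>No inner pole equals an outer one. For bases inside the unit disc this is exactly the
  condition for a separating contour to exist (\<open>separates_exists\<close>,
  \<open>separates_imp_nonresonant\<close>).\<close>

definition nonresonant :: "complex => complex => ('n => complex) => ('n => complex) => bool" where
 "nonresonant p q a b \<longleftrightarrow> (\<forall>i i' j k. a i * b i' * p ^ j * q ^ k ~= 1)"

definition sep_integral :: "complex => complex => ('n => complex) => ('n => complex) => (complex => complex) => complex" where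
 "sep_integral p q a b f = contour_integral (SOME gm. separates p q a b gm) f"

lemma not_pole_free_iff:
 assumes "norm q < 1" "norm p < 1"
 shows "z ~: pole_free p q a b \<longleftrightarrow> z = 0 | (\<exists>i j k. z = a i * p ^ j * q ^ k | b i * p ^ j * q ^ k * z = 1)"
proof (cases "z = 0")
 case False
 thus ?thesis unfolding pole_free_def by (simp add: qpoch2_eq_0_iff[OF assms] field_simps) (metis (no_types, lifting))
qed (simp add: pole_free_def)

lemma open_pole_free:
 fixes a b :: "'n::finite => complex"
 assumes "norm q < 1" "norm p < 1"
 shows "open (pole_free p q a b)"
proof -
 have "open {z\<in>-{0}. qpoch2 (a i / z) p q \<in> -{0}}" "open {z\<in>-{0}. qpoch2 (b i * z) p q \<in> -{0}}" for i
  by (intro open_Collect_preimage continuous_intros assms; simp)+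
 hence "open (\<Inter>i. {z\<in>-{0}. qpoch2 (a i / z) p q \<in> -{0}} \<inter> {z\<in>-{0}. qpoch2 (b i * z) p q \<in> -{0}})"
  by (intro open_INT open_Int) auto
 also have "... = pole_free p q a b" by (auto simp: pole_free_def)
 finally show ?thesis .
qed

lemma countable_not_pole_free:
 fixes a b :: "'n::finite => complex"
 assumes "norm q < 1" "norm p < 1"
 shows "countable (- pole_free p q a b)"
proof -
 define X where "X = insert 0 ((%(i,j,k). a i * p ^ j * q ^ k) ` UNIV \<union> (%(i,j,k). 1 / (b i * p ^ j * q ^ k)) ` UNIV)"
 have "countable X" unfolding X_def by auto
 thus ?thesis
 proof (rule countable_subset[rotated], intro subsetI)
  fix z assume "z \<in> - pole_free p q a b"
  then consider "z = 0" | i j k where "z = a i * p ^ j * q ^ k" | i j k where "b i * p ^ j * q ^ k * z = 1"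
   using not_pole_free_iff[OF assms, of z a b] by blast
  thus "z \<in> X"
  proof cases
   case 2
   thus ?thesis unfolding X_def by (auto intro!: image_eqI[of _ _ "(i, j, k)"])
  next
   case 3
   hence "z = 1 / (b i * p ^ j * q ^ k)" using mult_eq_1_imp_divide by auto
   thus ?thesis unfolding X_def by (auto intro!: image_eqI[of _ "%(i,j,k). 1 / (b i * p ^ j * q ^ k)" "(i, j, k)"])
  qed (simp add: X_def)
 qed
qed

lemma connected_superset_pole_free:
 fixes a b :: "'n::finite => complex"
 assumes "norm q < 1" "norm p < 1" "pole_free p q a b \<subseteq> S"
 shows "connected S"
proof -
 have "countable (- S)" using countable_not_pole_free[OF assms(1,2), of a b] assms(3) by (meson Compl_anti_mono countable_subset)
 hence "connected (UNIV - (- S))" by (intro connected_open_diff_countable) auto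
 thus ?thesis by (simp add: Diff_eq)
qed

lemma connected_pole_free:
 fixes a b :: "'n::finite => complex"
 assumes "norm q < 1" "norm p < 1"
 shows "connected (pole_free p q a b)"
 by (rule connected_superset_pole_free[OF assms subset_refl])

lemma open_inner_region: "path gm ==> pathfinish gm = pathstart gm ==> open (inner_region gm)"
 unfolding inner_region_def by (rule open_winding_number_levelsets)

text \<open>Near 0 this is the vanishing of the winding number near infinity. In the reciprocal
  coordinate the outer poles, too, form geometric families tending to 0, so both kinds of poles can
  be treated alike.\<close>

lemma open_outer_region:
 assumes "path gm" "pathfinish gm = pathstart gm"
 shows "open (outer_region gm)"
proof -
 define V where "V = {z. z ~: path_image gm & winding_number gm z = 0}"
 have V: "open V" unfolding V_def by (rule open_winding_number_levelsets[OF assms])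
 have "open {y\<in>-{0::complex}. 1 / y \<in> V}"
  by (intro open_Collect_preimage V continuous_intros) auto
 moreover obtain R where R: "!!z. R <= norm z ==> winding_number gm z = 0"
  using winding_number_zero_at_infinity[OF assms] by blast
 obtain R' where R': "!!z. z \<in> path_image gm ==> norm z <= R'"
  using bounded_path_image[OF assms(1)] by (auto simp: bounded_iff)
 define S where "S = max R R'"
 define T where "T = max S 0 + 1"
 have T: "T > 0" "T > S" by (auto simp: T_def)
 have "ball 0 (1 / T) \<subseteq> outer_region gm"
 proof
  fix y :: complex assume "y \<in> ball 0 (1 / T)"
  hence y: "norm y < 1 / T" by simp
  show "y \<in> outer_region gm"
  proof (cases "y = 0")
   case False
   hence "T < norm (1 / y)" using y T by (simp add: norm_divide field_simps)
   hence "norm (1 / y) > R'" "R <= norm (1 / y)" using T by (auto simp: S_def)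
   thus ?thesis using R R' by (force simp: outer_region_def)
  qed (simp add: outer_region_def)
 qed
 hence "outer_region gm = {y\<in>-{0}. 1 / y \<in> V} \<union> ball 0 (1 / T)"
  unfolding outer_region_def V_def using T by auto
 ultimately show ?thesis by (simp only: open_Un open_ball)
qed

text \<open>Uniformly for nearby parameters, all but finitely many members lie in one disc around 0
  inside \<open>V\<close>; what remains is finitely many open conditions. \<open>G\<close> restricts
  the claim to the indices that satisfy it in the limit, as pinched families require.\<close>

lemma eventually_geometric_family_in_open:
 fixes p q x :: complex
 assumes q: "norm q < 1" and p: "norm p < 1" and P: "(P \<longlongrightarrow> p) F" and X: "(X \<longlongrightarrow> x) F"
  and V: "open V" "0 \<in> V" "!!j k. G j k ==> x * p ^ j * q ^ k \<in> V"
 shows "eventually (%xi. \<forall>j k. G j k --> X xi * P xi ^ j * q ^ k \<in> V) F"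
proof -
 obtain \<delta> where \<delta>: "\<delta> > 0" "ball 0 \<delta> \<subseteq> V" using V openE by blast
 define M where "M = norm x + 1"
 have M: "M > 0" by (simp add: M_def add_nonneg_pos)
 obtain r where r: "norm p < r" "norm q < r" "r < 1" using dense[of "max (norm p) (norm q)" 1] p q by auto
 have r0: "r > 0" using r norm_ge_zero[of p] by linarith
 obtain N where N: "r ^ N < \<delta> / M" using real_arch_pow_inv[of "\<delta> / M" r] \<delta> M r by auto
 have 1: "eventually (%xi. norm (P xi) < r) F" using tendsto_norm[OF P] r by (intro order_tendstoD)
 have 2: "eventually (%xi. norm (X xi) < M) F" using tendsto_norm[OF X] by (intro order_tendstoD) (auto simp: M_def)
 have 3: "eventually (%xi. \<forall>jk\<in>{jk\<in>{..<N}\<times>{..<N}. G (fst jk) (snd jk)}. X xi * P xi ^ fst jk * q ^ snd jk \<in> V) F"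
 proof (rule eventually_ball_finite)
  show "\<forall>jk\<in>{jk\<in>{..<N}\<times>{..<N}. G (fst jk) (snd jk)}. \<forall>\<^sub>F xi in F. X xi * P xi ^ fst jk * q ^ snd jk \<in> V"
  proof
   fix jk assume "jk \<in> {jk\<in>{..<N}\<times>{..<N}. G (fst jk) (snd jk)}"
   hence G: "G (fst jk) (snd jk)" by auto
   show "\<forall>\<^sub>F xi in F. X xi * P xi ^ fst jk * q ^ snd jk \<in> V"
    by (rule topological_tendstoD[OF _ V(1) V(3)[OF G]]) (intro tendsto_intros P X)
  qed
 qed auto
 show ?thesis using 1 2 3
 proof eventually_elim
  case (elim xi)
  show ?case
  proof (intro allI impI)
   fix j k assume G: "G j k"
   show "X xi * P xi ^ j * q ^ k \<in> V"
   proof (cases "j < N & k < N")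
    case True
    thus ?thesis using elim(3) G by auto
   next
    case False
    have a: "norm (P xi) ^ j <= r ^ j" "norm q ^ k <= r ^ k" using elim r by (auto intro!: power_mono)
    have "norm (P xi) ^ j * norm q ^ k <= r ^ j * r ^ k" using a r0 by (intro mult_mono) auto
    also have "... <= r ^ N" unfolding power_add[symmetric] using False r r0 by (intro power_decreasing) auto
    finally have "norm (P xi) ^ j * norm q ^ k <= r ^ N" .
    hence "norm (X xi) * (norm (P xi) ^ j * norm q ^ k) <= M * r ^ N"
     using elim M by (intro mult_mono) auto
    also have "... < \<delta>" using N M by (simp add: field_simps)
    finally show ?thesis using \<delta> by (auto simp: norm_mult norm_power mult_ac subset_iff)
   qed
  qed
 qed
qed

lemma finite_geometric_family:
 fixes p q x :: complex
 assumes q: "norm q < 1" and p: "norm p < 1" and e: "e > 0"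
 shows "finite {(j, k). e <= norm (x * p ^ j * q ^ k)}"
proof -
 define M where "M = norm x + 1"
 have M: "M > 0" "norm x <= M" by (auto simp: M_def add_nonneg_pos)
 obtain r where r: "norm p < r" "norm q < r" "r < 1" using dense[of "max (norm p) (norm q)" 1] p q by auto
 have r0: "r > 0" using r norm_ge_zero[of p] by linarith
 obtain N where N: "r ^ N < e / M" using real_arch_pow_inv[of "e / M" r] e M r by auto
 show ?thesis
 proof (rule finite_subset)
  show "{(j, k). e <= norm (x * p ^ j * q ^ k)} \<subseteq> {..<N} \<times> {..<N}"
  proof clarify
   fix j k assume le: "e <= norm (x * p ^ j * q ^ k)"
   have a: "norm p ^ j <= r ^ j" "norm q ^ k <= r ^ k" using r by (auto intro!: power_mono)
   have b: "norm p ^ j * norm q ^ k <= r ^ j * r ^ k" using a r0 by (intro mult_mono) auto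
   have "\<not> N <= j + k | False"
   proof (rule ccontr)
    assume "\<not> (\<not> N <= j + k | False)"
    hence "r ^ j * r ^ k <= r ^ N" unfolding power_add[symmetric] using r r0 by (intro power_decreasing) auto
    hence "norm p ^ j * norm q ^ k <= r ^ N" using b by linarith
    hence "norm x * (norm p ^ j * norm q ^ k) <= M * r ^ N" using M by (intro mult_mono) auto
    also have "... < e" using N M by (simp add: field_simps)
    finally show False using le by (simp add: norm_mult norm_power mult_ac)
   qed
   thus "j \<in> {..<N} & k \<in> {..<N}" by auto
  qed
 qed auto
qed

text \<open>One contour serves a whole neighbourhood of the parameters, \<open>p\<close> included;
  continuity and holomorphy of the integrals then concern a fixed path.\<close>

lemma separates_eventually:
 fixes A B :: "'x => 'n::finite => complex"
 assumes q: "norm q < 1" and p: "norm p < 1" and sep: "separates p q a b gm"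
  and P: "(P \<longlongrightarrow> p) F" and A: "!!i. ((%xi. A xi i) \<longlongrightarrow> a i) F" and B: "!!i. ((%xi. B xi i) \<longlongrightarrow> b i) F"
 shows "eventually (%xi. separates (P xi) q (A xi) (B xi) gm) F"
proof -
 have g: "valid_path gm" "pathfinish gm = pathstart gm" "0 \<in> inner_region gm" using sep by (auto simp: separates_def)
 have pg: "path gm" using g valid_path_imp_path by auto
 have 1: "eventually (%xi. \<forall>i j k. A xi i * P xi ^ j * q ^ k \<in> inner_region gm) F"
  by (rule eventually_all_finite, rule eventually_geometric_family_in_open[OF q p P A open_inner_region[OF pg g(2)] g(3), where G = "%_ _. True", simplified])
   (use sep in \<open>auto simp: separates_def\<close>)
 have 2: "eventually (%xi. \<forall>i j k. B xi i * P xi ^ j * q ^ k \<in> outer_region gm) F"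
  by (rule eventually_all_finite, rule eventually_geometric_family_in_open[OF q p P B open_outer_region[OF pg g(2)], where G = "%_ _. True", simplified])
   (use sep in \<open>simp_all add: separates_def\<close>, simp add: outer_region_def)
 show ?thesis using 1 2 by eventually_elim (use g in \<open>auto simp: separates_def\<close>)
qed

lemma separates_path_image:
 assumes "norm q < 1" "norm p < 1" "separates p q a b gm"
 shows "path_image gm \<subseteq> pole_free p q a b"
proof (rule ccontr)
 assume "\<not> path_image gm \<subseteq> pole_free p q a b"
 then obtain z where z: "z \<in> path_image gm" "z ~: pole_free p q a b" by auto
 have "z = 0 | (\<exists>i j k. z = a i * p ^ j * q ^ k | b i * p ^ j * q ^ k * z = 1)"
  using z(2) not_pole_free_iff[OF assms(1,2)] by blast
 then consider "z = 0" | i j k where "z = a i * p ^ j * q ^ k" | i j k where "b i * p ^ j * q ^ k * z = 1" by blast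
 thus False
 proof cases
  case 1 thus False using z assms(3) by (auto simp: separates_def inner_region_def)
 next
  case 2
  have "a i * p ^ j * q ^ k \<in> inner_region gm" using assms(3) by (simp add: separates_def)
  thus False using z 2 by (simp add: inner_region_def)
 next
  case 3
  have "b i * p ^ j * q ^ k \<in> outer_region gm" using assms(3) by (simp add: separates_def)
  moreover have "b i * p ^ j * q ^ k ~= 0" "1 / (b i * p ^ j * q ^ k) = z" using mult_eq_1_imp_divide[OF 3] by auto
  ultimately show False using z(1) unfolding outer_region_def by (simp only: mem_Collect_eq simp_thms)
 qed
qed

text \<open>The complement of the domain consists of 0, the inner poles and the outer poles, and on
  each of these three sets the winding number is prescribed.\<close>

lemma separates_integral_eq:
 fixes a b :: "'n::finite => complex"
 assumes q: "norm q < 1" and p: "norm p < 1" and f: "f holomorphic_on pole_free p q a b"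
  and s: "separates p q a b gm1" "separates p q a b gm2"
 shows "contour_integral gm1 f = contour_integral gm2 f"
proof (rule contour_integral_eq_homologous[OF open_pole_free[OF q p] connected_pole_free[OF q p] f])
 fix w assume "w ~: pole_free p q a b"
 then consider "w = 0" | i j k where "w = a i * p ^ j * q ^ k" | i j k where "b i * p ^ j * q ^ k * w = 1"
  using not_pole_free_iff[OF q p, of w a b] by blast
 thus "winding_number gm1 w = winding_number gm2 w"
 proof cases
  case 3
  have "b i * p ^ j * q ^ k \<in> outer_region gm1" "b i * p ^ j * q ^ k \<in> outer_region gm2" using s by (auto simp: separates_def)
  moreover have "b i * p ^ j * q ^ k ~= 0" "1 / (b i * p ^ j * q ^ k) = w" using mult_eq_1_imp_divide[OF 3] by auto
  ultimately show ?thesis unfolding outer_region_def by (simp only: mem_Collect_eq simp_thms)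
 qed (use s in \<open>auto simp: separates_def inner_region_def\<close>)
qed (use s separates_path_image[OF q p] in \<open>auto simp: separates_def\<close>)

lemma sep_integral_eq:
 fixes a b :: "'n::finite => complex"
 assumes "norm q < 1" "norm p < 1" "f holomorphic_on pole_free p q a b" "separates p q a b gm"
 shows "sep_integral p q a b f = contour_integral gm f"
 unfolding sep_integral_def
 by (rule separates_integral_eq[OF assms(1-3) _ assms(4)]) (rule someI[of "separates p q a b", OF assms(4)])

lemma finite_inner_poles:
 fixes a :: "'n::finite => complex"
 assumes q: "norm q < 1" and p: "norm p < 1" and e: "e > 0"
 shows "finite {x. (\<exists>i j k. x = a i * p ^ j * q ^ k) & norm x >= e}"
proof (rule finite_subset)
 show "{x. (\<exists>i j k. x = a i * p ^ j * q ^ k) & norm x >= e} \<subseteq> (\<Union>i. (%(j, k). a i * p ^ j * q ^ k) ` {(j, k). e <= norm (a i * p ^ j * q ^ k)})"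
  by (fastforce)
 show "finite (\<Union>i. (%(j, k). a i * p ^ j * q ^ k) ` {(j, k). e <= norm (a i * p ^ j * q ^ k)})"
  by (intro finite_UN_I finite_imageI finite_geometric_family[OF q p e]) auto
qed

lemma finite_outer_poles:
 fixes b :: "'n::finite => complex"
 assumes q: "norm q < 1" and p: "norm p < 1"
 shows "finite {x. (\<exists>i j k. x = 1 / (b i * p ^ j * q ^ k) & b i * p ^ j * q ^ k ~= 0) & norm x <= R}"
proof (rule finite_subset)
 define e where "e = 1 / (max R 0 + 1)"
 have e: "e > 0" by (simp add: e_def)
 show "{x. (\<exists>i j k. x = 1 / (b i * p ^ j * q ^ k) & b i * p ^ j * q ^ k ~= 0) & norm x <= R} \<subseteq> (\<Union>i. (%(j, k). 1 / (b i * p ^ j * q ^ k)) ` {(j, k). e <= norm (b i * p ^ j * q ^ k)})"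
 proof
  fix x assume "x \<in> {x. (\<exists>i j k. x = 1 / (b i * p ^ j * q ^ k) & b i * p ^ j * q ^ k ~= 0) & norm x <= R}"
  then obtain i j k where x: "x = 1 / (b i * p ^ j * q ^ k)" "b i * p ^ j * q ^ k ~= 0" "norm x <= R" by blast
  have "1 = norm (b i * p ^ j * q ^ k) * norm x" using x(2) unfolding x(1) norm_mult[symmetric] by simp
  also have "... <= norm (b i * p ^ j * q ^ k) * (max R 0 + 1)" using x(3) by (intro mult_left_mono) auto
  finally have "e <= norm (b i * p ^ j * q ^ k)" by (simp add: e_def divide_simps)
  thus "x \<in> (\<Union>i. (%(j, k). 1 / (b i * p ^ j * q ^ k)) ` {(j, k). e <= norm (b i * p ^ j * q ^ k)})"
   using x(1) by (intro UN_I[of i]) auto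
 qed
 show "finite (\<Union>i. (%(j, k). 1 / (b i * p ^ j * q ^ k)) ` {(j, k). e <= norm (b i * p ^ j * q ^ k)})"
  by (intro finite_UN_I finite_imageI finite_geometric_family[OF q p e]) auto
qed

text \<open>\<open>Z\<close> leaves room for the points that \<open>E_admissible\<close> forbids in
  addition to the poles.\<close>

lemma separates_exists:
 fixes a b :: "'n::finite => complex"
 assumes q: "norm q < 1" and p: "norm p < 1" and nr: "nonresonant p q a b"
  and Z: "0 ~: Z" "!!e R. e > 0 ==> finite {x\<in>Z. norm x >= e & norm x <= R}"
 obtains gm where "polynomial_function gm" "separates p q a b gm" "path_image gm \<inter> Z = {}"
proof -
 define A where "A = {a i * p ^ j * q ^ k | i j k. a i * p ^ j * q ^ k ~= 0}"
 define B where "B = {1 / (b i * p ^ j * q ^ k) | i j k. b i * p ^ j * q ^ k ~= 0}"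
 have A: "finite {x\<in>A. norm x >= e}" if "e > 0" for e
  by (rule finite_subset[OF _ finite_inner_poles[OF q p that, of a]]) (auto simp: A_def)
 have B: "finite {x\<in>B. norm x <= R}" for R
  by (rule finite_subset[OF _ finite_outer_poles[OF q p, of b R]]) (auto simp: B_def)
 have AB: "A \<inter> B = {}"
 proof (rule ccontr)
  assume "A \<inter> B ~= {}"
  then obtain i j k i' j' k' where *: "a i * p ^ j * q ^ k = 1 / (b i' * p ^ j' * q ^ k')" "b i' * p ^ j' * q ^ k' ~= 0"
   unfolding A_def B_def by (simp add: disjoint_iff) metis
  hence "a i * p ^ j * q ^ k * (b i' * p ^ j' * q ^ k') = 1" by simp
  hence "a i * b i' * p ^ (j + j') * q ^ (k + k') = 1" by (simp add: power_add mult_ac)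
  thus False using nr by (simp add: nonresonant_def)
 qed
 obtain gm where g: "polynomial_function gm" "pathfinish gm = pathstart gm" "path_image gm \<inter> insert 0 (A \<union> B \<union> Z) = {}"
  "!!x. x \<in> insert 0 A ==> winding_number gm x = 1" "!!x. x \<in> B ==> winding_number gm x = 0"
  by (rule contour_separation[OF _ A _ B Z AB]) (auto simp: A_def B_def)
 show thesis
 proof (rule that[of gm])
  have "a i * p ^ j * q ^ k \<in> inner_region gm" for i j k
  proof -
   have "a i * p ^ j * q ^ k \<in> insert 0 A" unfolding A_def by blast
   thus ?thesis using g(3) g(4)[of "a i * p ^ j * q ^ k"] unfolding inner_region_def by blast
  qed
  moreover have "b i * p ^ j * q ^ k \<in> outer_region gm" for i j k
  proof (cases "b i * p ^ j * q ^ k = 0")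
   case False
   hence "1 / (b i * p ^ j * q ^ k) \<in> B" unfolding B_def by blast
   thus ?thesis using g by (auto simp: outer_region_def)
  qed (simp add: outer_region_def)
  ultimately show "separates p q a b gm"
   using g by (auto simp: separates_def inner_region_def valid_path_polynomial_function)
  show "path_image gm \<inter> Z = {}" using g(3) by blast
 qed (rule g)
qed

lemma separates_circle:
 assumes q: "norm q < 1" and p: "norm p < 1" and a: "!!i. norm (a i) < r" and b: "!!i. norm (b i) * r < 1" and r: "r > 0"
 shows "separates p q a b (circlepath 0 r)"
proof -
 have le: "norm (x * p ^ j * q ^ k) <= norm x" for x j k
  using q p unfolding norm_mult norm_power mult.assoc
  by (intro mult_left_le mult_le_one power_le_one) auto
 have i: "x \<in> inner_region (circlepath 0 r)" if "norm x < r" for x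
  using that r by (auto simp: inner_region_def winding_number_circlepath)
 have o: "x \<in> outer_region (circlepath 0 r)" if "norm x * r < 1" for x
 proof (cases "x = 0")
  case False
  hence "norm (1 / x) > r" using that by (simp add: norm_divide field_simps)
  thus ?thesis using r by (auto simp: outer_region_def intro!: winding_number_zero_outside[of _ "cball 0 r"] valid_path_imp_path)
 qed (simp add: outer_region_def)
 show ?thesis unfolding separates_def
 proof (intro conjI allI)
  fix i' j k
  show "a i' * p ^ j * q ^ k \<in> inner_region (circlepath 0 r)" using le[of "a i'" j k] a[of i'] by (intro i) linarith
  have "norm (b i' * p ^ j * q ^ k) * r <= norm (b i') * r" using le r by (intro mult_right_mono) auto
  thus "b i' * p ^ j * q ^ k \<in> outer_region (circlepath 0 r)" using b[of i'] by (intro o) linarith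
 qed (use i r in auto)
qed

section \<open>Parameter integrals over separating contours\<close>

lemma eventually_at_within_split:
 assumes "x \<in> U" "P x" "eventually P (at x within U)"
 obtains T where "open T" "x \<in> T" "!!y. y \<in> U \<inter> T ==> P y"
 using assms unfolding eventually_at_topological by (metis IntD1 IntD2)

lemma continuous_on_local:
 assumes "!!x. x \<in> U ==> \<exists>T. open T & x \<in> T & continuous_on (U \<inter> T) f"
 shows "continuous_on U f"
 unfolding continuous_on_def
proof
 fix x assume x: "x \<in> U"
 then obtain T where T: "open T" "x \<in> T" "continuous_on (U \<inter> T) f" using assms by blast
 have "(f \<longlongrightarrow> f x) (at x within U \<inter> T)" using T x by (auto simp: continuous_on_def)
 moreover have "at x within U \<inter> T = at x within U" by (rule at_within_nhd[of x T]) (use T in auto)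
 ultimately show "(f \<longlongrightarrow> f x) (at x within U)" by simp
qed

lemma holomorphicI_local:
 assumes "!!x. x \<in> U ==> \<exists>S. open S & x \<in> S & f holomorphic_on S"
 shows "f holomorphic_on U"
 unfolding holomorphic_on_def
 using assms by (meson field_differentiable_at_within holomorphic_on_imp_differentiable_at)

lemma contour_integral_polynomial_path:
 assumes "polynomial_function gm"
 obtains gm' where "continuous_on UNIV gm'" "!!f. contour_integral gm f = integral {0..1} (%t. f (gm t) * gm' t)"
proof -
 obtain gm' where g': "polynomial_function gm'" "!!x. (gm has_vector_derivative (gm' x)) (at x)"
  using has_vector_derivative_polynomial_function[OF assms] by metis
 show thesis
 proof (rule that[of gm'])
  show "continuous_on UNIV gm'" using g' continuous_on_polymonial_function by blast
  show "contour_integral gm f = integral {0..1} (%t. f (gm t) * gm' t)" for f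
   unfolding contour_integral_integral using vector_derivative_at[OF g'(2)] by simp
 qed
qed

lemma continuous_on_sep_integral:
 fixes A B :: "'x::topological_space => 'n::finite => complex"
 assumes q: "norm q < 1" and P: "continuous_on U P" "!!xi. xi \<in> U ==> norm (P xi) < 1"
  and A: "!!i. continuous_on U (%xi. A xi i)" and B: "!!i. continuous_on U (%xi. B xi i)"
  and nr: "!!xi. xi \<in> U ==> nonresonant (P xi) q (A xi) (B xi)"
  and hol: "!!xi. xi \<in> U ==> F xi holomorphic_on pole_free (P xi) q (A xi) (B xi)"
  and cont: "continuous_on {(xi, z). xi \<in> U & z \<in> pole_free (P xi) q (A xi) (B xi)} (%(xi, z). F xi z)"
 shows "continuous_on U (%xi. sep_integral (P xi) q (A xi) (B xi) (F xi))"
proof (rule continuous_on_local)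
 fix xi0 assume xi0: "xi0 \<in> U"
 obtain gm where g: "polynomial_function gm" "separates (P xi0) q (A xi0) (B xi0) gm"
  by (rule separates_exists[OF q P(2)[OF xi0] nr[OF xi0], of "{}"]) auto
 obtain gm' where g': "continuous_on UNIV gm'" "!!f. contour_integral gm f = integral {0..1} (%t. f (gm t) * gm' t)"
  using contour_integral_polynomial_path[OF g(1)] by metis
 have "eventually (%xi. separates (P xi) q (A xi) (B xi) gm) (at xi0 within U)"
  by (rule separates_eventually[OF q P(2)[OF xi0] g(2)]) (use P A B xi0 in \<open>auto simp: continuous_on_def\<close>)
 then obtain T where T: "open T" "xi0 \<in> T" "!!xi. xi \<in> U \<inter> T ==> separates (P xi) q (A xi) (B xi) gm"
  using eventually_at_within_split[of xi0 U "%xi. separates (P xi) q (A xi) (B xi) gm"] xi0 g(2) by metis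
 have im: "gm t \<in> pole_free (P xi) q (A xi) (B xi)" if "xi \<in> U \<inter> T" "t \<in> {0..1}" for xi t
  using separates_path_image[OF q P(2) T(3)[OF that(1)]] that by (auto simp: path_image_def)
 have "continuous_on (U \<inter> T) (%xi. integral (cbox 0 1) (%t. F xi (gm t) * gm' t))"
 proof (rule integral_continuous_on_param)
  have "continuous_on ((U \<inter> T) \<times> cbox 0 1) (%x. (%(xi, z). F xi z) (fst x, gm (snd x)))"
  proof (rule continuous_on_compose2[OF cont])
   show "continuous_on ((U \<inter> T) \<times> cbox 0 1) (%x. (fst x, gm (snd x)))"
    by (intro continuous_intros continuous_on_compose2[OF continuous_on_polymonial_function[OF g(1), of UNIV]]) auto
  qed (use im in auto)
  thus "continuous_on ((U \<inter> T) \<times> cbox 0 1) (%(xi, t). F xi (gm t) * gm' t)"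
   unfolding case_prod_beta'
   by (intro continuous_intros continuous_on_compose2[OF g'(1)]) auto
 qed
 moreover have "integral (cbox 0 1) (%t. F xi (gm t) * gm' t) = sep_integral (P xi) q (A xi) (B xi) (F xi)" if "xi \<in> U \<inter> T" for xi
  using sep_integral_eq[OF q P(2) hol T(3)[OF that]] that by (simp add: g')
 ultimately have "continuous_on (U \<inter> T) (%xi. sep_integral (P xi) q (A xi) (B xi) (F xi))"
  by (rule continuous_on_eq)
 thus "\<exists>T. open T & xi0 \<in> T & continuous_on (U \<inter> T) (%xi. sep_integral (P xi) q (A xi) (B xi) (F xi))"
  using T by blast
qed

lemma holomorphic_parametric_integral:
 fixes f :: "complex => real => complex"
 assumes S: "open S" and cont: "continuous_on (S \<times> {0..1}) (%(w, t). f w t)"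
  and hol: "!!t. t \<in> {0..1} ==> (%w. f w t) holomorphic_on S"
 shows "(%w. integral {0..1} (f w)) holomorphic_on S"
proof -
 have loc: "\<exists>T. open T & w0 \<in> T & (%w. integral {0..1} (f w)) holomorphic_on T" if w0: "w0 \<in> S" for w0
 proof -
  obtain r where r: "r > 0" "cball w0 r \<subseteq> S" using S w0 open_contains_cball by blast
  define c where "c = circlepath w0 r"
  have c: "c t = w0 + of_real r * exp (2 * of_real pi * \<i> * of_real t)" for t by (simp add: c_def circlepath)
  \<comment> \<open>The derivative in \<open>w\<close>, written by Cauchy's formula over the circle
    \<open>c\<close>. In this form its joint continuity in \<open>(w, t)\<close>, demanded by
    differentiation under the integral sign, follows from that of \<open>f\<close>.\<close>
  define fx where "fx = (%w t. 1 / (2 * of_real pi * \<i>) *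
   integral {0..1} (%s. f (c s) t / (c s - w)^2 * (2 * pi * \<i> * r * exp(2 * of_real pi * \<i> * of_real s))))"
  have cs: "c s \<in> sphere w0 r" "c s \<in> S" for s
  proof -
   have "norm (exp (2 * complex_of_real pi * \<i> * of_real s)) = 1" by simp
   thus "c s \<in> sphere w0 r" using r by (simp add: c dist_norm norm_mult)
   thus "c s \<in> S" using r by auto
  qed
  have der: "((%w. f w t) has_field_derivative fx w t) (at w within ball w0 r)" if "w \<in> ball w0 r" "t \<in> cbox 0 1" for w t
  proof -
   have "(%w. f w t) holomorphic_on S" using hol that by auto
   hence "continuous_on (cball w0 r) (%w. f w t)" "(%w. f w t) holomorphic_on ball w0 r"
    using r(2) ball_subset_cball[of w0 r] by (meson holomorphic_on_imp_continuous_on holomorphic_on_subset order_trans)+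
   from Cauchy_derivative_integral_circlepath(2)[OF this that(1)]
   have "((%w. f w t) has_field_derivative fx w t) (at w)"
    unfolding contour_integral_integral vector_derivative_circlepath fx_def c_def .
   thus ?thesis by (rule has_field_derivative_at_within)
  qed
  have contf: "continuous_on (X) (%x. f (g x) (h x))" if "continuous_on X g" "continuous_on X h" "!!x. x \<in> X ==> g x \<in> S & h x \<in> {0..1}"
   for X and g :: "'z::topological_space => complex" and h
   using continuous_on_compose2[OF cont continuous_on_Pair[OF that(1,2)]] that(3) by (simp add: image_subset_iff)
  have contc: "continuous_on X (%x. c (g x))" if "continuous_on X g" for X and g :: "'z::topological_space => real"
   unfolding c by (intro continuous_intros that)
  have "(%w. integral (cbox 0 1) (f w)) holomorphic_on ball w0 r"
  proof (rule leibniz_rule_holomorphic[OF der])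
   show "f w integrable_on cbox 0 1" if "w \<in> ball w0 r" for w
    by (rule integrable_continuous, rule continuous_on_compose2[OF cont, of _ "%t. (w, t)", simplified])
     (use that r ball_subset_cball[of w0 r] in \<open>auto intro!: continuous_intros\<close>)
   have "continuous_on ((ball w0 r \<times> {0..1}) \<times> cbox 0 1) (%(x, s). f (c s) (snd x) / (c s - fst x)^2
       * (2 * pi * \<i> * r * exp(2 * of_real pi * \<i> * of_real s)))"
    unfolding case_prod_beta'
   proof (intro continuous_intros contf contc)
    show "c (snd x) \<in> S & snd (fst x) \<in> {0..1}" if "x \<in> (ball w0 r \<times> {0..1}) \<times> cbox 0 1" for x
     using that cs by auto
    show "\<forall>x\<in>(ball w0 r \<times> {0..1}) \<times> cbox 0 1. (c (snd x) - fst (fst x))\<^sup>2 ~= 0"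
     using cs(1) by force
   qed
   from integral_continuous_on_param[OF this]
   show "continuous_on (ball w0 r \<times> cbox 0 1) (%(w, t). fx w t)"
    unfolding fx_def case_prod_beta' by (intro continuous_intros) auto
  qed auto
  thus ?thesis using r by (intro exI[of _ "ball w0 r"]) auto
 qed
 show ?thesis
  by (rule holomorphicI_local) (use loc in blast)
qed

lemma holomorphic_on_sep_integral:
 fixes A B :: "complex => 'n::finite => complex"
 assumes q: "norm q < 1" and p: "norm p < 1" and U: "open U"
  and A: "!!i. continuous_on U (%xi. A xi i)" and B: "!!i. continuous_on U (%xi. B xi i)"
  and nr: "!!xi. xi \<in> U ==> nonresonant p q (A xi) (B xi)"
  and hol: "!!xi. xi \<in> U ==> F xi holomorphic_on pole_free p q (A xi) (B xi)"
  and holw: "!!z T. T \<subseteq> {xi\<in>U. z \<in> pole_free p q (A xi) (B xi)} ==> (%xi. F xi z) holomorphic_on T"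
  and cont: "continuous_on {(xi, z). xi \<in> U & z \<in> pole_free p q (A xi) (B xi)} (%(xi, z). F xi z)"
 shows "(%xi. sep_integral p q (A xi) (B xi) (F xi)) holomorphic_on U"
proof (rule holomorphicI_local)
 fix xi0 assume xi0: "xi0 \<in> U"
 obtain gm where g: "polynomial_function gm" "separates p q (A xi0) (B xi0) gm"
  by (rule separates_exists[OF q p nr[OF xi0], of "{}"]) auto
 obtain gm' where g': "continuous_on UNIV gm'" "!!f. contour_integral gm f = integral {0..1} (%t. f (gm t) * gm' t)"
  using contour_integral_polynomial_path[OF g(1)] by metis
 have "eventually (%xi. separates p q (A xi) (B xi) gm) (at xi0 within U)"
  by (rule separates_eventually[OF q p g(2)]) (use A B xi0 in \<open>auto simp: continuous_on_def\<close>)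
 then obtain T where T: "open T" "xi0 \<in> T" "!!xi. xi \<in> U \<inter> T ==> separates p q (A xi) (B xi) gm"
  using eventually_at_within_split[of xi0 U "%xi. separates p q (A xi) (B xi) gm"] xi0 g(2) by metis
 have im: "gm t \<in> pole_free p q (A xi) (B xi)" if "xi \<in> U \<inter> T" "t \<in> {0..1}" for xi t
  using separates_path_image[OF q p T(3)[OF that(1)]] that by (auto simp: path_image_def)
 have "(%xi. integral {0..1} (%t. F xi (gm t) * gm' t)) holomorphic_on U \<inter> T"
 proof (rule holomorphic_parametric_integral)
  show "open (U \<inter> T)" using U T by auto
  have "continuous_on ((U \<inter> T) \<times> {0..1}) (%x. (%(xi, z). F xi z) (fst x, gm (snd x)))"
  proof (rule continuous_on_compose2[OF cont])
   show "continuous_on ((U \<inter> T) \<times> {0..1}) (%x. (fst x, gm (snd x)))"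
    by (intro continuous_intros continuous_on_compose2[OF continuous_on_polymonial_function[OF g(1), of UNIV]]) auto
  qed (use im in auto)
  thus "continuous_on ((U \<inter> T) \<times> {0..1}) (%(xi, t). F xi (gm t) * gm' t)"
   unfolding case_prod_beta'
   by (intro continuous_intros continuous_on_compose2[OF g'(1)]) auto
  show "(%xi. F xi (gm t) * gm' t) holomorphic_on U \<inter> T" if "t \<in> {0..1}" for t
   using im that by (intro holomorphic_intros holw) auto
 qed
 moreover have "integral {0..1} (%t. F xi (gm t) * gm' t) = sep_integral p q (A xi) (B xi) (F xi)" if "xi \<in> U \<inter> T" for xi
  using sep_integral_eq[OF q p hol T(3)[OF that]] that by (simp add: g')
 ultimately have "(%xi. sep_integral p q (A xi) (B xi) (F xi)) holomorphic_on U \<inter> T"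
  by (rule holomorphic_transform)
 thus "\<exists>S. open S & xi0 \<in> S & (%xi. sep_integral p q (A xi) (B xi) (F xi)) holomorphic_on S"
  using T U xi0 by (intro exI[of _ "U \<inter> T"]) auto
qed

text \<open>For \<open>a = b = t\<close> and \<open>c = d = p q / t\<close> this is the product of
  the \<Gamma>(t_r z) \<Gamma>(t_r / z). The numerators have parameters of their own, since t_r may
  vanish with p at a vertex while p q / t_r has a limit.\<close>

definition gamma_quot :: "complex => complex => ('n::finite => complex) => ('n => complex) => ('n => complex) => ('n => complex) => complex => complex" where
 "gamma_quot p q a b c d z =
  (\<Prod>r\<in>UNIV. qpoch2 (c r / z) p q * qpoch2 (d r * z) p q / (qpoch2 (a r / z) p q * qpoch2 (b r * z) p q))"

definition kernel_integral :: "complex => complex => ('n::finite => complex) => ('n => complex) => ('n => complex) => ('n => complex) => (complex => complex) => complex" where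
 "kernel_integral p q a b c d W =
  sep_integral p q a b (%z. W z * gamma_quot p q a b c d z / (2 * of_real pi * \<i> * z))"

lemma holomorphic_kernel:
 assumes q: "norm q < 1" and p: "norm p < 1" and W: "W holomorphic_on (-{0})"
 shows "(%z. W z * gamma_quot p q a b c d z / (2 * of_real pi * \<i> * z)) holomorphic_on pole_free p q a b"
proof -
 have "W holomorphic_on pole_free p q a b" using W by (rule holomorphic_on_subset) (auto simp: pole_free_def)
 thus ?thesis unfolding gamma_quot_def
  by (intro holomorphic_intros q p) (auto simp: pole_free_def)
qed

lemma kernel_integral_eq:
 assumes "norm q < 1" "norm p < 1" "W holomorphic_on (-{0})" "separates p q a b gm"
 shows "kernel_integral p q a b c d W = contour_integral gm (%z. W z * gamma_quot p q a b c d z / (2 * of_real pi * \<i> * z))"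
 unfolding kernel_integral_def by (rule sep_integral_eq[OF assms(1,2) holomorphic_kernel[OF assms(1-3)] assms(4)])

lemma continuous_on_kernel_integral:
 fixes A B C D :: "'x::topological_space => 'n::finite => complex"
 assumes q: "norm q < 1" and P: "continuous_on U P" "!!xi. xi \<in> U ==> norm (P xi) < 1"
  and ABCD: "!!i. continuous_on U (%xi. A xi i)" "!!i. continuous_on U (%xi. B xi i)"
   "!!i. continuous_on U (%xi. C xi i)" "!!i. continuous_on U (%xi. D xi i)"
  and nr: "!!xi. xi \<in> U ==> nonresonant (P xi) q (A xi) (B xi)"
  and W: "!!xi. xi \<in> U ==> W xi holomorphic_on (-{0})" "continuous_on (U \<times> (-{0})) (%(xi, z). W xi z)"
 shows "continuous_on U (%xi. kernel_integral (P xi) q (A xi) (B xi) (C xi) (D xi) (W xi))"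
 unfolding kernel_integral_def
proof (rule continuous_on_sep_integral[OF q P ABCD(1,2) nr])
 fix xi assume "xi \<in> U"
 thus "(%z. W xi z * gamma_quot (P xi) q (A xi) (B xi) (C xi) (D xi) z / (2 * of_real pi * \<i> * z))
     holomorphic_on pole_free (P xi) q (A xi) (B xi)"
  by (intro holomorphic_kernel q P W)
next
 define V where "V = {(xi, z). xi \<in> U & z \<in> pole_free (P xi) q (A xi) (B xi)}"
 have V: "V \<subseteq> U \<times> (-{0})" by (auto simp: V_def pole_free_def)
 have W': "continuous_on V (%x. W (fst x) (snd x))"
  using continuous_on_subset[OF W(2) V] by (simp add: case_prod_beta')
 have fstc: "continuous_on V (%x. f (fst x))" if "continuous_on U f" for f :: "'x => complex"
  by (rule continuous_on_compose2[OF that]) (use V in \<open>auto intro!: continuous_intros\<close>)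
 show "continuous_on V (%(xi, z). W xi z * gamma_quot (P xi) q (A xi) (B xi) (C xi) (D xi) z / (2 * of_real pi * \<i> * z))"
  unfolding case_prod_beta' gamma_quot_def
  by (intro continuous_intros W' fstc q P ABCD) (use V P(2) in \<open>auto simp: V_def pole_free_def\<close>)
qed

lemma holomorphic_on_kernel_integral:
 fixes A B C D :: "complex => 'n::finite => complex"
 assumes q: "norm q < 1" and p: "norm p < 1" and U: "open U"
  and ABCD: "!!i. (%xi. A xi i) holomorphic_on U" "!!i. (%xi. B xi i) holomorphic_on U"
   "!!i. (%xi. C xi i) holomorphic_on U" "!!i. (%xi. D xi i) holomorphic_on U"
  and nr: "!!xi. xi \<in> U ==> nonresonant p q (A xi) (B xi)"
  and W: "!!xi. xi \<in> U ==> W xi holomorphic_on (-{0})" "continuous_on (U \<times> (-{0})) (%(xi, z). W xi z)"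
   "!!z. z ~= 0 ==> (%xi. W xi z) holomorphic_on U"
 shows "(%xi. kernel_integral p q (A xi) (B xi) (C xi) (D xi) (W xi)) holomorphic_on U"
 unfolding kernel_integral_def
proof (rule holomorphic_on_sep_integral[OF q p U _ _ nr])
 show "continuous_on U (%xi. A xi i)" "continuous_on U (%xi. B xi i)" for i
  using ABCD by (auto intro: holomorphic_on_imp_continuous_on)
next
 fix xi assume "xi \<in> U"
 thus "(%z. W xi z * gamma_quot p q (A xi) (B xi) (C xi) (D xi) z / (2 * of_real pi * \<i> * z))
     holomorphic_on pole_free p q (A xi) (B xi)"
  by (intro holomorphic_kernel q p W)
next
 fix z T assume T: "T \<subseteq> {xi \<in> U. z \<in> pole_free p q (A xi) (B xi)}"
 show "(%xi. W xi z * gamma_quot p q (A xi) (B xi) (C xi) (D xi) z / (2 * of_real pi * \<i> * z)) holomorphic_on T"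
 proof (cases "T = {}")
  case False
  hence z: "z ~= 0" using T by (auto simp: pole_free_def)
  have "T \<subseteq> U" using T by auto
  thus ?thesis unfolding gamma_quot_def using z T
   by (intro holomorphic_intros q p holomorphic_on_subset[OF W(3)] holomorphic_on_subset[OF ABCD(1)]
    holomorphic_on_subset[OF ABCD(2)] holomorphic_on_subset[OF ABCD(3)] holomorphic_on_subset[OF ABCD(4)])
    (auto simp: pole_free_def)
 qed (simp add: holomorphic_on_def)
next
 define V where "V = {(xi, z). xi \<in> U & z \<in> pole_free p q (A xi) (B xi)}"
 have V: "V \<subseteq> U \<times> (-{0})" by (auto simp: V_def pole_free_def)
 have W': "continuous_on V (%x. W (fst x) (snd x))"
  using continuous_on_subset[OF W(2) V] by (simp add: case_prod_beta')
 have fstc: "continuous_on V (%x. f (fst x))" if "f holomorphic_on U" for f :: "complex => complex"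
  by (rule continuous_on_compose2[OF holomorphic_on_imp_continuous_on[OF that]]) (use V in \<open>auto intro!: continuous_intros\<close>)
 show "continuous_on V (%(xi, z). W xi z * gamma_quot p q (A xi) (B xi) (C xi) (D xi) z / (2 * of_real pi * \<i> * z))"
  unfolding case_prod_beta' gamma_quot_def
  by (intro continuous_intros W' fstc q p ABCD) (use V p in \<open>auto simp: V_def pole_free_def\<close>)
qed

text \<open>The reciprocal of \<open>\<Gamma>(z\<^sup>2) \<Gamma>(z\<^sup>-\<^sup>2)\<close>, in a form without removable singularities.\<close>

definition weyl_weight :: "complex => complex => complex => complex" where
 "weyl_weight p q z = qpoch (z^2) q * qpoch (p * z^2) p * (qpoch (1 / z^2) q * qpoch (p / z^2) p)"

lemma egamma_square_inverse:
 assumes q: "norm q < 1" and p: "norm p < 1" and z: "z ~= 0"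
  and nz: "qpoch2 (p * q / z^2) p q ~= 0" "qpoch2 (p * q * z^2) p q ~= 0"
 shows "x / (egamma p q (z^2) * egamma p q (1 / z^2)) = x * weyl_weight p q z"
proof -
 \<comment> \<open>Peeling off the factors with \<open>j = 0\<close> and then those with
   \<open>k = 0\<close> leaves (p q y; p, q), which cancels against the numerator of the other gamma
   function.\<close>
 have e: "qpoch2 y p q = qpoch y q * qpoch (p * y) p * qpoch2 (p * q * y) p q" for y
  using qpoch2_shift_p[OF q p, of y] qpoch2_shift_q[OF q p, of "p * y"] by (simp add: mult_ac)
 have "inverse (egamma p q (z^2) * egamma p q (1 / z^2)) = weyl_weight p q z"
  using nz z unfolding egamma_def weyl_weight_def e[of "z^2"] e[of "1 / z^2"] by (simp add: field_simps)
 thus ?thesis by (simp add: divide_inverse)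
qed

lemma holomorphic_weyl_weight [holomorphic_intros]:
 assumes "norm q < 1" "norm p < 1"
 shows "weyl_weight p q holomorphic_on (-{0})"
 unfolding weyl_weight_def[abs_def] using assms by (intro holomorphic_intros) auto

lemma finite_qpoch2_zeros:
 assumes "norm q < 1" "norm p < 1"
 shows "finite {x. qpoch2 x p q = 0 & norm x <= R}"
proof (rule finite_subset)
 define e where "e = 1 / (max R 0 + 1)"
 have e: "e > 0" by (simp add: e_def)
 show "{x. qpoch2 x p q = 0 & norm x <= R} \<subseteq> (%(j, k). 1 / (p ^ j * q ^ k)) ` {(j, k). e <= norm (1 * p ^ j * q ^ k)}"
 proof
  fix x assume "x \<in> {x. qpoch2 x p q = 0 & norm x <= R}"
  then obtain j k where x: "p ^ j * q ^ k * x = 1" "norm x <= R" using qpoch2_eq_0_iff[OF assms] by auto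
  have "1 = norm (p ^ j * q ^ k) * norm x" using x(1) by (metis norm_mult norm_one)
  also have "... <= norm (p ^ j * q ^ k) * (max R 0 + 1)" using x(2) by (intro mult_left_mono) auto
  finally have "e <= norm (1 * p ^ j * q ^ k)" by (simp add: e_def divide_simps)
  thus "x \<in> (%(j, k). 1 / (p ^ j * q ^ k)) ` {(j, k). e <= norm (1 * p ^ j * q ^ k)}"
   using mult_eq_1_imp_divide[OF x(1)] by auto
 qed
 show "finite ((%(j, k). 1 / (p ^ j * q ^ k)) ` {(j, k). e <= norm (1 * p ^ j * q ^ k)})"
  by (intro finite_imageI finite_geometric_family[OF assms e])
qed

text \<open>The nonzero points where the Weyl factor in \<open>E_integrand\<close> has a vanishing
  double product. They are no singularities of \<open>weyl_weight\<close>, but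
  \<open>E_admissible\<close> keeps the contour away from them.\<close>

definition weyl_poles :: "complex => complex => complex set" where
 "weyl_poles p q = {z. z ~= 0 & (qpoch2 (z^2) p q = 0 | qpoch2 (1 / z^2) p q = 0 |
  qpoch2 (p * q / z^2) p q = 0 | qpoch2 (p * q * z^2) p q = 0)}"

lemma finite_weyl_poles:
 assumes q: "norm q < 1" and p: "norm p < 1" and pq: "p ~= 0" "q ~= 0" and e: "e > 0"
 shows "finite {z \<in> weyl_poles p q. norm z >= e & norm z <= R}"
proof -
 define X where "X = (%R. {x. qpoch2 x p q = 0 & norm x <= R} - {0})"
 have X: "finite (X R)" for R unfolding X_def using finite_qpoch2_zeros[OF q p] by auto
 have f: "finite {z. z^2 = g x}" if "g x ~= 0" for g :: "complex => complex" and x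
  using finite_nth_roots[of 2 "g x"] that by simp
 have fin: "finite (\<Union>x\<in>X R. {z. z^2 = g x})" if "!!x. x ~= 0 ==> g x ~= 0" for g :: "complex => complex" and R
 proof (intro finite_UN_I X)
  fix x assume "x \<in> X R"
  hence "x ~= 0" by (auto simp: X_def)
  hence "g x ~= 0" by (rule that)
  thus "finite {z. z^2 = g x}" by (rule f)
 qed
 show ?thesis
 proof (rule finite_subset)
  show "{z \<in> weyl_poles p q. norm z >= e & norm z <= R} \<subseteq> (\<Union>x\<in>X (R^2). {z. z^2 = x}) \<union> (\<Union>x\<in>X (1 / e^2). {z. z^2 = 1 / x})
   \<union> (\<Union>x\<in>X (norm (p * q) / e^2). {z. z^2 = p * q / x}) \<union> (\<Union>x\<in>X (norm (p * q) * R^2). {z. z^2 = x / (p * q)})"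
  proof
   fix z assume "z \<in> {z \<in> weyl_poles p q. norm z >= e & norm z <= R}"
   hence z: "z \<in> weyl_poles p q" "norm z >= e" "norm z <= R" by auto
   have z0: "z ~= 0" using z e by auto
   have b: "norm z ^ 2 <= R ^ 2" "e ^ 2 <= norm z ^ 2" using z e by (auto intro!: power_mono)
   have b2: "1 / norm z ^ 2 <= 1 / e ^ 2" using b e z0 by (intro divide_left_mono) auto
   from z(1) consider "qpoch2 (z^2) p q = 0" | "qpoch2 (1 / z^2) p q = 0" | "qpoch2 (p * q / z^2) p q = 0" | "qpoch2 (p * q * z^2) p q = 0"
    by (auto simp: weyl_poles_def)
   thus "z \<in> (\<Union>x\<in>X (R^2). {z. z^2 = x}) \<union> (\<Union>x\<in>X (1 / e^2). {z. z^2 = 1 / x})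
   \<union> (\<Union>x\<in>X (norm (p * q) / e^2). {z. z^2 = p * q / x}) \<union> (\<Union>x\<in>X (norm (p * q) * R^2). {z. z^2 = x / (p * q)})"
   proof cases
    case 1 
    hence "z^2 \<in> X (R^2)" using b z0 by (auto simp: X_def norm_power)
    thus ?thesis by blast
   next
    case 2
    hence "1 / z^2 \<in> X (1 / e^2)" using b2 z0 by (auto simp: X_def norm_power norm_divide)
    moreover have "z^2 = 1 / (1 / z^2)" by simp
    ultimately show ?thesis by blast
   next
    case 3
    have "norm (p * q / z^2) <= norm (p * q) / e^2"
     using mult_left_mono[OF b2, of "norm (p * q)"] by (simp add: norm_divide norm_power)
    hence "p * q / z^2 \<in> X (norm (p * q) / e^2)" using 3 z0 pq by (auto simp: X_def)
    moreover have "z^2 = p * q / (p * q / z^2)" using pq by simp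
    ultimately show ?thesis by blast
   next
    case 4
    have "norm (p * q * z^2) <= norm (p * q) * R^2"
     using mult_left_mono[OF b(1), of "norm (p * q)"] by (simp add: norm_mult norm_power)
    hence "p * q * z^2 \<in> X (norm (p * q) * R^2)" using 4 z0 pq by (auto simp: X_def)
    moreover have "z^2 = p * q * z^2 / (p * q)" using pq by simp
    ultimately show ?thesis by blast
   qed
  qed
  show "finite ((\<Union>x\<in>X (R^2). {z. z^2 = x}) \<union> (\<Union>x\<in>X (1 / e^2). {z. z^2 = 1 / x})
   \<union> (\<Union>x\<in>X (norm (p * q) / e^2). {z. z^2 = p * q / x}) \<union> (\<Union>x\<in>X (norm (p * q) * R^2). {z. z^2 = x / (p * q)}))"
   using pq by (intro finite_UnI fin) auto
 qed
qed

section \<open>The integral and its normalised value\<close>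

definition pair_prefactor :: "complex => complex => ('n::finite => complex) => complex" where
 "pair_prefactor p q t = (\<Prod>P\<in>{P::'n set. card P = 2}. qpoch2 (\<Prod>r\<in>P. t r) p q)"

definition beta_integral :: "complex => complex => ('n::finite => complex) => complex" where
 "beta_integral p q t = kernel_integral p q t t (%r. p * q / t r) (%r. p * q / t r) (weyl_weight p q)"

definition beta_value :: "complex => complex => ('n::finite => complex) => complex" where
 "beta_value p q t = pair_prefactor p q t * qpoch p p * qpoch q q / 2 * beta_integral p q t"

lemma E_admissible_separates:
 assumes q: "norm q < 1" and p: "norm p < 1" and adm: "E_admissible p q t gm"
 shows "separates p q (vec_nth t) (vec_nth t) gm"
proof -
 have im: "qpoch2 (t $ r / z) p q ~= 0" "qpoch2 (t $ r * z) p q ~= 0" if "z \<in> path_image gm" for r z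
  using adm that unfolding E_admissible_def by blast+
 have *: "t $ r * p ^ j * q ^ k ~: path_image gm" if "t $ r * p ^ j * q ^ k ~= 0" for r j k
 proof
  assume "t $ r * p ^ j * q ^ k \<in> path_image gm"
  from im(1)[OF this, of r] have "qpoch2 (t $ r / (t $ r * p ^ j * q ^ k)) p q ~= 0" .
  moreover have "p ^ j * q ^ k * (t $ r / (t $ r * p ^ j * q ^ k)) = 1" using that by simp
  ultimately show False using qpoch2_eq_0_iff[OF q p] by blast
 qed
 have **: "1 / (t $ r * p ^ j * q ^ k) ~: path_image gm" if "t $ r * p ^ j * q ^ k ~= 0" for r j k
 proof
  assume "1 / (t $ r * p ^ j * q ^ k) \<in> path_image gm"
  from im(2)[OF this, of r] have "qpoch2 (t $ r * (1 / (t $ r * p ^ j * q ^ k))) p q ~= 0" .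
  moreover have "p ^ j * q ^ k * (t $ r * (1 / (t $ r * p ^ j * q ^ k))) = 1" using that by simp
  ultimately show False using qpoch2_eq_0_iff[OF q p] by blast
 qed
 have z: "0 \<in> inner_region gm" using adm by (auto simp: E_admissible_def inner_region_def)
 show ?thesis unfolding separates_def
 proof (intro conjI allI z)
  fix r j k
  show "t $ r * p ^ j * q ^ k \<in> inner_region gm"
  proof (cases "t $ r * p ^ j * q ^ k = 0")
   case True
   show ?thesis unfolding True by (rule z)
  next
   case False
   thus ?thesis using *[OF False] adm unfolding E_admissible_def inner_region_def by blast
  qed
  have "winding_number gm (1 / (t $ r * p ^ j * q ^ k)) = 0" using adm unfolding E_admissible_def by blast
  thus "t $ r * p ^ j * q ^ k \<in> outer_region gm"
   using **[of r j k] unfolding outer_region_def by blast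
 qed (use adm in \<open>auto simp: E_admissible_def\<close>)
qed

lemma E_admissible_nonresonant:
 assumes adm: "E_admissible p q t gm"
 shows "nonresonant p q (vec_nth t) (vec_nth t)"
 unfolding nonresonant_def
proof (intro allI notI)
 fix i i' j k assume *: "t $ i * t $ i' * p ^ j * q ^ k = 1"
 have "winding_number gm (t $ i * p ^ j * q ^ k) = 1" "winding_number gm (1 / (t $ i' * p ^ 0 * q ^ 0)) = 0"
  using adm unfolding E_admissible_def by blast+
 moreover have "t $ i' * (t $ i * p ^ j * q ^ k) = 1" using * by (simp add: mult_ac)
 hence "1 / (t $ i' * p ^ 0 * q ^ 0) = t $ i * p ^ j * q ^ k" using mult_eq_1_imp_divide by simp
 ultimately show False by simp
qed

lemma E_admissible_exists:
 fixes t :: "complex ^ 'n::finite"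
 assumes q: "norm q < 1" "q ~= 0" and p: "norm p < 1" "p ~= 0" and nz: "!!r. t $ r ~= 0"
  and nr: "nonresonant p q (vec_nth t) (vec_nth t)"
 shows "\<exists>gm. E_admissible p q t gm"
proof -
 obtain gm where g: "polynomial_function gm" "separates p q (vec_nth t) (vec_nth t) gm" "path_image gm \<inter> weyl_poles p q = {}"
  by (rule separates_exists[OF q(1) p(1) nr, of "weyl_poles p q"])
   (use finite_weyl_poles[OF q(1) p(1) p(2) q(2)] in \<open>auto simp: weyl_poles_def\<close>)
 have im: "path_image gm \<subseteq> pole_free p q (vec_nth t) (vec_nth t)" by (rule separates_path_image[OF q(1) p(1) g(2)])
 have "E_admissible p q t gm" unfolding E_admissible_def
 proof (intro conjI allI ballI)
  fix r j k
  have "t $ r * p ^ j * q ^ k \<in> inner_region gm" "t $ r * p ^ j * q ^ k \<in> outer_region gm" "t $ r * p ^ j * q ^ k ~= 0"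
   using g(2) nz[of r] p q by (auto simp: separates_def)
  thus "winding_number gm (t $ r * p ^ j * q ^ k) = 1" "winding_number gm (1 / (t $ r * p ^ j * q ^ k)) = 0"
   by (auto simp: inner_region_def outer_region_def)
 next
  fix z assume z: "z \<in> path_image gm"
  hence "z ~: weyl_poles p q" "z ~= 0" using g(3) im by (auto simp: pole_free_def)
  thus "qpoch2 (z^2) p q ~= 0" "qpoch2 (1 / z^2) p q ~= 0" "qpoch2 (p * q / z^2) p q ~= 0" "qpoch2 (p * q * z^2) p q ~= 0"
   by (auto simp: weyl_poles_def)
  fix r show "qpoch2 (t $ r * z) p q ~= 0" "qpoch2 (t $ r / z) p q ~= 0" using z im by (auto simp: pole_free_def)
 qed (use g in \<open>auto simp: separates_def inner_region_def\<close>)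
 thus ?thesis by blast
qed

lemma E_int_eq_beta_value:
 fixes t :: "complex ^ 'n::finite"
 assumes q: "norm q < 1" "q ~= 0" and p: "norm p < 1" "p ~= 0" and nz: "!!r. t $ r ~= 0"
  and nr: "nonresonant p q (vec_nth t) (vec_nth t)"
 shows "E_int p q t = beta_value p q (vec_nth t)"
proof -
 define gm where "gm = (SOME gm. E_admissible p q t gm)"
 have adm: "E_admissible p q t gm" unfolding gm_def by (rule someI_ex[OF E_admissible_exists[OF assms]])
 have "contour_integral gm (%z. E_integrand p q t z / (2 * of_real pi * \<i> * z)) =
  contour_integral gm (%z. weyl_weight p q z * gamma_quot p q (vec_nth t) (vec_nth t) (%r. p * q / t $ r) (%r. p * q / t $ r) z / (2 * of_real pi * \<i> * z))"
 proof (rule contour_integral_cong)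
  fix z assume z: "z \<in> path_image gm"
  hence "qpoch2 (p * q / z^2) p q ~= 0" "qpoch2 (p * q * z^2) p q ~= 0" "z ~= 0" using adm by (auto simp: E_admissible_def)
  from egamma_square_inverse[OF q(1) p(1) this(3,1,2)]
  have "E_integrand p q t z = (\<Prod>r\<in>UNIV. egamma p q (t $ r * z) * egamma p q (t $ r / z)) * weyl_weight p q z"
   by (simp add: E_integrand_def)
  also have "(\<Prod>r\<in>UNIV. egamma p q (t $ r * z) * egamma p q (t $ r / z)) =
   gamma_quot p q (vec_nth t) (vec_nth t) (%r. p * q / t $ r) (%r. p * q / t $ r) z"
   unfolding gamma_quot_def egamma_def by (rule prod.cong) (auto simp: mult_ac)
  finally show "E_integrand p q t z / (2 * of_real pi * \<i> * z) = weyl_weight p q z * gamma_quot p q (vec_nth t) (vec_nth t) (%r. p * q / t $ r) (%r. p * q / t $ r) z / (2 * of_real pi * \<i> * z)"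
   by (simp add: mult_ac)
 qed auto
 also have "... = beta_integral p q (vec_nth t)" unfolding beta_integral_def
  by (rule kernel_integral_eq[symmetric]) (use q p E_admissible_separates[OF q(1) p(1) adm] in \<open>auto intro: holomorphic_intros\<close>)
 finally show ?thesis unfolding E_int_def beta_value_def pair_prefactor_def gm_def by simp
qed

section \<open>Pinched contours\<close>

definition monomial_curve :: "('n => complex) => ('n => int) => complex => 'n => complex" where
 "monomial_curve ta e w r = ta r * w powi e r"

lemma isCont_monomial_curve: "w ~= 0 ==> isCont (%w. monomial_curve ta e w r) w"
 unfolding monomial_curve_def by (intro continuous_intros) auto

lemma eventually_nhds_imp_at: "eventually P (nhds x) ==> eventually P (at x)"
 by (simp add: eventually_at_filter eventually_mono)

text \<open>At \<open>w0\<close> a single resonance holds, between \<open>x\<close> and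
  \<open>y\<close> with exponents \<open>J\<close> and \<open>K\<close>; the inner poles are
  pairwise distinct, and \<open>e x + e y ~= 0\<close> makes the curve cross the resonance
  transversally. The case \<open>x = y\<close> is included.\<close>

locale pinch =
 fixes p q w0 :: complex and ta :: "'n::finite => complex" and e :: "'n => int" and x y :: 'n and J K :: nat
 assumes q: "norm q < 1" "q ~= 0" and p: "norm p < 1" "p ~= 0" and tau: "!!r. ta r ~= 0" and w0: "w0 ~= 0"
  and resonance: "monomial_curve ta e w0 x * monomial_curve ta e w0 y * p ^ J * q ^ K = 1"
  and poles_distinct: "!!r j k r' j' k'. monomial_curve ta e w0 r * p ^ j * q ^ k = monomial_curve ta e w0 r' * p ^ j' * q ^ k'
     ==> r = r' & j = j' & k = k'"
  and resonance_unique: "!!r s j k. monomial_curve ta e w0 r * monomial_curve ta e w0 s * p ^ j * q ^ k = 1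
     ==> ((r = x & s = y) | (r = y & s = x)) & j = J & k = K"
  and exy: "e x + e y ~= 0"
begin

abbreviation T :: "complex => 'n => complex" where "T \<equiv> monomial_curve ta e"

definition partner :: "'n => 'n" where "partner r = (if r = x then y else x)"
text \<open>The inner poles that run into outer ones as \<open>w\<close> tends to \<open>w0\<close>:
  \<open>(r, j, k)\<close> meets the outer pole of \<open>partner r\<close> with exponents
  \<open>J - j\<close> and \<open>K - k\<close>.\<close>

definition pinch_set :: "('n \<times> nat \<times> nat) set" where "pinch_set = {x, y} \<times> {..J} \<times> {..K}"
definition pole :: "('n => complex) => 'n \<times> nat \<times> nat => complex" where
 "pole u = (%(r, j, k). u r * p ^ j * q ^ k)"
definition num :: "('n => complex) => complex => complex" where
 "num u z = weyl_weight p q z * (\<Prod>s\<in>UNIV. qpoch2 (p * q / u s / z) p q * qpoch2 (p * q / u s * z) p q)"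
text \<open>The denominators of the integrand without the two factors that vanish in the collision
  \<open>i\<close>: the inner one of index \<open>(j, k)\<close> and the outer one of index
  \<open>(J - j, K - k)\<close>.\<close>

definition den :: "'n \<times> nat \<times> nat => ('n => complex) => complex => complex" where
 "den i u z = (case i of (r, j, k) => \<Prod>s\<in>UNIV. (if s = r then qpoch2_cofactor j k p q (u s / z) else qpoch2 (u s / z) p q)
  * (if s = partner r then qpoch2_cofactor (J - j) (K - k) p q (u s * z) else qpoch2 (u s * z) p q))"
text \<open>\<open>H / eps\<close> is the residue at the pole \<open>i\<close>
  (\<open>integrand_residue\<close>); \<open>H\<close> itself has a finite limit at
  \<open>w0\<close>.\<close>

definition H :: "('n => complex) => 'n \<times> nat \<times> nat => complex" where
 "H u i = num u (pole u i) / den i u (pole u i) / (2 * of_real pi * \<i>)"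
definition eps :: "complex => complex" where
 "eps w = 1 - T w x * T w y * p ^ J * q ^ K"
definition integrand :: "('n => complex) => complex => complex" where
 "integrand u z = weyl_weight p q z * gamma_quot p q u u (%r. p * q / u r) (%r. p * q / u r) z / (2 * of_real pi * \<i> * z)"

lemma finite_pinch_set: "finite pinch_set" by (simp add: pinch_set_def)

lemma T_nonzero: "w ~= 0 ==> T w r ~= 0"
 using tau by (simp add: monomial_curve_def)

lemma qpoch2_cofactor_if:
 "qpoch2 v p q = (if P then 1 - p ^ j * q ^ k * v else 1) * (if P then qpoch2_cofactor j k p q v else qpoch2 v p q)"
 by (cases P) (simp_all add: qpoch2_cofactor[OF q(1) p(1), of v j k])

lemma denominators_eq:
 assumes i: "(r, j, k) \<in> pinch_set"
 shows "(\<Prod>s\<in>UNIV. qpoch2 (u s / z) p q * qpoch2 (u s * z) p q) =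
  (1 - p ^ j * q ^ k * (u r / z)) * (1 - p ^ (J - j) * q ^ (K - k) * (u (partner r) * z)) * den (r, j, k) u z"
proof -
 have "(\<Prod>s\<in>UNIV. qpoch2 (u s / z) p q * qpoch2 (u s * z) p q) =
  (\<Prod>s\<in>UNIV. ((if s = r then 1 - p ^ j * q ^ k * (u s / z) else 1) * (if s = partner r then 1 - p ^ (J - j) * q ^ (K - k) * (u s * z) else 1))
   * ((if s = r then qpoch2_cofactor j k p q (u s / z) else qpoch2 (u s / z) p q)
  * (if s = partner r then qpoch2_cofactor (J - j) (K - k) p q (u s * z) else qpoch2 (u s * z) p q)))"
 proof (rule prod.cong[OF refl])
  fix s
  have alg: "a = a1 * a2 ==> b = b1 * b2 ==> a * b = (a1 * b1) * (a2 * b2)" for a b a1 a2 b1 b2 :: complex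
   by (simp add: mult_ac)
  show "qpoch2 (u s / z) p q * qpoch2 (u s * z) p q =
   ((if s = r then 1 - p ^ j * q ^ k * (u s / z) else 1) * (if s = partner r then 1 - p ^ (J - j) * q ^ (K - k) * (u s * z) else 1))
   * ((if s = r then qpoch2_cofactor j k p q (u s / z) else qpoch2 (u s / z) p q)
  * (if s = partner r then qpoch2_cofactor (J - j) (K - k) p q (u s * z) else qpoch2 (u s * z) p q))"
   by (rule alg) (rule qpoch2_cofactor_if)+
 qed
 also have "... = (1 - p ^ j * q ^ k * (u r / z)) * (1 - p ^ (J - j) * q ^ (K - k) * (u (partner r) * z)) * den (r, j, k) u z"
  unfolding prod.distrib[of "%s. (if s = r then 1 - p ^ j * q ^ k * (u s / z) else 1) * (if s = partner r then 1 - p ^ (J - j) * q ^ (K - k) * (u s * z) else 1)"]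
  by (simp add: den_def prod.distrib prod.delta)
 finally show ?thesis .
qed

lemma integrand_eq: "integrand u z = num u z / (\<Prod>s\<in>UNIV. qpoch2 (u s / z) p q * qpoch2 (u s * z) p q) / (2 * of_real pi * \<i> * z)"
 by (simp add: integrand_def gamma_quot_def num_def prod_dividef)

text \<open>The outer factor left out of \<open>den\<close> thus takes the value
  \<open>eps w\<close> at every colliding pole, so all the residues have the same small
  denominator.\<close>

lemma pole_resonance:
 assumes "(r, j, k) \<in> pinch_set"
 shows "p ^ (J - j) * q ^ (K - k) * (T w (partner r) * pole (T w) (r, j, k)) = 1 - eps w"
proof -
 have "p ^ (J - j) * p ^ j = p ^ J" "q ^ (K - k) * q ^ k = q ^ K" using assms by (auto simp: pinch_set_def simp flip: power_add)
 hence "p ^ (J - j) * q ^ (K - k) * (T w (partner r) * pole (T w) (r, j, k)) = T w (partner r) * T w r * p ^ J * q ^ K"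
  by (simp add: pole_def flip: \<open>p ^ (J - j) * p ^ j = p ^ J\<close> \<open>q ^ (K - k) * q ^ k = q ^ K\<close>)
 thus ?thesis using assms by (auto simp: eps_def partner_def pinch_set_def mult_ac)
qed

text \<open>A further vanishing factor would mean a second inner pole at the same point, excluded by
  \<open>poles_distinct\<close>, or another resonance, excluded by
  \<open>resonance_unique\<close>.\<close>

lemma den_nonzero:
 assumes i: "i \<in> pinch_set"
 shows "den i (T w0) (pole (T w0) i) ~= 0"
proof -
 obtain r j k where ijk: "i = (r, j, k)" using prod_cases3 by blast
 have r: "r = x | r = y" "j <= J" "k <= K" using i by (auto simp: ijk pinch_set_def)
 define z where "z = T w0 r * p ^ j * q ^ k"
 have z: "z ~= 0" using T_nonzero[OF w0] p q by (simp add: z_def)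
 have 1: "s = r & j' = j & k' = k" if "p ^ j' * q ^ k' * (T w0 s / z) = 1" for s j' k'
 proof -
  have "T w0 s * p ^ j' * q ^ k' = z" using that z by (simp add: field_simps)
  hence "T w0 s * p ^ j' * q ^ k' = T w0 r * p ^ j * q ^ k" by (simp only: z_def)
  from poles_distinct[OF this] show ?thesis by auto
 qed
 have 2: "s = partner r & j' = J - j & k' = K - k" if "p ^ j' * q ^ k' * (T w0 s * z) = 1" for s j' k'
 proof -
  have "T w0 s * T w0 r * p ^ (j' + j) * q ^ (k' + k) = 1" using that by (simp add: z_def power_add mult_ac)
  from resonance_unique[OF this] show ?thesis using r by (auto simp: partner_def)
 qed
 have "qpoch2_cofactor j k p q (T w0 r / z) ~= 0" by (rule qpoch2_cofactor_nonzero[OF q(1) p(1)]) (use 1 in blast)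
 moreover have "qpoch2_cofactor (J - j) (K - k) p q (T w0 (partner r) * z) ~= 0"
  by (rule qpoch2_cofactor_nonzero[OF q(1) p(1)]) (use 2 in blast)
 moreover have "qpoch2 (T w0 s / z) p q ~= 0" if "s ~= r" for s
  using 1[of _ _ s] that qpoch2_eq_0_iff[OF q(1) p(1)] by blast
 moreover have "qpoch2 (T w0 s * z) p q ~= 0" if "s ~= partner r" for s
  using 2[of _ _ s] that qpoch2_eq_0_iff[OF q(1) p(1)] by blast
 ultimately show ?thesis by (auto simp: den_def ijk pole_def z_def[symmetric])
qed

text \<open>Up to a constant, \<open>1 - eps w\<close> is \<open>w powi (e x + e y)\<close>, and the
  constant is fixed by the resonance at \<open>w0\<close>. As the exponent is nonzero,
  \<open>eps\<close> has a simple zero.\<close>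

lemma eps_deriv: "(eps has_field_derivative (- of_int (e x + e y) / w0)) (at w0)"
proof -
 define c where "c = ta x * ta y * p ^ J * q ^ K"
 have ev: "eventually (%w. w ~= 0) (nhds w0)" using w0 t1_space_nhds by blast
 have eq: "T w x * T w y * p ^ J * q ^ K = c * w powi (e x + e y)" if "w ~= 0" for w
  using that by (simp add: monomial_curve_def c_def power_int_add mult_ac)
 have c: "c * w0 powi (e x + e y) = 1" using resonance eq[OF w0] by simp
 have "((%w. 1 - c * w powi (e x + e y)) has_field_derivative (- (c * (of_int (e x + e y) * w0 powi (e x + e y - 1))))) (at w0)"
  using w0 by (auto intro!: derivative_eq_intros)
 also have "- (c * (of_int (e x + e y) * w0 powi (e x + e y - 1))) = - of_int (e x + e y) / w0"
 proof -
  have "w0 powi (e x + e y - 1) * w0 = w0 powi (e x + e y)" using w0 by (simp add: power_int_diff)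
  have "c * (of_int (e x + e y) * w0 powi (e x + e y - 1)) * w0
   = of_int (e x + e y) * (c * (w0 powi (e x + e y - 1) * w0))" by (simp only: mult_ac)
  also have "... = of_int (e x + e y)" unfolding \<open>w0 powi (e x + e y - 1) * w0 = w0 powi (e x + e y)\<close> c by simp
  finally have "c * (of_int (e x + e y) * w0 powi (e x + e y - 1)) = of_int (e x + e y) / w0"
   using w0 by (simp only: eq_divide_eq) simp
  thus ?thesis by (simp only: minus_divide_left)
 qed
 finally have d: "((%w. 1 - c * w powi (e x + e y)) has_field_derivative (- of_int (e x + e y) / w0)) (at w0)" .
 have "eventually (%w. eps w = 1 - c * w powi (e x + e y)) (nhds w0)"
  using ev by eventually_elim (unfold eps_def, subst eq, auto)
 from DERIV_cong_ev[OF refl this refl] d show ?thesis by blast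
qed

lemma eps_w0: "eps w0 = 0" using resonance by (simp add: eps_def)

lemma eps_quotient: "((%w. (w - w0) / eps w) \<longlongrightarrow> - w0 / of_int (e x + e y)) (at w0)"
proof -
 have "((%w. (eps w - eps w0) / (w - w0)) \<longlongrightarrow> - of_int (e x + e y) / w0) (at w0)"
  using eps_deriv by (simp add: has_field_derivative_iff)
 moreover have "- of_int (e x + e y) / w0 ~= 0" using exy w0 by (metis divide_eq_0_iff neg_equal_0_iff_equal of_int_eq_0_iff)
 ultimately have "((%w. inverse ((eps w - eps w0) / (w - w0))) \<longlongrightarrow> inverse (- of_int (e x + e y) / w0)) (at w0)"
  by (rule tendsto_inverse)
 moreover have "inverse (- a / w0) = - w0 / a" for a :: complex by (simp add: field_simps)
 ultimately show ?thesis by (simp only: eps_w0 inverse_divide diff_zero)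
qed

lemma eps_nonzero: "eventually (%w. eps w ~= 0) (at w0)"
proof -
 have "((%w. (eps w - eps w0) / (w - w0)) \<longlongrightarrow> - of_int (e x + e y) / w0) (at w0)"
  using eps_deriv by (simp add: has_field_derivative_iff)
 moreover have "- of_int (e x + e y) / w0 ~= 0" using exy w0 by (metis divide_eq_0_iff neg_equal_0_iff_equal of_int_eq_0_iff)
 ultimately have "eventually (%w. (eps w - eps w0) / (w - w0) ~= 0) (at w0)" by (rule tendsto_imp_eventually_ne)
 thus ?thesis by eventually_elim (auto simp: eps_w0)
qed

lemma tendsto_T: "((%w. T w r) \<longlongrightarrow> T w0 r) (nhds w0)"
 using isCont_monomial_curve[OF w0] by (simp add: tendsto_nhds_iff isCont_def)

lemma eventually_nonresonant: "eventually (%w. nonresonant p q (T w) (T w)) (at w0)"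
proof -
 \<comment> \<open>\<open>-{1}\<close> is an open set containing 0, to which the products tend; so
   near \<open>w0\<close> only the pinching indices can produce the value 1, and these are
   controlled by \<open>eps\<close>.\<close>
 have "eventually (%w. \<forall>r s j k. \<not> ((r = x & s = y | r = y & s = x) & j = J & k = K) --> T w r * T w s * p ^ j * q ^ k \<in> -{1}) (at w0)"
 proof (intro eventually_all_finite)
  fix r s
  show "eventually (%w. \<forall>j k. \<not> ((r = x & s = y | r = y & s = x) & j = J & k = K) --> T w r * T w s * p ^ j * q ^ k \<in> -{1}) (at w0)"
  proof (rule eventually_geometric_family_in_open[OF q(1) p(1) tendsto_const])
   show "((%w. T w r * T w s) \<longlongrightarrow> T w0 r * T w0 s) (at w0)"
    by (intro tendsto_mult) (use isCont_monomial_curve[OF w0] in \<open>auto simp: isCont_def\<close>)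
  qed (use resonance_unique in auto)
 qed
 thus ?thesis using eps_nonzero
 proof eventually_elim
  case (elim w)
  show ?case unfolding nonresonant_def
  proof (intro allI notI)
   fix r s j k assume *: "T w r * T w s * p ^ j * q ^ k = 1"
   hence "(r = x & s = y | r = y & s = x) & j = J & k = K"
    using elim(1)[rule_format, of r s j k] by (metis ComplD singletonI)
   moreover from this have "T w r * T w s = T w x * T w y" by (metis mult.commute)
   ultimately have "T w x * T w y * p ^ J * q ^ K = 1" using * by metis
   thus False using elim(2) by (simp add: eps_def)
  qed
 qed
qed

lemma continuous_on_num_den:
 fixes w z :: "'x::topological_space => complex"
 assumes "continuous_on S w" "continuous_on S z" "!!s. s \<in> S ==> w s ~= 0 & z s ~= 0"
 shows "continuous_on S (%s. num (T (w s)) (z s))" "continuous_on S (%s. den i (T (w s)) (z s))"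
  "continuous_on S (%s. \<Prod>r\<in>UNIV. qpoch2 (T (w s) r / z s) p q * qpoch2 (T (w s) r * z s) p q)"
proof -
 have T: "continuous_on S (%s. T (w s) r)" for r
  unfolding monomial_curve_def by (intro continuous_intros assms(1)) (use assms(3) in auto)
 have W: "continuous_on S (%s. weyl_weight p q (z s))"
  by (rule continuous_on_compose2[OF holomorphic_on_imp_continuous_on[OF holomorphic_weyl_weight[OF q(1) p(1)]] assms(2)])
   (use assms(3) in auto)
 show "continuous_on S (%s. num (T (w s)) (z s))" unfolding num_def
  by (intro continuous_intros T W assms(2) q p) (use assms(3) T_nonzero p in auto)
 show "continuous_on S (%s. \<Prod>r\<in>UNIV. qpoch2 (T (w s) r / z s) p q * qpoch2 (T (w s) r * z s) p q)"
  by (intro continuous_intros T assms(2) q p) (use assms(3) p in auto)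
 obtain r j k where i: "i = (r, j, k)" using prod_cases3 by blast
 show "continuous_on S (%s. den i (T (w s)) (z s))" unfolding i den_def prod.case
 proof (intro continuous_on_prod continuous_on_mult)
  fix t :: 'n
  show "continuous_on S (%s. if t = r then qpoch2_cofactor j k p q (T (w s) t / z s) else qpoch2 (T (w s) t / z s) p q)"
   by (cases "t = r") (use assms(3) p q in \<open>auto intro!: continuous_intros T assms(2)\<close>)
  show "continuous_on S (%s. if t = partner r then qpoch2_cofactor (J - j) (K - k) p q (T (w s) t * z s) else qpoch2 (T (w s) t * z s) p q)"
   by (cases "t = partner r") (use assms(3) p q in \<open>auto intro!: continuous_intros T assms(2)\<close>)
 qed
qed

lemma isCont_pole: "w ~= 0 ==> isCont (%w. pole (T w) i) w"
 unfolding pole_def case_prod_beta' by (intro continuous_intros isCont_monomial_curve)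

lemma pole_nonzero: "w ~= 0 ==> pole (T w) i ~= 0"
 using T_nonzero p q by (auto simp: pole_def case_prod_beta')

lemma continuous_on_pole: "continuous_on (-{0}) (%w. pole (T w) i)"
 by (intro continuous_at_imp_continuous_on ballI isCont_pole) auto

lemma tendsto_H:
 assumes "i \<in> pinch_set"
 shows "((%w. H (T w) i) \<longlongrightarrow> H (T w0) i) (at w0)"
proof -
 have op: "open (-{0::complex})" by auto
 have "isCont (%w. num (T w) (pole (T w) i)) w0" "isCont (%w. den i (T w) (pole (T w) i)) w0"
  using continuous_on_num_den(1,2)[OF continuous_on_id continuous_on_pole] pole_nonzero w0
  by (auto simp: continuous_on_eq_continuous_at[OF op])
 hence "isCont (%w. H (T w) i) w0" unfolding H_def
  by (intro continuous_intros) (use den_nonzero[OF assms] in auto)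
 thus ?thesis by (simp add: isCont_def)
qed

lemma eventually_den_nonzero:
 "eventually (%w. \<forall>i\<in>pinch_set. den i (T w) (pole (T w) i) ~= 0) (nhds w0)"
proof (rule eventually_ball_finite[OF finite_pinch_set], rule ballI)
 fix i assume i: "i \<in> pinch_set"
 have op: "open (-{0::complex})" by auto
 have "isCont (%w. den i (T w) (pole (T w) i)) w0"
  using continuous_on_num_den(1,2)[OF continuous_on_id continuous_on_pole] pole_nonzero w0
  by (auto simp: continuous_on_eq_continuous_at[OF op])
 hence "((%w. den i (T w) (pole (T w) i)) \<longlongrightarrow> den i (T w0) (pole (T w0) i)) (nhds w0)"
  by (simp add: isCont_def tendsto_nhds_iff)
 thus "eventually (%w. den i (T w) (pole (T w) i) ~= 0) (nhds w0)"
  by (rule tendsto_imp_eventually_ne) (rule den_nonzero[OF i])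
qed

lemma eventually_poles_inj: "eventually (%w. inj_on (pole (T w)) pinch_set) (nhds w0)"
proof -
 have "eventually (%w. \<forall>i\<in>pinch_set. \<forall>i'\<in>pinch_set. i ~= i' --> pole (T w) i ~= pole (T w) i') (nhds w0)"
 proof (intro eventually_ball_finite[OF finite_pinch_set] ballI)
  fix i i'
  show "eventually (%w. i ~= i' --> pole (T w) i ~= pole (T w) i') (nhds w0)"
  proof (cases "i = i'")
   case False
   have ne: "pole (T w0) i - pole (T w0) i' ~= 0"
    using False poles_distinct by (auto simp: pole_def case_prod_beta' prod_eq_iff)
   have "((%w. pole (T w) i - pole (T w) i') \<longlongrightarrow> pole (T w0) i - pole (T w0) i') (nhds w0)"
    using isCont_pole[OF w0] by (intro tendsto_intros) (auto simp: isCont_def tendsto_nhds_iff)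
   from tendsto_imp_eventually_ne[OF this ne] show ?thesis by eventually_elim auto
  qed auto
 qed
 thus ?thesis by eventually_elim (auto simp: inj_on_def)
qed

lemma integrand_residue:
 assumes w: "w ~= 0" and i: "i \<in> pinch_set" and eps: "eps w ~= 0" and den0: "den i (T w) (pole (T w) i) ~= 0"
 obtains Q where "open Q" "pole (T w) i \<in> Q" "Q - {pole (T w) i} \<subseteq> pole_free p q (T w) (T w)"
  "residue (integrand (T w)) (pole (T w) i) = H (T w) i / eps w"
proof -
 obtain r j k where ijk: "i = (r, j, k)" using prod_cases3 by blast
 note i' = i[unfolded ijk]
 define A where "A = pole (T w) i"
 define be where "be = p ^ (J - j) * q ^ (K - k) * T w (partner r)"
 \<comment> \<open>All denominators except the factor \<open>(z - A) / z\<close>. At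
   \<open>A\<close> this is \<open>den\<close> times \<open>eps w\<close>, hence nonzero, so the
   pole is at most simple.\<close>
 define D where "D = (%z. den i (T w) z * (1 - be * z))"
 define Q where "Q = {z\<in>-{0}. D z \<in> -{0}}"
 have A0: "A ~= 0" using pole_nonzero[OF w] by (simp add: A_def)
 have bA: "1 - be * A = eps w" using pole_resonance[OF i', of w] by (simp add: be_def A_def ijk mult_ac)
 have hol: "(%z. den i (T w) z) holomorphic_on -{0}" "num (T w) holomorphic_on -{0}"
 proof -
  show "(%z. den i (T w) z) holomorphic_on -{0}" unfolding ijk den_def prod.case
  proof (intro holomorphic_on_prod holomorphic_on_mult)
   fix s
   show "(%z. if s = r then qpoch2_cofactor j k p q (T w s / z) else qpoch2 (T w s / z) p q) holomorphic_on -{0}"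
    by (cases "s = r") (use p q in \<open>auto intro!: holomorphic_intros\<close>)
   show "(%z. if s = partner r then qpoch2_cofactor (J - j) (K - k) p q (T w s * z) else qpoch2 (T w s * z) p q) holomorphic_on -{0}"
    by (cases "s = partner r") (use p q in \<open>auto intro!: holomorphic_intros\<close>)
  qed
  show "num (T w) holomorphic_on -{0}" unfolding num_def[abs_def]
   by (intro holomorphic_intros p q holomorphic_on_mult[OF holomorphic_weyl_weight]) auto
 qed
 have Q: "open Q" unfolding Q_def D_def
  by (intro open_Collect_preimage continuous_intros holomorphic_on_imp_continuous_on[OF hol(1)])
 have "D A ~= 0" unfolding D_def bA using den0 eps by (simp add: A_def)
 hence AQ: "A \<in> Q" using A0 by (simp add: Q_def)
 have fac: "(\<Prod>s\<in>UNIV. qpoch2 (T w s / z) p q * qpoch2 (T w s * z) p q) = (z - A) / z * D z" if "z ~= 0" for z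
 proof -
  have "1 - p ^ j * q ^ k * (T w r / z) = (z - A) / z" using that by (simp add: A_def ijk pole_def field_simps)
  thus ?thesis using denominators_eq[OF i', of "T w" z] by (simp add: D_def be_def ijk mult_ac)
 qed
 show thesis
 proof (rule that[OF Q])
  show "pole (T w) i \<in> Q" using AQ by (simp add: A_def)
  show "Q - {pole (T w) i} \<subseteq> pole_free p q (T w) (T w)"
  proof
   fix z assume "z \<in> Q - {pole (T w) i}"
   hence z: "z ~= 0" "D z ~= 0" "z ~= A" by (auto simp: Q_def A_def)
   hence "(\<Prod>s\<in>UNIV. qpoch2 (T w s / z) p q * qpoch2 (T w s * z) p q) ~= 0" unfolding fac[OF z(1)] by simp
   thus "z \<in> pole_free p q (T w) (T w)" using z(1) by (auto simp: pole_free_def)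
  qed
  define S where "S = (%z. num (T w) z / D z / (2 * of_real pi * \<i>))"
  have "residue (integrand (T w)) A = residue (%z. S z / (z - A)) A"
  proof (rule residue_cong)
   have "eventually (%z. z \<in> Q - {A}) (at A)" using Q AQ by (intro eventually_at_in_open)
   thus "eventually (%z. integrand (T w) z = S z / (z - A)) (at A)"
   proof eventually_elim
    case (elim z)
    hence z: "z ~= 0" "D z ~= 0" "z ~= A" by (auto simp: Q_def)
    show ?case unfolding integrand_eq fac[OF z(1)] S_def using z by (simp add: field_simps)
   qed
  qed auto
  also have "... = S A"
  proof (rule residue_simple[OF Q AQ])
   show "S holomorphic_on Q" unfolding S_def D_def
    by (intro holomorphic_intros holomorphic_on_subset[OF hol(1)] holomorphic_on_subset[OF hol(2)]) (auto simp: Q_def D_def)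
  qed
  also have "S A = H (T w) i / eps w" unfolding S_def H_def D_def bA by (simp add: A_def)
  finally show "residue (integrand (T w)) (pole (T w) i) = H (T w) i / eps w" by (simp add: A_def)
 qed
qed

text \<open>At \<open>w0\<close> the colliding poles lie on outer poles. A contour that leaves them
  outside is not pinched and can be kept fixed while \<open>w\<close> tends to
  \<open>w0\<close>.\<close>

lemma pole_inner_contour:
 obtains gm where "polynomial_function gm" "pathfinish gm = pathstart gm" "0 \<in> inner_region gm"
  "!!i. i ~: pinch_set ==> pole (T w0) i \<in> inner_region gm"
  "!!r j k. T w0 r * p ^ j * q ^ k \<in> outer_region gm"
  "!!i. i \<in> pinch_set ==> pole (T w0) i ~: path_image gm & winding_number gm (pole (T w0) i) = 0"
proof -
 define A where "A = pole (T w0) ` (- pinch_set)"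
 define B where "B = range (%(r, j, k). 1 / (T w0 r * p ^ j * q ^ k))"
 have nz: "T w0 r * p ^ j * q ^ k ~= 0" for r j k using T_nonzero[OF w0] p q by simp
 have A: "finite {x\<in>A. norm x >= e}" if "e > 0" for e
  by (rule finite_subset[OF _ finite_inner_poles[OF q(1) p(1) that, of "T w0"]]) (force simp: A_def pole_def)
 have B: "finite {x\<in>B. norm x <= R}" for R
  by (rule finite_subset[OF _ finite_outer_poles[OF q(1) p(1), of "T w0" R]]) (use nz in \<open>force simp: B_def\<close>)
 have AB: "A \<inter> B = {}"
 proof (rule ccontr)
  assume "A \<inter> B ~= {}"
  then obtain r j k s j' k' where *: "(r, j, k) ~: pinch_set" "T w0 r * p ^ j * q ^ k = 1 / (T w0 s * p ^ j' * q ^ k')"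
   unfolding A_def B_def by (auto simp: pole_def)
  hence "T w0 r * p ^ j * q ^ k * (T w0 s * p ^ j' * q ^ k') = 1" using nz[of s j' k'] by simp
  hence "T w0 r * T w0 s * p ^ (j + j') * q ^ (k + k') = 1" by (simp add: power_add mult_ac)
  from resonance_unique[OF this] *(1) show False by (auto simp: pinch_set_def)
 qed
 obtain gm where g: "polynomial_function gm" "pathfinish gm = pathstart gm" "path_image gm \<inter> insert 0 (A \<union> B \<union> {}) = {}"
  "!!x. x \<in> insert 0 A ==> winding_number gm x = 1" "!!x. x \<in> B ==> winding_number gm x = 0"
  by (rule contour_separation[OF _ A _ B _ _ AB, of "{}"]) (auto simp: A_def B_def pole_def T_nonzero[OF w0] p q)
 have pB: "pole (T w0) i \<in> B" if "i \<in> pinch_set" for i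
 proof -
  obtain r j k where ijk: "i = (r, j, k)" using prod_cases3 by blast
  have "p ^ (J - j) * q ^ (K - k) * T w0 (partner r) * pole (T w0) i = 1"
   using pole_resonance[of r j k w0] that by (simp add: ijk eps_w0 mult_ac)
  hence "pole (T w0) i = 1 / (T w0 (partner r) * p ^ (J - j) * q ^ (K - k))"
   using mult_eq_1_imp_divide by (metis mult.assoc mult.commute)
  thus ?thesis unfolding B_def by (intro image_eqI[of _ _ "(partner r, J - j, K - k)"]) auto
 qed
 show thesis
 proof (rule that[OF g(1,2)])
  show "0 \<in> inner_region gm" using g(3) g(4)[of 0] by (auto simp: inner_region_def)
  show "pole (T w0) i \<in> inner_region gm" if "i ~: pinch_set" for i
  proof -
   have "pole (T w0) i \<in> A" using that by (auto simp: A_def)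
   thus ?thesis using g(3) g(4)[of "pole (T w0) i"] by (auto simp: inner_region_def)
  qed
  show "T w0 r * p ^ j * q ^ k \<in> outer_region gm" for r j k
  proof -
   have "1 / (T w0 r * p ^ j * q ^ k) \<in> B" unfolding B_def by (intro image_eqI[of _ _ "(r, j, k)"]) auto
   thus ?thesis using g(3) g(5) unfolding outer_region_def by blast
  qed
  show "pole (T w0) i ~: path_image gm & winding_number gm (pole (T w0) i) = 0" if "i \<in> pinch_set" for i
   using pB[OF that] g(3,5) by blast
 qed
qed

text \<open>The separating contour differs from the unpinched one by the residues at
  \<open>pinch_set\<close>, each of them \<open>H / eps\<close>. The integral over the unpinched
  contour is continuous at \<open>w0\<close>, and \<open>(w - w0) / eps w\<close> tends to
  \<open>- w0 / (e x + e y)\<close>.\<close>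

lemma tendsto_beta_integral_pinch:
 "((%w. (w - w0) * beta_integral p q (T w)) \<longlongrightarrow>
  2 * of_real pi * \<i> * (- w0 / of_int (e x + e y)) * (\<Sum>i\<in>pinch_set. H (T w0) i)) (at w0)"
proof -
 obtain gm where g: "polynomial_function gm" "pathfinish gm = pathstart gm" "0 \<in> inner_region gm"
  "!!i. i ~: pinch_set ==> pole (T w0) i \<in> inner_region gm"
  "!!r j k. T w0 r * p ^ j * q ^ k \<in> outer_region gm"
  "!!i. i \<in> pinch_set ==> pole (T w0) i ~: path_image gm & winding_number gm (pole (T w0) i) = 0"
  using pole_inner_contour by metis
 have vg: "valid_path gm" using g valid_path_polynomial_function by blast
 have pg: "path gm" using vg valid_path_imp_path by blast
 obtain gm' where g': "continuous_on UNIV gm'" "!!f. contour_integral gm f = integral {0..1} (%t. f (gm t) * gm' t)"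
  using contour_integral_polynomial_path[OF g(1)] by metis
 define V where "V = {z. z ~: path_image gm & winding_number gm z = 0}"
 have V: "open V" unfolding V_def by (rule open_winding_number_levelsets[OF pg g(2)])
 define good where "good = (%w. w ~= 0 & (\<forall>r j k. (r, j, k) ~: pinch_set --> T w r * p ^ j * q ^ k \<in> inner_region gm)
  & (\<forall>r j k. T w r * p ^ j * q ^ k \<in> outer_region gm) & (\<forall>i\<in>pinch_set. pole (T w) i \<in> V))"
 have "eventually (%w. w ~= 0) (nhds w0)" using w0 t1_space_nhds by blast
 moreover have "eventually (%w. \<forall>r j k. (r, j, k) ~: pinch_set --> T w r * p ^ j * q ^ k \<in> inner_region gm) (nhds w0)"
  by (intro eventually_all_finite eventually_geometric_family_in_open[OF q(1) p(1) tendsto_const tendsto_T]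
    open_inner_region pg g(2,3)) (use g(4) in \<open>force simp: pole_def\<close>)
 moreover have "eventually (%w. \<forall>r j k. True --> T w r * p ^ j * q ^ k \<in> outer_region gm) (nhds w0)"
  by (intro eventually_all_finite eventually_geometric_family_in_open[OF q(1) p(1) tendsto_const tendsto_T]
    open_outer_region pg g(2,5)) (simp add: outer_region_def)
 moreover have "eventually (%w. \<forall>i\<in>pinch_set. pole (T w) i \<in> V) (nhds w0)"
 proof (intro eventually_ball_finite[OF finite_pinch_set] ballI)
  fix i assume i: "i \<in> pinch_set"
  show "eventually (%w. pole (T w) i \<in> V) (nhds w0)"
   by (rule topological_tendstoD[OF _ V, of _ "pole (T w0) i"])
    (use isCont_pole[OF w0, of i] g(6)[OF i] in \<open>auto simp: V_def isCont_def tendsto_nhds_iff\<close>)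
 qed
 ultimately have "eventually good (nhds w0)" unfolding good_def by eventually_elim auto
 then obtain G where G: "open G" "w0 \<in> G" "!!w. w \<in> G ==> good w" unfolding eventually_nhds by blast
 have im: "path_image gm \<subseteq> pole_free p q (T w) (T w)" "path_image gm \<inter> pole (T w) ` pinch_set = {}" if "good w" for w
 proof -
  show 2: "path_image gm \<inter> pole (T w) ` pinch_set = {}" using that by (auto simp: good_def V_def)
  show "path_image gm \<subseteq> pole_free p q (T w) (T w)"
  proof (rule ccontr)
   assume "\<not> ?thesis"
   then obtain z where z: "z \<in> path_image gm" "z ~: pole_free p q (T w) (T w)" by blast
   then consider "z = 0" | r j k where "z = T w r * p ^ j * q ^ k" | r j k where "T w r * p ^ j * q ^ k * z = 1"
    using not_pole_free_iff[OF q(1) p(1), of z "T w" "T w"] by blast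
   thus False
   proof cases
    case 1 thus False using z(1) g(3) by (auto simp: inner_region_def)
   next
    case 2
    show False
    proof (cases "(r, j, k) \<in> pinch_set")
     case True
     have "z = pole (T w) (r, j, k)" using 2 by (simp add: pole_def)
     thus False using True z(1) \<open>path_image gm \<inter> pole (T w) ` pinch_set = {}\<close> by blast
    next
     case False
     hence "z \<in> inner_region gm" using that 2 by (auto simp: good_def)
     thus False using z(1) by (simp add: inner_region_def)
    qed
   next
    case 3
    have "T w r * p ^ j * q ^ k \<in> outer_region gm" using that by (simp add: good_def)
    thus False using mult_eq_1_imp_divide[OF 3] z(1) unfolding outer_region_def by (simp only: mem_Collect_eq simp_thms)
   qed
  qed
 qed
 have contI: "continuous_on G (%w. contour_integral gm (integrand (T w)))"
 proof -
  have n0: "gm t ~= 0" "(\<Prod>r\<in>UNIV. qpoch2 (T w r / gm t) p q * qpoch2 (T w r * gm t) p q) ~= 0" "w ~= 0" if "w \<in> G" "t \<in> {0..1}" for w t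
  proof -
   have "gm t \<in> pole_free p q (T w) (T w)" using im(1)[OF G(3)[OF that(1)]] that(2) by (auto simp: path_image_def)
   thus "gm t ~= 0" "(\<Prod>r\<in>UNIV. qpoch2 (T w r / gm t) p q * qpoch2 (T w r * gm t) p q) ~= 0" by (auto simp: pole_free_def)
   show "w ~= 0" using G(3)[OF that(1)] by (simp add: good_def)
  qed
  have cg: "continuous_on (G \<times> cbox 0 1) (%s. gm (snd s))"
   by (intro continuous_on_compose2[OF continuous_on_polymonial_function[OF g(1), of UNIV]] continuous_intros) auto
  have cg': "continuous_on (G \<times> cbox 0 1) (%s. gm' (snd s))"
   by (intro continuous_on_compose2[OF g'(1)] continuous_intros) auto
  have "continuous_on (G \<times> cbox 0 1) (%s. integrand (T (fst s)) (gm (snd s)) * gm' (snd s))"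
   unfolding integrand_eq
   by (intro continuous_intros continuous_on_num_den cg cg') (use n0 in auto)
  hence "continuous_on G (%w. integral (cbox 0 1) (%t. integrand (T w) (gm t) * gm' t))"
   by (intro integral_continuous_on_param) (simp add: case_prod_beta')
  thus ?thesis by (simp add: g')
 qed
 have key: "beta_integral p q (T w) = contour_integral gm (integrand (T w)) + 2 * of_real pi * \<i> * ((\<Sum>i\<in>pinch_set. H (T w) i) / eps w)"
  if good: "good w" and nr: "nonresonant p q (T w) (T w)" and eps: "eps w ~= 0"
   and den0: "\<forall>i\<in>pinch_set. den i (T w) (pole (T w) i) ~= 0" and inj: "inj_on (pole (T w)) pinch_set" for w
 proof -
  have w: "w ~= 0" using good by (simp add: good_def)
  define X where "X = pole (T w) ` pinch_set"
  have X: "finite X" unfolding X_def using finite_pinch_set by simp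
  define P where "P = pole_free p q (T w) (T w)"
  have "\<forall>i\<in>pinch_set. \<exists>Q. open Q & pole (T w) i \<in> Q & Q - {pole (T w) i} \<subseteq> P &
   residue (integrand (T w)) (pole (T w) i) = H (T w) i / eps w"
   using integrand_residue[OF w _ eps] den0 unfolding P_def by metis
  then obtain Q where Q: "!!i. i \<in> pinch_set ==> open (Q i)" "!!i. i \<in> pinch_set ==> pole (T w) i \<in> Q i"
   "!!i. i \<in> pinch_set ==> Q i - {pole (T w) i} \<subseteq> P"
   "!!i. i \<in> pinch_set ==> residue (integrand (T w)) (pole (T w) i) = H (T w) i / eps w" by metis
  have D: "open (P \<union> X)"
  proof -
   have "P \<union> X = P \<union> (\<Union>i\<in>pinch_set. Q i)" using Q(2,3) by (fastforce simp: X_def)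
   moreover have "open P" unfolding P_def by (rule open_pole_free[OF q(1) p(1)])
   moreover have "open (\<Union>i\<in>pinch_set. Q i)" using Q(1) by (rule open_UN[OF ballI])
   ultimately show ?thesis by (simp only: open_Un)
  qed
  have DX: "P \<union> X - X \<subseteq> P" by auto
  have XP: "X \<inter> P = {}"
  proof -
   have "pole (T w) i ~: P" for i
    unfolding P_def not_pole_free_iff[OF q(1) p(1)] pole_def case_prod_beta' by blast
   thus ?thesis by (auto simp: X_def)
  qed
  obtain gm1 where g1: "polynomial_function gm1" "separates p q (T w) (T w) gm1"
   by (rule separates_exists[OF q(1) p(1) nr, of "{}"]) auto
  have hol: "integrand (T w) holomorphic_on P" unfolding integrand_def P_def
   by (rule holomorphic_kernel[OF q(1) p(1) holomorphic_weyl_weight[OF q(1) p(1)]])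
  have "contour_integral gm1 (integrand (T w)) = contour_integral gm (integrand (T w))
   + 2 * of_real pi * \<i> * (\<Sum>x\<in>X. (winding_number gm1 x - winding_number gm x) * residue (integrand (T w)) x)"
  proof (rule contour_integral_homologous_residues[OF D _ X])
   show "connected (P \<union> X)" by (rule connected_superset_pole_free[OF q(1) p(1), of "T w" "T w"]) (auto simp: P_def)
   show "integrand (T w) holomorphic_on P \<union> X - X" by (rule holomorphic_on_subset[OF hol DX])
   show "path_image gm1 \<subseteq> P \<union> X - X" using separates_path_image[OF q(1) p(1) g1(2)] XP by (auto simp: P_def)
   show "path_image gm \<subseteq> P \<union> X - X" using im[OF good] by (auto simp: P_def X_def)
   fix z assume z: "z ~: P \<union> X"
   then consider "z = 0" | r j k where "z = T w r * p ^ j * q ^ k" | r j k where "T w r * p ^ j * q ^ k * z = 1"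
    using not_pole_free_iff[OF q(1) p(1), of z "T w" "T w"] unfolding P_def by blast
   thus "winding_number gm1 z = winding_number gm z"
   proof cases
    case 1 thus ?thesis using g(3) g1(2) by (simp add: inner_region_def separates_def)
   next
    case 2
    have "(r, j, k) ~: pinch_set"
    proof
     assume "(r, j, k) \<in> pinch_set"
     hence "pole (T w) (r, j, k) \<in> X" by (simp add: X_def)
     thus False using z 2 by (simp add: pole_def)
    qed
    hence "z \<in> inner_region gm" using good 2 unfolding good_def by blast
    moreover have "z \<in> inner_region gm1" using g1(2) 2 unfolding separates_def by blast
    ultimately show ?thesis by (simp add: inner_region_def)
   next
    case 3
    have "T w r * p ^ j * q ^ k \<in> outer_region gm" using good unfolding good_def by blast
    moreover have "T w r * p ^ j * q ^ k \<in> outer_region gm1" using g1(2) unfolding separates_def by blast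
    ultimately show ?thesis using mult_eq_1_imp_divide[OF 3] unfolding outer_region_def by (simp only: mem_Collect_eq simp_thms)
   qed
  qed (use g g1 vg valid_path_polynomial_function in \<open>auto simp: separates_def\<close>)
  also have "(\<Sum>x\<in>X. (winding_number gm1 x - winding_number gm x) * residue (integrand (T w)) x) = (\<Sum>i\<in>pinch_set. H (T w) i / eps w)"
   unfolding X_def sum.reindex[OF inj] o_def
  proof (rule sum.cong[OF refl])
   fix i assume i: "i \<in> pinch_set"
   have "pole (T w) i \<in> inner_region gm1" using g1(2) unfolding separates_def pole_def case_prod_beta' by blast
   hence "winding_number gm1 (pole (T w) i) = 1" by (simp add: inner_region_def)
   moreover have "winding_number gm (pole (T w) i) = 0" using good i by (simp add: good_def V_def)
   ultimately show "(winding_number gm1 (pole (T w) i) - winding_number gm (pole (T w) i)) * residue (integrand (T w)) (pole (T w) i) = H (T w) i / eps w"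
    using Q(4)[OF i] by simp
  qed
  also have "contour_integral gm1 (integrand (T w)) = beta_integral p q (T w)"
   unfolding beta_integral_def integrand_def
   by (rule kernel_integral_eq[OF q(1) p(1) holomorphic_weyl_weight[OF q(1) p(1)] g1(2), symmetric])
  finally show ?thesis by (simp add: sum_divide_distrib)
 qed
 have "eventually (%w. (w - w0) * beta_integral p q (T w) = (w - w0) * contour_integral gm (integrand (T w))
   + 2 * of_real pi * \<i> * ((w - w0) / eps w) * (\<Sum>i\<in>pinch_set. H (T w) i)) (at w0)"
  using \<open>eventually good (nhds w0)\<close>[THEN eventually_nhds_imp_at] eventually_nonresonant eps_nonzero
   eventually_den_nonzero[THEN eventually_nhds_imp_at] eventually_poles_inj[THEN eventually_nhds_imp_at]
 proof eventually_elim
  case (elim w)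
  show ?case unfolding key[OF elim] by (simp add: algebra_simps)
 qed
 moreover have "((%w. (w - w0) * contour_integral gm (integrand (T w))
   + 2 * of_real pi * \<i> * ((w - w0) / eps w) * (\<Sum>i\<in>pinch_set. H (T w) i)) \<longlongrightarrow>
   (w0 - w0) * contour_integral gm (integrand (T w0)) + 2 * of_real pi * \<i> * (- w0 / of_int (e x + e y)) * (\<Sum>i\<in>pinch_set. H (T w0) i)) (at w0)"
 proof (intro eps_quotient tendsto_add tendsto_mult tendsto_diff tendsto_ident_at tendsto_const tendsto_sum tendsto_H)
  show "((%w. contour_integral gm (integrand (T w))) \<longlongrightarrow> contour_integral gm (integrand (T w0))) (at w0)"
   using contI G(1,2) by (auto simp: continuous_on_eq_continuous_at[OF G(1)] isCont_def)
 qed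
 ultimately show ?thesis by (simp add: tendsto_cong)
qed

end

section \<open>Quasi-periodicity of the integrand and cancellation of residues\<close>

lemma power_even_eq_powi: "x ^ (2 * n) = x powi (2 * int n)" "(x ^ n)^2 = x powi (2 * int n)" for x :: "'a::division_ring"
proof -
 show "x ^ (2 * n) = x powi (2 * int n)" by (simp only: power_int_of_nat[symmetric] of_nat_mult of_nat_numeral)
 thus "(x ^ n)^2 = x powi (2 * int n)" by (simp only: power_mult[symmetric] mult.commute[of n])
qed

lemma power_int_prod: "(\<Prod>i\<in>A. f i) powi l = (\<Prod>i\<in>A. f i powi l)" for f :: "'i => complex"
 by (induction A rule: infinite_finite_induct) (auto simp: power_int_mult_distrib)

text \<open>The factor is c = (-1)^l q^(-l(l-1)/2). Only its square is recorded: where the exact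
  value matters it occurs to an even power, and neither the sign nor the halved exponent has to be
  tracked.\<close>

lemma qtheta_int_shift:
 assumes q: "norm q < 1" "q ~= 0"
 shows "\<exists>c. c ^ 2 = q powi (- (l * (l - 1))) & (\<forall>x. x ~= 0 --> qtheta (q powi l * x) q = c * x powi (- l) * qtheta x q)"
proof (induction l rule: int_induct[where k = 0])
 case base
 show ?case by (rule exI[of _ 1]) auto
next
 case (step1 l)
 then obtain c where c: "c ^ 2 = q powi (- (l * (l - 1)))" "!!x. x ~= 0 ==> qtheta (q powi l * x) q = c * x powi (- l) * qtheta x q" by blast
 show ?case
 proof (rule exI[of _ "- c * q powi (- l)"], intro conjI allI impI)
  have "(- c * q powi (- l)) ^ 2 = q powi (- (l * (l - 1))) * q powi (- 2 * l)"
   using q by (simp add: power_mult_distrib c(1) power_int_power' mult.commute)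
  also have "... = q powi (- ((l + 1) * (l + 1 - 1)))"
   using q by (simp add: algebra_simps flip: power_int_add)
  finally show "(- c * q powi (- l)) ^ 2 = q powi (- ((l + 1) * (l + 1 - 1)))" .
  fix x :: complex assume x: "x ~= 0"
  have "qtheta (q powi (l + 1) * x) q = qtheta (q * (q powi l * x)) q" using q by (simp add: power_int_add mult_ac)
  also have "... = - qtheta (q powi l * x) q / (q powi l * x)" by (rule qtheta_shift) (use q x in auto)
  also have "... = - c * q powi (- l) * (x powi (- l) * inverse x) * qtheta x q"
   using q x unfolding c(2)[OF x] by (simp add: power_int_minus field_simps)
  also have "x powi (- l) * inverse x = x powi (- l + (-1))"
   by (simp only: power_int_add[OF disjI1[OF x]] power_int_minus power_int_1_right)
  also have "- l + (-1) = - (l + 1)" by simp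
  finally show "qtheta (q powi (l + 1) * x) q = - c * q powi (- l) * x powi (- (l + 1)) * qtheta x q" .
 qed
next
 case (step2 l)
 then obtain c where c: "c ^ 2 = q powi (- (l * (l - 1)))" "!!x. x ~= 0 ==> qtheta (q powi l * x) q = c * x powi (- l) * qtheta x q" by blast
 show ?case
 proof (rule exI[of _ "- c * q powi (l - 1)"], intro conjI allI impI)
  have "(- c * q powi (l - 1)) ^ 2 = q powi (- (l * (l - 1))) * q powi (2 * (l - 1))"
   using q by (simp add: power_mult_distrib c(1) power_int_power' mult.commute)
  also have "... = q powi (- ((l - 1) * (l - 1 - 1)))"
   using q by (simp add: algebra_simps flip: power_int_add)
  finally show "(- c * q powi (l - 1)) ^ 2 = q powi (- ((l - 1) * (l - 1 - 1)))" .
  fix x :: complex assume x: "x ~= 0"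
  have "qtheta (q powi l * x) q = qtheta (q * (q powi (l - 1) * x)) q" using q by (simp add: power_int_diff mult_ac)
  also have "... = - qtheta (q powi (l - 1) * x) q / (q powi (l - 1) * x)" by (rule qtheta_shift) (use q x in auto)
  finally have "qtheta (q powi (l - 1) * x) q = - qtheta (q powi l * x) q * (q powi (l - 1) * x)"
   using q x by (simp add: field_simps)
  also have "... = - c * q powi (l - 1) * (x powi (- l) * x) * qtheta x q"
   unfolding c(2)[OF x] by (simp add: mult_ac)
  also have "x powi (- l) * x = x powi (- l + 1)"
   by (simp only: power_int_add[OF disjI1[OF x]] power_int_1_right)
  also have "- l + 1 = - (l - 1)" by simp
  finally show "qtheta (q powi (l - 1) * x) q = - c * q powi (l - 1) * x powi (- (l - 1)) * qtheta x q" .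
 qed
qed

lemma qtheta_double_shift:
 assumes "norm q < 1" "q ~= 0" "y ~= 0"
 shows "qtheta (q ^ 2 * y) q = qtheta y q / (q * y ^ 2)"
 using qtheta_shift[of q "q * y"] qtheta_shift[of q y] assms by (simp add: power2_eq_square mult_ac)

text \<open>Even shifts carry no sign and have a closed formula; the squared arguments of the Weyl
  weight lead to such shifts.\<close>

lemma qtheta_even_shift:
 assumes q: "norm q < 1" "q ~= 0" and x: "x ~= 0"
 shows "qtheta (q powi (2 * l) * x) q = q powi (- (l * (2 * l - 1))) * x powi (- 2 * l) * qtheta x q"
proof (induction l rule: int_induct[where k = 0])
 case base show ?case by simp
next
 case (step1 l)
 have "q powi (2 * (l + 1)) * x = q ^ 2 * (q powi (2 * l) * x)"
  using q by (simp add: distrib_left power_int_add mult_ac)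
 hence "qtheta (q powi (2 * (l + 1)) * x) q = qtheta (q ^ 2 * (q powi (2 * l) * x)) q" by (simp only:)
 also have "... = qtheta (q powi (2 * l) * x) q / (q * (q powi (2 * l) * x) ^ 2)"
  by (rule qtheta_double_shift[OF q]) (use x q in simp)
 also have "q * (q powi (2 * l) * x) ^ 2 = q powi (4 * l + 1) * x ^ 2"
  using q by (simp add: power_mult_distrib power_int_power' power_int_add mult_ac)
 also have "qtheta (q powi (2 * l) * x) q / (q powi (4 * l + 1) * x ^ 2)
  = (q powi (- (l * (2 * l - 1))) * q powi (- (4 * l + 1))) * (x powi (- 2 * l) * x powi (-2)) * qtheta x q"
 proof -
  have "a * b * c / (d * x ^ 2) = (a * inverse d) * (b * x powi (-2)) * c" for a b c d :: complex
   by (simp add: power_int_minus field_simps)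
  thus ?thesis unfolding step1(2) power_int_minus[of q "4 * l + 1"] .
 qed
 also have "q powi (- (l * (2 * l - 1))) * q powi (- (4 * l + 1)) = q powi (- ((l + 1) * (2 * (l + 1) - 1)))"
  using q by (simp add: algebra_simps flip: power_int_add)
 also have "x powi (- 2 * l) * x powi (-2) = x powi (- 2 * (l + 1))"
  using x by (simp add: algebra_simps flip: power_int_add)
 finally show ?case .
next
 case (step2 l)
 define y where "y = q powi (2 * (l - 1)) * x"
 have y: "y ~= 0" using q x by (simp add: y_def)
 have "q powi (2 * l) * x = q ^ 2 * y" unfolding y_def
  using q by (simp add: right_diff_distrib power_int_diff field_simps)
 hence "qtheta (q powi (2 * l) * x) q = qtheta (q ^ 2 * y) q" by (simp only:)
 also have "... = qtheta y q / (q * y ^ 2)" by (rule qtheta_double_shift[OF q y])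
 finally have "qtheta y q = qtheta (q powi (2 * l) * x) q * (q * y ^ 2)" using q y by simp
 also have "q * y ^ 2 = q powi (4 * l - 3) * x ^ 2"
 proof -
  have "y ^ 2 = q powi (4 * (l - 1)) * x ^ 2" unfolding y_def
   by (simp add: power_mult_distrib power_int_power' mult.commute)
  moreover have "q * q powi (4 * (l - 1)) = q powi (1 + 4 * (l - 1))"
   unfolding power_int_add[OF disjI1[OF q(2)]] by (simp only: power_int_1_right)
  moreover have "1 + 4 * (l - 1) = 4 * l - 3" by simp
  ultimately show ?thesis by (metis mult.assoc)
 qed
 also have "qtheta (q powi (2 * l) * x) q * (q powi (4 * l - 3) * x ^ 2)
  = (q powi (- (l * (2 * l - 1))) * q powi (4 * l - 3)) * (x powi (- 2 * l) * x powi 2) * qtheta x q"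
  unfolding step2(2) by (simp add: mult_ac)
 also have "q powi (- (l * (2 * l - 1))) * q powi (4 * l - 3) = q powi (- ((l - 1) * (2 * (l - 1) - 1)))"
  using q by (simp add: algebra_simps flip: power_int_add)
 also have "x powi (- 2 * l) * x powi 2 = x powi (- 2 * l + 2)" by (simp only: power_int_add[OF disjI1[OF x]])
 also have "- 2 * l + 2 = - 2 * (l - 1)" by simp
 finally show ?case by (simp add: y_def)
qed

lemma weyl_weight_qtheta:
 assumes q: "norm q < 1" and p: "norm p < 1" and z: "z ~= 0"
 shows "weyl_weight p q z = - qtheta (z^2) q * qtheta (z^2) p / z^2"
proof -
 define x where "x = z^2"
 have x: "x ~= 0" using z by (simp add: x_def)
 have 1: "qpoch (1 / x) q = (1 - 1 / x) * qpoch (q / x) q" using qpoch_shift[OF q, of "1 / x"] by simp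
 have 2: "qpoch x p = (1 - x) * qpoch (p * x) p" using qpoch_shift[OF p, of x] by (simp add: mult.commute)
 have "weyl_weight p q z * x = qpoch x q * qpoch (p * x) p * ((x * (1 - 1 / x)) * qpoch (q / x) q * qpoch (p / x) p)"
  by (simp add: weyl_weight_def x_def[symmetric] 1)
 also have "x * (1 - 1 / x) = - (1 - x)" using x by (simp add: field_simps)
 also have "qpoch x q * qpoch (p * x) p * (- (1 - x) * qpoch (q / x) q * qpoch (p / x) p) = - qtheta x q * qtheta x p"
  unfolding qtheta_def 2 by (simp add: algebra_simps)
 finally show ?thesis using x by (simp add: x_def[symmetric] field_simps)
qed

text \<open>By \<open>weyl_weight_qtheta\<close> the weight contains one theta function to base p,
  which shifts explicitly, and one to base q, which is kept. The identity is cross-multiplied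
  because the latter may vanish.\<close>

lemma weyl_weight_shift:
 assumes q: "norm q < 1" and p: "norm p < 1" "p ~= 0" and z: "z ~= 0"
 shows "weyl_weight p q (p ^ n * z) * qtheta (z^2) q =
  weyl_weight p q z * qtheta (p ^ (2 * n) * z^2) q * p powi (- (2 * int n * int n + int n)) * z powi (- 4 * int n)"
proof -
 have sq: "(p ^ n * z)^2 = p ^ (2 * n) * z^2" by (simp add: power_mult_distrib power_mult mult.commute[of 2])
 have "qtheta (p ^ (2 * n) * z^2) p = qtheta (p powi (2 * int n) * z^2) p" by (simp only: power_even_eq_powi)
 also have "... = p powi (- (int n * (2 * int n - 1))) * (z^2) powi (- 2 * int n) * qtheta (z^2) p"
  by (rule qtheta_even_shift) (use p z in auto)
 also have "(z^2) powi (- 2 * int n) = z powi (- 4 * int n)"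
  using z by (simp add: power_int_power)
 finally have th: "qtheta (p ^ (2 * n) * z^2) p = p powi (- (int n * (2 * int n - 1))) * z powi (- 4 * int n) * qtheta (z^2) p" .
 have alg: "- X * (c * d * Y) / (f * g) * Z = (- Z * Y / g) * X * (c / f) * d" for X Y Z c d f g :: complex
  by (simp add: mult_ac)
 have "weyl_weight p q (p ^ n * z) * qtheta (z^2) q = - qtheta (p ^ (2 * n) * z^2) q *
   (p powi (- (int n * (2 * int n - 1))) * z powi (- 4 * int n) * qtheta (z^2) p) / (p ^ (2 * n) * z^2) * qtheta (z^2) q"
  using weyl_weight_qtheta[OF q p(1), of "p ^ n * z"] p z unfolding sq th by simp
 also have "... = (- qtheta (z^2) q * qtheta (z^2) p / z^2) * qtheta (p ^ (2 * n) * z^2) q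
  * (p powi (- (int n * (2 * int n - 1))) / p ^ (2 * n)) * z powi (- 4 * int n)" by (rule alg)
 also have "p powi (- (int n * (2 * int n - 1))) / p ^ (2 * n) = p powi (- (int n * (2 * int n - 1)) - int (2 * n))"
  using p(2) by (metis power_int_diff power_int_of_nat)
 also have "- (int n * (2 * int n - 1)) - int (2 * n) = - (2 * int n * int n + int n)" by (simp add: algebra_simps)
 also have "- qtheta (z^2) q * qtheta (z^2) p / z^2 = weyl_weight p q z" using weyl_weight_qtheta[OF q p(1) z] by simp
 finally show ?thesis .
qed

lemma egamma_shift_power:
 assumes q: "norm q < 1" and p: "norm p < 1" "p ~= 0" and v: "v ~= 0" "qpoch2 v p q ~= 0"
 shows "egamma p q (p ^ n * v) = (\<Prod>i<n. qtheta (p ^ i * v) q) * egamma p q v"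
proof (induction n)
 case (Suc n)
 have "qpoch2 (p ^ n * v) p q ~= 0"
 proof
  assume "qpoch2 (p ^ n * v) p q = 0"
  then obtain j k where "p ^ j * q ^ k * (p ^ n * v) = 1" using qpoch2_eq_0_iff[OF q p(1)] by blast
  hence "p ^ (j + n) * q ^ k * v = 1" by (simp add: power_add mult_ac)
  thus False using v(2) qpoch2_eq_0_iff[OF q p(1)] by blast
 qed
 from egamma_shift[OF q p _ this] Suc v p show ?case by (simp add: mult_ac)
qed auto

text \<open>Repeated use of \<Gamma>(p x) = \<theta>(x; q) \<Gamma>(x), forwards for t_r z and
  backwards for t_r / z; cross-multiplied to avoid division by theta functions.\<close>

lemma gamma_quot_shift:
 fixes t :: "'n::finite => complex"
 assumes q: "norm q < 1" and p: "norm p < 1" "p ~= 0" and t: "!!r. t r ~= 0"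
  and z: "z \<in> pole_free p q t t" "p ^ n * z \<in> pole_free p q t t"
 shows "gamma_quot p q t t (%r. p * q / t r) (%r. p * q / t r) (p ^ n * z) * (\<Prod>r\<in>UNIV. \<Prod>i<n. qtheta (p ^ i * (t r / (p ^ n * z))) q)
  = gamma_quot p q t t (%r. p * q / t r) (%r. p * q / t r) z * (\<Prod>r\<in>UNIV. \<Prod>i<n. qtheta (p ^ i * (t r * z)) q)"
proof -
 have g: "gamma_quot p q t t (%r. p * q / t r) (%r. p * q / t r) z = (\<Prod>r\<in>UNIV. egamma p q (t r * z) * egamma p q (t r / z))" for z
  unfolding gamma_quot_def egamma_def by (rule prod.cong) (auto simp: mult_ac)
 have z0: "z ~= 0" using z by (simp add: pole_free_def)
 show ?thesis unfolding g prod.distrib[symmetric]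
 proof (rule prod.cong[OF refl])
  fix r
  have 1: "egamma p q (t r * (p ^ n * z)) = (\<Prod>i<n. qtheta (p ^ i * (t r * z)) q) * egamma p q (t r * z)"
   using egamma_shift_power[OF q p, of "t r * z" n] z(1) z0 t[of r] by (simp add: pole_free_def mult_ac)
  have "p ^ n * (t r / (p ^ n * z)) = t r / z" using p by simp
  hence 2: "egamma p q (t r / z) = (\<Prod>i<n. qtheta (p ^ i * (t r / (p ^ n * z))) q) * egamma p q (t r / (p ^ n * z))"
   using egamma_shift_power[OF q p, of "t r / (p ^ n * z)" n] z(2) z0 t[of r] p by (simp add: pole_free_def)
  show "egamma p q (t r * (p ^ n * z)) * egamma p q (t r / (p ^ n * z)) * (\<Prod>i<n. qtheta (p ^ i * (t r / (p ^ n * z))) q)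
   = egamma p q (t r * z) * egamma p q (t r / z) * (\<Prod>i<n. qtheta (p ^ i * (t r * z)) q)"
   unfolding 1 2 by (simp only: mult_ac)
 qed
qed

text \<open>The balancing condition makes the multiplier of the integrand under \<open>z \<mapsto> p\<^sup>n z\<close> equal to \<open>-1\<close>
 at the points with \<open>z\<^sup>2 = p\<^sup>-\<^sup>n q\<^sup>\<beta>\<close>; this is what cancels the residues on the walls \<open>t\<^sub>r\<^sup>2 p\<^sup>J q\<^sup>K = 1\<close>.\<close>

lemma multiplier_minus_one:
 fixes t :: "'n::finite => complex" and be :: int
 assumes card: "CARD('n) = 2 * m + 6" and q: "norm q < 1" "q ~= 0" and p: "norm p < 1" "p ~= 0"
  and t: "!!r. t r ~= 0" "(\<Prod>r\<in>UNIV. t r) = (p * q) ^ (m + 1)"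
  and z: "z^2 = p powi (- int n) * q powi be"
 shows "(\<Prod>r\<in>UNIV. \<Prod>i<n. qtheta (p ^ i * (t r * z)) q) * qtheta (p ^ (2 * n) * z^2) q
   * p powi (- (2 * int n * int n + int n)) * z powi (- 4 * int n)
  = - (\<Prod>r\<in>UNIV. \<Prod>i<n. qtheta (p ^ i * (t r / (p ^ n * z))) q) * qtheta (z^2) q"
proof -
 have z0: "z ~= 0" using z p q by auto
 define N where "N = int n"
 \<comment> \<open>Half the number of parameters; the balancing exponent \<open>m + 1\<close> is
   \<mu> - 2.\<close>
 define \<mu> where "\<mu> = int m + 3"
 obtain c where c: "c ^ 2 = q powi (- (be * (be - 1)))" "!!x. x ~= 0 ==> qtheta (q powi be * x) q = c * x powi (- be) * qtheta x q"
  using qtheta_int_shift[OF q, of be] by blast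
 define y where "y = (%r i. p ^ i * (t r / (p ^ n * z)))"
 have y0: "y r i ~= 0" for r i using p z0 t(1) by (simp add: y_def)
 \<comment> \<open>Since p^n z^2 = q^\<open>be\<close>, the theta arguments on the two sides differ
   exactly by the factor q^\<open>be\<close>.\<close>
 have yq: "p ^ i * (t r * z) = q powi be * y r i" for r i
 proof -
  have "z = q powi be / (p ^ n * z)" using z z0 p by (simp add: power2_eq_square power_int_minus field_simps)
  from arg_cong[OF this, of "%u. p ^ i * (t r * u)"]
  have "p ^ i * (t r * z) = p ^ i * (t r * (q powi be / (p ^ n * z)))" .
  also have "... = q powi be * y r i" by (simp add: y_def)
  finally show ?thesis .
 qed
 \<comment> \<open>The parameters enter this product only through their total product, which the
   balancing condition evaluates.\<close>
 have prod_y: "(\<Prod>r\<in>UNIV. \<Prod>i<n. y r i) = p powi (- 2 * N) * q powi (N * (\<mu> - 2) - be * \<mu> * N)"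
 proof -
  have "(\<Prod>r\<in>UNIV. y r i) = p powi (2 * \<mu> * int i - \<mu> * N + (\<mu> - 2)) * q powi (\<mu> - 2 - be * \<mu>)" for i
  proof -
   have "(\<Prod>r\<in>UNIV. y r i) = (p ^ i / (p ^ n * z)) ^ CARD('n) * (\<Prod>r\<in>UNIV. t r)"
    by (simp add: y_def prod.distrib prod_dividef power_divide power_mult_distrib)
   also have "(p ^ i / (p ^ n * z)) ^ CARD('n) = ((p ^ i / (p ^ n * z))^2) powi \<mu>"
   proof -
    have "CARD('n) = 2 * (m + 3)" using card by simp
    hence "(p ^ i / (p ^ n * z)) ^ CARD('n) = ((p ^ i / (p ^ n * z))^2) ^ (m + 3)" by (simp only: power_mult)
    also have "... = ((p ^ i / (p ^ n * z))^2) powi \<mu>"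
     unfolding \<mu>_def by (metis of_nat_add of_nat_numeral power_int_of_nat)
    finally show ?thesis .
   qed
   also have "(p ^ i / (p ^ n * z))^2 = p powi (2 * int i - N) * q powi (- be)"
   proof -
    have "(p ^ i / (p ^ n * z))^2 = (p ^ i)^2 / ((p ^ n)^2 * z^2)" by (simp add: power_divide power_mult_distrib)
    also have "... = p powi (2 * int i) / (p powi (2 * N) * (p powi (- N) * q powi be))"
     unfolding z N_def power_even_eq_powi ..
    also have "... = p powi (2 * int i - N) * q powi (- be)"
    proof -
     have e: "2 * int i - N = 2 * int i + - (2 * N) + N" by simp
     show ?thesis unfolding e power_int_add[OF disjI1[OF p(2)]] using p q by (simp add: power_int_minus field_simps)
    qed
    finally show ?thesis .
   qed
   also have "(p powi (2 * int i - N) * q powi (- be)) powi \<mu> * (\<Prod>r\<in>UNIV. t r) =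
    (p powi ((2 * int i - N) * \<mu>) * p powi (\<mu> - 2)) * (q powi (- be * \<mu>) * q powi (\<mu> - 2))"
   proof -
    have "(p * q) ^ (m + 1) = p powi (\<mu> - 2) * q powi (\<mu> - 2)"
    proof -
     have "int (m + 1) = \<mu> - 2" by (simp add: \<mu>_def)
     thus ?thesis unfolding power_mult_distrib by (metis power_int_of_nat)
    qed
    moreover have "(p powi a * q powi b) powi \<mu> * (x * y) = (p powi (a * \<mu>) * x) * (q powi (b * \<mu>) * y)" for a b x y
     by (simp add: power_int_mult_distrib mult_ac flip: power_int_mult)
    ultimately show ?thesis unfolding t(2) by (simp only:)
   qed
   also have "p powi ((2 * int i - N) * \<mu>) * p powi (\<mu> - 2) = p powi (2 * \<mu> * int i - \<mu> * N + (\<mu> - 2))"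
    using p by (simp add: algebra_simps flip: power_int_add)
   also have "q powi (- be * \<mu>) * q powi (\<mu> - 2) = q powi (\<mu> - 2 - be * \<mu>)"
    using q by (simp add: algebra_simps flip: power_int_add)
   finally show ?thesis .
  qed
  hence "(\<Prod>i<n. \<Prod>r\<in>UNIV. y r i) = (\<Prod>i<n. p powi (2 * \<mu> * int i - \<mu> * N + (\<mu> - 2)) * q powi (\<mu> - 2 - be * \<mu>))" by simp
  also have "... = p powi (\<Sum>i<n. 2 * \<mu> * int i - \<mu> * N + (\<mu> - 2)) * (q powi (\<mu> - 2 - be * \<mu>)) ^ n"
  proof -
   have "(\<Prod>i<k. p powi f i) = p powi (\<Sum>i<k. f i)" for f and k :: nat
    by (induction k) (use p in \<open>auto simp: power_int_add\<close>)
   thus ?thesis by (simp add: prod.distrib)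
  qed
  also have "(\<Sum>i<n. 2 * \<mu> * int i - \<mu> * N + (\<mu> - 2)) = - 2 * N"
  proof -
   have "(\<Sum>i<k. 2 * int i) = int k * int k - int k" for k :: nat by (induction k) (auto simp: algebra_simps)
   hence "(\<Sum>i<n. \<mu> * (2 * int i)) = \<mu> * (N * N - N)" unfolding sum_distrib_left[symmetric] N_def by simp
   thus ?thesis by (simp add: sum.distrib sum_subtractf N_def algebra_simps)
  qed
  also have "(q powi (\<mu> - 2 - be * \<mu>)) ^ n = q powi (N * (\<mu> - 2) - be * \<mu> * N)"
   by (simp add: N_def power_int_power' algebra_simps)
  finally show ?thesis by (subst prod.swap)
 qed
 have A: "(\<Prod>r\<in>UNIV. \<Prod>i<n. qtheta (p ^ i * (t r * z)) q) =
   p powi (2 * N * be) * q powi (2 * N * be) * (\<Prod>r\<in>UNIV. \<Prod>i<n. qtheta (y r i) q)"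
 proof -
  have "(\<Prod>r\<in>UNIV. \<Prod>i<n. qtheta (p ^ i * (t r * z)) q) = (\<Prod>r\<in>UNIV. \<Prod>i<n. c * y r i powi (- be) * qtheta (y r i) q)"
   unfolding yq using c(2)[OF y0] by simp
  also have "... = (c ^ n) ^ CARD('n) * (\<Prod>r\<in>UNIV. \<Prod>i<n. y r i) powi (- be) * (\<Prod>r\<in>UNIV. \<Prod>i<n. qtheta (y r i) q)"
   by (simp add: prod.distrib power_int_prod)
  also have "(c ^ n) ^ CARD('n) = q powi (- (be * (be - 1)) * N * \<mu>)"
  proof -
   have "(c ^ n) ^ CARD('n) = (c ^ 2) ^ (n * (m + 3))" unfolding card power_mult[symmetric] by (simp add: algebra_simps)
   also have "... = q powi (- (be * (be - 1)) * int (n * (m + 3)))" unfolding c(1)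
    by (simp only: power_int_mult power_int_of_nat)
   also have "int (n * (m + 3)) = N * \<mu>" by (simp add: N_def \<mu>_def)
   finally show ?thesis by (simp add: mult_ac)
  qed
  also have "(\<Prod>r\<in>UNIV. \<Prod>i<n. y r i) powi (- be) = p powi (2 * N * be) * q powi (- be * (N * (\<mu> - 2) - be * \<mu> * N))"
   unfolding prod_y by (simp add: power_int_mult_distrib mult_ac flip: power_int_mult)
  also have "q powi (- (be * (be - 1)) * N * \<mu>) * (p powi (2 * N * be) * q powi (- be * (N * (\<mu> - 2) - be * \<mu> * N)))
   = p powi (2 * N * be) * (q powi (- (be * (be - 1)) * N * \<mu>) * q powi (- be * (N * (\<mu> - 2) - be * \<mu> * N)))" by (simp only: mult_ac)
  also have "q powi (- (be * (be - 1)) * N * \<mu>) * q powi (- be * (N * (\<mu> - 2) - be * \<mu> * N)) = q powi (2 * N * be)"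
   using q by (simp add: algebra_simps flip: power_int_add)
  finally show ?thesis by simp
 qed
 \<comment> \<open>Both quadratic arguments are related to p^n q^(-\<open>be\<close>): p^(2n) z^2 by
   an even q-shift, z^2 by inversion. The inversion is the source of the sign.\<close>
 define \<Theta> where "\<Theta> = qtheta (p powi N * q powi (- be)) q"
 have B: "qtheta (p ^ (2 * n) * z^2) q = p powi (- 2 * N * be) * q powi be * \<Theta>"
 proof -
  have "p ^ (2 * n) * z^2 = p powi (2 * N) * p powi (- N) * q powi be" unfolding z N_def power_even_eq_powi by simp
  also have "p powi (2 * N) * p powi (- N) = p powi N" using p by (simp flip: power_int_add)
  also have "p powi N * q powi be = q powi (2 * be) * (p powi N * q powi (- be))"
  proof -
   have "q powi (2 * be) * q powi (- be) = q powi be" using q by (simp flip: power_int_add)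
   thus ?thesis by (simp add: mult_ac)
  qed
  finally have "qtheta (p ^ (2 * n) * z^2) q = q powi (- (be * (2 * be - 1))) * (p powi N * q powi (- be)) powi (- 2 * be) * \<Theta>"
   unfolding \<Theta>_def by (simp only:) (rule qtheta_even_shift, use p q in auto)
  also have "(p powi N * q powi (- be)) powi (- 2 * be) = p powi (- 2 * N * be) * q powi (2 * be * be)"
   by (simp add: power_int_mult_distrib mult_ac flip: power_int_mult)
  also have "q powi (- (be * (2 * be - 1))) * (p powi (- 2 * N * be) * q powi (2 * be * be)) =
   p powi (- 2 * N * be) * (q powi (- (be * (2 * be - 1))) * q powi (2 * be * be))" by (simp only: mult_ac)
  also have "q powi (- (be * (2 * be - 1))) * q powi (2 * be * be) = q powi be"
   using q by (simp add: algebra_simps flip: power_int_add)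
  finally show ?thesis .
 qed
 have C: "qtheta (z^2) q = - (p powi (- N) * q powi be * \<Theta>)"
 proof -
  have "z^2 = 1 / (p powi N * q powi (- be))" unfolding z N_def by (simp add: power_int_minus field_simps)
  hence "qtheta (z^2) q = - \<Theta> / (p powi N * q powi (- be))"
   using qtheta_inverse[OF q(1), of "p powi N * q powi (- be)"] p q by (simp add: \<Theta>_def)
  thus ?thesis using p q by (simp add: power_int_minus field_simps)
 qed
 have D: "z powi (- 4 * int n) = p powi (2 * N * N) * q powi (- 2 * N * be)"
 proof -
  have "z powi (- 4 * int n) = (z^2) powi (- 2 * N)" unfolding N_def
   by (simp add: power_int_power)
  thus ?thesis unfolding z N_def[symmetric] by (simp add: power_int_mult_distrib mult_ac flip: power_int_mult)
 qed
 define X where "X = (\<Prod>r\<in>UNIV. \<Prod>i<n. qtheta (y r i) q)"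
 have "(\<Prod>r\<in>UNIV. \<Prod>i<n. qtheta (p ^ i * (t r * z)) q) * qtheta (p ^ (2 * n) * z^2) q
   * p powi (- (2 * int n * int n + int n)) * z powi (- 4 * int n)
  = (p powi (2 * N * be) * p powi (- 2 * N * be) * p powi (- (2 * N * N + N)) * p powi (2 * N * N))
   * (q powi (2 * N * be) * q powi (- 2 * N * be)) * q powi be * \<Theta> * X"
  unfolding A B X_def N_def[symmetric] D[folded N_def] by (simp only: mult_ac)
 also have "p powi (2 * N * be) * p powi (- 2 * N * be) * p powi (- (2 * N * N + N)) * p powi (2 * N * N) = p powi (- N)"
  using p by (simp add: algebra_simps flip: power_int_add)
 also have "q powi (2 * N * be) * q powi (- 2 * N * be) = 1" using q by (simp flip: power_int_add)
 finally show ?thesis unfolding C X_def y_def by simp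
qed

text \<open>The prefactor runs over pairs of distinct indices and supplies no zero for the diagonal
  resonance t_x^2 p^J q^K = 1, so the residues themselves have to cancel. The conditions on the
  norms keep the theta functions to be divided out away from 0.\<close>

locale pinch_diag = pinch p q w0 ta e x x J K
 for p q w0 :: complex and ta :: "'n::finite => complex" and e :: "'n => int" and x :: 'n and J K :: nat +
 fixes m :: nat
 assumes card: "CARD('n) = 2 * m + 6" and balancing: "(\<Prod>r\<in>UNIV. monomial_curve ta e w0 r) = (p * q) ^ (m + 1)"
  and pq_indep: "!!a b::int. norm p powi a = norm q powi b ==> a = 0"
  and t_indep: "!!r (a::int) (b::int). r ~= x ==> norm (monomial_curve ta e w0 r) ^ 2 ~= norm p powi a * norm q powi b"
begin

definition Delta :: "complex => complex" where
 "Delta z = weyl_weight p q z * gamma_quot p q (T w0) (T w0) (%r. p * q / T w0 r) (%r. p * q / T w0 r) z"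

text \<open>At \<open>w0\<close> the two factors taken out are \<open>1 - A / z\<close> and
  \<open>1 - z / A\<close> for the same pole \<open>A\<close>. They depend only on
  \<open>z / A\<close>, so passing from one pole to another by scaling leaves them
  unchanged.\<close>

lemma Delta_factor:
 assumes i: "(x, j, k) \<in> pinch_set" and z: "z ~= 0" "z ~= pole (T w0) (x, j, k)" "den (x, j, k) (T w0) z ~= 0"
 shows "z \<in> pole_free p q (T w0) (T w0)"
  "num (T w0) z / den (x, j, k) (T w0) z = Delta z * (1 - pole (T w0) (x, j, k) / z) * (1 - z / pole (T w0) (x, j, k))"
proof -
 define A where "A = pole (T w0) (x, j, k)"
 have A: "A ~= 0" using pole_nonzero[OF w0] by (simp add: A_def)
 have 1: "1 - p ^ j * q ^ k * (T w0 x / z) = 1 - A / z" by (simp add: A_def pole_def mult_ac)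
 have "p ^ (J - j) * q ^ (K - k) * T w0 (partner x) * A = 1"
  using pole_resonance[OF i, of w0] by (simp add: A_def eps_w0 mult_ac)
 hence "p ^ (J - j) * q ^ (K - k) * T w0 (partner x) = 1 / A" using A by (simp add: field_simps)
 hence 2: "1 - p ^ (J - j) * q ^ (K - k) * (T w0 (partner x) * z) = 1 - z / A" by (metis mult.assoc mult.commute mult_1 times_divide_eq_right)
 have P: "(\<Prod>s\<in>UNIV. qpoch2 (T w0 s / z) p q * qpoch2 (T w0 s * z) p q) = (1 - A / z) * (1 - z / A) * den (x, j, k) (T w0) z"
  using denominators_eq[OF i, of "T w0" z] unfolding 1 2 .
 have nz: "1 - A / z ~= 0" "1 - z / A ~= 0" using z A by (auto simp: A_def)
 hence "(\<Prod>s\<in>UNIV. qpoch2 (T w0 s / z) p q * qpoch2 (T w0 s * z) p q) ~= 0" using z(3) unfolding P by simp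
 thus "z \<in> pole_free p q (T w0) (T w0)" using z(1) by (auto simp: pole_free_def)
 have D: "Delta z = num (T w0) z / ((1 - A / z) * (1 - z / A) * den (x, j, k) (T w0) z)"
  unfolding P[symmetric] by (simp add: Delta_def gamma_quot_def num_def prod_dividef)
 have alg: "v / d = v / (a * b * d) * a * b" if "a ~= 0" "b ~= 0" for a b d v :: complex
  using that by (cases "d = 0") (auto simp: divide_simps)
 show "num (T w0) z / den (x, j, k) (T w0) z = Delta z * (1 - pole (T w0) (x, j, k) / z) * (1 - z / pole (T w0) (x, j, k))"
  unfolding D A_def[symmetric] by (rule alg[OF nz])
qed

text \<open>For \<open>2 * j < J\<close> this is the form that \<open>multiplier_minus_one\<close>
  expects, with \<open>n = J - 2 * j\<close> and \<open>be = 2 * k - K\<close>.\<close>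

lemma pole_square:
 assumes "(x, j, k) \<in> pinch_set"
 shows "pole (T w0) (x, j, k) ^ 2 = p powi (2 * int j - int J) * q powi (2 * int k - int K)"
proof -
 have "pole (T w0) (x, j, k) ^ 2 * (p ^ J * q ^ K) = (p ^ j)^2 * (q ^ k)^2 * (T w0 x * T w0 x * p ^ J * q ^ K)"
  by (simp add: pole_def power_mult_distrib power2_eq_square mult_ac)
 also have "... = p powi (2 * int j) * q powi (2 * int k)" unfolding resonance power_even_eq_powi by simp
 finally have "pole (T w0) (x, j, k) ^ 2 = p powi (2 * int j) * q powi (2 * int k) / (p powi int J * q powi int K)"
  using p q by (simp add: eq_divide_eq)
 thus ?thesis using p q by (simp only: power_int_diff[OF disjI1[OF p(2)]] power_int_diff[OF disjI1[OF q(2)]] times_divide_times_eq)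
qed

text \<open>In the middle the square of the pole is a power of q, where the Weyl weight
  vanishes.\<close>

lemma H_center:
 assumes "(x, j, k) \<in> pinch_set" "2 * j = J"
 shows "H (T w0) (x, j, k) = 0"
proof -
 define z where "z = pole (T w0) (x, j, k)"
 have z: "z ~= 0" using pole_nonzero[OF w0] by (simp add: z_def)
 obtain c where "qtheta (q powi (2 * int k - int K) * 1) q = c * 1 powi (- (2 * int k - int K)) * qtheta 1 q"
  using qtheta_int_shift[OF q, of "2 * int k - int K"] by (metis one_neq_zero)
 moreover have "qpoch 1 q = 0" using qpoch_eq_0_iff[OF q(1), of 1] by (metis mult_1 power_0)
 moreover have "z^2 = q powi (2 * int k - int K)"
 proof -
  have "2 * int j - int J = 0" using assms(2) by linarith
  thus ?thesis using pole_square[OF assms(1)] by (simp add: z_def)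
 qed
 ultimately have "qtheta (z^2) q = 0" by (simp add: qtheta_def)
 hence "weyl_weight p q z = 0" using weyl_weight_qtheta[OF q(1) p(1) z] by simp
 thus ?thesis by (simp add: H_def num_def z_def)
qed

text \<open>The poles of index \<open>j\<close> and \<open>J - j\<close> differ by the factor p^(J -
  2j), and under this scaling the integrand has multiplier -1 there.\<close>

lemma H_reflect:
 assumes i: "(x, j, k) \<in> pinch_set" and j: "2 * j < J"
 shows "H (T w0) (x, J - j, k) = - H (T w0) (x, j, k)"
proof -
 define n where "n = J - 2 * j"
 define be where "be = 2 * int k - int K"
 define z1 where "z1 = pole (T w0) (x, j, k)"
 have n: "n > 0" using j by (simp add: n_def)
 have i': "(x, J - j, k) \<in> pinch_set" using i by (auto simp: pinch_set_def)
 have z1: "z1 ~= 0" using pole_nonzero[OF w0] by (simp add: z1_def)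
 have "n + j = J - j" using j by (simp add: n_def)
 hence pz: "pole (T w0) (x, J - j, k) = p ^ n * z1"
  unfolding z1_def pole_def prod.case by (metis (no_types, lifting) mult.assoc mult.commute power_add)
 have sq: "z1^2 = p powi (- int n) * q powi be"
  using pole_square[OF i] j by (simp add: z1_def n_def be_def of_nat_diff)
 have T0: "T w0 r ~= 0" for r by (rule T_nonzero[OF w0])
 define A where "A = (%z. \<Prod>r\<in>UNIV. \<Prod>l<n. qtheta (p ^ l * (T w0 r * z)) q)"
 define A' where "A' = (%z. \<Prod>r\<in>UNIV. \<Prod>l<n. qtheta (p ^ l * (T w0 r / (p ^ n * z))) q)"
 \<comment> \<open>\<open>F1\<close> and \<open>F2\<close> are finite at \<open>z1\<close>, where
   \<open>Delta\<close> itself may be singular. The functional equation is proved near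
   \<open>z1\<close> and carried to \<open>z1\<close> by continuity of its two cross-multiplied
   sides \<open>f\<close> and \<open>g\<close>.\<close>
 define F1 where "F1 = (%z. num (T w0) z / den (x, j, k) (T w0) z)"
 define F2 where "F2 = (%z. num (T w0) (p ^ n * z) / den (x, J - j, k) (T w0) (p ^ n * z))"
 define R' where "R' = (%z. A' z * qtheta (z^2) q)"
 define f where "f = (%z. F2 z * R' z)"
 define R where "R = (%z. A z * qtheta (p ^ (2 * n) * z^2) q * p powi (- (2 * int n * int n + int n)) * z powi (- 4 * int n))"
 define g where "g = (%z. F1 z * R z)"
 have op: "open (-{0::complex})" by auto
 have cnd0: "continuous_on (-{0}) (%z. num (T w0) (g z))" "continuous_on (-{0}) (%z. den i (T w0) (g z))"
  if "continuous_on (-{0}) g" "!!z. z ~= 0 ==> g z ~= 0" for g :: "complex => complex" and i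
  using continuous_on_num_den(1,2)[of "-{0}" "%_. w0" g] that w0 by auto
 have cnd: "continuous_on (-{0}) (%z. num (T w0) z)" "continuous_on (-{0}) (%z. den i (T w0) z)"
  "continuous_on (-{0}) (%z. num (T w0) (p ^ n * z))" "continuous_on (-{0}) (%z. den i (T w0) (p ^ n * z))" for i
  using p by (intro cnd0 continuous_intros; simp)+
 have d1: "den (x, j, k) (T w0) z1 ~= 0" using den_nonzero[OF i] by (simp add: z1_def)
 have d2: "den (x, J - j, k) (T w0) (p ^ n * z1) ~= 0" using den_nonzero[OF i'] by (simp add: pz)
 have ev: "eventually (%z. den (x, j, k) (T w0) z ~= 0 & den (x, J - j, k) (T w0) (p ^ n * z) ~= 0 & z ~= 0 & z ~= z1) (at z1)"
 proof (intro eventually_conj)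
  show "eventually (%z. den (x, j, k) (T w0) z ~= 0) (at z1)"
   by (rule tendsto_imp_eventually_ne[OF _ d1]) (use cnd(2)[of "(x, j, k)"] z1 in \<open>auto simp: continuous_on_eq_continuous_at[OF op] isCont_def\<close>)
  show "eventually (%z. den (x, J - j, k) (T w0) (p ^ n * z) ~= 0) (at z1)"
   by (rule tendsto_imp_eventually_ne[OF _ d2]) (use cnd(4)[of "(x, J - j, k)"] z1 in \<open>auto simp: continuous_on_eq_continuous_at[OF op] isCont_def\<close>)
  show "eventually (%z. z ~= 0) (at z1)" using eventually_at_in_open'[OF op, of z1] z1 by auto
  show "eventually (%z. z ~= z1) (at z1)" by (simp add: eventually_at_filter)
 qed
 have fg: "eventually (%z. f z = g z) (at z1)" using ev
 proof eventually_elim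
  case (elim z)
  have z: "z ~= 0" "z ~= z1" "p ^ n * z ~= 0" "p ^ n * z ~= p ^ n * z1" using elim p by auto
  note D1 = Delta_factor[OF i z(1) z(2)[unfolded z1_def]]
  note D2 = Delta_factor[OF i' z(3) z(4)[folded pz]]
  have pf: "z \<in> pole_free p q (T w0) (T w0)" "p ^ n * z \<in> pole_free p q (T w0) (T w0)" using D1(1) D2(1) elim by auto
  have G: "Delta (p ^ n * z) * (A' z * qtheta (z^2) q) =
   Delta z * (A z * qtheta (p ^ (2 * n) * z^2) q * p powi (- (2 * int n * int n + int n)) * z powi (- 4 * int n))"
  proof -
   have alg: "W2 * th = W1 * u ==> g2 * a2 = g1 * a1 ==> W2 * g2 * (a2 * th) = W1 * g1 * (a1 * u)" for W1 W2 th u g1 g2 a1 a2 :: complex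
    by algebra
   show ?thesis unfolding Delta_def
    using alg[OF weyl_weight_shift[OF q(1) p z(1), of n, unfolded mult.assoc[of "weyl_weight p q z"]]
      gamma_quot_shift[OF q(1) p T0 pf]] unfolding A_def A'_def by (simp only: mult.assoc)
  qed
  have "F1 z = Delta z * ((1 - z1 / z) * (1 - z / z1))" using D1(2) elim by (simp add: F1_def z1_def)
  moreover have "F2 z = Delta (p ^ n * z) * ((1 - z1 / z) * (1 - z / z1))"
   using D2(2) elim p unfolding F2_def pz by simp
  ultimately have "f z = (Delta (p ^ n * z) * (A' z * qtheta (z^2) q)) * ((1 - z1 / z) * (1 - z / z1))"
   by (simp only: f_def R'_def mult_ac)
  also have "... = g z" unfolding G g_def R_def \<open>F1 z = _\<close> by (simp only: mult_ac)
  finally show ?case .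
 qed
 have f1: "(f \<longlongrightarrow> f z1) (at z1)"
 proof -
  have c: "continuous_on (-{0}) R'" unfolding A'_def R'_def
   by (intro continuous_intros q) (use T0 p in auto)
  have "isCont R' z1" "isCont (%z. num (T w0) (p ^ n * z)) z1" "isCont (%z. den (x, J - j, k) (T w0) (p ^ n * z)) z1"
   using c cnd(3) cnd(4)[of "(x, J - j, k)"] z1 by (auto simp: continuous_on_eq_continuous_at[OF op])
  hence "isCont f z1" unfolding f_def F2_def using d2 by (intro isCont_mult isCont_divide)
  thus ?thesis by (simp add: isCont_def)
 qed
 have g1: "(g \<longlongrightarrow> g z1) (at z1)"
 proof -
  have c: "continuous_on (-{0}) R" unfolding A_def R_def
   by (intro continuous_intros q) (use T0 p in auto)
  have at: "isCont h z1" if "continuous_on (-{0}) h" for h :: "complex => complex"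
   using that z1 by (simp add: continuous_on_eq_continuous_at[OF op])
  have "isCont g z1" unfolding g_def F1_def
   by (rule isCont_mult[OF isCont_divide[OF at[OF cnd(1)] at[OF cnd(2)] d1] at[OF c]])
  thus ?thesis by (simp add: isCont_def)
 qed
 have "(g \<longlongrightarrow> f z1) (at z1)" using tendsto_cong[OF fg] f1 by blast
 hence "f z1 = g z1" using g1 by (rule tendsto_unique[OF trivial_limit_at])
 moreover have "A z1 * qtheta (p ^ (2 * n) * z1^2) q * p powi (- (2 * int n * int n + int n)) * z1 powi (- 4 * int n)
  = - A' z1 * qtheta (z1^2) q"
  unfolding A_def A'_def by (rule multiplier_minus_one[OF card q p T0 balancing sq])
 ultimately have eq: "F2 z1 * (A' z1 * qtheta (z1^2) q) = - F1 z1 * (A' z1 * qtheta (z1^2) q)"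
  by (simp add: f_def g_def R_def R'_def)
 have npow: "norm z1 ^ 2 = norm p powi (- int n) * norm q powi be"
  using arg_cong[OF sq, of norm] by (simp add: norm_mult norm_power norm_power_int)
 \<comment> \<open>A zero of a theta function forces its argument to have the modulus of a power of
   q. For the argument z1^2, and for those built from t_x, this contradicts \<open>pq_indep\<close>;
   for the other parameters it contradicts \<open>t_indep\<close>.\<close>
 have th0: "qtheta (z1^2) q ~= 0"
 proof
  assume "qtheta (z1^2) q = 0"
  then obtain l where "norm (z1^2) = norm q powi l" using qtheta_eq_0_norm[OF q, of "z1^2"] z1 by auto
  hence "norm p powi (- int n) * norm q powi be = norm q powi l" using npow by (simp add: norm_power)
  hence "norm p powi (- int n) = norm q powi (l - be)" using q by (simp add: power_int_diff field_simps)
  from pq_indep[OF this] n show False by simp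
 qed
 have "qtheta (p ^ l * (T w0 r / (p ^ n * z1))) q ~= 0" if l: "l < n" for l r
 proof
  assume "qtheta (p ^ l * (T w0 r / (p ^ n * z1))) q = 0"
  then obtain b where b: "norm (p ^ l * (T w0 r / (p ^ n * z1))) = norm q powi b"
   using qtheta_eq_0_norm[OF q, of "p ^ l * (T w0 r / (p ^ n * z1))"] p z1 T0[of r] by auto
  show False
  proof (cases "r = x")
   case True
   have "p ^ l * (T w0 r / (p ^ n * z1)) = p powi (int l - int n - int j) * q powi (- int k)"
    unfolding power_int_diff[OF disjI1[OF p(2)]] using True T0[of x] p q
    by (simp add: z1_def pole_def power_int_minus field_simps)
   hence "norm p powi (int l - int n - int j) * norm q powi (- int k) = norm q powi b"
    using b by (simp add: norm_mult norm_power_int)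
   hence "norm p powi (int l - int n - int j) = norm q powi (b + int k)"
    using q by (simp add: power_int_add power_int_minus field_simps)
   from pq_indep[OF this] l show False by simp
  next
   case False
   have "norm (T w0 r) = norm q powi b * (norm p ^ n * norm z1) / norm p ^ l"
    using b p z1 by (simp add: norm_mult norm_divide norm_power field_simps)
   hence "norm (T w0 r) ^ 2 = (norm q powi b)^2 * ((norm p ^ n)^2 * norm z1 ^ 2) / (norm p ^ l)^2"
    by (simp only: power_divide power_mult_distrib)
   also have "... = norm q powi (b * 2) * (norm p powi (int n * 2) * (norm p powi (- int n) * norm q powi be)) / norm p powi (int l * 2)"
    unfolding npow power_even_eq_powi power_int_power' by (simp add: mult.commute)
   also have "... = (norm p powi (int n * 2) * norm p powi (- int n) * norm p powi (- (int l * 2))) * (norm q powi (b * 2) * norm q powi be)"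
    by (simp add: power_int_minus field_simps)
   also have "... = norm p powi (int n * 2 + - int n + - (int l * 2)) * norm q powi (b * 2 + be)"
    using p q by (simp only: power_int_add[OF disjI1] norm_eq_zero simp_thms)
   finally show False using t_indep[OF False] by blast
  qed
 qed
 hence "A' z1 ~= 0" by (auto simp: A'_def)
 moreover have "(F2 z1 + F1 z1) * (A' z1 * qtheta (z1^2) q) = 0" unfolding distrib_right eq by simp
 ultimately have "F2 z1 + F1 z1 = 0" using th0 by simp
 hence "F2 z1 = - F1 z1" by (rule eq_neg_iff_add_eq_0[THEN iffD2])
 thus ?thesis unfolding H_def pz F1_def F2_def z1_def[symmetric] by simp
qed

text \<open>The involution j \<mapsto> J - j pairs opposite terms; its fixed terms vanish by
  \<open>H_center\<close>.\<close>

lemma sum_H_zero: "(\<Sum>i\<in>pinch_set. H (T w0) i) = 0"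
proof -
 define ph where "ph = (%(r::'n, j, k::nat). (r, J - j, k))"
 have neg: "H (T w0) (ph i) = - H (T w0) i" if i: "i \<in> pinch_set" for i
 proof -
  obtain j k where ijk: "i = (x, j, k)" using i by (auto simp: pinch_set_def)
  have jJ: "j <= J" using i ijk by (auto simp: pinch_set_def)
  consider "2 * j < J" | "2 * j = J" | "2 * (J - j) < J" using jJ by linarith
  thus ?thesis
  proof cases
   case 1 thus ?thesis using H_reflect i by (simp add: ijk ph_def)
  next
   case 2
   hence "ph i = i" by (auto simp: ijk ph_def)
   thus ?thesis using H_center 2 i by (simp add: ijk)
  next
   case 3
   have "(x, J - j, k) \<in> pinch_set" using i ijk by (auto simp: pinch_set_def)
   from H_reflect[OF this 3] jJ show ?thesis by (simp add: ijk ph_def)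
  qed
 qed
 have "(\<Sum>i\<in>pinch_set. H (T w0) i) = (\<Sum>i\<in>pinch_set. H (T w0) (ph i))"
  by (rule sum.reindex_bij_witness[of _ ph ph]) (auto simp: ph_def pinch_set_def)
 also have "... = - (\<Sum>i\<in>pinch_set. H (T w0) i)" using neg by (simp add: sum_negf)
 finally show ?thesis by simp
qed

end

section \<open>Continuation across all resonances of a generic curve\<close>

lemma holomorphic_extend_discrete:
 assumes S: "open S" and N: "open N" "N \<subseteq> S" and f: "f holomorphic_on N"
  and iso: "!!w0. w0 \<in> S ==> w0 ~: N ==> eventually (%w. w \<in> N) (at w0) & ((%w. (w - w0) * f w) \<longlongrightarrow> 0) (at w0)"
 shows "\<exists>g. g holomorphic_on S & (\<forall>w\<in>N. g w = f w)"
proof (intro exI conjI ballI)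
 define g where "g = (%w. if w \<in> N then f w else Lim (at w) f)"
 show "g w = f w" if "w \<in> N" for w using that by (simp add: g_def)
 show "g holomorphic_on S"
 proof (rule holomorphicI_local)
  fix w0 assume w0: "w0 \<in> S"
  show "\<exists>T. open T & w0 \<in> T & g holomorphic_on T"
  proof (cases "w0 \<in> N")
   case True
   have "g holomorphic_on N" using f by (rule holomorphic_transform) (simp add: g_def)
   thus ?thesis using True N by blast
  next
   case False
   obtain r1 where r1: "r1 > 0" "!!w. w ~= w0 ==> dist w w0 < r1 ==> w \<in> N"
    using iso[OF w0 False] by (auto simp: eventually_at)
   obtain r2 where r2: "r2 > 0" "ball w0 r2 \<subseteq> S" using S w0 openE by blast
   define r where "r = min r1 r2"
   have r: "r > 0" using r1 r2 by (simp add: r_def)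
   have rN: "ball w0 r - {w0} \<subseteq> N" by (intro subsetI r1(2)) (auto simp: r_def dist_commute)
   have "f holomorphic_on (ball w0 r - {w0})" using f rN by (rule holomorphic_on_subset)
   from holomorphic_on_extend_lim[OF this, of] obtain h where h: "h holomorphic_on ball w0 r" "!!z. z \<in> ball w0 r - {w0} ==> h z = f z"
    using iso[OF w0 False] r by (auto simp: interior_open)
   have "isCont h w0" 
    using continuous_on_interior[OF holomorphic_on_imp_continuous_on[OF h(1)], of w0] r by (simp add: interior_open)
   hence "(h \<longlongrightarrow> h w0) (at w0)" by (simp add: isCont_def)
   moreover have "eventually (%z. h z = f z) (at w0)"
    using eventually_at_in_open[of "ball w0 r" w0] r by (auto elim!: eventually_mono intro: h)
   ultimately have "(f \<longlongrightarrow> h w0) (at w0)" using tendsto_cong by blast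
   hence "Lim (at w0) f = h w0" by (intro tendsto_Lim) auto
   hence "g w = h w" if "w \<in> ball w0 r" for w
    using that rN h(2) False by (cases "w = w0") (auto simp: g_def)
   hence "g holomorphic_on ball w0 r" using h(1) by (metis holomorphic_transform)
   thus ?thesis using r by (intro exI[of _ "ball w0 r"]) auto
  qed
 qed
qed

lemma open_nonresonant:
 fixes A B :: "'x::t2_space => 'n::finite => complex"
 assumes q: "norm q < 1" and p: "norm p < 1" and U: "open U"
  and AB: "!!i. continuous_on U (%xi. A xi i)" "!!i. continuous_on U (%xi. B xi i)"
 shows "open {xi\<in>U. nonresonant p q (A xi) (B xi)}"
proof (subst open_subopen, rule ballI)
 fix xi0 assume "xi0 \<in> {xi\<in>U. nonresonant p q (A xi) (B xi)}"
 hence x: "xi0 \<in> U" "nonresonant p q (A xi0) (B xi0)" by auto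
 have c: "isCont (%xi. A xi i) xi0" "isCont (%xi. B xi i) xi0" for i
  using AB x(1) U by (auto simp: continuous_on_eq_continuous_at)
 have "eventually (%xi. \<forall>i i' j k. True --> A xi i * B xi i' * p ^ j * q ^ k \<in> -{1}) (nhds xi0)"
 proof (intro eventually_all_finite)
  fix i i'
  show "eventually (%xi. \<forall>j k. True --> A xi i * B xi i' * p ^ j * q ^ k \<in> -{1}) (nhds xi0)"
  proof (rule eventually_geometric_family_in_open[OF q p tendsto_const])
   show "((%xi. A xi i * B xi i') \<longlongrightarrow> A xi0 i * B xi0 i') (nhds xi0)"
    using c by (intro tendsto_mult) (auto simp: isCont_def tendsto_nhds_iff)
  qed (use x(2) in \<open>auto simp: nonresonant_def\<close>)
 qed
 moreover have "eventually (%xi. xi \<in> U) (nhds xi0)" using U x(1) by (rule eventually_nhds_in_open)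
 ultimately have "eventually (%xi. xi \<in> {xi\<in>U. nonresonant p q (A xi) (B xi)}) (nhds xi0)"
  by eventually_elim (auto simp: nonresonant_def)
 thus "\<exists>T. open T & xi0 \<in> T & T \<subseteq> {xi\<in>U. nonresonant p q (A xi) (B xi)}"
  unfolding eventually_nhds by blast
qed

lemma holomorphic_on_beta_value:
 fixes t :: "complex => 'n::finite => complex"
 assumes q: "norm q < 1" and p: "norm p < 1" and U: "open U"
  and t: "!!i. (%xi. t xi i) holomorphic_on U" "!!xi i. xi \<in> U ==> t xi i ~= 0"
  and nr: "!!xi. xi \<in> U ==> nonresonant p q (t xi) (t xi)"
 shows "(%xi. beta_value p q (t xi)) holomorphic_on U"
 unfolding beta_value_def
proof (intro holomorphic_intros)
 show "(%xi. pair_prefactor p q (t xi)) holomorphic_on U"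
  unfolding pair_prefactor_def by (intro holomorphic_intros t q p)
 have W: "continuous_on (-{0}) (weyl_weight p q)"
  by (rule holomorphic_on_imp_continuous_on[OF holomorphic_weyl_weight[OF q p]])
 show "(%xi. beta_integral p q (t xi)) holomorphic_on U" unfolding beta_integral_def
  by (rule holomorphic_on_kernel_integral[OF q p U t(1) t(1) _ _ nr holomorphic_weyl_weight[OF q p]])
   (use t in \<open>auto intro!: holomorphic_intros continuous_on_compose2[OF W] continuous_intros simp: case_prod_beta'\<close>)
qed auto

definition log_independent :: "'n set => real => real => ('n => real) => bool" where
 "log_independent S P Q lam \<longleftrightarrow> (\<forall>(i::int) (j::int) (f::'n => int).
  of_int i * P + of_int j * Q + (\<Sum>s\<in>S. of_int (f s) * lam s) = 0 --> i = 0 & j = 0 & (\<forall>s\<in>S. f s = 0))"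

text \<open>Logarithms of moduli at a point of a resonance. \<open>c\<close> and \<open>d\<close>
  are the two moving coordinates and \<open>c\<close> is the resonating one: with the fixed
  coordinate \<open>s0\<close> if \<open>ep\<close>, with itself otherwise. The resonance determines
  \<open>L c\<close> and the balancing condition \<open>L d\<close>, so every \<open>L r\<close> is
  a rational combination of the independent numbers \<open>P\<close>, \<open>Q\<close> and
  \<open>lam s\<close>.\<close>

locale resonance_logs =
 fixes L lam :: "'n::finite => real" and c d s0 :: 'n and ep :: bool and P Q :: real and J K :: nat and M :: int
 assumes cd: "c ~= d" and card: "card (- {c, d}) >= 3" and s0: "s0 \<in> - {c, d}"
  and ind: "log_independent (- {c, d}) P Q lam"
  and L_other: "!!s. s \<in> - {c, d} ==> L s = lam s"
  and L_c: "2 * L c = (if ep then - 2 * lam s0 - 2 * real J * P - 2 * real K * Q else - real J * P - real K * Q)"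
  and L_d: "L d = of_int M * (P + Q) - (\<Sum>s\<in>- {c, d}. lam s) - L c"
begin

text \<open>Integer coordinates of \<open>2 * L r\<close>: \<open>V r s\<close> is the coefficient
  of \<open>lam s\<close>, \<open>A r J\<close> that of \<open>P\<close> and \<open>A r K\<close>
  that of \<open>Q\<close>. Doubling clears the denominators coming from \<open>L_c\<close>.\<close>

definition V :: "'n => 'n => int" where
 "V r s = (if r = c then (if ep & s = s0 then - 2 else 0)
  else if r = d then - 2 + (if ep & s = s0 then 2 else 0) else (if s = r then 2 else 0))"
definition A :: "'n => nat => int" where
 "A r j = (let u = (if ep then - 2 * int j else - int j) in if r = c then u else if r = d then 2 * M - u else 0)"

lemma representation: "2 * L r = of_int (A r J) * P + of_int (A r K) * Q + (\<Sum>s\<in>- {c, d}. of_int (V r s) * lam s)"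
proof -
 have c: "2 * L c = of_int (A c J) * P + of_int (A c K) * Q + (\<Sum>s\<in>- {c, d}. of_int (V c s) * lam s)"
 proof -
  have "(\<Sum>s\<in>- {c, d}. of_int (V c s) * lam s) = (\<Sum>s\<in>- {c, d}. if s = s0 then (if ep then - 2 * lam s0 else 0) else 0)"
   by (rule sum.cong) (auto simp: V_def)
  also have "... = (if ep then - 2 * lam s0 else 0)" using s0 by (simp add: sum.delta)
  finally show ?thesis using L_c by (simp add: A_def)
 qed
 consider "r = c" | "r = d" | "r \<in> - {c, d}" by auto
 thus ?thesis
 proof cases
  case 2
  have "V d s = - 2 - V c s" for s using cd by (auto simp: V_def)
  hence sumV: "(\<Sum>s\<in>- {c, d}. of_int (V d s) * lam s) = - 2 * (\<Sum>s\<in>- {c, d}. lam s) - (\<Sum>s\<in>- {c, d}. of_int (V c s) * lam s)"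
   by (simp add: sum_distrib_left sum_subtractf left_diff_distrib sum_negf)
  have Ad: "of_int (A d j) = 2 * of_int M - (of_int (A c j) :: real)" for j using cd by (simp add: A_def Let_def)
  show ?thesis unfolding 2 sumV Ad using L_d c by algebra
 next
  case 3
  have "(\<Sum>s\<in>- {c, d}. of_int (V r s) * lam s) = (\<Sum>s\<in>- {c, d}. if s = r then 2 * lam r else 0)"
   using 3 by (intro sum.cong) (auto simp: V_def)
  also have "... = 2 * lam r" using 3 by (simp add: sum.delta)
  finally show ?thesis using 3 L_other[OF 3] by (simp add: A_def)
 qed (use c in simp)
qed

lemma relation:
 assumes "of_int u * (2 * L r) + of_int v * (2 * L s) + of_int i * P + of_int j * Q = 0"
 shows "!!s'. s' \<in> - {c, d} ==> u * V r s' + v * V s s' = 0" "u * A r J + v * A s J + i = 0" "u * A r K + v * A s K + j = 0"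
proof -
 have "of_int (u * A r J + v * A s J + i) * P + of_int (u * A r K + v * A s K + j) * Q
  + (\<Sum>s'\<in>- {c, d}. of_int (u * V r s' + v * V s s') * lam s')
  = of_int u * (2 * L r) + of_int v * (2 * L s) + of_int i * P + of_int j * Q"
  unfolding representation[of r] representation[of s]
  by (simp add: algebra_simps sum.distrib sum_distrib_left)
 also have "... = 0" by (rule assms)
 finally have "u * A r J + v * A s J + i = 0 & u * A r K + v * A s K + j = 0 & (\<forall>s'\<in>- {c, d}. u * V r s' + v * V s s' = 0)"
  by (rule ind[unfolded log_independent_def, rule_format])
 thus "!!s'. s' \<in> - {c, d} ==> u * V r s' + v * V s s' = 0" "u * A r J + v * A s J + i = 0" "u * A r K + v * A s K + j = 0" by auto
qed

lemma avoid: obtains s' where "s' \<in> - {c, d}" "s' ~= x" "s' ~= y"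
proof -
 have "card (- {c, d} - {x, y}) > 0"
  using card diff_card_le_card_Diff[of "{x, y}" "- {c, d}"] card_insert_le_m1[of 2 "{y}" x] by simp
 hence "- {c, d} - {x, y} ~= {}" by (metis card.empty less_irrefl)
 thus thesis using that by blast
qed

lemma V_inj: assumes "!!s'. s' \<in> - {c, d} ==> V r s' = V s s'" shows "r = s"
proof (rule ccontr)
 assume ne: "r ~= s"
 obtain s' where s': "s' \<in> - {c, d}" "s' ~= s0" using avoid[of s0 s0] by metis
 consider "r \<in> - {c, d}" | "s \<in> - {c, d}" | "{r, s} = {c, d}" using ne by auto
 thus False
 proof cases
  case 1 thus False using assms[of r] ne by (auto simp: V_def split: if_splits)
 next
  case 2 thus False using assms[of s] ne by (auto simp: V_def split: if_splits)
 next
  case 3 thus False using assms[OF s'(1)] s' cd ne by (auto simp: V_def doubleton_eq_iff)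
 qed
qed

lemma poles_distinct:
 assumes "L r + real j * P + real k * Q = L r' + real j' * P + real k' * Q"
 shows "r = r' & j = j' & k = k'"
proof -
 have "of_int 1 * (2 * L r) + of_int (-1) * (2 * L r') + of_int (2 * (int j - int j')) * P + of_int (2 * (int k - int k')) * Q = 0"
  using assms by (simp add: algebra_simps)
 from relation[OF this] show ?thesis using V_inj[of r r'] by auto
qed

lemma resonance_unique:
 assumes "L r + L s + real j * P + real k * Q = 0"
 shows "((r = c & s = (if ep then s0 else c)) | (r = (if ep then s0 else c) & s = c)) & j = J & k = K"
proof -
 have "of_int 1 * (2 * L r) + of_int 1 * (2 * L s) + of_int (2 * int j) * P + of_int (2 * int k) * Q = 0"
  using assms by (simp add: algebra_simps)
 note rel = relation[OF this]
 have V0: "V r s' + V s s' = 0" if "s' \<in> - {c, d}" for s' using rel(1)[OF that] by simp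
 obtain s' where s': "s' \<in> - {c, d}" "s' ~= s0" using avoid[of s0 s0] by metis
 \<comment> \<open>\<open>d\<close> has coordinate -2 at every fixed index other than
   \<open>s0\<close>, and a second index can make up for this at no more than one of them.\<close>
 have nd: "r ~= d" "s ~= d"
 proof -
  obtain s1 where s1: "s1 \<in> - {c, d}" "s1 ~= s0" "s1 ~= s" using avoid[of s0 s] by metis
  show "r ~= d" using V0[OF s1(1)] s1 cd by (auto simp: V_def split: if_splits)
  obtain s2 where s2: "s2 \<in> - {c, d}" "s2 ~= s0" "s2 ~= r" using avoid[of s0 r] by metis
  show "s ~= d" using V0[OF s2(1)] s2 cd by (auto simp: V_def split: if_splits)
 qed
 have type: "(r = c & s = (if ep then s0 else c)) | (r = (if ep then s0 else c) & s = c)"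
 proof -
  consider "r = c" "s = c" | "r \<in> - {c, d}" "s = c" | "r = c" "s \<in> - {c, d}" | "r \<in> - {c, d}" "s \<in> - {c, d}" using nd by auto
  thus ?thesis
  proof cases
   case 1 thus ?thesis using V0[OF s0] by (auto simp: V_def split: if_splits)
  next
   case 2 thus ?thesis using V0[of r] by (auto simp: V_def split: if_splits)
  next
   case 3 thus ?thesis using V0[of s] by (auto simp: V_def split: if_splits)
  next
   case 4 thus ?thesis using V0[of r] by (auto simp: V_def split: if_splits)
  qed
 qed
 thus ?thesis using rel(2,3) s0 by (auto simp: A_def Let_def split: if_splits)
qed

lemma not_pq_power:
 assumes "\<not> ep" "r ~= c"
 shows "2 * L r ~= of_int i * P + of_int j * Q"
proof
 assume "2 * L r = of_int i * P + of_int j * Q"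
 hence "of_int 1 * (2 * L r) + of_int 0 * (2 * L r) + of_int (- i) * P + of_int (- j) * Q = 0" by simp
 note rel = relation(1)[OF this]
 have "V r s' = V c s'" if "s' \<in> - {c, d}" for s'
 proof -
  have "V c s' = 0" unfolding V_def using assms(1) by simp
  thus ?thesis using rel[OF that] by linarith
 qed
 from V_inj[OF this] assms show False by auto
qed

lemma pq_independent:
 assumes "of_int i * P = of_int j * Q"
 shows "i = 0"
proof -
 have "of_int 0 * (2 * L c) + of_int 0 * (2 * L c) + of_int i * P + of_int (- j) * Q = 0" using assms by simp
 from relation(2)[OF this] show ?thesis by simp
qed

end

definition exch :: "'n => 'n => 'n => int" where
 "exch a b r = (if r = a then 1 else if r = b then - 1 else 0)"

text \<open>As \<open>ta a * ta b\<close> and all fixed parameters are small, a resonance involves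
  exactly one of the moving coordinates; by independence it is alone at its point, so
  \<open>pinch\<close> applies. The pole it would cause is removed by a zero of the prefactor if the
  two indices differ, and by \<open>sum_H_zero\<close> if they coincide.\<close>

lemma generic_curve_extends:
 fixes ta :: "'n::finite => complex"
 assumes card: "CARD('n) = 2 * m + 6" and q: "norm q < 1" "q ~= 0" and p: "norm p < 1" "p ~= 0"
  and ab: "a ~= b" and tau: "!!r. ta r ~= 0" "(\<Prod>r\<in>UNIV. ta r) = (p * q) ^ (m + 1)"
  and small: "!!r. r ~: {a, b} ==> norm (ta r) < 1" "norm (ta a * ta b) < 1"
  and ind: "log_independent (- {a, b}) (ln (norm p)) (ln (norm q)) (%r. ln (norm (ta r)))"
 shows "\<exists>g. g holomorphic_on (-{0}) & (\<forall>w. w ~= 0 -->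
  nonresonant p q (monomial_curve ta (exch a b) w) (monomial_curve ta (exch a b) w) -->
  g w = beta_value p q (monomial_curve ta (exch a b) w))"
proof -
 define e where "e = exch a b"
 define T where "T = monomial_curve ta e"
 define N where "N = {w\<in>-{0}. nonresonant p q (T w) (T w)}"
 have op: "open (-{0::complex})" by auto
 have T_hol: "(%w. T w r) holomorphic_on -{0}" for r
  unfolding T_def monomial_curve_def by (intro holomorphic_intros) auto
 have T0: "T w r ~= 0" if "w ~= 0" for w r using that tau by (simp add: T_def monomial_curve_def)
 have N: "open N" "N \<subseteq> -{0}"
 proof -
  show "open N" unfolding N_def
   by (rule open_nonresonant[OF q(1) p(1) op]) (rule holomorphic_on_imp_continuous_on[OF T_hol])+
 qed (auto simp: N_def)
 have hol: "(%w. beta_value p q (T w)) holomorphic_on N"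
  by (rule holomorphic_on_beta_value[OF q(1) p(1) N(1)])
   (use N(2) T0 in \<open>auto intro: holomorphic_on_subset[OF T_hol] simp: N_def\<close>)
 have prodT: "(\<Prod>r\<in>UNIV. T w r) = (p * q) ^ (m + 1)" if "w ~= 0" for w
 proof -
  have "(\<Prod>r\<in>A. w powi e r) = w powi (\<Sum>r\<in>A. e r)" for A
   by (induction A rule: infinite_finite_induct) (use that in \<open>auto simp: power_int_add\<close>)
  hence "(\<Prod>r\<in>UNIV. w powi e r) = w powi (\<Sum>r\<in>UNIV. e r)" .
  also have "(\<Sum>r\<in>UNIV. e r) = (\<Sum>r\<in>UNIV. if r = a then 1 else 0) + (\<Sum>r\<in>UNIV. if r = b then - 1 else 0)"
   unfolding sum.distrib[symmetric] by (rule sum.cong) (use ab in \<open>auto simp: e_def exch_def\<close>)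
  also have "... = 0" by (simp add: sum.delta)
  finally show ?thesis using tau(2) by (simp add: T_def monomial_curve_def prod.distrib)
 qed
 have Tother: "T w r = ta r" if "r ~: {a, b}" for w r using that by (simp add: T_def monomial_curve_def e_def exch_def)
 have Tab: "T w a * T w b = ta a * ta b" if "w ~= 0" for w
  using that ab by (simp add: T_def monomial_curve_def e_def exch_def power_int_minus)
 have le1: "norm (p ^ j * q ^ k) <= 1" for j k
  using q p by (simp add: norm_mult norm_power mult_le_one power_le_one)
 have "\<exists>g. g holomorphic_on (-{0}) & (\<forall>w\<in>N. g w = beta_value p q (T w))"
 proof (rule holomorphic_extend_discrete[OF op N hol])
  fix w0 assume w0: "w0 \<in> -{0}" "w0 ~: N"
  hence w: "w0 ~= 0" by auto
  obtain r s J K where res: "T w0 r * T w0 s * p ^ J * q ^ K = 1"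
   using w0 by (auto simp: N_def nonresonant_def)
  have no: False if "norm (T w0 r * T w0 s) < 1"
  proof -
   have "norm (T w0 r * T w0 s) * norm (p ^ J * q ^ K) <= norm (T w0 r * T w0 s)" using le1 by (intro mult_left_le) auto
   moreover have "norm (T w0 r * T w0 s) * norm (p ^ J * q ^ K) = 1"
    using arg_cong[OF res, of norm] by (simp add: norm_mult mult_ac)
   ultimately show False using that by linarith
  qed
  \<comment> \<open>\<open>c\<close> is the moving coordinate in the resonance and \<open>d\<close>
    the other one; \<open>y\<close> is \<open>c\<close> again or a fixed coordinate.\<close>
  obtain c d y where cdy: "{c, d} = {a, b}" "c ~= d" "y = c | y ~: {a, b}" "T w0 c * T w0 y * p ^ J * q ^ K = 1"
  proof -
   have "\<not> (r ~: {a, b} & s ~: {a, b})"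
   proof
    assume rs: "r ~: {a, b} & s ~: {a, b}"
    have "norm (T w0 r * T w0 s) = norm (ta r) * norm (ta s)" using rs by (simp add: Tother norm_mult)
    also have "... < 1 * 1" using small(1) rs by (intro mult_strict_mono) auto
    finally show False using no by simp
   qed
   moreover have "\<not> (r \<in> {a, b} & s \<in> {a, b} & r ~= s)"
    using no small(2) Tab[OF w] by (auto simp: mult.commute)
   moreover have "T w0 s * T w0 r * p ^ J * q ^ K = 1" using res by (simp add: mult_ac)
   ultimately show thesis
    using that[of a b s] that[of b a s] that[of a b r] that[of b a r] res ab by (metis insert_iff singletonD doubleton_eq_iff)
  qed
  define ep where "ep = (y ~= c)"
  define L where "L = (%r. ln (norm (T w0 r)))"
  define lam where "lam = (%r. ln (norm (ta r)))"
  define P where "P = ln (norm p)"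
  define Q where "Q = ln (norm q)"
  have card_o: "card (- {c, d}) >= 3" using cdy(2) card by (simp add: Compl_eq_Diff_UNIV card_Diff_subset)
  obtain s1 where s1: "s1 \<in> - {c, d}" using card_o by (metis card.empty ex_in_conv not_numeral_le_zero)
  \<comment> \<open>In the diagonal case an arbitrary fixed coordinate stands in for the
    partner.\<close>
  define s0 where "s0 = (if ep then y else s1)"
  have s0: "s0 \<in> - {c, d}" using s1 cdy by (auto simp: s0_def ep_def)
  have y: "y = (if ep then s0 else c)" by (auto simp: s0_def ep_def)
  have lnp: "ln (norm (u * v * p ^ j * q ^ k)) = ln (norm u) + ln (norm v) + real j * P + real k * Q"
   if "u ~= 0" "v ~= 0" for u v j k
   using that p q by (simp add: norm_mult norm_power ln_mult ln_realpow P_def Q_def)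
  have Lres: "L c + L y + real J * P + real K * Q = 0"
   using lnp[OF T0[OF w, of c] T0[OF w, of y], of J K] unfolding cdy(4) L_def by simp
  have Lo: "L r = lam r" if "r \<in> - {c, d}" for r using that cdy(1) Tother by (auto simp: L_def lam_def)
  have Lsum: "(\<Sum>r\<in>UNIV. L r) = real (m + 1) * (P + Q)"
  proof -
   have "(\<Sum>r\<in>UNIV. L r) = ln (\<Prod>r\<in>UNIV. norm (T w0 r))" unfolding L_def
    by (rule ln_prod[symmetric]) (use T0[OF w] in auto)
   also have "(\<Prod>r\<in>UNIV. norm (T w0 r)) = norm ((p * q) ^ (m + 1))" unfolding prod_norm prodT[OF w] ..
   finally show ?thesis using p q by (simp add: norm_power norm_mult ln_realpow ln_mult P_def Q_def del: power_Suc)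
  qed
  interpret RL: resonance_logs L lam c d s0 ep P Q J K "int (m + 1)"
  proof
   show "log_independent (- {c, d}) P Q lam" using ind unfolding cdy(1) P_def Q_def lam_def .
   show "2 * L c = (if ep then - 2 * lam s0 - 2 * real J * P - 2 * real K * Q else - real J * P - real K * Q)"
    using Lres Lo[OF s0] by (auto simp: y split: if_splits)
   have "(\<Sum>r\<in>UNIV. L r) = L c + L d + (\<Sum>r\<in>- {c, d}. L r)"
   proof -
    have "UNIV = insert c (insert d (- {c, d}))" by auto
    hence "(\<Sum>r\<in>UNIV. L r) = sum L (insert c (insert d (- {c, d})))" by simp
    also have "... = L c + L d + (\<Sum>r\<in>- {c, d}. L r)" using cdy(2) by simp
    finally show ?thesis .
   qed
   moreover have "(\<Sum>r\<in>- {c, d}. L r) = (\<Sum>r\<in>- {c, d}. lam r)" using Lo by (intro sum.cong) auto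
   ultimately show "L d = of_int (int (m + 1)) * (P + Q) - (\<Sum>s\<in>- {c, d}. lam s) - L c" using Lsum by simp
   show "c ~= d" by (rule cdy(2))
   show "card (- {c, d}) >= 3" by (rule card_o)
   show "s0 \<in> - {c, d}" by (rule s0)
   show "L s = lam s" if "s \<in> - {c, d}" for s using that by (rule Lo)
  qed
  have Tpq: "ln (norm (T w0 r * p ^ j * q ^ k)) = L r + real j * P + real k * Q" for r j k
   using lnp[OF T0[OF w, of r] one_neq_zero, of j k] by (simp add: L_def)
  have pd: "r = r' & j = j' & k = k'" if "T w0 r * p ^ j * q ^ k = T w0 r' * p ^ j' * q ^ k'" for r j k r' j' k'
   by (rule RL.poles_distinct) (use arg_cong[OF that, of "%z. ln (norm z)"] in \<open>simp only: Tpq\<close>)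
  have ru: "((r = c & s = y) | (r = y & s = c)) & j = J & k = K" if "T w0 r * T w0 s * p ^ j * q ^ k = 1" for r s j k
   unfolding y by (rule RL.resonance_unique) (use lnp[OF T0[OF w, of r] T0[OF w, of s], of j k] that in \<open>simp add: L_def\<close>)
  interpret PI: pinch p q w0 ta e c y J K
  proof
   show "e c + e y ~= 0" using cdy ab by (auto simp: e_def exch_def doubleton_eq_iff)
   show "monomial_curve ta e w0 c * monomial_curve ta e w0 y * p ^ J * q ^ K = 1" using cdy(4) unfolding T_def .
   show "r = r' & j = j' & k = k'" if "monomial_curve ta e w0 r * p ^ j * q ^ k = monomial_curve ta e w0 r' * p ^ j' * q ^ k'" for r j k r' j' k'
    using that unfolding T_def[symmetric] by (rule pd)
   show "(r = c & s = y | r = y & s = c) & j = J & k = K" if "monomial_curve ta e w0 r * monomial_curve ta e w0 s * p ^ j * q ^ k = 1" for r s j k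
    using that unfolding T_def[symmetric] by (rule ru)
  qed (rule q p tau w)+
  have 1: "eventually (%w. w \<in> N) (at w0)"
   using PI.eventually_nonresonant eventually_at_in_open'[OF op, of w0] w by (auto simp: N_def T_def elim: eventually_elim2)
  define C where "C = 2 * of_real pi * \<i> * (- w0 / of_int (e c + e y)) * (\<Sum>i\<in>PI.pinch_set. PI.H (T w0) i)"
  have lim: "((%w. (w - w0) * beta_integral p q (T w)) \<longlongrightarrow> C) (at w0)"
   using PI.tendsto_beta_integral_pinch unfolding C_def T_def .
  have pre_hol: "(%w. pair_prefactor p q (T w)) holomorphic_on -{0}"
   unfolding pair_prefactor_def by (intro holomorphic_intros T_hol q p)
  have "isCont (%w. pair_prefactor p q (T w)) w0"
   using holomorphic_on_imp_continuous_on[OF pre_hol] w by (auto simp: continuous_on_eq_continuous_at[OF op])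
  hence pre: "((%w. pair_prefactor p q (T w)) \<longlongrightarrow> pair_prefactor p q (T w0)) (at w0)" by (simp add: isCont_def)
  \<comment> \<open>Either the prefactor has a zero at the pair \<open>{c, y}\<close>, or the limit
    \<open>C\<close> of the rescaled integral vanishes.\<close>
  have Z: "pair_prefactor p q (T w0) * C = 0"
  proof (cases ep)
   case True
   have "card {c, y} = 2" using True by (auto simp: ep_def)
   moreover have "qpoch2 (\<Prod>r\<in>{c, y}. T w0 r) p q = 0"
    using cdy(4) True unfolding qpoch2_eq_0_iff[OF q(1) p(1)] by (intro exI[of _ J] exI[of _ K]) (auto simp: ep_def mult_ac)
   ultimately have "\<exists>X\<in>{X::'n set. card X = 2}. qpoch2 (\<Prod>r\<in>X. T w0 r) p q = 0" by blast
   hence "pair_prefactor p q (T w0) = 0" unfolding pair_prefactor_def by (intro prod_zero) auto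
   thus ?thesis by simp
  next
   case False
   hence yc: "y = c" by (simp add: ep_def)
   have lnpow: "ln (norm p powi i) = of_int i * P" "ln (norm q powi i) = of_int i * Q" for i
    unfolding P_def Q_def using p q by (auto simp: powr_real_of_int'[symmetric] ln_powr)
   interpret PD: pinch_diag p q w0 ta e c J K m
   proof (intro pinch_diag.intro pinch_diag_axioms.intro)
    show "pinch p q w0 ta e c c J K" using PI.pinch_axioms unfolding yc .
    show "(\<Prod>r\<in>UNIV. monomial_curve ta e w0 r) = (p * q) ^ (m + 1)" using prodT[OF w] by (simp add: T_def)
    show "i = 0" if "norm p powi i = norm q powi j" for i j
     by (rule RL.pq_independent[of i j]) (use arg_cong[OF that, of ln] in \<open>simp add: lnpow\<close>)
    show "norm (monomial_curve ta e w0 r) ^ 2 ~= norm p powi i * norm q powi j" if "r ~= c" for r i j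
    proof
     assume *: "norm (monomial_curve ta e w0 r) ^ 2 = norm p powi i * norm q powi j"
     have "2 * L r = ln (norm (T w0 r) ^ 2)" using T0[OF w, of r] by (simp add: L_def ln_realpow)
     also have "... = of_int i * P + of_int j * Q" using * p q by (simp add: T_def ln_mult lnpow)
     finally show False using RL.not_pq_power[OF False that] by blast
    qed
   qed (rule card)
   show ?thesis using PD.sum_H_zero by (simp add: C_def yc T_def)
  qed
  have "((%w. pair_prefactor p q (T w) * ((w - w0) * beta_integral p q (T w)) * (qpoch p p * qpoch q q / 2)) \<longlongrightarrow>
   pair_prefactor p q (T w0) * C * (qpoch p p * qpoch q q / 2)) (at w0)"
   by (intro tendsto_mult pre lim tendsto_const)
  from this[unfolded Z mult_zero_left] have "((%w. (w - w0) * beta_value p q (T w)) \<longlongrightarrow> 0) (at w0)"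
   by (simp add: beta_value_def mult_ac)
  with 1 show "eventually (%w. w \<in> N) (at w0) & ((%w. (w - w0) * beta_value p q (T w)) \<longlongrightarrow> 0) (at w0)" by blast
 qed
 thus ?thesis unfolding N_def T_def e_def by auto
qed

section \<open>Fourier series on the torus\<close>

text \<open>Lebesgue measure of the unit interval carried by the whole real line, so that the
  product measure has all functions as its space.\<close>

definition unit_interval_measure :: "real measure" where
 "unit_interval_measure = density lborel (%x. ennreal (indicator {0..1} x))"

definition torus_measure :: "('n::finite => real) measure" where
 "torus_measure = Pi\<^sub>M UNIV (%_. unit_interval_measure)"

definition torus_point :: "('n => real) => complex ^ 'n::finite" where
 "torus_point ph = (\<chi> r. cis (2 * pi * ph r))"

definition utorus :: "(complex ^ 'n::finite) set" where
 "utorus = {z. \<forall>r. norm (z $ r) = 1}"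

definition torus_mean :: "(complex ^ 'n::finite => complex) => complex" where
 "torus_mean f = (\<integral>ph. f (torus_point ph) \<partial>torus_measure)"

definition monomial :: "('n::finite => int) => complex ^ 'n => complex" where
 "monomial kp z = (\<Prod>r\<in>UNIV. z $ r powi kp r)"

definition torus_coeff :: "(complex ^ 'n::finite => complex) => ('n => int) => complex" where
 "torus_coeff f kp = torus_mean (%z. f z * monomial (%r. - kp r) z)"

lemma sets_unit_interval_measure [measurable_cong]: "sets unit_interval_measure = sets borel"
 by (simp add: unit_interval_measure_def)

lemma space_unit_interval_measure [simp]: "space unit_interval_measure = UNIV"
 by (simp add: unit_interval_measure_def)

lemma emeasure_unit_interval_measure:
 "A \<in> sets borel ==> emeasure unit_interval_measure A = emeasure lborel ({0..1} \<inter> A)"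
 unfolding unit_interval_measure_def
 by (subst emeasure_density) (auto simp: nn_integral_indicator[symmetric] indicator_inter_arith ennreal_indicator ennreal_mult simp del: nn_integral_indicator)

lemma finite_unit_interval_measure: "finite_measure unit_interval_measure"
 by (rule finite_measureI) (simp add: emeasure_unit_interval_measure)

lemma product_unit_interval: "product_sigma_finite (%_::'n. unit_interval_measure)"
 unfolding product_sigma_finite_def using finite_unit_interval_measure finite_measure.axioms(1) by blast

lemma integral_unit_interval:
 fixes f :: "real => complex"
 assumes "continuous_on UNIV f"
 shows "integral\<^sup>L unit_interval_measure f = integral {0..1} f"
proof -
 have m: "f \<in> borel_measurable lborel" using borel_measurable_continuous_onI[OF assms] by simp
 have "integral\<^sup>L unit_interval_measure f = (LINT x|lborel. indicator {0..1} x *\<^sub>R f x)"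
  unfolding unit_interval_measure_def by (rule integral_density) (use m in auto)
 also have "... = integral {0..1} f"
  using set_borel_integral_eq_integral(2)[OF borel_integrable_atLeastAtMost'[of 0 1 f]] continuous_on_subset[OF assms]
  unfolding set_lebesgue_integral_def by auto
 finally show ?thesis .
qed

lemma emeasure_torus_box:
 assumes "!!r. X r \<in> sets borel"
 shows "emeasure torus_measure (Pi\<^sub>E UNIV X :: ('n::finite => real) set) = (\<Prod>r\<in>UNIV. emeasure lborel ({0..1} \<inter> X r))"
proof -
 interpret product_sigma_finite "%_::'n. unit_interval_measure" by (rule product_unit_interval)
 have "emeasure torus_measure (Pi\<^sub>E UNIV X) = (\<Prod>r\<in>UNIV. emeasure unit_interval_measure (X r))"
  unfolding torus_measure_def by (rule emeasure_PiM) (use assms sets_unit_interval_measure in auto)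
 thus ?thesis using assms by (simp add: emeasure_unit_interval_measure)
qed

lemma space_torus_measure: "space torus_measure = UNIV"
 by (simp add: torus_measure_def space_PiM)

lemma emeasure_torus_space: "emeasure torus_measure (UNIV :: ('n::finite => real) set) = 1"
 using emeasure_torus_box[of "%_::'n. UNIV"] by simp

lemma finite_torus_measure: "finite_measure (torus_measure :: ('n::finite => real) measure)"
 by (rule finite_measureI) (simp add: space_torus_measure emeasure_torus_space)

lemma torus_point_in [simp]: "torus_point ph \<in> utorus"
 by (simp add: torus_point_def utorus_def)

lemma compact_utorus: "compact (utorus :: (complex ^ 'n::finite) set)"
proof -
 have "closed (utorus :: (complex ^ 'n) set)" unfolding utorus_def
  by (intro closed_Collect_all closed_Collect_eq continuous_intros)
 moreover have "bounded (utorus :: (complex ^ 'n) set)"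
 proof (rule boundedI)
  fix z :: "complex ^ 'n" assume z: "z \<in> utorus"
  have "norm z <= (\<Sum>r\<in>UNIV. norm (z $ r))" unfolding norm_vec_def by (rule L2_set_le_sum) auto
  also have "... = real CARD('n)" using z by (simp add: utorus_def)
  finally show "norm z <= real CARD('n)" .
 qed
 ultimately show ?thesis by (simp add: compact_eq_bounded_closed)
qed

lemma measurable_torus_point: "(torus_point :: ('n::finite => real) => _) \<in> borel_measurable torus_measure"
proof (subst borel_measurable_euclidean_space, rule ballI)
 fix b :: "complex ^ 'n" assume "b \<in> Basis"
 then obtain r u where b: "b = axis r u" by (auto simp: Basis_vec_def)
 have c: "(%ph. ph r) \<in> borel_measurable (torus_measure :: ('n => real) measure)"
  unfolding torus_measure_def by measurable
 have "continuous_on UNIV (%x. cis (2 * pi * x) \<bullet> u)" by (intro continuous_intros)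
 from measurable_compose[OF c borel_measurable_continuous_onI[OF this]]
 show "(%ph. torus_point ph \<bullet> b) \<in> borel_measurable torus_measure"
  by (simp add: b inner_axis torus_point_def)
qed

lemma measurable_torus:
 assumes "continuous_on utorus f"
 shows "(%ph. f (torus_point ph) :: complex) \<in> borel_measurable (torus_measure :: ('n::finite => real) measure)"
proof -
 have "utorus \<in> sets (borel :: (complex ^ 'n) measure)" by (rule borel_compact[OF compact_utorus])
 hence "(%z. if z \<in> utorus then f z else 0) \<in> borel_measurable borel"
  by (intro borel_measurable_continuous_on_if assms continuous_intros) auto
 from measurable_compose[OF measurable_torus_point this] show ?thesis by simp
qed

lemma torus_bounded:
 assumes "continuous_on utorus f"
 obtains C where "!!z. z \<in> utorus ==> norm (f z :: complex) <= C"
 using compact_imp_bounded[OF compact_continuous_image[OF assms compact_utorus]] unfolding bounded_iff by auto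

lemma torus_integrable:
 assumes "continuous_on utorus f"
 shows "integrable (torus_measure :: ('n::finite => real) measure) (%ph. f (torus_point ph) :: complex)"
proof -
 obtain C where "!!z. z \<in> utorus ==> norm (f z) <= C" using torus_bounded[OF assms] by blast
 thus ?thesis using finite_measure.integrable_const_bound[OF finite_torus_measure, of "%ph. f (torus_point ph)" C]
   measurable_torus[OF assms] by auto
qed

lemma torus_mean_add:
 "continuous_on utorus f ==> continuous_on utorus g ==> torus_mean (%z. f z + g z) = torus_mean f + torus_mean g"
 unfolding torus_mean_def by (intro Bochner_Integration.integral_add torus_integrable)

lemma torus_mean_diff:
 "continuous_on utorus f ==> continuous_on utorus g ==> torus_mean (%z. f z - g z) = torus_mean f - torus_mean g"
 unfolding torus_mean_def by (intro Bochner_Integration.integral_diff torus_integrable)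

lemma torus_mean_cmult: "torus_mean (%z. c * f z) = c * torus_mean f"
 unfolding torus_mean_def by simp

lemma torus_mean_sum:
 "(!!i. i \<in> I ==> continuous_on utorus (f i)) ==> torus_mean (%z. \<Sum>i\<in>I. f i z) = (\<Sum>i\<in>I. torus_mean (f i))"
 unfolding torus_mean_def by (intro Bochner_Integration.integral_sum torus_integrable)

lemma torus_mean_cong: "(!!z. z \<in> utorus ==> f z = g z) ==> torus_mean f = torus_mean g"
 unfolding torus_mean_def by (intro Bochner_Integration.integral_cong) auto

lemma norm_torus_mean_le:
 fixes f :: "complex ^ 'n::finite => complex"
 assumes "continuous_on utorus f" "!!z. z \<in> utorus ==> norm (f z) <= C"
 shows "norm (torus_mean f) <= C"
proof -
 have "norm (torus_mean f) <= (\<integral>ph. norm (f (torus_point ph)) \<partial>(torus_measure :: ('n => real) measure))"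
  unfolding torus_mean_def by (rule integral_norm_bound)
 also have "... <= (\<integral>ph. C \<partial>(torus_measure :: ('n => real) measure))"
  using finite_measure.integrable_const[OF finite_torus_measure] torus_integrable[OF assms(1)] assms(2)
  by (intro integral_mono) auto
 also have "... = C" by (simp add: measure_def space_torus_measure emeasure_torus_space)
 finally show ?thesis .
qed

lemma torus_nonzero: "z \<in> utorus ==> z $ r ~= 0"
 by (metis (mono_tags, lifting) mem_Collect_eq norm_zero utorus_def zero_neq_one)

lemma continuous_on_monomial [continuous_intros]: "continuous_on utorus (monomial kp)"
 unfolding monomial_def[abs_def] by (intro continuous_intros) (auto simp: torus_nonzero)

lemma norm_monomial_torus: "z \<in> utorus ==> norm (monomial kp z) = 1"
 by (simp add: monomial_def utorus_def norm_power_int flip: prod_norm)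

lemma monomial_mult: "(!!r. z $ r ~= 0) ==> monomial kp z * monomial kp' z = monomial (%r. kp r + kp' r) z"
 by (simp add: monomial_def power_int_add flip: prod.distrib)

lemma integral_cis: "integral {0..1} (%y. cis (2 * pi * y) powi k) = (if k = 0 then 1 else 0)"
proof (cases "k = 0")
 case False
 define c where "c = 2 * of_real pi * \<i> * of_int k"
 have c: "c ~= 0" using False by (simp add: c_def)
 have e: "cis (2 * pi * y) powi k = exp (c * of_real y)" for y
  by (simp add: cis_conv_exp c_def exp_of_real exp_power_int mult_ac)
 have "((%y. exp (c * of_real y)) has_integral (exp (c * of_real 1) / c - exp (c * of_real 0) / c)) {0..1}"
 proof (rule fundamental_theorem_of_calculus)
  fix x :: real
  have "((%z. exp (c * z) / c) has_field_derivative exp (c * of_real x)) (at (of_real x))"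
   using c by (auto intro!: derivative_eq_intros)
  from has_vector_derivative_real_field[OF this]
  show "((%y. exp (c * of_real y) / c) has_vector_derivative exp (c * of_real x)) (at x within {0..1})"
   by (rule has_vector_derivative_at_within)
 qed auto
 moreover have "exp c = 1" using exp_integer_2pi[of "of_int k"] by (simp add: c_def mult_ac)
 ultimately show ?thesis using False by (simp add: e integral_unique)
qed auto

lemma torus_mean_monomial: "torus_mean (monomial kp) = (if \<forall>r. kp r = 0 then 1 else 0)"
proof -
 interpret product_sigma_finite "%_::'a. unit_interval_measure" by (rule product_unit_interval)
 have c: "continuous_on UNIV (%y. cis (2 * pi * y) powi k)" for k by (intro continuous_intros) auto
 have i: "integrable unit_interval_measure (%y. cis (2 * pi * y) powi k)" for k
 proof (rule finite_measure.integrable_const_bound[OF finite_unit_interval_measure, of _ 1])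
  show "(%y. cis (2 * pi * y) powi k) \<in> borel_measurable unit_interval_measure"
   using borel_measurable_continuous_onI[OF c] by (simp add: measurable_cong_sets[OF sets_unit_interval_measure refl])
 qed (simp add: norm_power_int)
 have "torus_mean (monomial kp) = (\<integral>ph. (\<Prod>r\<in>UNIV. cis (2 * pi * ph r) powi kp r) \<partial>Pi\<^sub>M UNIV (%_. unit_interval_measure))"
  by (simp add: torus_mean_def torus_measure_def monomial_def torus_point_def)
 also have "... = (\<Prod>r\<in>UNIV. integral\<^sup>L unit_interval_measure (%y. cis (2 * pi * y) powi kp r))"
  by (rule product_integral_prod) (use i in auto)
 also have "... = (\<Prod>r\<in>UNIV. if kp r = 0 then 1 else 0)" by (simp add: integral_unit_interval[OF c] integral_cis)
 also have "... = (if \<forall>r. kp r = 0 then 1 else 0)" by (auto intro: prod.neutral)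
 finally show ?thesis .
qed

text \<open>All Fourier coefficients vanish. Quantifying over all monomials makes the class stable
  under multiplication by Laurent monomials.\<close>

definition torus_null :: "(complex ^ 'n::finite => complex) => bool" where
 "torus_null u \<longleftrightarrow> continuous_on utorus u & (\<forall>kp. torus_mean (%z. u z * monomial kp z) = 0)"

lemma torus_null_mult_coordinate:
 assumes u: "torus_null u"
 shows "torus_null (%z. u z * (z $ r) powi k)"
proof -
 have c: "continuous_on utorus (%z. u z * (z $ r) powi k)"
  using u unfolding torus_null_def by (intro continuous_intros) (auto simp: torus_nonzero)
 have "torus_mean (%z. u z * (z $ r) powi k * monomial kp z) = 0" for kp
 proof -
  have "torus_mean (%z. u z * (z $ r) powi k * monomial kp z) = torus_mean (%z. u z * monomial (%s. (if s = r then k else 0) + kp s) z)"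
  proof (rule torus_mean_cong)
   fix z :: "complex ^ 'a" assume z: "z \<in> utorus"
   have "monomial (%s. if s = r then k else 0) z = (z $ r) powi k"
    unfolding monomial_def by (simp add: if_distrib[of "%x. _ powi x"] prod.delta cong: if_cong)
   thus "u z * (z $ r) powi k * monomial kp z = u z * monomial (%s. (if s = r then k else 0) + kp s) z"
    using monomial_mult[OF torus_nonzero[OF z], of "%s. if s = r then k else 0" kp] by (simp add: mult_ac)
  qed
  thus ?thesis using u by (simp add: torus_null_def)
 qed
 with c show ?thesis by (simp add: torus_null_def)
qed

lemma torus_null_add: "torus_null u ==> torus_null v ==> torus_null (%z. u z + v z)"
 unfolding torus_null_def by (auto simp: distrib_right torus_mean_add continuous_intros)

lemma torus_null_cmult: "torus_null u ==> torus_null (%z. c * u z)"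
 unfolding torus_null_def by (auto simp: mult.assoc torus_mean_cmult continuous_intros)

lemma torus_null_sum:
 "finite I ==> (!!i. i \<in> I ==> torus_null (f i)) ==> torus_null (%z. \<Sum>i\<in>I. f i z)"
proof (induction I rule: finite_induct)
 case empty
 show ?case using torus_mean_cmult[of 0] by (simp add: torus_null_def)
next
 case (insert i I)
 thus ?case by (simp add: torus_null_add)
qed

lemma torus_null_cong: "torus_null u ==> (!!z. z \<in> utorus ==> u z = v z) ==> torus_null v"
 unfolding torus_null_def by (metis (no_types, lifting) continuous_on_cong torus_mean_cong)

text \<open>On the torus the conjugate of a coordinate is its inverse, so real-linear functions are
  combinations of the coordinates and their inverses.\<close>

lemma torus_null_polynomial:
 fixes f :: "complex ^ 'n::finite => real"
 assumes "real_polynomial_function f" "torus_null u"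
 shows "torus_null (%z. u z * of_real (f z))"
 using assms
proof (induction arbitrary: u rule: real_polynomial_function.induct)
 case (linear f)
 interpret bounded_linear f by (rule linear)
 define a where "a = (%r. f (axis r 1))"
 define b where "b = (%r. f (axis r \<i>))"
 have fz: "f z = (\<Sum>r\<in>UNIV. Re (z $ r) * a r + Im (z $ r) * b r)" for z
 proof -
  have "z = (\<Sum>r\<in>UNIV. Re (z $ r) *\<^sub>R axis r 1 + Im (z $ r) *\<^sub>R axis r \<i>)"
   by (simp add: vec_eq_iff axis_def if_distrib sum.delta complex_eq_iff Re_sum Im_sum cong: if_cong)
  hence "f z = f (\<Sum>r\<in>UNIV. Re (z $ r) *\<^sub>R axis r 1 + Im (z $ r) *\<^sub>R axis r \<i>)" by simp
  thus ?thesis by (simp add: sum add scaleR a_def b_def)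
 qed
 have "torus_null (%z. \<Sum>r\<in>UNIV. ((of_real (a r) / 2 + of_real (b r) / (2 * \<i>)) * (u z * (z $ r) powi 1)
   + (of_real (a r) / 2 - of_real (b r) / (2 * \<i>)) * (u z * (z $ r) powi (- 1))))"
  by (intro torus_null_sum torus_null_add torus_null_cmult torus_null_mult_coordinate linear.prems) auto
 thus ?case
 proof (rule torus_null_cong)
  fix z :: "complex ^ 'n" assume z: "z \<in> utorus"
  have zi: "(z $ r) powi (- 1) = cnj (z $ r)" for r
  proof -
   have "z $ r * cnj (z $ r) = 1" using z complex_norm_square[of "z $ r"] by (simp add: utorus_def)
   thus ?thesis by (simp add: power_int_minus inverse_unique)
  qed
  have re: "(A / 2 + B / (2 * \<i>)) * (U * x) + (A / 2 - B / (2 * \<i>)) * (U * cnj x) = U * (of_real (Re x) * A + of_real (Im x) * B)" for A B U x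
   by (simp add: complex_eq_iff field_simps)
  show "(\<Sum>r\<in>UNIV. ((of_real (a r) / 2 + of_real (b r) / (2 * \<i>)) * (u z * (z $ r) powi 1)
   + (of_real (a r) / 2 - of_real (b r) / (2 * \<i>)) * (u z * (z $ r) powi (- 1)))) = u z * of_real (f z)"
   unfolding zi power_int_1_right re fz of_real_sum sum_distrib_left by simp
 qed
next
 case (const c)
 have "(%z. u z * of_real c) = (%z. of_real c * u z)" by (auto simp: mult.commute)
 thus ?case using torus_null_cmult[OF const, of "of_real c"] by simp
next
 case (add f g)
 show ?case using torus_null_add[OF add.IH(1)[OF add.prems] add.IH(2)[OF add.prems]] by (simp add: distrib_left)
next
 case (mult f g)
 show ?case using mult.IH(2)[OF mult.IH(1)[OF mult.prems]] by (simp add: mult.assoc)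
qed

text \<open>By Stone-Weierstrass the conjugate of \<open>u\<close> is a uniform limit of
  polynomials, against all of which \<open>u\<close> has mean 0. Hence the mean of |u|^2 is 0, and
  continuity forces \<open>u\<close> to vanish.\<close>

lemma torus_null_imp_zero:
 fixes u :: "complex ^ 'n::finite => complex"
 assumes u: "torus_null u" and z0: "z0 \<in> utorus"
 shows "u z0 = 0"
proof (rule ccontr)
 assume nz: "u z0 ~= 0"
 have cu: "continuous_on utorus u" using u by (simp add: torus_null_def)
 obtain C0 where C0: "!!z. z \<in> utorus ==> norm (u z) <= C0" using torus_bounded[OF cu] by blast
 define C where "C = max C0 1"
 have C: "C > 0" "!!z. z \<in> utorus ==> norm (u z) <= C" using C0 by (auto simp: C_def intro: max.coboundedI1)
 have mean0: "torus_mean (%z. u z * cnj (u z)) = 0"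
 proof (rule ccontr)
  assume "torus_mean (%z. u z * cnj (u z)) ~= 0"
  define e where "e = norm (torus_mean (%z. u z * cnj (u z))) / (2 * C)"
  have e: "e > 0" using \<open>torus_mean _ ~= 0\<close> C by (simp add: e_def)
  have cc: "continuous_on utorus (%z. cnj (u z))" by (intro continuous_intros cu)
  obtain P where P: "polynomial_function P" "!!z. z \<in> utorus ==> norm (cnj (u z) - P z) < e"
   using Stone_Weierstrass_polynomial_function[OF compact_utorus cc e] by blast
  have "real_polynomial_function (%z. Re (P z))" "real_polynomial_function (%z. Im (P z))"
   using P(1) bounded_linear_Re bounded_linear_Im unfolding polynomial_function_def o_def by blast+
  hence "torus_null (%z. u z * of_real (Re (P z)) + \<i> * (u z * of_real (Im (P z))))"
   by (intro torus_null_add torus_null_cmult torus_null_polynomial u)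
  hence "torus_null (%z. u z * P z)"
   by (rule torus_null_cong) (simp add: complex_eq_iff)
  hence P0: "torus_mean (%z. u z * P z * monomial (%_. 0) z) = 0" "continuous_on utorus (%z. u z * P z)"
   unfolding torus_null_def by blast+
  have "monomial (%_. 0) z = 1" for z :: "complex ^ 'n" by (simp add: monomial_def)
  hence "torus_mean (%z. u z * cnj (u z)) = torus_mean (%z. u z * cnj (u z)) - torus_mean (%z. u z * P z)" using P0(1) by simp
  also have "... = torus_mean (%z. u z * cnj (u z) - u z * P z)"
   by (intro torus_mean_diff[symmetric] P0 continuous_intros cu)
  finally have "norm (torus_mean (%z. u z * cnj (u z))) = norm (torus_mean (%z. u z * cnj (u z) - u z * P z))" by simp
  also have "... <= C * e"
  proof (rule norm_torus_mean_le)
   show "continuous_on utorus (%z. u z * cnj (u z) - u z * P z)" by (intro continuous_intros P0 cu)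
   fix z :: "complex ^ 'n" assume z: "z \<in> utorus"
   have "norm (u z * cnj (u z) - u z * P z) = norm (u z) * norm (cnj (u z) - P z)"
    by (simp add: norm_mult flip: right_diff_distrib)
   also have "... <= C * e" using C P(2)[OF z] z by (intro mult_mono) (auto intro: less_imp_le)
   finally show "norm (u z * cnj (u z) - u z * P z) <= C * e" .
  qed
  also have "... = norm (torus_mean (%z. u z * cnj (u z))) / 2" using C by (simp add: e_def)
  finally show False using \<open>torus_mean _ ~= 0\<close> by simp
 qed
 define h where "h = (%z. (norm (u z))^2)"
 have hu: "u z * cnj (u z) = of_real (h z)" for z unfolding h_def by (rule complex_norm_square[symmetric])
 have ih: "integrable (torus_measure :: ('n => real) measure) (%ph. h (torus_point ph))"
 proof -
  have "integrable (torus_measure :: ('n => real) measure) (%ph. Re (u (torus_point ph) * cnj (u (torus_point ph))))"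
   by (intro integrable_Re torus_integrable[of "%z. u z * cnj (u z)"] continuous_intros cu)
  thus ?thesis by (simp add: hu)
 qed
 have int0: "(\<integral>ph. h (torus_point ph) \<partial>(torus_measure :: ('n => real) measure)) = 0"
  using mean0 unfolding torus_mean_def hu by simp
 obtain ph0 where p0: "z0 = torus_point ph0" "!!r. ph0 r \<in> {0..1}"
 proof -
  have "\<exists>x\<in>{0..1}. z0 $ r = cis (2 * pi * x)" for r
  proof -
   have "z0 $ r = cis (Arg2pi (z0 $ r))"
    using Arg2pi_eq[of "z0 $ r"] z0 by (simp add: utorus_def cis_conv_exp mult.commute)
   moreover have "Arg2pi (z0 $ r) / (2 * pi) \<in> {0..1}" using Arg2pi[of "z0 $ r"] by (auto simp: field_simps)
   ultimately show ?thesis by (intro bexI[of _ "Arg2pi (z0 $ r) / (2 * pi)"]) auto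
  qed
  then obtain f where "!!r. f r \<in> {0..1} & z0 $ r = cis (2 * pi * f r)" by metis
  thus thesis using that[of f] by (simp add: torus_point_def vec_eq_iff)
 qed
 define k where "k = (%v :: real ^ 'n. h (\<chi> r. cis (2 * pi * v $ r)))"
 have c1: "continuous_on UNIV (%v::real^'n. \<chi> r. cis (2 * pi * v $ r))"
  by (intro continuous_on_vec_lambda continuous_intros)
 have c2: "continuous_on UNIV (%v::real^'n. u (\<chi> r. cis (2 * pi * v $ r)))"
  by (rule continuous_on_compose2[OF cu c1]) (auto simp: utorus_def)
 have "continuous_on UNIV k" unfolding k_def h_def by (intro continuous_intros c2)
 hence "isCont k (\<chi> r. ph0 r)" by (simp add: continuous_on_eq_continuous_at)
 moreover have k0: "k (\<chi> r. ph0 r) > 0" using nz p0(1) by (simp add: k_def h_def torus_point_def)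
 ultimately obtain \<delta> where \<delta>: "\<delta> > 0" "!!v. dist v (\<chi> r. ph0 r) < \<delta> ==> dist (k v) (k (\<chi> r. ph0 r)) < k (\<chi> r. ph0 r) / 2"
  unfolding continuous_at_eps_delta by (metis half_gt_zero)
 define \<eta> where "\<eta> = \<delta> / (real CARD('n) + 1)"
 have \<eta>: "\<eta> > 0" using \<delta> by (simp add: \<eta>_def)
 define B where "B = Pi\<^sub>E UNIV (%r. {ph0 r - \<eta><..<ph0 r + \<eta>})"
 have hB: "h (torus_point ph) >= k (\<chi> r. ph0 r) / 2" if "ph \<in> B" for ph
 proof -
  have "dist (\<chi> r. ph r) (\<chi> r. ph0 r) <= (\<Sum>r\<in>UNIV. \<bar>ph r - ph0 r\<bar>)"
   unfolding dist_norm using norm_le_l1_cart[of "(\<chi> r. ph r) - (\<chi> r. ph0 r)"] by simp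
  also have "... <= (\<Sum>r\<in>(UNIV::'n set). \<eta>)"
   using that by (intro sum_mono) (auto simp: B_def PiE_iff abs_le_iff, (metis add.commute diff_le_eq greaterThanLessThan_iff less_imp_le, metis diff_le_eq add.commute greaterThanLessThan_iff less_imp_le le_diff_eq)?)
  also have "... < \<delta>" using \<delta> by (simp add: \<eta>_def field_simps)
  finally have "dist (k (\<chi> r. ph r)) (k (\<chi> r. ph0 r)) < k (\<chi> r. ph0 r) / 2" by (rule \<delta>(2))
  hence "k (\<chi> r. ph r) >= k (\<chi> r. ph0 r) / 2" unfolding dist_real_def by linarith
  thus ?thesis by (simp add: k_def torus_point_def)
 qed
 have Bs: "B \<in> sets torus_measure" unfolding B_def torus_measure_def
  by (intro sets_PiM_I_finite) (auto simp: sets_unit_interval_measure)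
 have "emeasure torus_measure B = (\<Prod>r\<in>UNIV. emeasure lborel ({0..1} \<inter> {ph0 r - \<eta><..<ph0 r + \<eta>}))"
  unfolding B_def by (rule emeasure_torus_box) auto
 also have "... ~= 0"
 proof -
  have "emeasure lborel ({0..1} \<inter> {ph0 r - \<eta><..<ph0 r + \<eta>}) ~= 0" for r
  proof -
   \<comment> \<open>\<open>ph0 r\<close> may be an end point of the unit interval; the side of the
     box cut to the interval still has positive length.\<close>
   define l where "l = max 0 (ph0 r - \<eta>)"
   define u' where "u' = min 1 (ph0 r + \<eta>)"
   have "l < u'" using p0(2)[of r] \<eta> by (auto simp: l_def u'_def)
   hence "emeasure lborel {l<..<u'} > 0" by simp
   also have "emeasure lborel {l<..<u'} <= emeasure lborel ({0..1} \<inter> {ph0 r - \<eta><..<ph0 r + \<eta>})"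
    by (rule emeasure_mono) (auto simp: l_def u'_def)
   finally show ?thesis by simp
  qed
  hence "(\<Prod>r\<in>A. emeasure lborel ({0..1} \<inter> {ph0 r - \<eta><..<ph0 r + \<eta>})) ~= 0" for A
   by (induction A rule: infinite_finite_induct) auto
  thus ?thesis .
 qed
 finally have "measure torus_measure B > 0"
  using finite_measure.emeasure_eq_measure[OF finite_torus_measure, of B] by (simp add: zero_less_measure_iff)
 hence "0 < k (\<chi> r. ph0 r) / 2 * measure torus_measure B" using k0 by simp
 also have "... = (\<integral>ph. k (\<chi> r. ph0 r) / 2 * indicator B ph \<partial>torus_measure)" using Bs by simp
 also have "... <= (\<integral>ph. h (torus_point ph) \<partial>torus_measure)"
 proof (rule integral_mono[OF _ ih])
  show "integrable torus_measure (%ph. k (\<chi> r. ph0 r) / 2 * indicator B ph)"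
   using Bs finite_measure.emeasure_finite[OF finite_torus_measure, of B] by (intro integrable_mult_right integrable_real_indicator) (auto simp: less_top)
  show "k (\<chi> r. ph0 r) / 2 * indicator B ph <= h (torus_point ph)" for ph
   using hB[of ph] by (cases "ph \<in> B") (auto simp: h_def)
 qed
 finally show False using int0 by simp
qed

lemma norm_torus_coeff_le:
 fixes f :: "complex ^ 'n::finite => complex"
 assumes "continuous_on utorus f" "!!z. z \<in> utorus ==> norm (f z) <= C"
 shows "norm (torus_coeff f kp) <= C"
 unfolding torus_coeff_def
 by (rule norm_torus_mean_le) (use assms in \<open>auto simp: norm_mult norm_monomial_torus intro!: continuous_intros\<close>)

lemma torus_coeff_diff:
 fixes f :: "complex ^ 'n::finite => complex"
 assumes "continuous_on utorus f" "continuous_on utorus g"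
 shows "torus_coeff (%z. f z - g z) kp = torus_coeff f kp - torus_coeff g kp"
 unfolding torus_coeff_def left_diff_distrib by (intro torus_mean_diff continuous_intros assms)

lemma torus_coeff_monomial:
 "torus_coeff (%z. c * monomial kp z) kp' = (if kp = kp' then c else 0)"
proof -
 have "torus_coeff (%z. c * monomial kp z) kp' = torus_mean (%z. c * monomial (%r. kp r + - kp' r) z)"
  unfolding torus_coeff_def
 proof (rule torus_mean_cong)
  fix z :: "complex ^ 'a" assume z: "z \<in> utorus"
  show "c * monomial kp z * monomial (%r. - kp' r) z = c * monomial (%r. kp r + - kp' r) z"
   unfolding mult.assoc monomial_mult[OF torus_nonzero[OF z]] ..
 qed
 also have "... = c * (if \<forall>r. kp r + - kp' r = 0 then 1 else 0)" unfolding torus_mean_cmult torus_mean_monomial ..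
 also have "(\<forall>r. kp r + - kp' r = 0) \<longleftrightarrow> kp = kp'" by (auto simp: fun_eq_iff)
 finally show ?thesis by simp
qed

lemma torus_series:
 fixes a :: "('n::finite => int) => complex"
 assumes a: "(%kp. norm (a kp)) summable_on UNIV"
 shows "continuous_on utorus (%z. \<Sum>\<^sub>\<infinity>kp. a kp * monomial kp z)"
  "torus_coeff (%z. \<Sum>\<^sub>\<infinity>kp. a kp * monomial kp z) kp = a kp"
proof -
 have ul: "uniform_limit utorus (%X z. \<Sum>kp\<in>X. a kp * monomial kp z) (%z. \<Sum>\<^sub>\<infinity>kp. a kp * monomial kp z) (finite_subsets_at_top UNIV)"
  by (rule Weierstrass_m_test_general[OF _ a]) (simp add: norm_mult norm_monomial_torus)
 have cont: "continuous_on utorus (%z. \<Sum>kp\<in>X. a kp * monomial kp z)" for X by (intro continuous_intros)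
 show c: "continuous_on utorus (%z. \<Sum>\<^sub>\<infinity>kp. a kp * monomial kp z)"
  by (rule uniform_limit_theorem[OF always_eventually ul]) (use cont in auto)
 have "norm (torus_coeff (%z. \<Sum>\<^sub>\<infinity>kp. a kp * monomial kp z) kp - a kp) <= e" if e: "e > 0" for e
 proof -
  have "eventually (%X. \<forall>z\<in>utorus. dist (\<Sum>kp\<in>X. a kp * monomial kp z) (\<Sum>\<^sub>\<infinity>kp. a kp * monomial kp z) < e) (finite_subsets_at_top UNIV)"
   using ul e by (simp add: uniform_limit_iff)
  moreover have "eventually (%X. finite X & {kp} \<subseteq> X) (finite_subsets_at_top UNIV)"
   unfolding eventually_finite_subsets_at_top by (rule exI[of _ "{kp}"]) auto
  ultimately have "eventually (%X. (\<forall>z\<in>utorus. dist (\<Sum>kp\<in>X. a kp * monomial kp z) (\<Sum>\<^sub>\<infinity>kp. a kp * monomial kp z) < e)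
   & finite X & {kp} \<subseteq> X) (finite_subsets_at_top UNIV)" by (rule eventually_conj)
  from eventually_happens[OF this] obtain X where
   "(\<forall>z\<in>utorus. dist (\<Sum>kp\<in>X. a kp * monomial kp z) (\<Sum>\<^sub>\<infinity>kp. a kp * monomial kp z) < e) & finite X & {kp} \<subseteq> X"
   by (auto simp: finite_subsets_at_top_neq_bot)
  hence X: "!!z. z \<in> utorus ==> dist (\<Sum>kp\<in>X. a kp * monomial kp z) (\<Sum>\<^sub>\<infinity>kp. a kp * monomial kp z) < e"
   "finite X" "kp \<in> X" by simp_all
  have "torus_coeff (%z. \<Sum>kp\<in>X. a kp * monomial kp z) kp = (\<Sum>kp'\<in>X. torus_coeff (%z. a kp' * monomial kp' z) kp)"
   unfolding torus_coeff_def sum_distrib_right by (intro torus_mean_sum continuous_intros)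
  also have "... = a kp" using X(2,3) by (simp add: torus_coeff_monomial sum.delta)
  finally have "torus_coeff (%z. \<Sum>\<^sub>\<infinity>kp. a kp * monomial kp z) kp - a kp
   = torus_coeff (%z. (\<Sum>\<^sub>\<infinity>kp. a kp * monomial kp z) - (\<Sum>kp\<in>X. a kp * monomial kp z)) kp"
   using torus_coeff_diff[OF c cont] by simp
  also have "norm ... <= e"
  proof (rule norm_torus_coeff_le)
   fix z :: "complex ^ 'n" assume "z \<in> utorus"
   from X(1)[OF this] show "norm ((\<Sum>\<^sub>\<infinity>kp. a kp * monomial kp z) - (\<Sum>kp\<in>X. a kp * monomial kp z)) <= e"
    by (simp only: dist_norm norm_minus_commute[of "\<Sum>\<^sub>\<infinity>kp. a kp * monomial kp z"])
  qed (rule continuous_on_diff[OF c cont])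
  finally show ?thesis .
 qed
 hence "norm (torus_coeff (%z. \<Sum>\<^sub>\<infinity>kp. a kp * monomial kp z) kp - a kp) <= 0"
  by (rule field_le_epsilon) simp
 thus "torus_coeff (%z. \<Sum>\<^sub>\<infinity>kp. a kp * monomial kp z) kp = a kp" by simp
qed

text \<open>Both sides are continuous with the same coefficients, so their difference is
  \<open>torus_null\<close>.\<close>

lemma torus_inversion:
 fixes f :: "complex ^ 'n::finite => complex"
 assumes f: "continuous_on utorus f" and s: "(%kp. norm (torus_coeff f kp)) summable_on UNIV" and z: "z \<in> utorus"
 shows "f z = (\<Sum>\<^sub>\<infinity>kp. torus_coeff f kp * monomial kp z)"
proof -
 define g where "g = (%z. \<Sum>\<^sub>\<infinity>kp. torus_coeff f kp * monomial kp z)"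
 have g: "continuous_on utorus g" "!!kp. torus_coeff g kp = torus_coeff f kp"
  using torus_series[OF s] by (auto simp: g_def)
 have "torus_null (%z. f z - g z)" unfolding torus_null_def
 proof (intro conjI allI continuous_intros f g)
  fix kp :: "'n => int"
  have "torus_coeff (%z. f z - g z) (%r. - kp r) = 0" using torus_coeff_diff[OF f g(1)] g(2) by simp
  thus "torus_mean (%z. (f z - g z) * monomial kp z) = 0" by (simp add: torus_coeff_def)
 qed
 from torus_null_imp_zero[OF this z] show ?thesis by (simp add: g_def)
qed

definition update_coord :: "complex ^ 'n::finite => 'n => complex => complex ^ 'n" where
 "update_coord z r zt = (\<chi> s. if s = r then zt else z $ s)"

lemma circle_mean_eq_contour_integral:
 assumes ro: "ro > 0"
 shows "integral {0..1} (%y. g (of_real ro * cis (2 * pi * y)) * cis (2 * pi * y) powi (- k)) * of_real ro powi (- k)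
  = contour_integral (circlepath 0 ro) (%w. g w * w powi (- k - 1) / (2 * of_real pi * \<i>))"
proof -
 have e: "exp (2 * of_real pi * \<i> * of_real y) = cis (2 * pi * y)" for y
  by (simp add: cis_conv_exp mult_ac)
 have "contour_integral (circlepath 0 ro) (%w. g w * w powi (- k - 1) / (2 * of_real pi * \<i>)) =
  integral {0..1} (%y. g (of_real ro * cis (2 * pi * y)) * cis (2 * pi * y) powi (- k) * of_real ro powi (- k))"
  unfolding contour_integral_integral
 proof (rule integral_cong)
  fix y :: real
  define w where "w = of_real ro * cis (2 * pi * y)"
  have w: "w ~= 0" using ro by (simp add: w_def)
  have c: "circlepath 0 ro y = w" by (simp add: circlepath w_def e)
  have v: "vector_derivative (circlepath 0 ro) (at y) = 2 * of_real pi * \<i> * w"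
   unfolding vector_derivative_circlepath e w_def by simp
  have "w powi (- k - 1) * w = w powi (- k)" using w by (simp add: power_int_diff)
  hence "g w * w powi (- k - 1) / (2 * of_real pi * \<i>) * (2 * of_real pi * \<i> * w) = g w * w powi (- k)"
   by (simp add: mult_ac)
  also have "w powi (- k) = cis (2 * pi * y) powi (- k) * of_real ro powi (- k)"
   by (simp add: w_def power_int_mult_distrib)
  finally show "g (circlepath 0 ro y) * circlepath 0 ro y powi (- k - 1) / (2 * of_real pi * \<i>) * vector_derivative (circlepath 0 ro) (at y)
   = g (of_real ro * cis (2 * pi * y)) * cis (2 * pi * y) powi (- k) * of_real ro powi (- k)"
   unfolding c v by (simp add: w_def mult_ac)
 qed
 thus ?thesis by simp
qed

text \<open>Cauchy's theorem in the punctured plane, obtained as the case of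
  \<open>separates_integral_eq\<close> with \<open>p = q = 0\<close> and zero parameters, in which 0
  is the only excluded point.\<close>

lemma circle_mean_move_radius:
 assumes g: "g holomorphic_on (-{0})" and r: "ro > 0" "R > 0"
 shows "integral {0..1} (%y. g (of_real ro * cis (2 * pi * y)) * cis (2 * pi * y) powi (- k)) * of_real ro powi (- k)
  = integral {0..1} (%y. g (of_real R * cis (2 * pi * y)) * cis (2 * pi * y) powi (- k)) * of_real R powi (- k)"
 unfolding circle_mean_eq_contour_integral[OF r(1)] circle_mean_eq_contour_integral[OF r(2)]
proof (rule separates_integral_eq[where p = 0 and q = 0 and a = "%_::unit. 0" and b = "%_::unit. 0"])
 have "pole_free 0 0 (%_::unit. 0) (%_. 0) = -{0}" by (auto simp: pole_free_def)
 moreover have "(%w. g w * w powi (- k - 1) / (2 * of_real pi * \<i>)) holomorphic_on -{0}"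
  by (intro holomorphic_intros g) auto
 ultimately show "(%w. g w * w powi (- k - 1) / (2 * of_real pi * \<i>)) holomorphic_on pole_free 0 0 (%_::unit. 0) (%_. 0)" by simp
qed (auto intro!: separates_circle r)

text \<open>Fubini isolates the coordinate \<open>r\<close>, in which the two functions are the
  values of one holomorphic \<open>g\<close> on the circles of radius \<open>ro\<close> and
  \<open>R\<close>.\<close>

lemma torus_coeff_move_radius:
 fixes f1 f2 :: "complex ^ 'n::finite => complex"
 assumes f: "continuous_on utorus f1" "continuous_on utorus f2" and r: "ro > 0" "R > 0"
  and hol: "!!z. z \<in> utorus ==> \<exists>g. g holomorphic_on (-{0}) &
   (\<forall>zt. norm zt = 1 --> f1 (update_coord z r zt) = g (of_real ro * zt) & f2 (update_coord z r zt) = g (of_real R * zt))"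
 shows "torus_coeff f1 kp * of_real ro powi (- kp r) = torus_coeff f2 kp * of_real R powi (- kp r)"
proof -
 interpret product_sigma_finite "%_::'n. unit_interval_measure" by (rule product_unit_interval)
 define I where "I = UNIV - {r}"
 have I: "finite I" "r ~: I" "insert r I = UNIV" by (auto simp: I_def)
 have split: "torus_mean F = (\<integral>ph. (\<integral>y. F (torus_point (ph(r := y))) \<partial>unit_interval_measure) \<partial>Pi\<^sub>M I (%_. unit_interval_measure))"
  if "continuous_on utorus F" for F
  using product_integral_insert[OF I(1,2), of "%ph. F (torus_point ph)"] torus_integrable[OF that]
  unfolding torus_mean_def torus_measure_def I(3) by simp
 have in_eq: "(\<integral>y. f1 (torus_point (ph(r := y))) * monomial (%s. - kp s) (torus_point (ph(r := y))) \<partial>unit_interval_measure) * of_real ro powi (- kp r)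
  = (\<integral>y. f2 (torus_point (ph(r := y))) * monomial (%s. - kp s) (torus_point (ph(r := y))) \<partial>unit_interval_measure) * of_real R powi (- kp r)" for ph
 proof -
  define C where "C = (\<Prod>s\<in>I. cis (2 * pi * ph s) powi (- kp s))"
  have pt: "torus_point (ph(r := y)) = update_coord (torus_point ph) r (cis (2 * pi * y))" for y
   by (auto simp: torus_point_def update_coord_def vec_eq_iff)
  have mono: "monomial (%s. - kp s) (torus_point (ph(r := y))) = cis (2 * pi * y) powi (- kp r) * C" for y
   unfolding monomial_def I(3)[symmetric] prod.insert[OF I(1,2)] C_def
   by (auto simp: torus_point_def I_def intro!: arg_cong2[of _ _ _ _ "(*)"] prod.cong)
  obtain g where g: "g holomorphic_on (-{0})"
   "!!zt. norm zt = 1 ==> f1 (update_coord (torus_point ph) r zt) = g (of_real ro * zt)"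
   "!!zt. norm zt = 1 ==> f2 (update_coord (torus_point ph) r zt) = g (of_real R * zt)"
   using hol[OF torus_point_in, of ph] by metis
  have cg: "continuous_on UNIV (%y. C * (g (of_real s * cis (2 * pi * y)) * cis (2 * pi * y) powi (- kp r)))" if "s > 0" for s
  proof (intro continuous_intros)
   show "continuous_on UNIV (%y. g (of_real s * cis (2 * pi * y)))"
    by (rule continuous_on_compose2[OF holomorphic_on_imp_continuous_on[OF g(1)]]) (use that in \<open>auto intro!: continuous_intros\<close>)
  qed auto
  have i: "(\<integral>y. C * (g (of_real s * cis (2 * pi * y)) * cis (2 * pi * y) powi (- kp r)) \<partial>unit_interval_measure) =
   C * integral {0..1} (%y. g (of_real s * cis (2 * pi * y)) * cis (2 * pi * y) powi (- kp r))" if "s > 0" for s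
   unfolding integral_unit_interval[OF cg[OF that]] by simp
  have 1: "(\<integral>y. f1 (torus_point (ph(r := y))) * monomial (%s. - kp s) (torus_point (ph(r := y))) \<partial>unit_interval_measure)
   = C * integral {0..1} (%y. g (of_real ro * cis (2 * pi * y)) * cis (2 * pi * y) powi (- kp r))"
   unfolding i[OF r(1), symmetric] unfolding mono unfolding pt by (simp add: g(2) mult_ac)
  have 2: "(\<integral>y. f2 (torus_point (ph(r := y))) * monomial (%s. - kp s) (torus_point (ph(r := y))) \<partial>unit_interval_measure)
   = C * integral {0..1} (%y. g (of_real R * cis (2 * pi * y)) * cis (2 * pi * y) powi (- kp r))"
   unfolding i[OF r(2), symmetric] unfolding mono unfolding pt by (simp add: g(3) mult_ac)
  show ?thesis unfolding 1 2 using circle_mean_move_radius[OF g(1) r, of "kp r"] by (simp add: mult.assoc)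
 qed
 have e1: "torus_coeff f1 kp * x = (\<integral>ph. (\<integral>y. f1 (torus_point (ph(r := y))) * monomial (%s. - kp s) (torus_point (ph(r := y))) \<partial>unit_interval_measure) * x \<partial>Pi\<^sub>M I (%_. unit_interval_measure))" for x
  unfolding torus_coeff_def by (subst split) (auto intro!: continuous_intros f)
 have e2: "torus_coeff f2 kp * x = (\<integral>ph. (\<integral>y. f2 (torus_point (ph(r := y))) * monomial (%s. - kp s) (torus_point (ph(r := y))) \<partial>unit_interval_measure) * x \<partial>Pi\<^sub>M I (%_. unit_interval_measure))" for x
  unfolding torus_coeff_def by (subst split) (auto intro!: continuous_intros f)
 show ?thesis unfolding e1 e2 in_eq ..
qed

section \<open>Decay of coefficients\<close>

text \<open>Joint continuity and compactness of the torus give uniform convergence of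
  \<open>f x\<close> to \<open>f x0\<close>, and every coefficient is bounded by the supremum
  norm.\<close>

lemma torus_coeff_tendsto:
 fixes f :: "'x::topological_space => complex ^ 'n::finite => complex"
 assumes f: "continuous_on (U \<times> utorus) (%(x, z). f x z)" and x0: "x0 \<in> U"
 shows "((%x. torus_coeff (f x) kp) \<longlongrightarrow> torus_coeff (f x0) kp) (at x0 within U)"
  "\<exists>C. eventually (%x. \<forall>kp. norm (torus_coeff (f x) kp) <= C) (at x0 within U)"
proof -
 have c: "continuous_on utorus (f x)" if "x \<in> U" for x
 proof -
  have "continuous_on utorus ((%(x, z). f x z) \<circ> (%z. (x, z)))"
   by (rule continuous_on_compose) (auto intro!: continuous_intros continuous_on_subset[OF f] that)
  thus ?thesis by (simp add: o_def)
 qed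
 have near: "eventually (%x. x \<in> U & (\<forall>z\<in>utorus. norm (f x z - f x0 z) <= e)) (at x0 within U)" if "e > 0" for e
 proof -
  obtain X0 where X0: "x0 \<in> X0" "open X0" "\<forall>x\<in>X0 \<inter> U. \<forall>z\<in>utorus. dist ((%(x, z). f x z) (x, z)) ((%(x, z). f x z) (x0, z)) <= e"
   using continuous_on_prod_compactE[OF f compact_utorus x0 \<open>e > 0\<close>] by metis
  thus ?thesis unfolding eventually_at_topological by (intro exI[of _ X0]) (auto simp: dist_norm)
 qed
 show "((%x. torus_coeff (f x) kp) \<longlongrightarrow> torus_coeff (f x0) kp) (at x0 within U)"
 proof (rule tendstoI)
  fix e :: real assume e: "e > 0"
  show "eventually (%x. dist (torus_coeff (f x) kp) (torus_coeff (f x0) kp) < e) (at x0 within U)"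
   using near[of "e / 2"]
  proof (rule eventually_mono)
   fix x assume x: "x \<in> U & (\<forall>z\<in>utorus. norm (f x z - f x0 z) <= e / 2)"
   have "norm (torus_coeff (%z. f x z - f x0 z) kp) <= e / 2"
    by (rule norm_torus_coeff_le) (use x c x0 in \<open>auto intro!: continuous_intros\<close>)
   thus "dist (torus_coeff (f x) kp) (torus_coeff (f x0) kp) < e"
    using e torus_coeff_diff[OF c c, of x x0] x x0 by (simp add: dist_norm)
  qed (use e in simp)
 qed
 obtain C where C: "!!z. z \<in> utorus ==> norm (f x0 z) <= C" using torus_bounded[OF c[OF x0]] by blast
 have "eventually (%x. \<forall>kp. norm (torus_coeff (f x) kp) <= C + 1) (at x0 within U)"
  using near[of 1]
 proof (rule eventually_mono)
  fix x assume x: "x \<in> U & (\<forall>z\<in>utorus. norm (f x z - f x0 z) <= 1)"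
  have "norm (f x z) <= C + 1" if "z \<in> utorus" for z
   using C[OF that] x that norm_triangle_sub[of "f x z" "f x0 z"] by fastforce
  thus "\<forall>kp. norm (torus_coeff (f x) kp) <= C + 1" using norm_torus_coeff_le[OF c] x by blast
 qed simp
 thus "\<exists>C. eventually (%x. \<forall>kp. norm (torus_coeff (f x) kp) <= C) (at x0 within U)" by blast
qed

text \<open>A function constant in the coordinate \<open>r\<close> extends constantly to all radii.
  Comparing the radii 1 and 2 shows that the coefficient equals 2^(-k) times itself for k =
  \<open>kp r\<close>.\<close>

lemma torus_coeff_independent:
 fixes f :: "complex ^ 'n::finite => complex"
 assumes f: "continuous_on utorus f" and ind: "!!z zt. z \<in> utorus ==> norm zt = 1 ==> f (update_coord z r zt) = f z" and k: "kp r ~= 0"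
 shows "torus_coeff f kp = 0"
proof (rule ccontr)
 assume nz: "torus_coeff f kp ~= 0"
 have "torus_coeff f kp * of_real 1 powi (- kp r) = torus_coeff f kp * of_real 2 powi (- kp r)"
 proof (rule torus_coeff_move_radius[OF f f])
  fix z :: "complex ^ 'n" assume z: "z \<in> utorus"
  show "\<exists>g. g holomorphic_on - {0} & (\<forall>zt. norm zt = 1 --> f (update_coord z r zt) = g (of_real 1 * zt) & f (update_coord z r zt) = g (of_real 2 * zt))"
   by (rule exI[of _ "%_. f z"]) (use ind[OF z] in auto)
 qed auto
 hence "(2::complex) powi (- kp r) = 1" using nz by simp
 hence "norm ((2::complex) powi (- kp r)) = 1" by simp
 hence 1: "(2::real) powi (- kp r) = 1" by (simp add: norm_power_int)
 from k consider "- kp r > 0" | "kp r > 0" by linarith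
 thus False
 proof cases
  case 1
  thus False using \<open>(2::real) powi (- kp r) = 1\<close> one_less_power_int[of "2::real" "- kp r"] by simp
 next
  case 2
  thus False using \<open>(2::real) powi (- kp r) = 1\<close> one_less_power_int[of "2::real" "kp r"] by (simp add: power_int_minus)
 qed
qed

definition dsize :: "('n::finite => int) => nat" where
 "dsize kp = (\<Sum>r\<in>UNIV. nat \<bar>kp r\<bar>)"

lemma summable_power_dsize:
 fixes x :: real
 assumes x: "0 <= x" "x < 1"
 shows "(%kp::'n::finite => int. x ^ dsize kp) summable_on UNIV"
proof -
 define B where "B = (2 / (1 - x)) ^ CARD('n)"
 have one: "(\<Sum>k\<in>{-int N..int N}. x ^ nat \<bar>k\<bar>) <= 2 / (1 - x)" for N
 proof -
  have g: "(\<Sum>k<Suc N. x ^ k) <= 1 / (1 - x)"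
   using sum_le_suminf[of "%k. x ^ k" "{..<Suc N}"] x by (simp add: suminf_geometric summable_geometric)
  have "(\<Sum>k\<in>{-int N..int N}. x ^ nat \<bar>k\<bar>) <= (\<Sum>k\<in>{0..int N} \<union> {-int N..0}. x ^ nat \<bar>k\<bar>)"
   by (rule sum_mono2) (use x in auto)
  also have "... <= (\<Sum>k\<in>{0..int N}. x ^ nat \<bar>k\<bar>) + (\<Sum>k\<in>{-int N..0}. x ^ nat \<bar>k\<bar>)"
   by (subst sum.union_inter[symmetric]) (use x in \<open>auto intro!: sum_nonneg\<close>)
  also have "(\<Sum>k\<in>{0..int N}. x ^ nat \<bar>k\<bar>) = (\<Sum>k<Suc N. x ^ k)"
   by (rule sum.reindex_bij_witness[of _ int nat]) auto
  also have "(\<Sum>k\<in>{-int N..0}. x ^ nat \<bar>k\<bar>) = (\<Sum>k<Suc N. x ^ k)"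
   by (rule sum.reindex_bij_witness[of _ "%k. - int k" "%k. nat (-k)"]) auto
  finally show ?thesis using g by simp
 qed
 have "(\<Sum>kp\<in>X. x ^ dsize kp) <= B" if "finite X" for X :: "('n => int) set"
 proof -
  define N where "N = (\<Sum>kp\<in>X. dsize kp)"
  have "X \<subseteq> PiE UNIV (%_. {-int N..int N})"
  proof
   fix kp assume k: "kp \<in> X"
   have "nat \<bar>kp r\<bar> <= N" for r
   proof -
    have "nat \<bar>kp r\<bar> <= dsize kp" unfolding dsize_def by (rule member_le_sum) auto
    also have "... <= N" unfolding N_def by (rule member_le_sum) (use k that in auto)
    finally show ?thesis .
   qed
   hence "!!r. -int N <= kp r & kp r <= int N" by (smt (verit) nat_le_iff)
   thus "kp \<in> PiE UNIV (%_. {-int N..int N})" by auto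
  qed
  hence "(\<Sum>kp\<in>X. x ^ dsize kp) <= (\<Sum>kp\<in>PiE (UNIV::'n set) (%_. {-int N..int N}). x ^ dsize kp)"
   by (rule sum_mono2[rotated]) (use x in \<open>auto intro!: finite_PiE\<close>)
  also have "... = (\<Sum>kp\<in>PiE (UNIV::'n set) (%_. {-int N..int N}). \<Prod>r\<in>UNIV. x ^ nat \<bar>kp r\<bar>)"
   by (simp add: dsize_def power_sum)
  also have "... = (\<Prod>r\<in>(UNIV::'n set). \<Sum>k\<in>{-int N..int N}. x ^ nat \<bar>k\<bar>)"
   by (subst prod_sum_PiE) auto
  also have "... <= (\<Prod>r\<in>(UNIV::'n set). 2 / (1 - x))"
   by (rule prod_mono) (use one x in \<open>auto intro!: sum_nonneg\<close>)
  finally show ?thesis by (simp add: B_def)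
 qed
 hence "bdd_above (sum (%kp::'n => int. x ^ dsize kp) ` {F. F \<subseteq> UNIV & finite F})"
  by (intro bdd_aboveI2[where M = B]) simp
 thus ?thesis by (intro nonneg_bdd_above_summable_on) (use x in simp_all)
qed

text \<open>Faster than every exponential in the l1 norm \<open>dsize\<close>, uniformly along the
  filter. This makes the Laurent series converge at all points with nonzero coordinates, and it is
  stable under a change of radii (\<open>rapid_decay_radial\<close>).\<close>

definition rapid_decay :: "'x filter => ('x => ('n::finite => int) => complex) => bool" where
 "rapid_decay F a \<longleftrightarrow> (\<forall>x>0. \<exists>C. eventually (%xi. \<forall>kp. norm (a xi kp) <= C * x ^ dsize kp) F)"

text \<open>For positive radii \<open>sg\<close> this is the modulus of the monomial
  \<open>kp\<close> on the torus of those radii.\<close>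

definition radial :: "('n::finite => real) => ('n => int) => real" where
 "radial sg kp = (\<Prod>r\<in>UNIV. sg r powi kp r)"

lemma radial_pos: "(!!r. sg r > 0) ==> radial sg kp > 0"
 unfolding radial_def by (intro prod_pos) auto

lemma power_int_le_power_nat:
 fixes s Y :: real
 assumes "0 < s" "s <= Y" "1 / s <= Y" "1 <= Y"
 shows "s powi k <= Y ^ nat \<bar>k\<bar>"
proof (cases "k >= 0")
 case True
 hence "s powi k = s ^ nat \<bar>k\<bar>" by (simp add: power_int_def)
 thus ?thesis using assms by (simp add: power_mono)
next
 case False
 hence "s powi k = (1 / s) ^ nat \<bar>k\<bar>" by (simp add: power_int_def power_one_over inverse_eq_divide)
 also have "... <= Y ^ nat \<bar>k\<bar>" using assms by (intro power_mono) auto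
 finally show ?thesis .
qed

lemma radial_le:
 assumes "!!r. 0 < sg r & sg r <= Y & 1 / sg r <= Y" "1 <= Y"
 shows "radial sg kp <= Y ^ dsize kp"
 unfolding radial_def dsize_def power_sum
 by (intro prod_mono conjI power_int_le_power_nat) (use assms in \<open>auto intro: less_imp_le\<close>)

lemma exists_radial_bound:
 fixes sg :: "'n::finite => real"
 assumes "!!r. sg r > 0"
 obtains Y where "!!r. sg r <= Y & 1 / sg r <= Y" "1 <= Y"
proof -
 define Y where "Y = 1 + (\<Sum>r\<in>UNIV. sg r + 1 / sg r)"
 have nn: "0 <= sg r + 1 / sg r" for r using assms[of r] by (simp add: add_nonneg_nonneg less_imp_le)
 have "sg r + 1 / sg r <= Y - 1" for r
  using member_le_sum[of r UNIV "%r. sg r + 1 / sg r"] nn by (simp add: Y_def)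
 moreover have "0 < sg r & 0 < 1 / sg r" for r using assms[of r] by simp
 ultimately have "sg r <= Y & 1 / sg r <= Y" for r by (smt (verit))
 moreover have "1 <= Y" unfolding Y_def using nn by (simp add: sum_nonneg)
 ultimately show ?thesis using that by blast
qed

lemma rapid_decay_radial:
 fixes sg :: "'n::finite => real"
 assumes a: "rapid_decay F a" and s: "!!r. sg r > 0"
 shows "rapid_decay F (%xi kp. a xi kp * of_real (radial sg kp))"
 unfolding rapid_decay_def
proof (intro allI impI)
 fix x :: real assume x: "x > 0"
 obtain Y where Y: "!!r. sg r <= Y & 1 / sg r <= Y" "1 <= Y" using exists_radial_bound[of sg] s by blast
 obtain C where C: "eventually (%xi. \<forall>kp. norm (a xi kp) <= C * (x / Y) ^ dsize kp) F"
  using a x Y(2) unfolding rapid_decay_def by (meson divide_pos_pos less_le_trans zero_less_one)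
 show "\<exists>C. eventually (%xi. \<forall>kp. norm (a xi kp * of_real (radial sg kp)) <= C * x ^ dsize kp) F"
 proof (rule exI[of _ C], rule eventually_mono[OF C], intro allI)
  fix xi kp assume "\<forall>kp. norm (a xi kp) <= C * (x / Y) ^ dsize kp"
  hence 1: "norm (a xi kp) <= C * (x / Y) ^ dsize kp" by blast
  have r: "0 < radial sg kp" "radial sg kp <= Y ^ dsize kp" using radial_pos[of sg] s radial_le[of sg Y] Y by auto
  have "norm (a xi kp * of_real (radial sg kp)) = norm (a xi kp) * radial sg kp" using r by (simp add: norm_mult)
  also have "... <= (C * (x / Y) ^ dsize kp) * Y ^ dsize kp"
   by (rule mult_mono[OF 1 r(2)]) (use 1 r norm_ge_zero[of "a xi kp"] in linarith)+
  also have "... = C * x ^ dsize kp" using Y(2) by (simp add: power_divide)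
  finally show "norm (a xi kp * of_real (radial sg kp)) <= C * x ^ dsize kp" .
 qed
qed

lemma dsize_le:
 assumes "!!s. \<bar>kp s\<bar> <= \<bar>kp r\<bar>"
 shows "dsize kp <= CARD('n) * nat \<bar>(kp :: 'n::finite => int) r\<bar>"
proof -
 have "dsize kp <= (\<Sum>s\<in>(UNIV::'n set). nat \<bar>kp r\<bar>)" unfolding dsize_def
  by (rule sum_mono) (use assms in \<open>auto intro: nat_mono\<close>)
 thus ?thesis by simp
qed

text \<open>A Cauchy estimate on a torus where only the radius of a coordinate with largest exponent
  is changed. With N the modulus of this exponent and n the number of coordinates, the others lose
  at most Y^(nN); R^\<open>ep\<close> \<ge> (Y/x)^n makes up for this and leaves x^(nN), which is at
  most \<open>x ^ dsize kp\<close>.\<close>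

lemma decay_from_long_tori:
 fixes a :: "('n::finite => int) => complex" and ro :: "'n => real"
 assumes x: "0 < x" "x <= 1" and ro: "!!r. 0 < ro r & ro r <= Y & 1 / ro r <= Y" "1 <= Y"
  and R: "\<bar>kp r\<bar> = ep * kp r" "R > 0" "(ep = 1 & R >= (Y / x) ^ CARD('n)) | (ep = -1 & 1 / R >= (Y / x) ^ CARD('n))"
  and max: "!!s. \<bar>kp s\<bar> <= \<bar>kp r\<bar>"
  and bd: "norm (a kp) * radial (ro(r := R)) kp <= C"
 shows "norm (a kp) <= C * x ^ dsize kp"
proof -
 define N where "N = nat \<bar>kp r\<bar>"
 define n where "n = CARD('n)"
 have Cnn: "C >= 0"
  using bd radial_pos[of "ro(r := R)" kp] R(2) ro(1) by (smt (verit) fun_upd_apply mult_nonneg_nonneg norm_ge_zero)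
 define S where "S = UNIV - {r}"
 have "radial (ro(r := R)) kp = R powi kp r * (\<Prod>s\<in>S. ro s powi kp s)"
  unfolding radial_def by (subst prod.remove[of _ r]) (auto simp: S_def intro!: prod.cong)
 moreover have "R powi kp r >= ((Y / x) ^ n) ^ N"
 proof (cases "ep = 1")
  case True
  hence "R powi kp r = R ^ N" using R(1) by (simp add: N_def power_int_def)
  thus ?thesis using R(3) True x ro(2) by (simp add: n_def power_mono)
 next
  case False
  hence e: "ep = -1" "1 / R >= (Y / x) ^ n" using R(3) by (auto simp: n_def)
  hence "kp r <= 0" using R(1) by simp
  hence "R powi kp r = (1 / R) ^ N" by (cases "kp r = 0") (auto simp add: N_def power_int_def power_one_over inverse_eq_divide)
  thus ?thesis using e x ro(2) by (simp add: power_mono)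
 qed
 moreover have "(\<Prod>s\<in>S. ro s powi kp s) * (Y ^ n) ^ N >= 1"
 proof -
  have pos: "ro s powi kp s > 0" for s using ro(1) by simp
  have "(\<Prod>s\<in>S. ro s powi - kp s) <= (\<Prod>s\<in>S. Y ^ N)"
  proof (rule prod_mono, rule conjI)
   fix s
   show "0 <= ro s powi - kp s" using ro(1) by (simp add: less_imp_le)
   have "ro s powi - kp s <= Y ^ nat \<bar>- kp s\<bar>" by (rule power_int_le_power_nat) (use ro in auto)
   also have "... <= Y ^ N" unfolding N_def using max[of s] ro(2) by (intro power_increasing) auto
   finally show "ro s powi - kp s <= Y ^ N" .
  qed
  also have "... = (Y ^ N) ^ card S" by simp
  also have "... <= (Y ^ N) ^ n" by (rule power_increasing) (use ro(2) in \<open>auto simp: S_def n_def intro: card_mono\<close>)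
  also have "... = (Y ^ n) ^ N" by (simp add: mult.commute flip: power_mult)
  finally have "(\<Prod>s\<in>S. ro s powi - kp s) <= (Y ^ n) ^ N" .
  moreover have "(\<Prod>s\<in>S. ro s powi - kp s) * (\<Prod>s\<in>S. ro s powi kp s) = 1"
   unfolding prod.distrib[symmetric] using ro(1) by (intro prod.neutral) (auto simp: power_int_minus less_imp_neq[symmetric])
  moreover have "(\<Prod>s\<in>S. ro s powi kp s) > 0" using pos by (rule prod_pos)
  ultimately show ?thesis by (smt (verit) mult.commute mult_right_mono)
 qed
 ultimately have 1: "radial (ro(r := R)) kp * x ^ (n * N) >= 1"
 proof -
  define A where "A = (\<Prod>s\<in>S. ro s powi kp s)"
  have A: "A > 0" unfolding A_def by (rule prod_pos) (use ro(1) in simp)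
  assume r: "radial (ro(r := R)) kp = R powi kp r * (\<Prod>s\<in>S. ro s powi kp s)"
   and 2: "((Y / x) ^ n) ^ N <= R powi kp r" and 3: "1 <= (\<Prod>s\<in>S. ro s powi kp s) * (Y ^ n) ^ N"
  have "1 <= A * (Y ^ n) ^ N" using 3 by (simp add: A_def)
  also have "... = (((Y / x) ^ n) ^ N * A) * x ^ (n * N)" using x by (simp add: power_divide power_mult)
  also have "... <= (R powi kp r * A) * x ^ (n * N)"
   using 2 A x by (intro mult_right_mono) auto
  finally show ?thesis by (simp add: r A_def)
 qed
 have "norm (a kp) <= norm (a kp) * (radial (ro(r := R)) kp * x ^ (n * N))"
  using mult_left_mono[OF 1, of "norm (a kp)"] by simp
 also have "... <= C * x ^ (n * N)" using bd x by (simp add: mult.assoc[symmetric] mult_right_mono)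
 also have "... <= C * x ^ dsize kp"
  using dsize_le[of kp r, OF max] x Cnn by (intro mult_left_mono power_decreasing) (auto simp: n_def N_def)
 finally show ?thesis .
qed

text \<open>It is enough to change a single radius at a time, namely that of a largest exponent, and
  never that of the dependent coordinate \<open>k0\<close>, whose exponent is 0.\<close>

lemma rapid_decay_from_tori:
 fixes a :: "'x => ('n::finite => int) => complex" and ro :: "'n => real"
 assumes ro: "!!r. ro r > 0" and n: "CARD('n) >= 2"
  and zero: "!!xi kp. kp k0 ~= 0 ==> a xi kp = 0"
  and tori: "!!r T. r ~= k0 ==> \<exists>R>0. \<exists>C. R >= T & eventually (%xi. \<forall>kp. norm (a xi kp) * radial (ro(r := R)) kp <= C) F"
   "!!r T. r ~= k0 ==> \<exists>R>0. \<exists>C. 1 / R >= T & eventually (%xi. \<forall>kp. norm (a xi kp) * radial (ro(r := R)) kp <= C) F"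
 shows "rapid_decay F a"
 unfolding rapid_decay_def
proof (intro allI impI)
 fix x0 :: real assume x0: "x0 > 0"
 define x where "x = min x0 1"
 have x: "0 < x" "x <= 1" "x <= x0" using x0 by (auto simp: x_def)
 obtain Y where Y: "!!r. ro r <= Y & 1 / ro r <= Y" "1 <= Y" using exists_radial_bound[of ro] ro by blast
 define T where "T = (Y / x) ^ CARD('n)"
 \<comment> \<open>\<open>ep\<close> is the sign of the exponent: a large radius serves positive
   exponents, a small one negative exponents. Only finitely many tori occur, so one bound
   \<open>C0\<close> serves them all.\<close>
 define Q where "Q = (%(r, ep::int) (R, C). R > 0 & ((ep = 1 & R >= T) | (ep = -1 & 1 / R >= T)) &
  eventually (%xi. \<forall>kp. norm (a xi kp) * radial (ro(r := R)) kp <= C) F)"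
 have "\<forall>x\<in>(-{k0}) \<times> {1, -1}. \<exists>y. Q x y"
  using tori(1)[of _ T] tori(2)[of _ T] unfolding Q_def by fastforce
 then obtain f where f: "\<forall>x\<in>(-{k0}) \<times> {1, -1}. Q x (f x)" using bchoice by blast
 define R C where "R = (%r ep. fst (f (r, ep)))" and "C = (%r ep. snd (f (r, ep)))"
 have RC: "R r ep > 0 & ((ep = 1 & R r ep >= T) | (ep = -1 & 1 / R r ep >= T)) &
  eventually (%xi. \<forall>kp. norm (a xi kp) * radial (ro(r := R r ep)) kp <= C r ep) F"
  if "r \<in> -{k0}" "ep \<in> {1, -1::int}" for r ep
  using bspec[OF f, of "(r, ep)"] that unfolding Q_def R_def C_def by (simp add: case_prod_unfold)
 define C0 where "C0 = (\<Sum>r\<in>-{k0}. \<Sum>ep\<in>{1, -1}. \<bar>C r ep\<bar>)"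
 have C0: "C r ep <= C0" if "r \<in> -{k0}" "ep \<in> {1, -1}" for r ep
 proof -
  have "C r ep <= \<bar>C r ep\<bar>" by simp
  also have "... <= (\<Sum>ep\<in>{1, -1}. \<bar>C r ep\<bar>)" using that by (intro member_le_sum) auto
  also have "... <= C0" unfolding C0_def using that by (intro member_le_sum[of r "-{k0}" "%r. \<Sum>ep\<in>{1, -1}. \<bar>C r ep\<bar>"]) (auto intro!: sum_nonneg)
  finally show ?thesis .
 qed
 have "card (-{k0}) > 0" using n by (simp add: Compl_eq_Diff_UNIV card_Diff_singleton)
 hence ne: "-{k0} ~= {}" by (metis card.empty less_irrefl)
 have ev: "eventually (%xi. \<forall>r\<in>-{k0}. \<forall>ep\<in>{1, -1}. \<forall>kp. norm (a xi kp) * radial (ro(r := R r ep)) kp <= C r ep) F"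
  by (intro eventually_ball_finite ballI) (use RC in auto)
 show "\<exists>C. eventually (%xi. \<forall>kp. norm (a xi kp) <= C * x0 ^ dsize kp) F"
 proof (rule exI[of _ C0], rule eventually_mono[OF ev], rule allI)
  fix xi kp
  assume E: "\<forall>r\<in>-{k0}. \<forall>ep\<in>{1, -1}. \<forall>kp. norm (a xi kp) * radial (ro(r := R r ep)) kp <= C r ep"
  have C0nn: "C0 >= 0" unfolding C0_def by (intro sum_nonneg) auto
  have "norm (a xi kp) <= C0 * x ^ dsize kp"
  proof (cases "kp k0 = 0")
   case False
   thus ?thesis using zero x C0nn by simp
  next
   case True
   have fin: "finite ((%s. \<bar>kp s\<bar>) ` (-{k0}))" "(%s. \<bar>kp s\<bar>) ` (-{k0}) ~= {}" using ne by auto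
   obtain r where r: "r \<in> -{k0}" "\<bar>kp r\<bar> = Max ((%s. \<bar>kp s\<bar>) ` (-{k0}))"
    using Max_in[OF fin] by (metis (no_types, lifting) imageE)
   have max: "\<bar>kp s\<bar> <= \<bar>kp r\<bar>" for s
    using Max_ge[OF fin(1)] r True by (cases "s = k0") auto
   define ep :: int where "ep = (if kp r >= 0 then 1 else -1)"
   have eps: "ep \<in> {1, -1}" "\<bar>kp r\<bar> = ep * kp r" by (auto simp: ep_def)
   show ?thesis
   proof (rule decay_from_long_tori[where r = r and R = "R r ep" and ep = ep and kp = kp and a = "a xi" and C = C0, OF x(1,2) _ Y(2) eps(2) _ _ max])
    show "0 < ro s & ro s <= Y & 1 / ro s <= Y" for s using ro Y(1) by auto
    show "R r ep > 0" "ep = 1 & R r ep >= (Y / x) ^ CARD('n) | ep = -1 & 1 / R r ep >= (Y / x) ^ CARD('n)"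
     using RC[OF r(1) eps(1)] unfolding T_def by auto
    show "norm (a xi kp) * radial (ro(r := R r ep)) kp <= C0" using E r(1) eps(1) C0[OF r(1) eps(1)] by (meson order_trans)
   qed
  qed
  also have "... <= C0 * x0 ^ dsize kp" using x C0nn by (intro mult_left_mono power_mono) auto
  finally show "norm (a xi kp) <= C0 * x0 ^ dsize kp" .
 qed
qed

lemma abs_summable_rapid:
 assumes C: "!!kp. norm (a kp :: complex) <= C * (1/2) ^ dsize (kp :: 'n::finite => int)"
 shows "(%kp. norm (a kp)) summable_on UNIV"
proof (rule summable_on_comparison_test)
 show "(%kp::'n => int. C * (1/2) ^ dsize kp) summable_on UNIV"
  by (intro summable_on_cmult_right summable_power_dsize) auto
qed (use C in auto)

text \<open>With second base 0 each inner product is its first factor, as \<open>0 ^ 0 = 1\<close>.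
  Continuity of \<open>qpoch\<close> in its base thus follows from that of
  \<open>qpoch2\<close>.\<close>

lemma qpoch_eq_qpoch2: "qpoch x p = qpoch2 x p 0"
proof -
 have "qpoch y 0 = 1 - y" for y using qpoch_shift[of 0 y] by simp
 thus ?thesis by (simp add: qpoch2_altdef qpoch_def[of x p] mult.commute)
qed

lemma continuous_on_qpoch_base [continuous_intros]:
 assumes "continuous_on A f" "continuous_on A g" "!!x. x \<in> A ==> norm (g x) < 1"
 shows "continuous_on A (%x. qpoch (f x) (g x))"
 unfolding qpoch_eq_qpoch2 by (rule continuous_on_qpoch2) (use assms in auto)

lemma continuous_on_fst_compose:
 "continuous_on U f ==> continuous_on (U \<times> S) (%x. f (fst x))"
 by (rule continuous_on_compose2[of U]) (auto intro!: continuous_intros)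

lemma continuous_on_beta_value:
 fixes t :: "'x::topological_space => 'n::finite => complex"
 assumes q: "norm q < 1" and P: "continuous_on U P" "!!xi. xi \<in> U ==> norm (P xi) < 1"
  and t: "!!r. continuous_on U (%xi. t xi r)" "!!xi r. xi \<in> U ==> t xi r ~= 0"
  and nr: "!!xi. xi \<in> U ==> nonresonant (P xi) q (t xi) (t xi)"
 shows "continuous_on U (%xi. beta_value (P xi) q (t xi))"
 unfolding beta_value_def pair_prefactor_def beta_integral_def
proof (intro continuous_intros P t q)
 show "continuous_on U (%xi. kernel_integral (P xi) q (t xi) (t xi) (%r. P xi * q / t xi r) (%r. P xi * q / t xi r) (weyl_weight (P xi) q))"
 proof (intro continuous_on_kernel_integral q P t nr)
  show "weyl_weight (P xi) q holomorphic_on - {0}" if "xi \<in> U" for xi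
   by (rule holomorphic_weyl_weight[OF q P(2)[OF that]])
  show "continuous_on (U \<times> - {0}) (%(xi, z). weyl_weight (P xi) q z)"
   unfolding weyl_weight_def case_prod_unfold
   by (intro continuous_intros q continuous_on_fst_compose P) (use P(2) in auto)
 qed (auto intro!: continuous_intros P t(1) simp: t(2))
qed (use P(2) q in auto)

section \<open>Tori in the hypersurface where the product of the coordinates is fixed, with
  dependent coordinate \<open>k0\<close>\<close>

definition base_point :: "complex => 'n::finite => ('n => real) => complex ^ 'n => complex ^ 'n" where
 "base_point C k0 sg z = (\<chi> s. if s = k0 then C / (\<Prod>s\<in>-{k0}. of_real (sg s) * z $ s) else of_real (sg s) * z $ s)"

definition moduli :: "real => 'n::finite => ('n => real) => 'n => real" where
 "moduli C k0 sg s = (if s = k0 then C / (\<Prod>s\<in>-{k0}. sg s) else sg s)"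

lemma norm_base_point:
 assumes "z \<in> utorus" "!!s. s ~= k0 ==> sg s > 0"
 shows "norm (base_point C k0 sg z $ s) = moduli (norm C) k0 sg s"
proof -
 have "(\<Prod>s\<in>-{k0}. norm (of_real (sg s) * z $ s)) = (\<Prod>s\<in>-{k0}. sg s)"
  by (rule prod.cong) (use assms in \<open>auto simp: norm_mult utorus_def less_imp_le\<close>)
 thus ?thesis using assms by (auto simp: base_point_def moduli_def norm_divide norm_mult utorus_def less_imp_le simp flip: prod_norm)
qed

lemma moduli_pos: "C > 0 ==> (!!s. s ~= k0 ==> sg s > 0) ==> moduli C k0 sg s > 0"
 by (auto simp: moduli_def intro!: divide_pos_pos prod_pos)

lemma base_point_nonzero:
 assumes "z \<in> utorus" "!!s. s ~= k0 ==> sg s > 0" "C ~= 0"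
 shows "base_point C k0 sg z $ s ~= 0"
proof
 assume "base_point C k0 sg z $ s = 0"
 hence "moduli (norm C) k0 sg s = 0" using norm_base_point[where C = C and s = s and sg = sg and ?k0.0 = k0, OF assms(1,2)] by simp
 moreover have "moduli (norm C) k0 sg s > 0" by (rule moduli_pos) (use assms in simp_all)
 ultimately show False by simp
qed

lemma prod_base_point:
 assumes "z \<in> utorus" "!!s. s ~= k0 ==> sg s > 0"
 shows "(\<Prod>s\<in>UNIV. base_point C k0 sg z $ s) = C"
proof -
 have "of_real (sg s) * z $ s ~= 0" if "s ~= k0" for s using assms(2)[OF that] torus_nonzero[OF assms(1)] by simp
 hence "(\<Prod>s\<in>-{k0}. of_real (sg s) * z $ s) ~= 0" by simp
 moreover have "(\<Prod>s\<in>-{k0}. base_point C k0 sg z $ s) = (\<Prod>s\<in>-{k0}. of_real (sg s) * z $ s)"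
  by (rule prod.cong) (auto simp: base_point_def)
 moreover have "(\<Prod>s\<in>UNIV. base_point C k0 sg z $ s) = base_point C k0 sg z $ k0 * (\<Prod>s\<in>-{k0}. base_point C k0 sg z $ s)"
  by (subst prod.remove[of _ k0]) (auto simp: Compl_eq_Diff_UNIV)
 ultimately show ?thesis by (simp add: base_point_def)
qed

lemma base_point_eqI:
 fixes t :: "complex ^ 'n::finite"
 assumes "!!r. r ~= k0 ==> t $ r = of_real (sg r) * z $ r" "(\<Prod>r\<in>UNIV. t $ r) = C" "!!r. t $ r ~= 0"
 shows "t = base_point C k0 sg z"
proof -
 have "(\<Prod>r\<in>UNIV. t $ r) = t $ k0 * (\<Prod>r\<in>-{k0}. t $ r)"
  by (subst prod.remove[of _ k0]) (auto simp: Compl_eq_Diff_UNIV)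
 moreover have "(\<Prod>r\<in>-{k0}. t $ r) ~= 0" using assms(3) by simp
 moreover have "(\<Prod>r\<in>-{k0}. t $ r) = (\<Prod>s\<in>-{k0}. of_real (sg s) * z $ s)"
  by (rule prod.cong) (use assms(1) in auto)
 ultimately have "t $ k0 = C / (\<Prod>s\<in>-{k0}. of_real (sg s) * z $ s)" using assms(2) by (auto simp: field_simps)
 thus ?thesis using assms(1) by (auto simp: vec_eq_iff base_point_def)
qed

lemma monomial_base_point:
 assumes "kp k0 = 0"
 shows "monomial kp (base_point C k0 sg z) = of_real (radial sg kp) * monomial kp z"
 unfolding monomial_def radial_def of_real_prod prod.distrib[symmetric]
 by (rule prod.cong) (use assms in \<open>auto simp: base_point_def power_int_mult_distrib\<close>)

lemma continuous_on_base_point: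
 assumes "!!s. s ~= k0 ==> sg s > 0" "continuous_on U C"
 shows "continuous_on (U \<times> utorus) (%x. base_point (C (fst x)) k0 sg (snd x) $ r)"
proof -
 have "of_real (sg s) * z $ s ~= 0" if "z \<in> utorus" "s ~= k0" for z s
  using assms(1)[OF that(2)] torus_nonzero[OF that(1)] by simp
 hence "(\<Prod>s\<in>-{k0}. of_real (sg s) * z $ s) ~= 0" if "z \<in> utorus" for z using that by simp
 thus ?thesis unfolding base_point_def
  by (cases "r = k0") (auto intro!: continuous_intros continuous_on_fst_compose assms(2))
qed

text \<open>Nonresonance expressed in moduli, so that it holds on a whole torus at once.\<close>

definition rad_nonres :: "real => real => ('n => real) => ('n => real) => bool" where
 "rad_nonres P Q af be \<longleftrightarrow> (\<forall>i i' j k. af i * be i' * P ^ j * Q ^ k ~= 1)"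

lemma nonresonant_radial:
 assumes "rad_nonres (norm p) (norm q) af be" "!!i. norm (a i) = af i" "!!i. norm (b i) = be i"
 shows "nonresonant p q a b"
 unfolding nonresonant_def
proof (intro allI notI)
 fix i i' j k assume "a i * b i' * p ^ j * q ^ k = 1"
 hence "norm (a i * b i' * p ^ j * q ^ k) = 1" by simp
 thus False using assms by (simp add: rad_nonres_def norm_mult norm_power)
qed

lemma rad_nonres_small:
 assumes "!!i i'. 0 <= af i * be i' & af i * be i' < 1" "0 <= P" "P <= 1" "0 <= Q" "Q <= 1"
 shows "rad_nonres P Q af be"
 unfolding rad_nonres_def
proof (intro allI notI)
 fix i i' j k assume "af i * be i' * P ^ j * Q ^ k = 1"
 moreover have "af i * be i' * (P ^ j * Q ^ k) <= af i * be i' * 1"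
  by (rule mult_left_mono) (use assms in \<open>auto intro!: mult_le_one power_le_one\<close>)
 ultimately show False using assms(1)[of i i'] by (simp add: mult.assoc)
qed

lemma separates_imp_nonresonant:
 assumes "separates p q a b gm"
 shows "nonresonant p q a b"
 unfolding nonresonant_def
proof (intro allI notI)
 fix i i' j k assume 1: "a i * b i' * p ^ j * q ^ k = 1"
 have "a i * p ^ j * q ^ k \<in> inner_region gm" using assms by (auto simp: separates_def)
 moreover have "b i' * p ^ 0 * q ^ 0 \<in> outer_region gm" using assms unfolding separates_def by blast
 moreover have "b i' ~= 0" "1 / b i' = a i * p ^ j * q ^ k"
  using mult_eq_1_imp_divide[of "b i'" "a i * p ^ j * q ^ k"] 1 by (auto simp: mult_ac)
 ultimately show False by (simp add: inner_region_def outer_region_def)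
qed

text \<open>Regarded as complex parameters, nonresonant moduli admit a separating contour; it
  survives small changes and in turn implies nonresonance.\<close>

lemma eventually_rad_nonres:
 fixes af be :: "'n::finite => real"
 assumes nr: "rad_nonres P0 Q af be" and Q: "\<bar>Q\<bar> < 1" and P0: "\<bar>P0\<bar> < 1"
  and P: "(P \<longlongrightarrow> P0) F" and A: "!!i. ((%xi. A xi i) \<longlongrightarrow> af i) F" and B: "!!i. ((%xi. B xi i) \<longlongrightarrow> be i) F"
 shows "eventually (%xi. rad_nonres (P xi) Q (A xi) (B xi)) F"
proof -
 have iff: "nonresonant (of_real P) (of_real Q) (%i. of_real (af i)) (%i. of_real (be i)) \<longleftrightarrow> rad_nonres P Q af be"
  for P and af be :: "'n => real"
 proof -
  have "(of_real (af i) * of_real (be i') * of_real P ^ j * of_real Q ^ k = (1::complex)) = (af i * be i' * P ^ j * Q ^ k = 1)" for i i' j k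
   by (metis of_real_eq_1_iff of_real_mult of_real_power)
  thus ?thesis by (simp add: nonresonant_def rad_nonres_def)
 qed
 obtain gm where g: "separates (of_real P0) (of_real Q) (%i. of_real (af i)) (%i. of_real (be i)) gm"
 proof (rule separates_exists[of "of_real Q" "of_real P0" "%i. of_real (af i)" "%i. of_real (be i)" "{}"])
  show "nonresonant (of_real P0) (of_real Q) (%i. of_real (af i)) (%i. of_real (be i))" using nr iff by blast
 qed (use Q P0 in auto)
 have "eventually (%xi. separates (of_real (P xi)) (of_real Q) (%i. of_real (A xi i)) (%i. of_real (B xi i)) gm) F"
  by (rule separates_eventually[OF _ _ g]) (use Q P0 in \<open>auto intro!: tendsto_of_real P A B\<close>)
 thus ?thesis
 proof (rule eventually_mono)
  fix xi assume "separates (of_real (P xi)) (of_real Q) (%i. of_real (A xi i)) (%i. of_real (B xi i)) gm"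
  from separates_imp_nonresonant[OF this] show "rad_nonres (P xi) Q (A xi) (B xi)" unfolding iff .
 qed
qed

text \<open>A resonance whose equation involves \<open>R\<close> excludes at most one positive value
  of \<open>R\<close>, and there are countably many resonances. The equations free of
  \<open>R\<close> are never satisfied.\<close>

lemma exists_nonresonant_radius:
 fixes ro :: "'n::finite => real"
 assumes r: "r ~= k0" and ro: "!!s. ro s > 0" and C: "C > 0" "!!s. moduli C k0 ro s < 1"
  and PQ: "0 <= P" "P <= 1" "0 <= Q" "Q <= 1" and ab: "0 <= a" "a < b"
 obtains R where "a < R" "R < b" "rad_nonres P Q (moduli C k0 (ro(r := R))) (moduli C k0 (ro(r := R)))"
proof -
 define e where "e = exch r k0"
 define \<nu> where "\<nu> = moduli C k0 (ro(r := 1))"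
 have \<mu>: "moduli C k0 (ro(r := R)) s = \<nu> s * R powi e s" if "R > 0" for R s
 proof -
  have "(\<Prod>s\<in>-{k0}. (ro(r := R)) s) = R * (\<Prod>s\<in>-{k0}-{r}. (ro(r := R)) s)" for R
   using r by (subst prod.remove[of _ r]) auto
  moreover have "(\<Prod>s\<in>-{k0}-{r}. (ro(r := R)) s) = (\<Prod>s\<in>-{k0}-{r}. ro s)" for R by (rule prod.cong) auto
  ultimately have "(\<Prod>s\<in>-{k0}. (ro(r := R)) s) = R * (\<Prod>s\<in>-{k0}-{r}. ro s)" for R by simp
  thus ?thesis using r by (auto simp: moduli_def \<nu>_def e_def exch_def power_int_minus field_simps)
 qed
 define S where "S = (%(x, y, j::nat, k::nat). {R. R > 0 & \<nu> x * \<nu> y * P ^ j * Q ^ k * R powi (e x + e y) = 1})"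
 have "countable (S w)" for w
 proof -
  obtain x y j k where w: "w = (x, y, j, k)" by (metis prod_cases4)
  define c where "c = \<nu> x * \<nu> y * P ^ j * Q ^ k"
  show ?thesis
  proof (cases "e x + e y = 0")
   case True
   \<comment> \<open>A resonance free of \<open>R\<close> can be evaluated at the original radius
     \<open>ro r\<close>, where all moduli are below 1.\<close>
   have "c < 1"
   proof -
    have "\<nu> x * \<nu> y = \<nu> x * ro r powi e x * (\<nu> y * ro r powi e y)"
    proof -
     have "ro r powi e x * ro r powi e y = 1" using True ro[of r] by (simp flip: power_int_add)
     thus ?thesis by (simp add: mult_ac)
    qed
    also have "... = moduli C k0 ro x * moduli C k0 ro y" using \<mu>[of "ro r"] ro[of r] by simp
    finally have 1: "\<nu> x * \<nu> y = moduli C k0 ro x * moduli C k0 ro y" .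
    have pos: "moduli C k0 ro s > 0" for s using moduli_pos[of C k0 ro s] C ro by simp
    have "\<nu> x * \<nu> y < 1 * 1" unfolding 1 by (rule mult_strict_mono) (use C(2) pos in \<open>auto intro: less_imp_le\<close>)
    moreover have "c <= \<nu> x * \<nu> y * 1" unfolding c_def mult.assoc[of _ "P ^ j"]
     by (rule mult_left_mono) (use PQ 1 pos in \<open>auto intro!: mult_le_one power_le_one mult_nonneg_nonneg intro: less_imp_le\<close>)
    ultimately show ?thesis by simp
   qed
   hence "S w = {}" by (auto simp: S_def w True c_def)
   thus ?thesis by simp
  next
   case False
   have "R = R'" if "R \<in> S w" "R' \<in> S w" for R R'
   proof -
    have R: "R > 0" "R' > 0" "c * R powi (e x + e y) = 1" "c * R' powi (e x + e y) = 1" using that by (auto simp: S_def w c_def)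
    hence "R powi (e x + e y) = R' powi (e x + e y)" by (metis mult_cancel_left mult_zero_left zero_neq_one)
    hence "R powr of_int (e x + e y) = R' powr of_int (e x + e y)" using R(1,2) by (simp add: powr_real_of_int' del: of_int_add)
    hence "ln (R powr of_int (e x + e y)) = ln (R' powr of_int (e x + e y))" by simp
    hence "ln R = ln R'" using False R(1,2) by (simp add: ln_powr flip: of_int_add)
    thus ?thesis using R by simp
   qed
   hence "S w \<subseteq> {SOME R. R \<in> S w}" by (metis singleton_iff someI_ex subsetI)
   thus ?thesis by (rule countable_subset) simp
  qed
 qed
 hence "countable (\<Union>w. S w)" by blast
 moreover have "uncountable {a<..<b}" using ab by (simp add: uncountable_open_interval)
 ultimately have "\<not> {a<..<b} \<subseteq> (\<Union>w. S w)" using countable_subset by blast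
 then obtain R where "R \<in> {a<..<b}" and RS: "R ~: (\<Union>w. S w)" unfolding subset_iff by blast
 hence R: "a < R" "R < b" "R ~: (\<Union>w. S w)" by simp_all
 have "rad_nonres P Q (moduli C k0 (ro(r := R))) (moduli C k0 (ro(r := R)))"
  unfolding rad_nonres_def
 proof (intro allI notI)
  fix x y j k assume 1: "moduli C k0 (ro(r := R)) x * moduli C k0 (ro(r := R)) y * P ^ j * Q ^ k = 1"
  have "R > 0" using R ab by simp
  have "\<nu> x * \<nu> y * P ^ j * Q ^ k * R powi (e x + e y) = 1"
   using 1 \<open>R > 0\<close> by (simp add: \<mu>[OF \<open>R > 0\<close>] power_int_add mult_ac)
  hence "R \<in> S (x, y, j, k)" using \<open>R > 0\<close> by (simp add: S_def)
  thus False using R(3) by blast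
 qed
 thus ?thesis using that R by blast
qed

section \<open>Everywhere convergent Laurent series and identities along exponential curves\<close>

lemma laurent_uniform_limit:
 fixes a :: "('n::finite => int) => complex" and t :: "'w => complex ^ 'n"
 assumes a: "!!x. x > 0 ==> \<exists>C. \<forall>kp. norm (a kp) <= C * x ^ dsize kp"
  and t: "!!w r. w \<in> S ==> t w $ r ~= 0 & norm (t w $ r) <= Y & 1 / norm (t w $ r) <= Y" and Y: "1 <= Y"
 shows "uniform_limit S (%X w. \<Sum>kp\<in>X. a kp * monomial kp (t w)) (%w. \<Sum>\<^sub>\<infinity>kp. a kp * monomial kp (t w)) (finite_subsets_at_top UNIV)"
proof -
 \<comment> \<open>The monomials grow at most like \<open>Y ^ dsize kp\<close>; decay at the rate
   \<open>1 / (2 * Y)\<close> leaves the summable majorant \<open>(1/2) ^ dsize kp\<close>.\<close>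
 obtain C where C: "!!kp. norm (a kp) <= C * (1 / (2 * Y)) ^ dsize kp" using a[of "1 / (2 * Y)"] Y by auto
 show ?thesis
 proof (rule Weierstrass_m_test_general)
  show "(%kp::'n => int. C * (1/2) ^ dsize kp) summable_on UNIV"
   by (intro summable_on_cmult_right summable_power_dsize) auto
  fix kp :: "'n => int" and w assume w: "w \<in> S"
  have "norm (monomial kp (t w)) = radial (%r. norm (t w $ r)) kp"
   by (simp add: monomial_def radial_def norm_power_int flip: prod_norm)
  also have "... <= Y ^ dsize kp" by (rule radial_le) (use t[OF w] Y in auto)
  finally have "norm (a kp * monomial kp (t w)) <= C * (1 / (2 * Y)) ^ dsize kp * Y ^ dsize kp"
   unfolding norm_mult by (intro mult_mono C) (use order_trans[OF norm_ge_zero C[of kp]] in auto)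
  also have "... = C * (1/2) ^ dsize kp" using Y by (simp add: power_divide power_mult_distrib)
  finally show "norm (a kp * monomial kp (t w)) <= C * (1/2) ^ dsize kp" .
 qed
qed

lemma continuous_on_laurent:
 fixes a :: "('n::finite => int) => complex"
 assumes a: "!!x. x > 0 ==> \<exists>C. \<forall>kp. norm (a kp) <= C * x ^ dsize kp"
 shows "continuous_on {t. \<forall>r. t $ r ~= 0} (%t. \<Sum>\<^sub>\<infinity>kp. a kp * monomial kp t)"
proof (rule continuous_on_local)
 fix t :: "complex ^ 'n" assume t: "t \<in> {t. \<forall>r. t $ r ~= 0}"
 obtain Y where Y: "!!r. norm (t $ r) <= Y & 1 / norm (t $ r) <= Y" "1 <= Y"
  using exists_radial_bound[of "%r. norm (t $ r)"] t by auto
 define T where "T = {t::complex ^ 'n. \<forall>r. 1 / (2 * Y) < norm (t $ r) & norm (t $ r) < 2 * Y}"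
 have "T = (\<Inter>r. {t. 1 / (2 * Y) < norm (t $ r)} \<inter> {t. norm (t $ r) < 2 * Y})" by (auto simp: T_def)
 hence T: "open T" by (auto intro!: open_INT open_Int open_Collect_less continuous_intros)
 have "1 / (2 * Y) < norm (t $ r)" for r
 proof -
  have "1 / Y <= norm (t $ r)" using Y(1)[of r] Y(2) t by (auto simp: field_simps)
  moreover have "1 / (2 * Y) < 1 / Y" using Y(2) by (simp add: field_simps)
  ultimately show ?thesis by linarith
 qed
 moreover have "norm (t $ r) < 2 * Y" for r using Y(1)[of r] Y(2) by linarith
 ultimately have tT: "t \<in> T" by (simp add: T_def)
 have nz: "s $ r ~= 0 & norm (s $ r) <= 2 * Y & 1 / norm (s $ r) <= 2 * Y" if "s \<in> T" for s :: "complex ^ 'n" and r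
 proof -
  have 1: "1 / (2 * Y) < norm (s $ r)" "norm (s $ r) < 2 * Y" using that by (auto simp: T_def)
  moreover have "0 < 1 / (2 * Y)" using Y(2) by simp
  ultimately have 2: "0 < norm (s $ r)" by linarith
  have "1 < 2 * Y * norm (s $ r)" using 1(1) Y(2) by (simp add: field_simps)
  hence "1 / norm (s $ r) <= 2 * Y" using 2 by (simp add: divide_le_eq)
  thus ?thesis using 1 2 by auto
 qed
 have ul: "uniform_limit T (%X s. \<Sum>kp\<in>X. a kp * monomial kp s) (%s. \<Sum>\<^sub>\<infinity>kp. a kp * monomial kp s) (finite_subsets_at_top UNIV)"
  by (rule laurent_uniform_limit[where Y = "2 * Y", OF a]) (use nz Y(2) in auto)
 have "continuous_on T (%s. \<Sum>kp\<in>X. a kp * monomial kp s)" for X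
  unfolding monomial_def by (intro continuous_intros) (use nz in auto)
 hence "continuous_on T (%s. \<Sum>\<^sub>\<infinity>kp. a kp * monomial kp s)"
  by (intro uniform_limit_theorem[OF always_eventually ul]) auto
 thus "\<exists>T. open T & t \<in> T & continuous_on ({t. \<forall>r. t $ r ~= 0} \<inter> T) (%t. \<Sum>\<^sub>\<infinity>kp. a kp * monomial kp t)"
  using T tT by (meson continuous_on_subset inf_le2)
qed

lemma holomorphic_on_laurent:
 fixes a :: "('n::finite => int) => complex" and t :: "complex => complex ^ 'n"
 assumes a: "!!x. x > 0 ==> \<exists>C. \<forall>kp. norm (a kp) <= C * x ^ dsize kp" and U: "open U"
  and t: "!!r. (%w. t w $ r) holomorphic_on U" "!!w r. w \<in> U ==> t w $ r ~= 0"
 shows "(%w. \<Sum>\<^sub>\<infinity>kp. a kp * monomial kp (t w)) holomorphic_on U"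
proof (rule holomorphicI_local)
 fix w0 assume w0: "w0 \<in> U"
 obtain e where e: "e > 0" "cball w0 e \<subseteq> U" using U w0 open_contains_cball by blast
 define h where "h = (%w. 1 + (\<Sum>r\<in>UNIV. norm (t w $ r) + 1 / norm (t w $ r)))"
 have "continuous_on (cball w0 e) h" unfolding h_def
  by (intro continuous_intros continuous_on_subset[OF holomorphic_on_imp_continuous_on[OF t(1)] e(2)]) (use t(2) e(2) in auto)
 hence "bounded (h ` cball w0 e)" by (intro compact_imp_bounded compact_continuous_image) auto
 then obtain Y where Y0: "\<forall>x\<in>h ` cball w0 e. norm x <= Y" unfolding bounded_iff by blast
 have Y: "h w <= Y" if "w \<in> cball w0 e" for w
 proof -
  have "norm (h w) <= Y" using bspec[OF Y0 imageI[OF that]] .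
  thus ?thesis by simp
 qed
 have h1: "1 <= h w" for w unfolding h_def by (simp add: sum_nonneg)
 have hr: "norm (t w $ r) + 1 / norm (t w $ r) <= h w" for w r
  using member_le_sum[of r UNIV "%r. norm (t w $ r) + 1 / norm (t w $ r)"] by (simp add: h_def)
 have Y1: "1 <= Y" using Y[of w0] h1[of w0] e(1) by simp
 have ul: "uniform_limit (cball w0 e) (%X w. \<Sum>kp\<in>X. a kp * monomial kp (t w)) (%w. \<Sum>\<^sub>\<infinity>kp. a kp * monomial kp (t w)) (finite_subsets_at_top UNIV)"
 proof (rule laurent_uniform_limit[OF a _ Y1])
  fix w r assume w: "w \<in> cball w0 e"
  have "t w $ r ~= 0" using t(2)[of w r] w e(2) by blast
  moreover have "norm (t w $ r) >= 0" "1 / norm (t w $ r) >= 0" by auto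
  ultimately show "t w $ r ~= 0 & norm (t w $ r) <= Y & 1 / norm (t w $ r) <= Y"
   using hr[of w r] Y[OF w] by linarith
 qed
 have hol: "(%w. \<Sum>kp\<in>X. a kp * monomial kp (t w)) holomorphic_on cball w0 e" for X
  unfolding monomial_def by (intro holomorphic_intros holomorphic_on_subset[OF t(1) e(2)]) (use t(2) e(2) in auto)
 have ev: "eventually (%X. continuous_on (cball w0 e) (%w. \<Sum>kp\<in>X. a kp * monomial kp (t w)) &
  (%w. \<Sum>kp\<in>X. a kp * monomial kp (t w)) holomorphic_on ball w0 e) (finite_subsets_at_top UNIV)"
  by (rule always_eventually) (use hol holomorphic_on_imp_continuous_on holomorphic_on_subset[OF hol ball_subset_cball] in blast)
 have "(%w. \<Sum>\<^sub>\<infinity>kp. a kp * monomial kp (t w)) holomorphic_on ball w0 e"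
  using holomorphic_uniform_limit[OF ev ul] by (simp add: finite_subsets_at_top_neq_bot)
 thus "\<exists>S. open S & w0 \<in> S & (%w. \<Sum>\<^sub>\<infinity>kp. a kp * monomial kp (t w)) holomorphic_on S"
  using e(1) by (intro exI[of _ "ball w0 e"]) auto
qed

lemma countable_exp_solutions:
 assumes "D ~= (0::complex)"
 shows "countable {w. c * exp (w * D) = 1}"
proof (cases "c = 0")
 case False
 have "{w. c * exp (w * D) = 1} \<subseteq> range (%n::int. (Ln (1 / c) + of_int (2 * n) * of_real pi * \<i>) / D)"
 proof
  fix w assume "w \<in> {w. c * exp (w * D) = 1}"
  hence "exp (w * D) = exp (Ln (1 / c))" using False by (simp add: field_simps)
  then obtain n :: int where "w * D = Ln (1 / c) + of_int (2 * n) * of_real pi * \<i>" unfolding exp_eq by auto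
  hence "w = (Ln (1 / c) + of_int (2 * n) * of_real pi * \<i>) / D" using assms by (simp add: field_simps)
  thus "w \<in> range (%n::int. (Ln (1 / c) + of_int (2 * n) * of_real pi * \<i>) / D)" by blast
 qed
 thus ?thesis by (rule countable_subset) simp
qed simp

text \<open>For real \<open>d\<close>, imaginary \<open>w\<close> only rotate the coordinates, and
  the moduli change along the real axis.\<close>

definition exp_curve :: "('n => complex) => ('n => complex) => complex => 'n => complex" where
 "exp_curve ta d w r = ta r * exp (w * d r)"

lemma exp_curve_countable_resonances:
 fixes af be d e :: "'n::finite => complex"
 assumes small: "!!x y j k. d x + e y = 0 ==> af x * be y * p ^ j * q ^ k ~= 1"
 shows "countable {w. \<not> nonresonant p q (exp_curve af d w) (exp_curve be e w)}"
proof -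
 define S where "S = (%(x, y, j::nat, k::nat). {w. (af x * be y * p ^ j * q ^ k) * exp (w * (d x + e y)) = 1})"
 have "countable (S i)" for i
 proof -
  obtain x y j k where i: "i = (x, y, j, k)" by (metis prod_cases4)
  show ?thesis
  proof (cases "d x + e y = 0")
   case True
   hence "S i = {}" using small[OF True] by (simp add: S_def i)
   thus ?thesis by simp
  next
   case False
   thus ?thesis unfolding S_def i by (simp add: countable_exp_solutions)
  qed
 qed
 hence "countable (\<Union>i. S i)" by blast
 moreover have "{w. \<not> nonresonant p q (exp_curve af d w) (exp_curve be e w)} \<subseteq> (\<Union>i. S i)"
 proof
  fix w assume "w \<in> {w. \<not> nonresonant p q (exp_curve af d w) (exp_curve be e w)}"
  then obtain x y j k where "exp_curve af d w x * exp_curve be e w y * p ^ j * q ^ k = 1"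
   by (auto simp: nonresonant_def)
  hence "w \<in> S (x, y, j, k)" by (simp add: S_def exp_curve_def distrib_left exp_add mult_ac)
  thus "w \<in> (\<Union>i. S i)" by blast
 qed
 ultimately show ?thesis using countable_subset by blast
qed

text \<open>The resonances on the curve form a countable set, so the nonresonant points are
  connected and the identity spreads from the imaginary axis. \<open>small\<close> rules out a
  resonance that persists along the whole curve.\<close>

lemma exp_curve_identity:
 fixes af be d e :: "'n::finite => complex"
 assumes q: "norm q < 1" and p: "norm p < 1"
  and small: "!!x y j k. d x + e y = 0 ==> af x * be y * p ^ j * q ^ k ~= 1"
  and f: "f holomorphic_on {w. nonresonant p q (exp_curve af d w) (exp_curve be e w)}"
  and g: "g holomorphic_on {w. nonresonant p q (exp_curve af d w) (exp_curve be e w)}"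
  and imag: "!!y::real. nonresonant p q (exp_curve af d (\<i> * y)) (exp_curve be e (\<i> * y)) & f (\<i> * y) = g (\<i> * y)"
  and w: "nonresonant p q (exp_curve af d w) (exp_curve be e w)"
 shows "f w = g w"
proof -
 define N where "N = {w. nonresonant p q (exp_curve af d w) (exp_curve be e w)}"
 have N: "open N"
 proof -
  have "continuous_on UNIV (%w. exp_curve af d w i)" for af d :: "'n => complex" and i
   unfolding exp_curve_def by (intro continuous_intros)
  from open_nonresonant[OF q p open_UNIV this this] show ?thesis by (simp add: N_def)
 qed
 have "countable (- N)"
  using exp_curve_countable_resonances[where p = p and q = q, OF small] by (simp add: N_def Collect_neg_eq)
 from connected_open_diff_countable[OF _ open_UNIV connected_UNIV this]
 have con: "connected N" by (simp flip: Compl_eq_Diff_UNIV)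
 define I where "I = range (%y::real. \<i> * of_real y)"
 have "f w - g w = 0"
 proof (rule analytic_continuation[where f = "%w. f w - g w" and S = N and U = I and \<xi> = 0])
  show "(%w. f w - g w) holomorphic_on N" using f g unfolding N_def by (intro holomorphic_intros)
  show "0 \<in> N" using imag[of 0] by (simp add: N_def)
  show "I \<subseteq> N" using imag by (auto simp: N_def I_def)
  show "w \<in> N" using w by (simp add: N_def)
  show "0 islimpt I" unfolding islimpt_approachable
  proof (intro allI impI)
   fix ep :: real assume "ep > 0"
   thus "\<exists>x'\<in>I. x' ~= 0 & dist x' 0 < ep"
    by (intro bexI[of _ "\<i> * of_real (ep / 2)"]) (auto simp: I_def norm_mult simp del: of_real_divide intro!: rangeI)
  qed
  show "!!z. z \<in> I ==> f z - g z = 0" using imag by (auto simp: I_def)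
 qed (use N con in auto)
 thus ?thesis by simp
qed

section \<open>The Laurent expansion\<close>

text \<open>Each new value is chosen in the interval outside the countable set of rational
  combinations of \<open>Q\<close> and the previous values.\<close>

lemma exists_rationally_independent:
 fixes S :: "'n::finite set" and a b Q :: real
 assumes "finite S" "a < b" "Q ~= 0"
 shows "\<exists>lam. (\<forall>s. a < lam s & lam s < b) &
  (\<forall>(j::int) (f::'n => int). of_int j * Q + (\<Sum>s\<in>S. of_int (f s) * lam s) = 0 --> j = 0 & (\<forall>s\<in>S. f s = 0))"
 using assms(1)
proof (induction S rule: finite_induct)
 case empty
 show ?case by (rule exI[of _ "%_. (a + b) / 2"]) (use assms in auto)
next
 case (insert s0 S)
 then obtain lam where lam: "!!s. a < lam s & lam s < b"
  "!!(j::int) (f::'n => int). of_int j * Q + (\<Sum>s\<in>S. of_int (f s) * lam s) = 0 ==> j = 0 & (\<forall>s\<in>S. f s = 0)"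
  by blast
 define B where "B = range (%(i::int, j::int, f::'n => int). - (of_int j * Q + (\<Sum>s\<in>S. of_int (f s) * lam s)) / of_int i)"
 have "countable B" unfolding B_def by simp
 moreover have "uncountable {a<..<b}" using assms by (simp add: uncountable_open_interval)
 ultimately have "\<not> {a<..<b} \<subseteq> B" using countable_subset by blast
 then obtain x where x: "a < x" "x < b" "x ~: B" by (meson greaterThanLessThan_iff subsetI)
 show ?case
 proof (intro exI[of _ "lam(s0 := x)"] conjI allI impI)
  fix s show "a < (lam(s0 := x)) s" "(lam(s0 := x)) s < b" using lam(1) x by auto
 next
  fix j :: int and f :: "'n => int"
  assume "of_int j * Q + (\<Sum>s\<in>insert s0 S. of_int (f s) * (lam(s0 := x)) s) = 0"
  moreover have "(\<Sum>s\<in>S. of_int (f s) * (lam(s0 := x)) s) = (\<Sum>s\<in>S. of_int (f s) * lam s)"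
   by (rule sum.cong) (use insert.hyps in auto)
  ultimately have e: "of_int (f s0) * x + (of_int j * Q + (\<Sum>s\<in>S. of_int (f s) * lam s)) = 0"
   using insert.hyps by simp
  have f0: "f s0 = 0"
  proof (rule ccontr)
   assume "f s0 ~= 0"
   hence "x = - (of_int j * Q + (\<Sum>s\<in>S. of_int (f s) * lam s)) / of_int (f s0)" using e by (simp add: field_simps)
   hence "x \<in> B" unfolding B_def by (intro range_eqI[of _ _ "(f s0, j, f)"]) simp
   thus False using x by simp
  qed
  have "j = 0 & (\<forall>s\<in>S. f s = 0)" by (rule lam(2)) (use e f0 in simp)
  thus "j = 0" "\<forall>s\<in>insert s0 S. f s = 0" using f0 by auto
 qed
qed

text \<open>\<open>ro\<close> are the radii of a torus on which every coordinate has modulus below 1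
  for all p in the punctured disc; at the dependent coordinate \<open>k0\<close> this is due to
  \<open>rho_prod\<close>. \<open>ro k0 = 1\<close> is a filler. The independence of the logarithms
  lets resonances be met one at a time.\<close>

locale elliptic_base =
 fixes m :: nat and q :: complex and k0 :: "'n::finite" and ro :: "'n => real"
 assumes card: "CARD('n) = 2 * m + 6" and q: "norm q < 1" "q ~= 0"
  and rho_k0: "ro k0 = 1" and rho: "!!s. s ~= k0 ==> 0 < ro s & ro s < 1"
  and rho_prod: "norm q < (\<Prod>s\<in>-{k0}. ro s)"
  and independent: "!!(j::int) (f::'n => int). of_int j * ln (norm q) + (\<Sum>s\<in>-{k0}. of_int (f s) * ln (ro s)) = 0
   ==> j = 0 & (\<forall>s\<in>-{k0}. f s = 0)"

lemma exists_elliptic_base: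
 fixes k0 :: "'n::finite" and q :: complex
 assumes card: "CARD('n) = 2 * m + 6" and q: "norm q < 1" "q ~= 0"
 shows "\<exists>ro. elliptic_base m q k0 ro"
proof -
 \<comment> \<open>Negative logarithms above this value add up to more than ln |q|, which is the
   logarithmic form of \<open>rho_prod\<close>.\<close>
 define a where "a = ln (norm q) / CARD('n)"
 have lnq: "ln (norm q) < 0" using q by simp
 have a: "a < 0" using lnq by (simp add: a_def divide_neg_pos)
 obtain lam where lam: "!!s. a < lam s & lam s < 0"
  "!!(j::int) (f::'n => int). of_int j * ln (norm q) + (\<Sum>s\<in>-{k0}. of_int (f s) * lam s) = 0 ==> j = 0 & (\<forall>s\<in>-{k0}. f s = 0)"
  using exists_rationally_independent[of "-{k0}" a 0 "ln (norm q)"] a lnq by auto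
 define ro where "ro = (%s. if s = k0 then 1 else exp (lam s))"
 have "elliptic_base m q k0 ro"
 proof
  show "norm q < (\<Prod>s\<in>-{k0}. ro s)"
  proof -
   have c: "card (-{k0}) = CARD('n) - 1" by (simp add: Compl_eq_Diff_UNIV card_Diff_singleton)
   have "card (-{k0}) > 0" using c card by simp
   hence ne: "-{k0} ~= {}" by (metis card.empty less_irrefl)
   have "ln (norm q) = (\<Sum>s\<in>(UNIV::'n set). a)" by (simp add: a_def)
   also have "... = a + (\<Sum>s\<in>-{k0}. a)" by (subst sum.remove[of _ k0]) (auto simp: Compl_eq_Diff_UNIV)
   also have "... < 0 + (\<Sum>s\<in>-{k0}. lam s)"
    by (intro add_strict_mono a sum_strict_mono) (use ne lam in auto)
   finally have "exp (ln (norm q)) < exp (\<Sum>s\<in>-{k0}. lam s)" by simp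
   moreover have "exp (\<Sum>s\<in>-{k0}. lam s) = (\<Prod>s\<in>-{k0}. ro s)" by (simp add: exp_sum ro_def)
   ultimately show ?thesis using q by simp
  qed
  fix j :: int and f :: "'n => int"
  assume "of_int j * ln (norm q) + (\<Sum>s\<in>-{k0}. of_int (f s) * ln (ro s)) = 0"
  thus "j = 0 & (\<forall>s\<in>-{k0}. f s = 0)" using lam(2)[of j f] by (simp add: ro_def)
 qed (use card q lam in \<open>auto simp: ro_def\<close>)
 thus ?thesis by (intro exI[of _ ro])
qed

context elliptic_base
begin

lemma rho_pos: "ro s > 0"
 using rho[of s] rho_k0 by (cases "s = k0") auto

lemma base_moduli_less_1:
 assumes "0 < C" "C <= norm q"
 shows "moduli C k0 ro s < 1"
proof (cases "s = k0")
 case True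
 have "C < (\<Prod>s\<in>-{k0}. ro s)" using assms rho_prod by simp
 thus ?thesis using True assms by (auto simp: moduli_def divide_less_eq_1)
qed (use rho[of s] in \<open>simp add: moduli_def\<close>)

lemma power_Suc_le_q: "norm p <= 1 ==> norm ((p * q) ^ (m + 1)) <= norm q"
proof -
 assume p: "norm p <= 1"
 have "norm (p * q) ^ Suc m <= norm (p * q)" using power_le_one[of "norm (p * q)" m] p q
  by (simp add: norm_mult mult_left_le mult_le_one)
 also have "... <= norm q" using p by (simp add: norm_mult mult_left_le_one_le)
 finally show ?thesis by (simp add: norm_power norm_mult)
qed

lemma base_rad_nonres:
 assumes "0 < C" "C <= norm q" "0 <= P" "P <= 1"
 shows "rad_nonres P (norm q) (moduli C k0 ro) (moduli C k0 ro)"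
proof (rule rad_nonres_small)
 fix i i'
 have pos: "moduli C k0 ro s > 0" for s using moduli_pos assms rho_pos by blast
 have "moduli C k0 ro i * moduli C k0 ro i' < 1 * 1"
  by (rule mult_strict_mono) (use base_moduli_less_1[OF assms(1,2)] pos in \<open>auto intro: less_imp_le\<close>)
 thus "0 <= moduli C k0 ro i * moduli C k0 ro i' & moduli C k0 ro i * moduli C k0 ro i' < 1"
  using pos by (simp add: less_imp_le)
qed (use assms q in auto)

definition pt :: "complex => ('n => real) => complex ^ 'n => complex ^ 'n" where
 "pt p sg z = base_point ((p * q) ^ (m + 1)) k0 sg z"

text \<open>For these p the whole torus of radii \<open>sg\<close> avoids the resonances, so
  \<open>beta_value\<close> is continuous on it. The base torus is tame for every p in the punctured
  disc.\<close>

definition tame :: "('n => real) => complex set" where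
 "tame sg = {p. p ~= 0 & norm p < 1 &
  rad_nonres (norm p) (norm q) (moduli (norm ((p * q) ^ (m + 1))) k0 sg) (moduli (norm ((p * q) ^ (m + 1))) k0 sg)}"

lemma tame_base: "p ~= 0 ==> norm p < 1 ==> p \<in> tame ro"
 unfolding tame_def using base_rad_nonres[OF _ power_Suc_le_q, of p "norm p"] q by auto

lemma tame_nonresonant:
 assumes "p \<in> tame sg" "z \<in> utorus" "!!s. sg s > 0"
 shows "nonresonant p q (vec_nth (pt p sg z)) (vec_nth (pt p sg z))"
 using assms by (intro nonresonant_radial[where af = "moduli (norm ((p * q) ^ (m + 1))) k0 sg" and be = "moduli (norm ((p * q) ^ (m + 1))) k0 sg"])
  (auto simp: tame_def pt_def norm_base_point)

lemma continuous_on_torus_beta: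
 assumes s: "!!s. sg s > 0"
 shows "continuous_on (tame sg \<times> utorus) (%(p, z). beta_value p q (vec_nth (pt p sg z)))"
 unfolding case_prod_unfold
proof (rule continuous_on_beta_value[OF q(1)])
 show "continuous_on (tame sg \<times> utorus) (%x. pt (fst x) sg (snd x) $ r)" for r
  unfolding pt_def by (rule continuous_on_base_point) (use s in \<open>auto intro!: continuous_intros\<close>)
 show "nonresonant (fst xi) q (vec_nth (pt (fst xi) sg (snd xi))) (vec_nth (pt (fst xi) sg (snd xi)))" if "xi \<in> tame sg \<times> utorus" for xi
  by (rule tame_nonresonant) (use that s in auto)
 show "pt (fst xi) sg (snd xi) $ r ~= 0" if "xi \<in> tame sg \<times> utorus" for xi r
  unfolding pt_def by (rule base_point_nonzero) (use that s q in \<open>auto simp: tame_def\<close>)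
qed (auto intro!: continuous_intros simp: tame_def)

lemma continuous_on_utorus_beta:
 assumes "p \<in> tame sg" "!!s. sg s > 0"
 shows "continuous_on utorus (%z. beta_value p q (vec_nth (pt p sg z)))"
proof -
 have "continuous_on utorus ((%(p, z). beta_value p q (vec_nth (pt p sg z))) \<circ> (%z. (p, z)))"
  by (rule continuous_on_compose) (auto intro!: continuous_intros continuous_on_subset[OF continuous_on_torus_beta] assms)
 thus ?thesis by (simp add: o_def)
qed

lemma eventually_tame:
 assumes p0: "p0 \<in> tame sg" and s: "!!s. sg s > 0"
 shows "eventually (%p. p \<in> tame sg) (nhds p0)"
proof -
 have p0': "p0 ~= 0" "norm p0 < 1" using p0 by (auto simp: tame_def)
 have id: "((%p. p) \<longlongrightarrow> p0) (nhds p0)" by (rule filterlim_ident)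
 have t: "((%p. moduli (norm ((p * q) ^ (m + 1))) k0 sg i) \<longlongrightarrow> moduli (norm ((p0 * q) ^ (m + 1))) k0 sg i) (nhds p0)" for i
  unfolding moduli_def by (cases "i = k0") (use s in \<open>auto intro!: tendsto_intros id simp: less_imp_neq[symmetric]\<close>)
 have "eventually (%p. rad_nonres (norm p) (norm q) (moduli (norm ((p * q) ^ (m + 1))) k0 sg) (moduli (norm ((p * q) ^ (m + 1))) k0 sg)) (nhds p0)"
 proof (rule eventually_rad_nonres[OF _ _ _ _ t t])
  show "((%p. norm p) \<longlongrightarrow> norm p0) (nhds p0)" by (rule tendsto_norm) (rule filterlim_ident)
 qed (use p0 q in \<open>auto simp: tame_def\<close>)
 moreover have "eventually (%p. p \<in> -{0} \<inter> ball 0 1) (nhds p0)"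
  by (rule eventually_nhds_in_open) (use p0' in auto)
 ultimately show ?thesis by eventually_elim (auto simp: tame_def)
qed

text \<open>The Laurent coefficient, read off on the base torus. The default 0 outside the punctured
  disc lets the decay estimate hold for every p.\<close>

definition ecoeff :: "complex => ('n => int) => complex" where
 "ecoeff p kp = (if p ~= 0 & norm p < 1 then torus_coeff (%z. beta_value p q (vec_nth (pt p ro z))) kp / of_real (radial ro kp) else 0)"

lemma ecoeff_base:
 "p ~= 0 ==> norm p < 1 ==> torus_coeff (%z. beta_value p q (vec_nth (pt p ro z))) kp = ecoeff p kp * of_real (radial ro kp)"
 using radial_pos[of ro kp] rho_pos by (simp add: ecoeff_def)

text \<open>\<open>pt\<close> does not depend on the coordinate \<open>k0\<close> of the torus
  point.\<close>

lemma ecoeff_eq_0: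
 assumes k: "kp k0 ~= 0"
 shows "ecoeff p kp = 0"
proof (cases "p ~= 0 & norm p < 1")
 case True
 have "torus_coeff (%z. beta_value p q (vec_nth (pt p ro z))) kp = 0"
 proof (rule torus_coeff_independent[where r = k0 and kp = kp, OF _ _ k])
  show "continuous_on utorus (%z. beta_value p q (vec_nth (pt p ro z)))"
   by (rule continuous_on_utorus_beta[OF tame_base]) (use True rho_pos in auto)
  fix z zt
  have "(\<Prod>s\<in>-{k0}. of_real (ro s) * update_coord z k0 zt $ s) = (\<Prod>s\<in>-{k0}. of_real (ro s) * z $ s)"
   by (rule prod.cong) (auto simp: update_coord_def)
  hence "pt p ro (update_coord z k0 zt) = pt p ro z"
   by (auto simp: pt_def base_point_def vec_eq_iff update_coord_def)
  thus "beta_value p q (vec_nth (pt p ro (update_coord z k0 zt))) = beta_value p q (vec_nth (pt p ro z))" by simp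
 qed
 thus ?thesis by (simp add: ecoeff_def)
qed (auto simp add: ecoeff_def)

text \<open>ln |p| is no rational combination of ln |q| and the logarithms of the radii. The index
  \<open>i = 0\<close> contributes only the value \<open>x / 0 = 0\<close>, which is harmless
  because ln |p| < 0.\<close>

definition generic :: "complex set" where
 "generic = {p. p ~= 0 & norm p < 1 & ln (norm p) ~: range (%(i::int, j::int, f::'n => int). - (of_int j * ln (norm q) + (\<Sum>s\<in>-{k0}. of_int (f s) * ln (ro s))) / of_int i)}"

lemma generic_independent:
 assumes p: "p \<in> generic" and r: "r ~= k0" and t: "!!s. s ~: {r, k0} ==> norm (ta s) = ro s"
 shows "log_independent (- {r, k0}) (ln (norm p)) (ln (norm q)) (%s. ln (norm (ta s)))"
 unfolding log_independent_def
proof (intro allI impI)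
 fix i j :: int and f :: "'n => int"
 assume e: "of_int i * ln (norm p) + of_int j * ln (norm q) + (\<Sum>s\<in>-{r, k0}. of_int (f s) * ln (norm (ta s))) = 0"
 define f' where "f' = f(r := 0)"
 have "(\<Sum>s\<in>-{k0}. of_int (f' s) * ln (ro s)) = (\<Sum>s\<in>-{k0}-{r}. of_int (f' s) * ln (ro s))"
  using r by (subst sum.remove[of _ r]) (auto simp: f'_def)
 also have "... = (\<Sum>s\<in>-{r, k0}. of_int (f s) * ln (norm (ta s)))"
  by (rule sum.cong) (use t in \<open>auto simp: f'_def\<close>)
 finally have e': "of_int i * ln (norm p) + (of_int j * ln (norm q) + (\<Sum>s\<in>-{k0}. of_int (f' s) * ln (ro s))) = 0" using e by simp
 have i: "i = 0"
 proof (rule ccontr)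
  assume "i ~= 0"
  hence "ln (norm p) = - (of_int j * ln (norm q) + (\<Sum>s\<in>-{k0}. of_int (f' s) * ln (ro s))) / of_int i"
   using e' by (simp add: field_simps)
  hence "ln (norm p) \<in> range (%(i::int, j::int, f::'n => int). - (of_int j * ln (norm q) + (\<Sum>s\<in>-{k0}. of_int (f s) * ln (ro s))) / of_int i)"
   by (intro range_eqI[of _ _ "(i, j, f')"]) simp
  thus False using p by (simp add: generic_def)
 qed
 have "j = 0 & (\<forall>s\<in>-{k0}. f' s = 0)" by (rule independent) (use e' i in simp)
 moreover from this have "f s = 0" if "s \<in> - {r, k0}" for s
 proof -
  have "f' s = 0" using \<open>j = 0 & (\<forall>s\<in>-{k0}. f' s = 0)\<close> that by blast
  thus ?thesis using that by (simp add: f'_def)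
 qed
 ultimately show "i = 0 & j = 0 & (\<forall>s\<in>-{r, k0}. f s = 0)" using i by blast
qed

text \<open>The coordinates \<open>r\<close> and \<open>k0\<close> move inversely along an
  \<open>exch\<close> curve through each torus point. There \<open>generic_curve_extends\<close>
  yields a function holomorphic on the punctured plane, so both circles give the same Laurent
  coefficient.\<close>

lemma ecoeff_other_torus:
 assumes p: "p \<in> generic" "p \<in> tame (ro(r := R))" and r: "r ~= k0" and R: "R > 0"
 shows "torus_coeff (%z. beta_value p q (vec_nth (pt p (ro(r := R)) z))) kp = ecoeff p kp * of_real (radial (ro(r := R)) kp)"
proof -
 have p0: "p ~= 0" "norm p < 1" using p by (auto simp: generic_def)
 have R': "(ro(r := R)) s > 0" for s using R rho_pos by simp
 define C where "C = (p * q) ^ (m + 1)"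
 have C0: "C ~= 0" using p0 q by (simp add: C_def)
 have move: "torus_coeff (%z. beta_value p q (vec_nth (pt p ro z))) kp * of_real (ro r) powi (- kp r) =
  torus_coeff (%z. beta_value p q (vec_nth (pt p (ro(r := R)) z))) kp * of_real R powi (- kp r)"
 proof (rule torus_coeff_move_radius)
  show "continuous_on utorus (%z. beta_value p q (vec_nth (pt p ro z)))"
   by (rule continuous_on_utorus_beta[OF tame_base]) (use p0 rho_pos in auto)
  show "continuous_on utorus (%z. beta_value p q (vec_nth (pt p (ro(r := R)) z)))"
   by (rule continuous_on_utorus_beta[OF p(2) R'])
  fix z :: "complex ^ 'n" assume z: "z \<in> utorus"
  define D where "D = (\<Prod>s\<in>-{k0}-{r}. of_real (ro s) * z $ s)"
  have nD: "norm D = (\<Prod>s\<in>-{k0}-{r}. ro s)" unfolding D_def prod_norm[symmetric]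
   by (rule prod.cong) (use z rho_pos in \<open>auto simp: norm_mult utorus_def less_imp_le\<close>)
  have D0: "D ~= 0" using nD rho_pos by (metis less_imp_neq norm_zero prod_pos)
  define ta where "ta s = (if s = r then 1 else if s = k0 then C / D else of_real (ro s) * z $ s)" for s
  \<comment> \<open>The modulus of the curve parameter is the radius \<open>S\<close> of the
    coordinate \<open>r\<close>, and its argument is the torus coordinate.\<close>
  have curve: "monomial_curve ta (exch r k0) (of_real S * zt) = vec_nth (pt p (ro(r := S)) (update_coord z r zt))"
   if S: "S > 0" "norm zt = 1" for S zt
  proof (rule ext)
   fix s
   have "(\<Prod>s\<in>-{k0}. of_real ((ro(r := S)) s) * update_coord z r zt $ s) = of_real S * zt * (\<Prod>s\<in>-{k0}-{r}. of_real ((ro(r := S)) s) * update_coord z r zt $ s)"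
    using r by (subst prod.remove[of _ r]) (auto simp: update_coord_def)
   also have "(\<Prod>s\<in>-{k0}-{r}. of_real ((ro(r := S)) s) * update_coord z r zt $ s) = D"
    unfolding D_def by (rule prod.cong) (auto simp: update_coord_def)
   finally show "monomial_curve ta (exch r k0) (of_real S * zt) s = pt p (ro(r := S)) (update_coord z r zt) $ s"
    using r by (auto simp: monomial_curve_def exch_def ta_def pt_def base_point_def C_def update_coord_def power_int_minus field_simps)
  qed
  have "\<exists>g. g holomorphic_on (-{0}) & (\<forall>w. w ~= 0 -->
   nonresonant p q (monomial_curve ta (exch r k0) w) (monomial_curve ta (exch r k0) w) -->
   g w = beta_value p q (monomial_curve ta (exch r k0) w))"
  proof (rule generic_curve_extends[OF card q p0(2,1) r])
   show "ta s ~= 0" for s using C0 D0 rho_pos[of s] torus_nonzero[OF z] by (auto simp: ta_def)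
   have "(\<Prod>s\<in>UNIV. ta s) = ta k0 * (\<Prod>s\<in>-{k0}. ta s)"
    by (subst prod.remove[of _ k0]) (auto simp: Compl_eq_Diff_UNIV)
   also have "(\<Prod>s\<in>-{k0}. ta s) = ta r * (\<Prod>s\<in>-{k0}-{r}. ta s)" using r by (subst prod.remove[of _ r]) auto
   also have "(\<Prod>s\<in>-{k0}-{r}. ta s) = D" unfolding D_def by (rule prod.cong) (auto simp: ta_def)
   finally show "(\<Prod>s\<in>UNIV. ta s) = (p * q) ^ (m + 1)" using r D0 by (simp add: ta_def C_def)
   have nt: "norm (ta s) = ro s" if "s ~: {r, k0}" for s
    using that z rho_pos[of s] by (auto simp: ta_def norm_mult utorus_def)
   show "norm (ta s) < 1" if "s ~: {r, k0}" for s using nt[OF that] rho[of s] that by simp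
   show "log_independent (- {r, k0}) (ln (norm p)) (ln (norm q)) (%s. ln (norm (ta s)))"
    by (rule generic_independent[OF p(1) r nt])
   have "norm C <= norm q" unfolding C_def using power_Suc_le_q p0 by simp
   also have "... < (\<Prod>s\<in>-{k0}. ro s)" by (rule rho_prod)
   also have "... = ro r * norm D" using r unfolding nD by (subst prod.remove[of _ r]) auto
   also have "... <= 1 * norm D" using rho[OF r] by (intro mult_right_mono) auto
   finally show "norm (ta r * ta k0) < 1" using r D0 by (simp add: ta_def norm_divide)
  qed
  then obtain g where g: "g holomorphic_on (-{0})" "!!w. w ~= 0 ==>
   nonresonant p q (monomial_curve ta (exch r k0) w) (monomial_curve ta (exch r k0) w) ==>
   g w = beta_value p q (monomial_curve ta (exch r k0) w)" by blast
  have gS: "beta_value p q (vec_nth (pt p (ro(r := S)) (update_coord z r zt))) = g (of_real S * zt)"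
   if S: "S > 0" "norm zt = 1" "p \<in> tame (ro(r := S))" for S zt
  proof -
   have u: "update_coord z r zt \<in> utorus" using z S by (auto simp: utorus_def update_coord_def)
   have "zt ~= 0" using S by auto
   show ?thesis using g(2)[of "of_real S * zt"] tame_nonresonant[OF S(3) u] S rho_pos \<open>zt ~= 0\<close> by (simp add: curve)
  qed
  have "ro(r := ro r) = ro" by simp
  hence "\<forall>zt. norm zt = 1 --> beta_value p q (vec_nth (pt p ro (update_coord z r zt))) = g (of_real (ro r) * zt) &
    beta_value p q (vec_nth (pt p (ro(r := R)) (update_coord z r zt))) = g (of_real R * zt)"
   using gS[of "ro r"] gS[of R] tame_base[OF p0] p(2) R rho_pos by simp
  thus "\<exists>g. g holomorphic_on - {0} & (\<forall>zt. norm zt = 1 -->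
   beta_value p q (vec_nth (pt p ro (update_coord z r zt))) = g (of_real (ro r) * zt) &
   beta_value p q (vec_nth (pt p (ro(r := R)) (update_coord z r zt))) = g (of_real R * zt))" using g(1) by blast
 qed (use R rho_pos in auto)
 have rad: "radial (ro(r := S)) kp = S powi kp r * (\<Prod>s\<in>-{r}. ro s powi kp s)" for S
  unfolding radial_def by (subst prod.remove[of _ r]) (auto simp: Compl_eq_Diff_UNIV intro!: prod.cong)
 have rad0: "radial ro kp = ro r powi kp r * (\<Prod>s\<in>-{r}. ro s powi kp s)" using rad[of "ro r"] by simp
 have "torus_coeff (%z. beta_value p q (vec_nth (pt p (ro(r := R)) z))) kp * of_real R powi (- kp r) = ecoeff p kp * of_real (\<Prod>s\<in>-{r}. ro s powi kp s)"
  unfolding move[symmetric] ecoeff_base[OF p0] rad0 using rho_pos[of r] by (simp add: power_int_minus)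
 thus ?thesis unfolding rad using R by (simp add: power_int_minus field_simps)
qed

text \<open>On the segment from \<open>p0\<close> to 0 only countably many points fail to be
  generic.\<close>

lemma generic_dense:
 assumes p0: "p0 ~= 0" "norm p0 < 1"
 shows "at p0 within generic ~= bot"
proof -
 have "p0 islimpt generic" unfolding islimpt_approachable
 proof (intro allI impI)
  fix e :: real assume e: "e > 0"
  define X where "X = range (%(i::int, j::int, f::'n => int). - (of_int j * ln (norm q) + (\<Sum>s\<in>-{k0}. of_int (f s) * ln (ro s))) / of_int i)"
  define Z where "Z = exp ` ((%x. x - ln (norm p0)) ` X)"
  have "countable Z" unfolding Z_def X_def by simp
  define a where "a = max (1/2) (1 - e)"
  have a: "1/2 <= a" "1 - e <= a" "a < 1" using e by (auto simp: a_def)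
  have "\<not> {a<..<1} \<subseteq> Z" using \<open>countable Z\<close> uncountable_open_interval[of a 1] a countable_subset by blast
  then obtain x where x: "a < x" "x < 1" "x ~: Z" by (meson greaterThanLessThan_iff subsetI)
  have x0: "x > 0" using x a by simp
  have "ln (norm (of_real x * p0)) = ln x + ln (norm p0)" using x0 p0 by (simp add: norm_mult ln_mult)
  moreover have "ln x + ln (norm p0) ~: X"
  proof
   assume "ln x + ln (norm p0) \<in> X"
   hence "exp (ln x) \<in> Z" unfolding Z_def by (intro imageI) (force intro: image_eqI[of _ _ "ln x + ln (norm p0)"])
   thus False using x x0 by simp
  qed
  moreover have "norm (of_real x * p0) < 1" using p0 x0 x mult_strict_mono[of x 1 "norm p0" 1] by (simp add: norm_mult)
  ultimately have "of_real x * p0 \<in> generic" using p0 x0 unfolding generic_def X_def by simp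
  moreover have "of_real x * p0 ~= p0" using p0 x by simp
  moreover have "dist (of_real x * p0) p0 < e"
  proof -
   have "of_real x * p0 - p0 = of_real (x - 1) * p0" by (simp add: algebra_simps)
   hence "dist (of_real x * p0) p0 = (1 - x) * norm p0" using x by (simp add: dist_norm norm_mult del: of_real_diff)
   also have "... <= (1 - x) * 1" using x p0 by (intro mult_left_mono) auto
   finally show ?thesis using x a by simp
  qed
  ultimately show "\<exists>x'\<in>generic. x' ~= p0 & dist x' p0 < e" by blast
 qed
 thus ?thesis by (simp add: trivial_limit_within)
qed

text \<open>The coefficients for generic p near \<open>p0\<close> are bounded on all required tori,
  with constants due to continuity at \<open>p0\<close>. The resulting estimate passes to
  \<open>p0\<close>, because its coefficients are limits of those at generic p; this limit is taken
  on the base torus, which is tame for every p.\<close>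

lemma ecoeff_decay:
 assumes x: "x > 0"
 shows "\<exists>C. \<forall>kp. norm (ecoeff p0 kp) <= C * x ^ dsize kp"
proof (cases "p0 ~= 0 & norm p0 < 1")
 case True
 hence p0: "p0 ~= 0" "norm p0 < 1" by auto
 define C0 where "C0 = norm ((p0 * q) ^ (m + 1))"
 have C0: "0 < C0" "C0 <= norm q" using power_Suc_le_q[of p0] p0 q by (auto simp: C0_def)
 have tori: "\<exists>R>a. R < b & (\<exists>C. eventually (%p. \<forall>kp. norm (ecoeff p kp) * radial (ro(r := R)) kp <= C) (at p0 within generic))"
  if r: "r ~= k0" and ab: "0 <= a" "a < b" for r a b
 proof -
  obtain R where R: "a < R" "R < b" "rad_nonres (norm p0) (norm q) (moduli C0 k0 (ro(r := R))) (moduli C0 k0 (ro(r := R)))"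
   by (rule exists_nonresonant_radius[OF r rho_pos C0(1) base_moduli_less_1[OF C0], of "norm p0" "norm q" a b]) (use p0 q ab in auto)
  have R0: "R > 0" using R ab by simp
  have pos: "(ro(r := R)) s > 0" for s using R0 rho_pos by simp
  have t: "p0 \<in> tame (ro(r := R))" using R p0 by (simp add: tame_def C0_def)
  obtain C where "eventually (%p. \<forall>kp. norm (torus_coeff (%z. beta_value p q (vec_nth (pt p (ro(r := R)) z))) kp) <= C) (at p0 within tame (ro(r := R)))"
   using torus_coeff_tendsto(2)[OF continuous_on_torus_beta t] pos by blast
  hence "eventually (%p. p \<in> tame (ro(r := R)) --> (\<forall>kp. norm (torus_coeff (%z. beta_value p q (vec_nth (pt p (ro(r := R)) z))) kp) <= C)) (at p0)"
   unfolding eventually_at_filter by (auto elim: eventually_mono)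
  moreover have "eventually (%p. p \<in> tame (ro(r := R))) (at p0)"
   unfolding eventually_at_filter by (rule eventually_mono[OF eventually_tame[OF t pos]]) blast
  ultimately have "eventually (%p. p \<in> tame (ro(r := R)) & (\<forall>kp. norm (torus_coeff (%z. beta_value p q (vec_nth (pt p (ro(r := R)) z))) kp) <= C)) (at p0)"
   by eventually_elim auto
  hence ev: "eventually (%p. p \<in> generic --> p \<in> tame (ro(r := R)) & (\<forall>kp. norm (torus_coeff (%z. beta_value p q (vec_nth (pt p (ro(r := R)) z))) kp) <= C)) (at p0)"
   by (auto elim: eventually_mono)
  hence "eventually (%p. p \<in> generic & p \<in> tame (ro(r := R)) & (\<forall>kp. norm (torus_coeff (%z. beta_value p q (vec_nth (pt p (ro(r := R)) z))) kp) <= C)) (at p0 within generic)"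
   unfolding eventually_at_filter by (auto elim: eventually_mono)
  hence "eventually (%p. \<forall>kp. norm (ecoeff p kp) * radial (ro(r := R)) kp <= C) (at p0 within generic)"
  proof (rule eventually_mono)
   fix p assume p: "p \<in> generic & p \<in> tame (ro(r := R)) & (\<forall>kp. norm (torus_coeff (%z. beta_value p q (vec_nth (pt p (ro(r := R)) z))) kp) <= C)"
   show "\<forall>kp. norm (ecoeff p kp) * radial (ro(r := R)) kp <= C"
   proof
    fix kp
    have "norm (ecoeff p kp) * radial (ro(r := R)) kp = norm (ecoeff p kp * of_real (radial (ro(r := R)) kp))"
     using radial_pos[of "ro(r := R)" kp] pos by (simp add: norm_mult)
    also have "... <= C" using p ecoeff_other_torus[of p r R kp] r R0 by (metis (no_types, lifting))
    finally show "norm (ecoeff p kp) * radial (ro(r := R)) kp <= C" .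
   qed
  qed
  thus ?thesis using R by blast
 qed
 have rapid: "rapid_decay (at p0 within generic) ecoeff"
 proof (rule rapid_decay_from_tori[where ro = ro and ?k0.0 = k0])
  show "\<exists>R>0. \<exists>C. T <= R & eventually (%p. \<forall>kp. norm (ecoeff p kp) * radial (ro(r := R)) kp <= C) (at p0 within generic)" if "r ~= k0" for r T
   using tori[OF that, of "max T 0" "max T 0 + 1"] by force
  show "\<exists>R>0. \<exists>C. T <= 1 / R & eventually (%p. \<forall>kp. norm (ecoeff p kp) * radial (ro(r := R)) kp <= C) (at p0 within generic)" if rk: "r ~= k0" for r T
  proof -
   define M where "M = max T 1"
   have M: "T <= M" "1 <= M" by (auto simp: M_def)
   hence "0 < 1 / M" by simp
   from tori[OF rk order_refl this] obtain R C where R: "R > 0" "R < 1 / M"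
    "eventually (%p. \<forall>kp. norm (ecoeff p kp) * radial (ro(r := R)) kp <= C) (at p0 within generic)" by blast
   have "M < 1 / R" using R(1,2) M(2) by (simp add: field_simps)
   hence "T <= 1 / R" using M(1) by simp
   thus ?thesis using R(1,3) by blast
  qed
 qed (use rho_pos card ecoeff_eq_0 in auto)
 then obtain C where C: "eventually (%p. \<forall>kp. norm (ecoeff p kp) <= C * x ^ dsize kp) (at p0 within generic)"
  using x unfolding rapid_decay_def by blast
 have "norm (ecoeff p0 kp) <= C * x ^ dsize kp" for kp
 proof (rule tendsto_upperbound)
  have "((%p. torus_coeff (%z. beta_value p q (vec_nth (pt p ro z))) kp) \<longlongrightarrow> torus_coeff (%z. beta_value p0 q (vec_nth (pt p0 ro z))) kp) (at p0 within tame ro)"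
   using torus_coeff_tendsto(1)[OF continuous_on_torus_beta tame_base[OF p0]] rho_pos by blast
  moreover have "generic \<subseteq> tame ro" using tame_base by (auto simp: generic_def)
  ultimately have "((%p. torus_coeff (%z. beta_value p q (vec_nth (pt p ro z))) kp) \<longlongrightarrow> torus_coeff (%z. beta_value p0 q (vec_nth (pt p0 ro z))) kp) (at p0 within generic)"
   by (rule tendsto_within_subset)
  hence "((%p. norm (torus_coeff (%z. beta_value p q (vec_nth (pt p ro z))) kp / of_real (radial ro kp))) \<longlongrightarrow> norm (torus_coeff (%z. beta_value p0 q (vec_nth (pt p0 ro z))) kp / of_real (radial ro kp))) (at p0 within generic)"
   by (intro tendsto_intros) (use radial_pos[of ro kp] rho_pos in auto)
  moreover have "eventually (%p. norm (torus_coeff (%z. beta_value p q (vec_nth (pt p ro z))) kp / of_real (radial ro kp)) = norm (ecoeff p kp)) (at p0 within generic)"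
   unfolding eventually_at_filter by (rule always_eventually) (auto simp: generic_def ecoeff_def)
  ultimately show "((%p. norm (ecoeff p kp)) \<longlongrightarrow> norm (ecoeff p0 kp)) (at p0 within generic)"
   using p0 by (simp add: ecoeff_def[of p0] tendsto_cong)
  show "eventually (%p. norm (ecoeff p kp) <= C * x ^ dsize kp) (at p0 within generic)"
   using C by (rule eventually_mono) blast
 qed (rule generic_dense[OF p0])
 thus ?thesis by blast
qed (auto simp: ecoeff_def intro!: exI[of _ 0])

definition eseries :: "complex => complex ^ 'n => complex" where
 "eseries p t = (\<Sum>\<^sub>\<infinity>kp. ecoeff p kp * monomial kp t)"

lemma eseries_base:
 assumes p: "p ~= 0" "norm p < 1" and z: "z \<in> utorus"
 shows "eseries p (pt p ro z) = beta_value p q (vec_nth (pt p ro z))"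
proof -
 define f where "f = (%z. beta_value p q (vec_nth (pt p ro z)))"
 have cf: "continuous_on utorus f" unfolding f_def by (rule continuous_on_utorus_beta[OF tame_base[OF p] rho_pos])
 have c: "torus_coeff f kp = ecoeff p kp * of_real (radial ro kp)" for kp unfolding f_def by (rule ecoeff_base[OF p])
 have "rapid_decay (top :: unit filter) (%_. ecoeff p)" unfolding rapid_decay_def using ecoeff_decay by simp
 from rapid_decay_radial[where sg = ro, OF this rho_pos] have "\<exists>C. \<forall>kp. norm (ecoeff p kp * of_real (radial ro kp)) <= C * (1/2) ^ dsize kp"
  unfolding rapid_decay_def by (elim allE[of _ "1/2"]) simp
 then obtain C where "\<forall>kp. norm (torus_coeff f kp) <= C * (1/2) ^ dsize kp" unfolding c by blast
 hence "(%kp. norm (torus_coeff f kp)) summable_on UNIV" by (intro abs_summable_rapid) blast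
 from torus_inversion[OF cf this z] have "f z = (\<Sum>\<^sub>\<infinity>kp. torus_coeff f kp * monomial kp z)" .
 also have "... = (\<Sum>\<^sub>\<infinity>kp. ecoeff p kp * monomial kp (pt p ro z))"
 proof (rule infsum_cong)
  fix kp
  show "torus_coeff f kp * monomial kp z = ecoeff p kp * monomial kp (pt p ro z)"
   by (cases "kp k0 = 0") (simp_all add: c pt_def monomial_base_point ecoeff_eq_0)
 qed
 finally show ?thesis by (simp add: f_def eseries_def)
qed

section \<open>Identification of the series with \<open>E_m\<close>\<close>

lemma H_m_nonzero:
 fixes t :: "complex ^ 'n"
 assumes "p ~= 0" "t \<in> H_m m p q"
 shows "t $ r ~= 0"
proof
 assume "t $ r = 0"
 hence "(\<Prod>r\<in>UNIV. t $ r) = 0" by (intro prod_zero) auto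
 moreover have "(p * q) ^ (m + 1) ~= 0" using assms(1) q by simp
 ultimately show False using assms(2) unfolding H_m_def by (metis mem_Collect_eq)
qed

lemma holomorphic_on_eseries:
 fixes t :: "complex => complex ^ 'n"
 assumes "open U" "!!r. (%w. t w $ r) holomorphic_on U" "!!w r. w \<in> U ==> t w $ r ~= 0"
 shows "(%w. eseries p (t w)) holomorphic_on U"
 unfolding eseries_def by (rule holomorphic_on_laurent[OF ecoeff_decay]) (use assms in auto)

text \<open>\<open>d\<close> is the logarithm of the ratio of the moduli of \<open>t\<close> to
  those of the base torus. These ratios multiply to 1, so the curve stays in \<open>H_m\<close>;
  imaginary parameters leave the moduli on the base torus.\<close>

lemma radial_curve:
 assumes p: "p ~= 0" "norm p < 1" and t: "t \<in> H_m m p q"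
 obtains ta d :: "'n => complex" where "!!r. 0 < norm (ta r) & norm (ta r) < 1" "exp_curve ta d 1 = vec_nth t"
  "!!w. (\<chi> r. exp_curve ta d w r) \<in> H_m m p q"
  "!!y::real. \<exists>z\<in>utorus. exp_curve ta d (\<i> * y) = vec_nth (pt p ro z)"
proof -
 define C where "C = (p * q) ^ (m + 1)"
 have C: "0 < norm C" "norm C <= norm q" using power_Suc_le_q[of p] p q by (auto simp: C_def)
 define \<mu> where "\<mu> = moduli (norm C) k0 ro"
 have \<mu>: "\<mu> r > 0" "\<mu> r < 1" for r using moduli_pos[OF C(1) rho_pos] base_moduli_less_1[OF C] by (auto simp: \<mu>_def)
 note nz = H_m_nonzero[OF p(1) t]
 have pt: "(\<Prod>r\<in>UNIV. t $ r) = C" using t by (simp add: H_m_def C_def)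
 have prod_mu: "(\<Prod>r\<in>UNIV. \<mu> r) = norm C"
 proof -
  have "(\<Prod>r\<in>UNIV. \<mu> r) = \<mu> k0 * (\<Prod>s\<in>-{k0}. \<mu> s)" by (subst prod.remove[of _ k0]) (auto simp: Compl_eq_Diff_UNIV)
  also have "(\<Prod>s\<in>-{k0}. \<mu> s) = (\<Prod>s\<in>-{k0}. ro s)" by (rule prod.cong) (auto simp: \<mu>_def moduli_def)
  finally show ?thesis using rho_pos by (simp add: \<mu>_def moduli_def less_imp_neq[symmetric])
 qed
 define ta where "ta r = of_real (\<mu> r) * (t $ r / of_real (norm (t $ r)))" for r
 define d where "d r = (of_real (ln (norm (t $ r) / \<mu> r)) :: complex)" for r
 have ntau: "norm (ta r) = \<mu> r" for r using \<mu>[of r] nz by (simp add: ta_def norm_mult norm_divide)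
 have curve1: "exp_curve ta d 1 r = t $ r" for r
 proof -
  have "exp (d r) = of_real (norm (t $ r) / \<mu> r)" unfolding d_def exp_of_real using nz[of r] \<mu>[of r] by simp
  thus ?thesis using nz[of r] \<mu>[of r] by (simp add: exp_curve_def ta_def)
 qed
 have sum_d: "(\<Sum>r\<in>UNIV. d r) = 0"
 proof -
  have "(\<Sum>r\<in>UNIV. ln (norm (t $ r) / \<mu> r)) = ln (\<Prod>r\<in>UNIV. norm (t $ r) / \<mu> r)"
  proof (rule ln_prod[symmetric])
   fix r
   have "norm (t $ r) / \<mu> r > 0" using nz[of r] \<mu>(1)[of r] by simp
   thus "norm (t $ r) / \<mu> r ~= 0" by linarith
  qed simp
  also have "(\<Prod>r\<in>UNIV. norm (t $ r) / \<mu> r) = 1" using C(1) prod_mu by (simp add: prod_dividef prod_norm pt)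
  finally show ?thesis unfolding d_def by (metis ln_one of_real_0 of_real_sum)
 qed
 have prod_curve: "(\<Prod>r\<in>UNIV. exp_curve ta d w r) = C" for w
 proof -
  have "(\<Prod>r\<in>UNIV. exp_curve ta d w r) = (\<Prod>r\<in>UNIV. ta r) * exp (w * (\<Sum>r\<in>UNIV. d r))"
   by (simp add: exp_curve_def prod.distrib exp_sum sum_distrib_left)
  also have "(\<Prod>r\<in>UNIV. ta r) = of_real (\<Prod>r\<in>UNIV. \<mu> r) * ((\<Prod>r\<in>UNIV. t $ r) / of_real (norm (\<Prod>r\<in>UNIV. t $ r)))"
   by (simp add: ta_def prod.distrib prod_dividef of_real_prod flip: prod_norm)
  also have "... = C" using C(1) by (simp add: prod_mu pt)
  finally show ?thesis by (simp add: sum_d)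
 qed
 have curve_nz: "exp_curve ta d w r ~= 0" for w r using ntau[of r] \<mu>[of r] by (auto simp: exp_curve_def)
 have imag: "\<exists>z\<in>utorus. exp_curve ta d (\<i> * y) = vec_nth (pt p ro z)" for y :: real
 proof -
  define z :: "complex ^ 'n" where "z = (\<chi> r. t $ r / of_real (norm (t $ r)) * exp (\<i> * of_real y * d r))"
  have z: "z \<in> utorus" using nz by (simp add: z_def utorus_def norm_mult norm_divide d_def)
  have e: "(\<chi> r. exp_curve ta d (\<i> * y) r) = pt p ro z" unfolding pt_def C_def[symmetric]
  proof (rule base_point_eqI)
   fix r assume "r ~= k0"
   thus "(\<chi> r. exp_curve ta d (\<i> * y) r) $ r = of_real (ro r) * z $ r"
    by (simp add: z_def exp_curve_def ta_def \<mu>_def moduli_def)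
  qed (use prod_curve curve_nz in auto)
  hence "exp_curve ta d (\<i> * y) = vec_nth (pt p ro z)" by (metis ext vec_lambda_beta)
  thus ?thesis using z by blast
 qed
 show ?thesis
 proof (rule that)
  show "0 < norm (ta r) & norm (ta r) < 1" for r using ntau \<mu> by simp
  show "exp_curve ta d 1 = vec_nth t" using curve1 by auto
  show "(\<chi> r. exp_curve ta d w r) \<in> H_m m p q" for w using prod_curve by (simp add: H_m_def C_def)
 qed (rule imag)
qed

lemma small_nonresonant:
 assumes "!!r. norm (a r) < 1" "!!r. norm (b r) < 1" "norm p < 1"
 shows "nonresonant p q a b"
proof (rule nonresonant_radial)
 show "rad_nonres (norm p) (norm q) (%r. norm (a r)) (%r. norm (b r))"
 proof (rule rad_nonres_small)
  fix i i'
  have "norm (a i) * norm (b i') < 1 * 1" by (rule mult_strict_mono) (use assms in auto)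
  thus "0 <= norm (a i) * norm (b i') & norm (a i) * norm (b i') < 1" by simp
 qed (use assms q in auto)
qed auto

text \<open>On the base torus this is Fourier inversion (\<open>eseries_base\<close>);
  \<open>exp_curve_identity\<close> carries it along \<open>radial_curve\<close> to
  \<open>t\<close>.\<close>

lemma eseries_eq_beta_value:
 assumes p: "p ~= 0" "norm p < 1" and t: "t \<in> H_m m p q" and nr: "nonresonant p q (vec_nth t) (vec_nth t)"
 shows "eseries p t = beta_value p q (vec_nth t)"
proof -
 obtain ta d :: "'n => complex" where ta: "!!r. 0 < norm (ta r) & norm (ta r) < 1" and curve1: "exp_curve ta d 1 = vec_nth t"
  and H: "!!w. (\<chi> r. exp_curve ta d w r) \<in> H_m m p q"
  and imag: "!!y::real. \<exists>z\<in>utorus. exp_curve ta d (\<i> * y) = vec_nth (pt p ro z)"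
  using radial_curve[OF p t] by metis
 have curve_nz: "exp_curve ta d w r ~= 0" for w r using ta[of r] by (auto simp: exp_curve_def)
 have hol_curve: "(%w. exp_curve ta d w r) holomorphic_on U" for U r
  unfolding exp_curve_def by (intro holomorphic_intros)
 define f g where "f = (%w. eseries p (\<chi> r. exp_curve ta d w r))" and "g = (%w. beta_value p q (exp_curve ta d w))"
 have "f 1 = g 1"
 proof (rule exp_curve_identity[where f = f and g = g and w = 1, OF q(1) p(2)])
  define N where "N = {w. nonresonant p q (exp_curve ta d w) (exp_curve ta d w)}"
  have N: "open N" unfolding N_def
   using open_nonresonant[OF q(1) p(2) open_UNIV, where A = "exp_curve ta d" and B = "exp_curve ta d"]
    holomorphic_on_imp_continuous_on[OF hol_curve] by simp
  show "f holomorphic_on {w. nonresonant p q (exp_curve ta d w) (exp_curve ta d w)}" unfolding f_def N_def[symmetric]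
   by (rule holomorphic_on_eseries[OF N]) (use hol_curve curve_nz in auto)
  show "g holomorphic_on {w. nonresonant p q (exp_curve ta d w) (exp_curve ta d w)}" unfolding g_def N_def[symmetric]
   by (rule holomorphic_on_beta_value[OF q(1) p(2) N]) (use hol_curve curve_nz in \<open>auto simp: N_def\<close>)
  show "nonresonant p q (exp_curve ta d 1) (exp_curve ta d 1)" using nr curve1 by simp
  show "ta x * ta y * p ^ j * q ^ k ~= 1" for x y j k
   using small_nonresonant[of ta ta p] ta p by (simp add: nonresonant_def)
  fix y :: real
  obtain z where z: "z \<in> utorus" and e: "exp_curve ta d (\<i> * y) = vec_nth (pt p ro z)" using imag by blast
  have e': "(\<chi> r. exp_curve ta d (\<i> * y) r) = pt p ro z" unfolding e by (simp add: vec_eq_iff)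
  show "nonresonant p q (exp_curve ta d (\<i> * y)) (exp_curve ta d (\<i> * y)) & f (\<i> * y) = g (\<i> * y)"
   unfolding f_def g_def e' unfolding e using tame_nonresonant[OF tame_base[OF p] z rho_pos] eseries_base[OF p z] by simp
 qed
 moreover have "(\<chi> r. exp_curve ta d 1 r) = t" using curve1 by (simp add: vec_eq_iff)
 ultimately show ?thesis using curve1 by (simp add: f_def g_def)
qed

lemma analytic_on_H_eseries:
 assumes p: "p ~= 0"
 shows "analytic_on_H m p q (eseries p)"
 unfolding analytic_on_H_def Let_def
proof (intro allI conjI ballI impI)
 fix k :: 'n
 define C where "C = (p * q) ^ (m + 1)"
 have C: "C ~= 0" using p q by (simp add: C_def)
 define D where "D = {s::complex ^ 'n. \<forall>r. r ~= k --> s $ r ~= 0}"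
 define h where "h s = (\<chi> r. if r = k then C / (\<Prod>r'\<in>- {k}. s $ r') else s $ r)" for s :: "complex ^ 'n"
 have nz: "(\<Prod>r'\<in>- {k}. s $ r') ~= 0" if "s \<in> D" for s using that by (auto simp: D_def)
 have hnz: "h s $ r ~= 0" if "s \<in> D" for s r using that nz[OF that] C by (auto simp: h_def D_def)
 have "continuous_on D (%s. eseries p (h s))"
 proof (rule continuous_on_compose2[of "{t::complex ^ 'n. \<forall>r. t $ r ~= 0}"])
  show "continuous_on {t::complex ^ 'n. \<forall>r. t $ r ~= 0} (eseries p)" unfolding eseries_def by (rule continuous_on_laurent[OF ecoeff_decay])
  show "continuous_on D h" unfolding h_def
  proof (rule continuous_on_vec_lambda)
   show "continuous_on D (%s. if r = k then C / (\<Prod>r'\<in>- {k}. s $ r') else s $ r)" for r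
    by (cases "r = k") (use nz in \<open>auto intro!: continuous_intros simp: D_def\<close>)
  qed
 qed (use hnz in auto)
 thus "continuous_on {s. \<forall>r. r ~= k --> s $ r ~= 0} (%s. eseries p (\<chi> r. if r = k then (p * q) ^ (m + 1) / (\<Prod>r'\<in>- {k}. s $ r') else s $ r))"
  unfolding D_def h_def C_def .
 fix s :: "complex ^ 'n" and i assume s: "s \<in> {s. \<forall>r. r ~= k --> s $ r ~= 0}" and i: "i ~= k"
 define u where "u w = (\<chi> r. if r = i then w else s $ r)" for w
 have uD: "u w \<in> D" if "w \<in> -{0}" for w using that s i by (auto simp: u_def D_def)
 have hu: "(%w. u w $ r) holomorphic_on -{0}" for r by (cases "r = i") (auto simp: u_def intro!: holomorphic_intros)
 have "(%w. eseries p (h (u w))) holomorphic_on -{0}"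
 proof (rule holomorphic_on_eseries)
  show "(%w. h (u w) $ r) holomorphic_on -{0}" for r
   by (cases "r = k") (use uD in \<open>auto simp: h_def D_def intro!: holomorphic_intros hu\<close>)
 qed (use hnz uD in auto)
 thus "(%w. eseries p (\<chi> r. if r = k then (p * q) ^ (m + 1) / (\<Prod>r'\<in>- {k}. (\<chi> r. if r = i then w else s $ r) $ r') else (\<chi> r. if r = i then w else s $ r) $ r)) field_differentiable at (s $ i)"
  using s i unfolding h_def u_def C_def by (intro holomorphic_on_imp_differentiable_at) auto
qed

text \<open>\<open>eseries\<close> shows that a continuation exists. Any continuation agrees with it
  where a contour exists, which along a suitable curve through \<open>t\<close> fails only at
  countably many points; continuity settles the others.\<close>

lemma E_m_eq_eseries:
 assumes p: "p ~= 0" "norm p < 1" and t: "t \<in> H_m m p q"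
 shows "E_m m p q t = eseries p t"
proof -
 define P where "P = (%F. analytic_on_H m p q F & (\<forall>t\<in>H_m m p q. (\<exists>gm. E_admissible p q t gm) --> F t = E_int p q (t :: complex ^ 'n)))"
 have "P (eseries p)" unfolding P_def
 proof (intro conjI ballI impI analytic_on_H_eseries p)
  fix t :: "complex ^ 'n" assume t: "t \<in> H_m m p q" and "\<exists>gm. E_admissible p q t gm"
  hence "nonresonant p q (vec_nth t) (vec_nth t)" using E_admissible_nonresonant by blast
  thus "eseries p t = E_int p q t"
   using eseries_eq_beta_value[OF p t] E_int_eq_beta_value[OF q p(2,1) H_m_nonzero[OF p(1) t]] by simp
 qed
 moreover have "E_m m p q = (SOME F. P F)" unfolding E_m_def P_def ..
 ultimately have "P (E_m m p q)" by (simp only: someI)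
 hence an: "analytic_on_H m p q (E_m m p q :: complex ^ 'n => complex)"
  and agree: "!!t. t \<in> H_m m p q ==> \<exists>gm. E_admissible p q t gm ==> E_m m p q t = E_int p q (t :: complex ^ 'n)" unfolding P_def by auto
 note nz = H_m_nonzero[OF p(1) t]
 define C where "C = (p * q) ^ (m + 1)"
 \<comment> \<open>No two of the exponents 1 and -(2m+5) add up to 0, so no resonance persists along
   the curve; all of them together add up to 0, so the curve stays in \<open>H_m\<close>.\<close>
 define d where "d r = (if r = k0 then - of_nat (2 * m + 5) else 1 :: complex)" for r
 have sum_d: "(\<Sum>r\<in>UNIV. d r) = 0"
 proof -
  have "(\<Sum>r\<in>UNIV. d r) = d k0 + (\<Sum>r\<in>-{k0}. d r)" by (subst sum.remove[of _ k0]) (auto simp: Compl_eq_Diff_UNIV)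
  also have "(\<Sum>r\<in>-{k0}. d r) = of_nat (card (-{k0}))" by (simp add: d_def)
  also have "card (-{k0}) = 2 * m + 5" using card by (simp add: Compl_eq_Diff_UNIV card_Diff_singleton)
  finally show ?thesis by (simp add: d_def)
 qed
 define T where "T w = (\<chi> r. exp_curve (vec_nth t) d w r)" for w
 have T0: "T 0 = t" by (simp add: T_def exp_curve_def vec_eq_iff)
 have Tnz: "T w $ r ~= 0" for w r using nz by (simp add: T_def exp_curve_def)
 have TH: "T w \<in> H_m m p q" for w
 proof -
  have "(\<Prod>r\<in>UNIV. T w $ r) = (\<Prod>r\<in>UNIV. t $ r) * exp (w * (\<Sum>r\<in>UNIV. d r))"
   by (simp add: T_def exp_curve_def prod.distrib exp_sum sum_distrib_left)
  thus ?thesis using t by (simp add: sum_d H_m_def)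
 qed
 have contT: "continuous_on UNIV T" unfolding T_def exp_curve_def
  by (rule continuous_on_vec_lambda) (intro continuous_intros)
 define B where "B = {w. \<not> nonresonant p q (exp_curve (vec_nth t) d w) (exp_curve (vec_nth t) d w)}"
 have B: "countable B" unfolding B_def
 proof (rule exp_curve_countable_resonances)
  fix x y :: 'n and j k assume "d x + d y = 0"
  hence "Re (d x + d y) = 0" by simp
  thus "t $ x * t $ y * p ^ j * q ^ k ~= 1" by (auto simp: d_def split: if_splits)
 qed
 have eq: "E_m m p q (T w) = eseries p (T w)" if "w ~: B" for w
 proof -
  have "nonresonant p q (vec_nth (T w)) (vec_nth (T w))" using that by (simp add: B_def T_def nonresonant_def)
  thus ?thesis using agree[OF TH E_admissible_exists[OF q p(2,1) Tnz]] E_int_eq_beta_value[OF q p(2,1) Tnz]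
   eseries_eq_beta_value[OF p TH] by simp
 qed
 have contE: "continuous_on UNIV (%w. E_m m p q (T w))"
 proof -
  define D where "D = {s::complex ^ 'n. \<forall>r. r ~= k0 --> s $ r ~= 0}"
  define G where "G s = E_m m p q (\<chi> r. if r = k0 then C / (\<Prod>r'\<in>- {k0}. s $ r') else s $ r)" for s :: "complex ^ 'n"
  have "continuous_on D G" using an unfolding analytic_on_H_def Let_def D_def G_def C_def by blast
  hence "continuous_on UNIV (%w. G (T w))"
   by (rule continuous_on_compose2[OF _ contT]) (use Tnz in \<open>auto simp: D_def\<close>)
  moreover have "(\<chi> r. if r = k0 then C / (\<Prod>r'\<in>- {k0}. T w $ r') else T w $ r) = T w" for w
  proof -
   have "(\<Prod>r\<in>UNIV. T w $ r) = T w $ k0 * (\<Prod>r\<in>-{k0}. T w $ r)"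
    by (subst prod.remove[of _ k0]) (auto simp: Compl_eq_Diff_UNIV)
   hence "C = T w $ k0 * (\<Prod>r\<in>-{k0}. T w $ r)" using TH[of w] by (simp add: H_m_def C_def)
   thus ?thesis using Tnz by (auto simp: vec_eq_iff)
  qed
  ultimately show ?thesis by (simp add: G_def)
 qed
 have contF: "continuous_on UNIV (%w. eseries p (T w))"
  using holomorphic_on_imp_continuous_on[OF holomorphic_on_eseries[OF open_UNIV, of T p]] Tnz
  by (simp add: T_def exp_curve_def holomorphic_intros)
 have "{w. E_m m p q (T w) ~= eseries p (T w)} = {}"
 proof (rule ccontr)
  assume ne: "{w. E_m m p q (T w) ~= eseries p (T w)} ~= {}"
  have "open {w. E_m m p q (T w) ~= eseries p (T w)}" by (rule open_Collect_neq[OF contE contF])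
  then obtain w e where "e > 0" "ball w e \<subseteq> {w. E_m m p q (T w) ~= eseries p (T w)}"
   using ne by (meson ex_in_conv openE)
  moreover have "{w. E_m m p q (T w) ~= eseries p (T w)} \<subseteq> B" using eq by auto
  ultimately show False using uncountable_ball[of e w] B by (meson countable_subset)
 qed
 hence "E_m m p q (T 0) = eseries p (T 0)" by blast
 thus ?thesis by (simp add: T0)
qed

end

section \<open>Limits of the coefficients\<close>

lemma norm_powr_of_real: "p ~= 0 ==> norm ((p::complex) powr of_real a) = norm p powr a"
 by (simp add: powr_def norm_exp_eq_Re)

lemma tendsto_powr_of_real_0:
 assumes c: "c > 0"
 shows "((%p::complex. p powr of_real c) \<longlongrightarrow> 0) (at 0)"
proof (rule tendsto_norm_zero_cancel)
 have "((%p::complex. norm p powr c) \<longlongrightarrow> 0 powr c) (at 0)"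
  by (rule tendsto_powr') (use c in \<open>auto intro!: tendsto_norm_zero tendsto_ident_at tendsto_const\<close>)
 hence "((%p::complex. norm p powr c) \<longlongrightarrow> 0) (at 0)" by simp
 moreover have "eventually (%p::complex. norm p powr c = norm (p powr of_real c)) (at 0)"
  unfolding eventually_at_filter by (rule always_eventually) (simp add: norm_powr_of_real)
 ultimately show "((%p::complex. norm (p powr of_real c)) \<longlongrightarrow> 0) (at 0)"
  by (rule Lim_transform_eventually)
qed

lemma at_within_eventually:
 assumes "eventually (%x. x \<in> U) (nhds a)"
 shows "at a within U = at a"
proof -
 obtain W where W: "open W" "a \<in> W" "!!x. x \<in> W ==> x \<in> U" using assms unfolding eventually_nhds by blast
 show ?thesis by (rule at_within_nhd[OF W(2,1)]) (use W(3) in auto)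
qed

definition dot :: "('n::finite => int) => real ^ 'n => real" where
 "dot kp af = (\<Sum>r\<in>UNIV. of_int (kp r) * af $ r)"

lemma dot_convex: "dot kp ((1 - s) *\<^sub>R af + s *\<^sub>R be) = (1 - s) * dot kp af + s * dot kp be"
 by (simp add: dot_def sum_distrib_left sum.distrib[symmetric] algebra_simps)

lemma monomial_pscale:
 assumes "p ~= 0"
 shows "monomial kp (pscale u p af) = monomial kp u * p powr of_real (dot kp af)"
proof -
 have "(p powr of_real (af $ r)) powi kp r = exp (of_real (of_int (kp r) * af $ r) * Ln p)" for r
  using assms by (simp add: powr_def exp_power_int mult_ac)
 hence "(\<Prod>r\<in>UNIV. (p powr of_real (af $ r)) powi kp r) = exp (\<Sum>r\<in>UNIV. of_real (of_int (kp r) * af $ r) * Ln p)"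
  by (simp add: exp_sum)
 also have "... = p powr of_real (dot kp af)"
  using assms unfolding dot_def of_real_sum by (simp only: powr_def sum_distrib_right if_False)
 finally show ?thesis
  by (simp add: monomial_def pscale_def power_int_mult_distrib prod.distrib)
qed

lemma pscale_in_H_m:
 fixes u :: "complex ^ 'n::finite" and af :: "real ^ 'n"
 assumes "p ~= 0" "u \<in> Htilde_m m q" "(\<Sum>r\<in>UNIV. af $ r) = real (m + 1)"
 shows "pscale u p af \<in> H_m m p q"
proof -
 have "(\<Prod>r\<in>UNIV. p powr of_real (af $ r)) = exp (\<Sum>r\<in>UNIV. of_real (af $ r) * Ln p)"
  using assms(1) by (simp add: powr_def exp_sum)
 also have "(\<Sum>r\<in>UNIV. of_real (af $ r) * Ln p) = of_real (\<Sum>r\<in>UNIV. af $ r) * Ln p"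
  by (simp add: sum_distrib_right)
 also have "... = of_nat (m + 1) * Ln p" unfolding assms(3) by simp
 also have "exp ... = p ^ (m + 1)" unfolding exp_of_nat_mult using assms(1) by simp
 finally have "(\<Prod>r\<in>UNIV. pscale u p af $ r) = q ^ (m + 1) * p ^ (m + 1)"
  using assms(2) by (simp add: pscale_def prod.distrib Htilde_m_def)
 thus ?thesis by (simp add: H_m_def power_mult_distrib mult_ac)
qed

context elliptic_base
begin

definition wt :: "complex => real ^ 'n => ('n => int) => complex" where
 "wt p af kp = ecoeff p kp * p powr of_real (dot kp af)"

text \<open>A convex condition on exponents that suffices for the limit: each coefficient converges,
  and all of them have a common summable majorant for small p.\<close>

definition good :: "real ^ 'n => bool" where
 "good af \<longleftrightarrow> rapid_decay (at 0) (%p. wt p af) & (\<forall>kp. \<exists>L. ((%p. wt p af kp) \<longlongrightarrow> L) (at 0))"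

lemma wt_shift: "p ~= 0 ==> wt p gm kp = wt p af kp * p powr of_real (dot kp gm - dot kp af)"
 by (simp add: wt_def powr_def algebra_simps flip: exp_add)

text \<open>Compared with one of the two end points, the weight inside the segment carries an extra
  positive power of p, while the weight at that end point converges.\<close>

lemma wt_tendsto_0:
 assumes af: "good af" and be: "good be" and s: "0 < s" "s < 1" and ne: "dot kp af ~= dot kp be"
 shows "((%p. wt p ((1 - s) *\<^sub>R af + s *\<^sub>R be) kp) \<longlongrightarrow> 0) (at 0)"
proof -
 define gm where "gm = (1 - s) *\<^sub>R af + s *\<^sub>R be"
 have *: "((%p. wt p gm kp) \<longlongrightarrow> 0) (at 0)" if d: "dot kp gm - dot kp \<delta> > 0" and g: "good \<delta>" for \<delta>
 proof -
  obtain L where "((%p. wt p \<delta> kp) \<longlongrightarrow> L) (at 0)" using g unfolding good_def by blast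
  from tendsto_mult[OF this tendsto_powr_of_real_0[OF d]]
  have "((%p. wt p \<delta> kp * p powr of_real (dot kp gm - dot kp \<delta>)) \<longlongrightarrow> 0) (at 0)" by simp
  moreover have "eventually (%p. wt p \<delta> kp * p powr of_real (dot kp gm - dot kp \<delta>) = wt p gm kp) (at 0)"
   unfolding eventually_at_filter by (rule always_eventually) (metis wt_shift)
  ultimately show ?thesis by (rule Lim_transform_eventually)
 qed
 have d: "dot kp gm = (1 - s) * dot kp af + s * dot kp be" unfolding gm_def by (rule dot_convex)
 have "dot kp gm - dot kp af = s * (dot kp be - dot kp af)" "dot kp gm - dot kp be = (1 - s) * (dot kp af - dot kp be)"
  unfolding d by (simp_all add: algebra_simps)
 hence "dot kp gm - dot kp af > 0 | dot kp gm - dot kp be > 0" using s ne by (smt (verit) mult_pos_pos)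
 thus ?thesis using * af be unfolding gm_def by blast
qed

lemma wt_eq: "dot kp af = dot kp be ==> wt p af kp = wt p be kp"
 by (simp add: wt_def)

lemma good_convex: "convex {af. good af}"
 unfolding convex_alt
proof (intro ballI allI impI, elim conjE)
 fix af be and s :: real
 assume "af \<in> {af. good af}" "be \<in> {af. good af}" and s: "0 <= s" "s <= 1"
 hence good: "good af" "good be" by auto
 define gm where "gm = (1 - s) *\<^sub>R af + s *\<^sub>R be"
 have d: "dot kp gm = (1 - s) * dot kp af + s * dot kp be" for kp unfolding gm_def by (rule dot_convex)
 have "rapid_decay (at 0) (%p. wt p gm)" unfolding rapid_decay_def
 proof (intro allI impI)
  fix x :: real assume x: "x > 0"
  obtain C where C: "eventually (%p. \<forall>kp. norm (wt p af kp) <= C * x ^ dsize kp) (at 0)"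
   using good(1) x unfolding good_def rapid_decay_def by blast
  obtain C' where C': "eventually (%p. \<forall>kp. norm (wt p be kp) <= C' * x ^ dsize kp) (at 0)"
   using good(2) x unfolding good_def rapid_decay_def by blast
  have p: "eventually (%p::complex. p \<in> ball 0 1 - {0}) (at 0)"
   by (rule eventually_at_in_open) auto
  show "\<exists>C. eventually (%p. \<forall>kp. norm (wt p gm kp) <= C * x ^ dsize kp) (at 0)"
  proof (rule exI[of _ "C + C'"], use C C' p in eventually_elim, rule allI)
   fix p kp assume 1: "\<forall>kp. norm (wt p af kp) <= C * x ^ dsize kp" "\<forall>kp. norm (wt p be kp) <= C' * x ^ dsize kp"
    and p: "p \<in> ball 0 1 - {0}"
   have n: "norm (wt p \<delta> kp) = norm (ecoeff p kp) * norm p powr dot kp \<delta>" for \<delta>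
    using p by (simp add: wt_def norm_mult norm_powr_of_real)
   \<comment> \<open>For |p| < 1 the power at an intermediate exponent is at most the larger of the
     powers at the two ends.\<close>
   have "norm p powr dot kp gm <= norm p powr dot kp af + norm p powr dot kp be"
   proof (cases "dot kp af <= dot kp be")
    case True
    hence "s * dot kp af <= s * dot kp be" using s by (intro mult_left_mono)
    hence "dot kp af <= dot kp gm" unfolding d by (simp add: algebra_simps)
    hence "norm p powr dot kp gm <= norm p powr dot kp af" using p by (intro powr_mono') auto
    thus ?thesis by (smt (verit) powr_ge_zero)
   next
    case False
    hence "(1 - s) * dot kp be <= (1 - s) * dot kp af" using s by (intro mult_left_mono) auto
    hence "dot kp be <= dot kp gm" unfolding d by (simp add: algebra_simps)
    hence "norm p powr dot kp gm <= norm p powr dot kp be" using p by (intro powr_mono') auto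
    thus ?thesis by (smt (verit) powr_ge_zero)
   qed
   hence "norm (wt p gm kp) <= norm (wt p af kp) + norm (wt p be kp)"
    unfolding n by (simp add: mult_left_mono flip: distrib_left)
   thus "norm (wt p gm kp) <= (C + C') * x ^ dsize kp" using 1 by (simp add: distrib_right) (smt (verit))
  qed
 qed
 moreover have "\<exists>L. ((%p. wt p gm kp) \<longlongrightarrow> L) (at 0)" for kp
 proof (cases "dot kp af = dot kp be | s = 0")
  case True
  hence "dot kp gm = dot kp af" unfolding d by (auto simp: algebra_simps)
  hence "(%p. wt p gm kp) = (%p. wt p af kp)" using wt_eq by blast
  thus ?thesis using good(1) unfolding good_def by metis
 next
  case False
  show ?thesis
  proof (cases "s = 1")
   case True
   hence "dot kp gm = dot kp be" unfolding d by simp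
   hence "(%p. wt p gm kp) = (%p. wt p be kp)" using wt_eq by blast
   thus ?thesis using good(2) unfolding good_def by metis
  next
   case neq: False
   have "0 < s" "s < 1" using neq False s by auto
   thus ?thesis using wt_tendsto_0[OF good, of s kp] False unfolding gm_def by blast
  qed
 qed
 ultimately show "(1 - s) *\<^sub>R af + s *\<^sub>R be \<in> {af. good af}" by (simp add: good_def gm_def)
qed

lemma E_m_pscale:
 fixes u :: "complex ^ 'n" and af :: "real ^ 'n"
 assumes p: "p ~= 0" "norm p < 1" and u: "u \<in> Htilde_m m q" and af: "(\<Sum>r\<in>UNIV. af $ r) = real (m + 1)"
 shows "E_m m p q (pscale u p af) = (\<Sum>\<^sub>\<infinity>kp. wt p af kp * monomial kp u)"
 unfolding E_m_eq_eseries[OF p pscale_in_H_m[OF p(1) u af]] eseries_def wt_def monomial_pscale[OF p(1)]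
 by (simp add: mult_ac)

text \<open>Dominated convergence for the series: the rapid decay, rescaled by the moduli of
  \<open>u\<close>, supplies the majorant.\<close>

lemma good_limit:
 fixes u :: "complex ^ 'n" and af :: "real ^ 'n"
 assumes g: "good af" and af: "(\<Sum>r\<in>UNIV. af $ r) = real (m + 1)" and u: "u \<in> Htilde_m m q"
 shows "((%p. E_m m p q (pscale u p af)) \<longlongrightarrow> (\<Sum>\<^sub>\<infinity>kp. Lim (at 0) (%p. wt p af kp) * monomial kp u)) (at 0)"
proof -
 have u0: "u $ r ~= 0" for r
 proof
  assume "u $ r = 0"
  hence "(\<Prod>r\<in>UNIV. u $ r) = 0" by (intro prod_zero) auto
  moreover have "q ^ (m + 1) ~= 0" using q by simp
  ultimately show False using u unfolding Htilde_m_def by (metis mem_Collect_eq)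
 qed
 define L where "L kp = Lim (at 0) (%p. wt p af kp)" for kp
 have L: "((%p. wt p af kp) \<longlongrightarrow> L kp) (at 0)" for kp
  using g unfolding good_def L_def by (metis tendsto_Lim trivial_limit_at)
 have "rapid_decay (at 0) (%p. wt p af)" using g unfolding good_def by blast
 from rapid_decay_radial[where sg = "%r. norm (u $ r)", OF this]
 have "rapid_decay (at 0) (%p kp. wt p af kp * of_real (radial (%r. norm (u $ r)) kp))" using u0 by simp
 then obtain C where C: "eventually (%p. \<forall>kp. norm (wt p af kp * of_real (radial (%r. norm (u $ r)) kp)) <= C * (1/2) ^ dsize kp) (at 0)"
  unfolding rapid_decay_def by (elim allE[of _ "1/2"]) auto
 have nm: "norm (of_real (radial (%r. norm (u $ r)) kp) :: complex) = norm (monomial kp u)" for kp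
  using radial_pos[of "%r. norm (u $ r)" kp] u0 by (simp add: monomial_def radial_def norm_power_int flip: prod_norm)
 obtain d where d: "d > 0" "!!p. p ~= 0 ==> norm p < d ==> \<forall>kp. norm (wt p af kp * monomial kp u) <= C * (1/2) ^ dsize kp"
  using C unfolding eventually_at norm_mult nm by auto
 define S where "S = ball (0::complex) (min d 1) - {0}"
 have at: "at 0 within S = at 0"
  by (rule at_within_nhd[of 0 "ball 0 (min d 1)"]) (use d(1) in \<open>auto simp: S_def\<close>)
 have sm: "(%kp::'n => int. C * (1/2) ^ dsize kp) summable_on UNIV"
  by (intro summable_on_cmult_right summable_power_dsize) auto
 have ul: "uniform_limit S (%X p. \<Sum>kp\<in>X. wt p af kp * monomial kp u) (%p. \<Sum>\<^sub>\<infinity>kp. wt p af kp * monomial kp u) (finite_subsets_at_top UNIV)"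
  by (rule Weierstrass_m_test_general[OF _ sm]) (use d(2) in \<open>auto simp: S_def\<close>)
 have Lb: "norm (L kp * monomial kp u) <= C * (1/2) ^ dsize kp" for kp
 proof (rule tendsto_upperbound)
  show "((%p. norm (wt p af kp * monomial kp u)) \<longlongrightarrow> norm (L kp * monomial kp u)) (at 0)" by (intro tendsto_intros L)
  show "eventually (%p. norm (wt p af kp * monomial kp u) <= C * (1/2) ^ dsize kp) (at 0)"
   unfolding eventually_at using d by (intro exI[of _ d]) auto
 qed simp
 have "(%kp. norm (L kp * monomial kp u)) summable_on UNIV" by (rule abs_summable_rapid[OF Lb])
 hence "(%kp. L kp * monomial kp u) summable_on UNIV" by (rule abs_summable_summable)
 hence sumL: "((%X. \<Sum>kp\<in>X. L kp * monomial kp u) \<longlongrightarrow> (\<Sum>\<^sub>\<infinity>kp. L kp * monomial kp u)) (finite_subsets_at_top UNIV)"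
  using has_sum_infsum unfolding has_sum_def by blast
 have "((%p. \<Sum>\<^sub>\<infinity>kp. wt p af kp * monomial kp u) \<longlongrightarrow> (\<Sum>\<^sub>\<infinity>kp. L kp * monomial kp u)) (at 0 within S)"
 proof (rule swap_uniform_limit[OF _ sumL ul])
  show "eventually (%X. ((%p. \<Sum>kp\<in>X. wt p af kp * monomial kp u) \<longlongrightarrow> (\<Sum>kp\<in>X. L kp * monomial kp u)) (at 0 within S)) (finite_subsets_at_top UNIV)"
   unfolding at by (rule always_eventually) (intro allI tendsto_intros L)
 qed (simp add: finite_subsets_at_top_neq_bot)
 hence "((%p. \<Sum>\<^sub>\<infinity>kp. wt p af kp * monomial kp u) \<longlongrightarrow> (\<Sum>\<^sub>\<infinity>kp. L kp * monomial kp u)) (at 0)" unfolding at .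
 moreover have "eventually (%p. (\<Sum>\<^sub>\<infinity>kp. wt p af kp * monomial kp u) = E_m m p q (pscale u p af)) (at 0)"
  unfolding eventually_at using E_m_pscale[OF _ _ u af] by (intro exI[of _ 1]) auto
 ultimately show ?thesis unfolding L_def by (rule Lim_transform_eventually)
qed

text \<open>If the exponents of a coefficient differ at the two points, each point is interior to a
  segment in \<open>F\<close> that starts at the other one, and the weight tends to 0 there by
  \<open>wt_tendsto_0\<close>.\<close>

lemma face_limits_eq:
 assumes F: "convex F" "!!gm. gm \<in> F ==> good gm" and ab: "af \<in> rel_interior F" "be \<in> rel_interior F"
 shows "Lim (at 0) (%p. wt p af kp) = Lim (at 0) (%p. wt p be kp)"
proof (cases "dot kp af = dot kp be")
 case True
 hence "(%p. wt p af kp) = (%p. wt p be kp)" using wt_eq by blast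
 thus ?thesis by simp
next
 case False
 have zero: "((%p. wt p af kp) \<longlongrightarrow> 0) (at 0)" if a: "af \<in> rel_interior F" and b: "be \<in> F" and ne: "dot kp af ~= dot kp be" for af be
 proof -
  have "F ~= {}" using b by auto
  \<comment> \<open>The new end point lies beyond \<open>af\<close> on the ray from
    \<open>be\<close>; it can be taken in \<open>F\<close> because \<open>af\<close> is a relative
    interior point.\<close>
  then obtain e where e: "e > 1" "(1 - e) *\<^sub>R be + e *\<^sub>R af \<in> F"
   using convex_rel_interior_iff[OF F(1)] a b by blast
  define gm where "gm = (1 - e) *\<^sub>R be + e *\<^sub>R af"
  have "(1 / e) *\<^sub>R gm = (1 / e - 1) *\<^sub>R be + af"
   using e(1) by (simp add: gm_def scaleR_add_right diff_divide_distrib)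
  hence af: "af = (1 - 1 / e) *\<^sub>R be + (1 / e) *\<^sub>R gm" by (simp add: algebra_simps)
  have "dot kp af = (1 - 1 / e) * dot kp be + (1 / e) * dot kp gm" by (subst af) (rule dot_convex)
  hence "dot kp be ~= dot kp gm" using ne by (auto simp: algebra_simps)
  from wt_tendsto_0[OF F(2)[OF b] F(2)[OF e(2)[folded gm_def]] _ _ this, of "1 / e"]
  show ?thesis using e(1) unfolding af[symmetric] by simp
 qed
 have "af \<in> F" "be \<in> F" using ab rel_interior_subset by auto
 hence "((%p. wt p af kp) \<longlongrightarrow> 0) (at 0)" "((%p. wt p be kp) \<longlongrightarrow> 0) (at 0)" using zero ab False by metis+
 thus ?thesis by (metis tendsto_Lim trivial_limit_at)
qed

lemma base_point_Htilde:
 assumes "!!s. sg s > 0" "z \<in> utorus"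
 shows "base_point (q ^ (m + 1)) k0 sg z \<in> Htilde_m m q"
 using prod_base_point[OF assms(2), of k0 sg] assms(1) by (simp add: Htilde_m_def)

lemma torus_coeff_E_m:
 fixes v :: "real ^ 'n"
 assumes p: "p ~= 0" "norm p < 1" and sg: "!!s. sg s > 0" and v: "(\<Sum>r\<in>UNIV. v $ r) = real (m + 1)"
 shows "torus_coeff (%z. E_m m p q (pscale (base_point (q ^ (m + 1)) k0 sg z) p v)) kp = wt p v kp * of_real (radial sg kp)"
proof -
 define a where "a kp = wt p v kp * of_real (radial sg kp)" for kp
 have "torus_coeff (%z. E_m m p q (pscale (base_point (q ^ (m + 1)) k0 sg z) p v)) kp = torus_coeff (%z. \<Sum>\<^sub>\<infinity>kp. a kp * monomial kp z) kp"
  unfolding torus_coeff_def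
 proof (rule torus_mean_cong)
  fix z :: "complex ^ 'n" assume z: "z \<in> utorus"
  have "wt p v kp * monomial kp (base_point (q ^ (m + 1)) k0 sg z) = a kp * monomial kp z" for kp
   by (cases "kp k0 = 0") (simp_all add: a_def monomial_base_point wt_def ecoeff_eq_0)
  thus "E_m m p q (pscale (base_point (q ^ (m + 1)) k0 sg z) p v) * monomial (%r. - kp r) z = (\<Sum>\<^sub>\<infinity>kp. a kp * monomial kp z) * monomial (%r. - kp r) z"
   unfolding E_m_pscale[OF p base_point_Htilde[OF sg z] v] by simp
 qed
 also have "... = a kp"
 proof (rule torus_series(2))
  define \<pi> where "\<pi> r = norm p powr (v $ r)" for r
  have pi: "\<pi> r > 0" for r using p by (simp add: \<pi>_def)
  have r0: "rapid_decay (top :: unit filter) (%_. ecoeff p)" unfolding rapid_decay_def using ecoeff_decay by simp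
  from rapid_decay_radial[where sg = sg, OF rapid_decay_radial[where sg = \<pi>, OF r0 pi] sg]
  have "\<exists>C. \<forall>kp. norm (ecoeff p kp * of_real (radial \<pi> kp) * of_real (radial sg kp)) <= C * (1/2) ^ dsize kp"
   unfolding rapid_decay_def by (elim allE[of _ "1/2"]) simp
  moreover have "norm (ecoeff p kp * of_real (radial \<pi> kp) * of_real (radial sg kp)) = norm (a kp)" for kp
  proof -
   have "ln (radial \<pi> kp) = (\<Sum>r\<in>UNIV. ln (\<pi> r powi kp r))" unfolding radial_def
    by (rule ln_prod) (use pi in \<open>auto simp: less_imp_neq[symmetric]\<close>)
   also have "... = (\<Sum>r\<in>UNIV. of_int (kp r) * v $ r * ln (norm p))"
    using p pi by (intro sum.cong refl) (simp add: \<pi>_def flip: powr_real_of_int')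
   also have "... = dot kp v * ln (norm p)" by (simp add: dot_def sum_distrib_right)
   finally have "radial \<pi> kp = norm p powr dot kp v"
    using p radial_pos[of \<pi> kp] pi by (metis exp_ln powr_def norm_eq_zero)
   thus ?thesis using p by (simp add: a_def wt_def norm_mult norm_powr_of_real)
  qed
  ultimately obtain C where "!!kp. norm (a kp) <= C * (1/2) ^ dsize kp" by auto
  thus "(%kp. norm (a kp)) summable_on UNIV" by (rule abs_summable_rapid)
 qed
 finally show ?thesis by (simp add: a_def)
qed

definition um :: "('n => real) => 'n => real" where
 "um sg = moduli (norm (q ^ (m + 1))) k0 sg"

lemma um_pos: "(!!s. sg s > 0) ==> um sg r > 0"
 unfolding um_def by (rule moduli_pos) (use q in auto)

lemma norm_um: "z \<in> utorus ==> (!!s. sg s > 0) ==> norm (base_point (q ^ (m + 1)) k0 sg z $ r) = um sg r"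
 unfolding um_def by (rule norm_base_point) auto

text \<open>A function \<open>g\<close> continuous up to p = 0 yields both the bounds on tori that
  force rapid decay and the limits of the coefficients. The tori only have to be nonresonant at p =
  0, where just the resonances with j = 0 remain.\<close>

lemma good_criterion:
 fixes v :: "real ^ 'n"
 assumes v: "(\<Sum>r\<in>UNIV. v $ r) = real (m + 1)"
  and ext: "!!sg. (!!s. sg s > 0) ==> rad_nonres 0 (norm q) (um sg) (um sg) ==>
   \<exists>U g. eventually (%p. p \<in> U) (nhds 0) & continuous_on (U \<times> utorus) (%(p, z). g p z) &
    (\<forall>p\<in>U - {0}. \<forall>z\<in>utorus. norm p < 1 --> E_m m p q (pscale (base_point (q ^ (m + 1)) k0 sg z) p v) = g p z)"
 shows "good v"
proof -
 have C0: "0 < norm (q ^ (m + 1))" "norm (q ^ (m + 1)) <= norm q" using power_Suc_le_q[of 1] q by simp_all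
 have main: "(\<exists>C. eventually (%p. \<forall>kp. norm (wt p v kp) * radial sg kp <= C) (at 0)) &
   (\<forall>kp. \<exists>L. ((%p. wt p v kp) \<longlongrightarrow> L) (at 0))"
  if sg: "!!s. sg s > 0" and nr: "rad_nonres 0 (norm q) (um sg) (um sg)" for sg
 proof -
  obtain U g where U: "eventually (%p. p \<in> U) (nhds 0)" and g: "continuous_on (U \<times> utorus) (%(p, z). g p z)"
   and E: "\<forall>p\<in>U - {0}. \<forall>z\<in>utorus. norm p < 1 --> E_m m p q (pscale (base_point (q ^ (m + 1)) k0 sg z) p v) = g p z"
   using ext[OF sg nr] by blast
  have U0: "0 \<in> U" using U by (rule eventually_nhds_x_imp_x)
  have at: "at 0 within U = at 0" by (rule at_within_eventually[OF U])
  have ev: "eventually (%p. p \<in> U & p ~= 0 & norm p < 1) (at 0)"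
  proof -
   have "eventually (%p::complex. p \<in> ball 0 1 - {0}) (at 0)" by (rule eventually_at_in_open) auto
   moreover have "eventually (%p. p \<in> U) (at 0)" using U unfolding eventually_at_filter by (auto elim: eventually_mono)
   ultimately show ?thesis by eventually_elim auto
  qed
  have c: "torus_coeff (g p) kp = wt p v kp * of_real (radial sg kp)" if p: "p \<in> U & p ~= 0 & norm p < 1" for p kp
  proof -
   have "torus_coeff (g p) kp = torus_coeff (%z. E_m m p q (pscale (base_point (q ^ (m + 1)) k0 sg z) p v)) kp"
    unfolding torus_coeff_def by (rule torus_mean_cong) (use E p in auto)
   thus ?thesis using torus_coeff_E_m[OF _ _ sg v] p by simp
  qed
  have rp: "radial sg kp > 0" for kp by (rule radial_pos[OF sg])
  obtain C where C: "eventually (%p. \<forall>kp. norm (torus_coeff (g p) kp) <= C) (at 0)"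
   using torus_coeff_tendsto(2)[OF g U0] unfolding at by blast
  have "eventually (%p. \<forall>kp. norm (wt p v kp) * radial sg kp <= C) (at 0)"
   using C ev
  proof eventually_elim
   case (elim p)
   have "norm (wt p v kp) * radial sg kp = norm (torus_coeff (g p) kp)" for kp
    using c[OF elim(2), of kp] rp[of kp] by (simp add: norm_mult)
   thus ?case using elim(1) by simp
  qed
  moreover have "((%p. wt p v kp) \<longlongrightarrow> torus_coeff (g 0) kp / of_real (radial sg kp)) (at 0)" for kp
  proof (rule Lim_transform_eventually)
   show "((%p. torus_coeff (g p) kp / of_real (radial sg kp)) \<longlongrightarrow> torus_coeff (g 0) kp / of_real (radial sg kp)) (at 0)"
    using torus_coeff_tendsto(1)[OF g U0, of kp] rp[of kp] unfolding at by (intro tendsto_intros) auto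
   show "eventually (%p. torus_coeff (g p) kp / of_real (radial sg kp) = wt p v kp) (at 0)"
    using ev by (rule eventually_mono) (use c rp in \<open>auto simp: less_imp_neq[symmetric]\<close>)
  qed
  ultimately show ?thesis by blast
 qed
 have tori: "\<exists>R>a. R < b & (\<exists>C. eventually (%p. \<forall>kp. norm (wt p v kp) * radial (ro(r := R)) kp <= C) (at 0))"
  if r: "r ~= k0" and ab: "0 <= a" "a < b" for r a b
 proof -
  obtain R where R: "a < R" "R < b" "rad_nonres 0 (norm q) (um (ro(r := R))) (um (ro(r := R)))"
   unfolding um_def
   by (rule exists_nonresonant_radius[OF r rho_pos C0(1) base_moduli_less_1[OF C0], of 0 "norm q" a b]) (use q ab in auto)
  have "(ro(r := R)) s > 0" for s using R ab rho_pos by simp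
  thus ?thesis using main[of "ro(r := R)"] R by blast
 qed
 have "rapid_decay (at 0) (%p. wt p v)"
 proof (rule rapid_decay_from_tori[where ro = ro and ?k0.0 = k0])
  show "\<exists>R>0. \<exists>C. T <= R & eventually (%p. \<forall>kp. norm (wt p v kp) * radial (ro(r := R)) kp <= C) (at 0)" if "r ~= k0" for r T
   using tori[OF that, of "max T 0" "max T 0 + 1"] by force
  show "\<exists>R>0. \<exists>C. T <= 1 / R & eventually (%p. \<forall>kp. norm (wt p v kp) * radial (ro(r := R)) kp <= C) (at 0)" if rk: "r ~= k0" for r T
  proof -
   define M where "M = max T 1"
   have M: "T <= M" "1 <= M" by (auto simp: M_def)
   hence "0 < 1 / M" by simp
   from tori[OF rk order_refl this] obtain R C where R: "R > 0" "R < 1 / M"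
    "eventually (%p. \<forall>kp. norm (wt p v kp) * radial (ro(r := R)) kp <= C) (at 0)" by blast
   have "M < 1 / R" using R(1,2) M(2) by (simp add: field_simps)
   hence "T <= 1 / R" using M(1) by simp
   thus ?thesis using R(1,3) by blast
  qed
 qed (use rho_pos card ecoeff_eq_0 in \<open>auto simp: wt_def\<close>)
 moreover have "rad_nonres 0 (norm q) (um ro) (um ro)" unfolding um_def
  by (rule base_rad_nonres[OF C0]) auto
 ultimately show ?thesis using main[where sg = ro, OF rho_pos] unfolding good_def by blast
qed

text \<open>At p = 0 each entry is 0 or the old modulus. Products containing a 0 cannot equal 1, the
  others are covered by \<open>nr\<close>, and nonresonance is an open condition.\<close>

lemma eventually_nonresonant_near_0:
 fixes \<mu> :: "'n => real" and af be :: "complex => 'n => real"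
 assumes nr: "rad_nonres 0 (norm q) \<mu> \<mu>" and pos: "!!r. \<mu> r > 0"
  and A: "!!r. ((%p::complex. af p r) \<longlongrightarrow> af 0 r) (nhds 0)" "!!r. af 0 r = 0 | af 0 r = \<mu> r"
  and B: "!!r. ((%p::complex. be p r) \<longlongrightarrow> be 0 r) (nhds 0)" "!!r. be 0 r = 0 | be 0 r = \<mu> r"
 shows "eventually (%p. rad_nonres (norm p) (norm q) (af p) (be p)) (nhds 0)"
proof (rule eventually_rad_nonres[where ?P0.0 = 0 and P = norm and A = af and B = be and af = "af 0" and be = "be 0", OF _ _ _ _ A(1) B(1)])
 show "rad_nonres 0 (norm q) (af 0) (be 0)" unfolding rad_nonres_def
 proof (intro allI)
  fix i i' j k
  show "af 0 i * be 0 i' * 0 ^ j * norm q ^ k ~= 1"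
   using A(2)[of i] B(2)[of i'] nr unfolding rad_nonres_def by (auto simp: mult.assoc)
 qed
 show "((%p::complex. norm p) \<longlongrightarrow> 0) (nhds 0)" using tendsto_norm[OF filterlim_ident, of "0::complex"] by simp
qed (use q in auto)

end

section \<open>The theta addition formula\<close>

lemma eq_off_countable:
 fixes f g :: "complex => complex"
 assumes S: "open S" and f: "continuous_on S f" and g: "continuous_on S g" and B: "countable B"
  and eq: "!!x. x \<in> S ==> x ~: B ==> f x = g x" and x: "x \<in> S"
 shows "f x = g x"
proof (rule ccontr)
 assume ne: "f x ~= g x"
 have "open {x \<in> S. f x - g x \<in> -{0}}" by (rule open_Collect_preimage[OF S]) (auto intro!: continuous_intros f g)
 moreover have "x \<in> {x \<in> S. f x - g x \<in> -{0}}" using ne x by simp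
 ultimately obtain e where e: "e > 0" "ball x e \<subseteq> {x \<in> S. f x - g x \<in> -{0}}" by (meson openE)
 have "{x \<in> S. f x - g x \<in> -{0}} \<subseteq> B" using eq by auto
 thus False using e uncountable_ball[of e x] B by (meson countable_subset)
qed

lemma qtheta_eq_0:
 assumes q: "norm q < 1" "q ~= 0" and x: "x ~= 0" "qtheta x q = 0"
 shows "\<exists>l::int. x = q powi l"
proof -
 consider "qpoch x q = 0" | "qpoch (q / x) q = 0" using x by (auto simp: qtheta_def)
 thus ?thesis
 proof cases
  case 1
  then obtain k where "x * q ^ k = 1" using qpoch_eq_0_iff[OF q(1)] by blast
  hence "x = q powi (- int k)" using q by (simp add: power_int_minus field_simps)
  thus ?thesis by blast
 next
  case 2
  then obtain k where "q / x * q ^ k = 1" using qpoch_eq_0_iff[OF q(1)] by blast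
  hence "x = q powi (int (Suc k))" using x unfolding power_int_of_nat by (simp add: field_simps)
  thus ?thesis by blast
 qed
qed

text \<open>A q-shift moves the zero to 1, where the factor \<open>1 - x\<close> splits off the
  product.\<close>

lemma qtheta_simple_zero:
 assumes q: "norm q < 1" "q ~= 0" and x0: "x0 ~= 0" "qtheta x0 q = 0"
 obtains \<psi> where "continuous_on (-{0}) \<psi>" "\<psi> x0 ~= 0" "!!x. x ~= 0 ==> qtheta x q = (1 - x / x0) * \<psi> x"
proof -
 obtain l :: int where l: "x0 = q powi l" using qtheta_eq_0[OF q x0] by blast
 obtain c where c: "c ^ 2 = q powi (- (l * (l - 1)))" "!!x. x ~= 0 ==> qtheta (q powi l * x) q = c * x powi (- l) * qtheta x q"
  using qtheta_int_shift[OF q, of l] by blast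
 have c0: "c ~= 0" using c(1) q by auto
 define \<psi> where "\<psi> x = c * (x / x0) powi (- l) * (qpoch (x / x0 * q) q * qpoch (q / (x / x0)) q)" for x
 show ?thesis
 proof (rule that)
  show "continuous_on (-{0}) \<psi>" unfolding \<psi>_def by (intro continuous_intros q) (use x0 in auto)
  have "qpoch q q ~= 0"
  proof
   assume "qpoch q q = 0"
   then obtain k where "q * q ^ k = 1" using qpoch_eq_0_iff[OF q(1)] by blast
   hence "norm q ^ Suc k = 1" by (metis norm_one norm_power power_Suc)
   moreover have "norm q ^ Suc k < 1" using q by (intro power_Suc_less_one) auto
   ultimately show False by simp
  qed
  thus "\<psi> x0 ~= 0" using c0 x0 by (simp add: \<psi>_def)
  fix x :: complex assume x: "x ~= 0"
  have "qtheta x q = qtheta (q powi l * (x / x0)) q" using x0 by (simp flip: l)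
  also have "... = c * (x / x0) powi (- l) * qtheta (x / x0) q" using x x0 by (intro c(2)) simp
  also have "qtheta (x / x0) q = (1 - x / x0) * (qpoch (x / x0 * q) q * qpoch (q / (x / x0)) q)"
   unfolding qtheta_def by (subst qpoch_shift[OF q(1)]) (simp add: mult.assoc)
  finally show "qtheta x q = (1 - x / x0) * \<psi> x" by (simp add: \<psi>_def mult_ac)
 qed
qed

text \<open>Periodicity reduces all values to those on the compact annulus |q| \<le> |z| \<le> 1, so
  \<open>g\<close> is bounded, and Liouville's theorem applies to \<open>g\<close> composed with
  \<open>exp\<close>.\<close>

lemma q_periodic_constant:
 assumes q: "norm q < 1" "q ~= 0" and g: "g holomorphic_on (-{0})" and per: "!!z. z ~= 0 ==> g (q * z) = g z"
 shows "\<exists>c. \<forall>z. z ~= 0 --> g z = c"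
proof -
 have perI: "g (q powi l * z) = g z" if "z ~= 0" for z and l :: int
 proof (induction l rule: int_induct[of _ 0])
  case (step1 i)
  have "q powi (i + 1) * z = q * (q powi i * z)" using q by (simp add: power_int_add_1)
  thus ?case using step1.IH per[of "q powi i * z"] q that by (simp add: mult.assoc)
 next
  case (step2 i)
  have "q powi i * z = q * (q powi (i - 1) * z)" using q by (simp add: power_int_diff)
  thus ?case using step2.IH per[of "q powi (i - 1) * z"] q that by (simp add: mult.assoc)
 qed simp
 define K where "K = cball (0::complex) 1 - ball 0 (norm q)"
 have "compact K" unfolding K_def by (intro compact_diff) auto
 moreover have "K \<subseteq> -{0}" using q by (auto simp: K_def)
 ultimately have "bounded (g ` K)"
  by (meson compact_continuous_image compact_imp_bounded continuous_on_subset g holomorphic_on_imp_continuous_on)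
 then obtain B where B: "!!z. z \<in> K ==> norm (g z) <= B" unfolding bounded_iff by blast
 have bd: "norm (g z) <= B" if z: "z ~= 0" for z
 proof -
  define l where "l = \<lfloor>ln (norm z) / ln (norm q)\<rfloor>"
  have lnq: "ln (norm q) < 0" using q by simp
  define w where "w = q powi (- l) * z"
  have w0: "w ~= 0" using q z by (simp add: w_def)
  have "norm (q powi (- l)) = norm q powr of_int (- l)" unfolding norm_power_int by (subst powr_real_of_int') (use q in auto)
  hence "ln (norm w) = - of_int l * ln (norm q) + ln (norm z)" using q z by (simp add: w_def norm_mult ln_mult ln_powr)
  moreover have "of_int l <= ln (norm z) / ln (norm q)" "ln (norm z) / ln (norm q) < of_int l + 1"
   unfolding l_def by linarith+
  hence "ln (norm z) <= of_int l * ln (norm q)" "(of_int l + 1) * ln (norm q) < ln (norm z)"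
   using lnq by (simp_all add: neg_le_divide_eq neg_divide_less_eq)
  ultimately have "ln (norm w) <= 0" "ln (norm q) < ln (norm w)" by (simp_all add: algebra_simps)
  hence "w \<in> K" using w0 q by (simp add: K_def)
  moreover have "g w = g z" unfolding w_def by (rule perI[OF z])
  ultimately show ?thesis using B by metis
 qed
 have "g \<circ> exp holomorphic_on UNIV"
  by (rule holomorphic_on_compose_gen[OF _ g]) (auto intro!: holomorphic_intros)
 hence "(%w. g (exp w)) holomorphic_on UNIV" by (simp add: o_def)
 moreover have "bounded (range (%w. g (exp w)))" unfolding bounded_iff by (intro exI[of _ B]) (use bd in auto)
 ultimately have "(%w. g (exp w)) constant_on UNIV" by (rule Liouville_theorem)
 then obtain c where c: "!!w. g (exp w) = c" unfolding constant_on_def by auto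
 have "g z = c" if "z ~= 0" for z using c[of "Ln z"] that by simp
 thus ?thesis by blast
qed

text \<open>The last factor makes the four arguments multiply to q z^4, so that under z \<mapsto> q
  z the product has the same multiplier as \<theta>(z^2; q).\<close>

definition theta_product :: "complex => complex => complex => complex => complex => complex" where
 "theta_product q a b c z = qtheta (a * z) q * qtheta (b * z) q * qtheta (c * z) q * qtheta (q * z / (a * b * c)) q"

lemma holomorphic_theta_product:
 assumes "norm q < 1" "q ~= 0" "a ~= 0" "b ~= 0" "c ~= 0"
 shows "theta_product q a b c holomorphic_on (-{0})"
 unfolding theta_product_def by (intro holomorphic_intros) (use assms in auto)

lemma theta_product_int_shift:
 assumes q: "norm q < 1" "q ~= 0" and abc: "a ~= 0" "b ~= 0" "c ~= 0" and z: "z ~= 0"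
 shows "theta_product q a b c (q powi l * z) = q powi (- (2 * l * l - l)) * z powi (- 4 * l) * theta_product q a b c z"
proof -
 obtain d where d: "d ^ 2 = q powi (- (l * (l - 1)))" "!!x. x ~= 0 ==> qtheta (q powi l * x) q = d * x powi (- l) * qtheta x q"
  using qtheta_int_shift[OF q, of l] by blast
 have s: "qtheta (a * (q powi l * z)) q = d * (a * z) powi (- l) * qtheta (a * z) q" if "a ~= 0" for a
  using d(2)[of "a * z"] that z by (simp add: mult_ac)
 have "q / (a * b * c) ~= 0" using abc q by simp
 from s[OF this] have s4: "qtheta (q * (q powi l * z) / (a * b * c)) q = d * (q * z / (a * b * c)) powi (- l) * qtheta (q * z / (a * b * c)) q"
  by (simp only: times_divide_eq_left)
 have "theta_product q a b c (q powi l * z) = (d ^ 2) ^ 2 *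
  ((a * z) powi (- l) * (b * z) powi (- l) * (c * z) powi (- l) * (q * z / (a * b * c)) powi (- l)) * theta_product q a b c z"
  unfolding theta_product_def s[OF abc(1)] s[OF abc(2)] s[OF abc(3)] s4 by (simp add: power2_eq_square mult_ac)
 also have "(a * z) powi (- l) * (b * z) powi (- l) * (c * z) powi (- l) * (q * z / (a * b * c)) powi (- l) = (q * z ^ 4) powi (- l)"
 proof -
  have "(a * z) * (b * z) * (c * z) * (q * z / (a * b * c)) = q * z ^ 4" using abc by (simp add: field_simps eval_nat_numeral)
  thus ?thesis by (simp flip: power_int_mult_distrib)
 qed
 also have "... = q powi (- l) * z powi (- 4 * l)"
 proof -
  have "(z ^ 4) powi (- l) = z powi (- 4 * l)"
   using power_int_mult[of z 4 "- l"] by simp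
  thus ?thesis by (simp add: power_int_mult_distrib)
 qed
 also have "(d ^ 2) ^ 2 = q powi (- (2 * l * (l - 1)))"
  unfolding d(1) using power_int_mult[of q "- (l * (l - 1))" 2] by (simp add: mult_ac)
 also have "q powi (- (2 * l * (l - 1))) * (q powi (- l) * z powi (- 4 * l)) = q powi (- (2 * l * l - l)) * z powi (- 4 * l)"
 proof -
  have e: "- (2 * l * l - l) = - (2 * l * (l - 1)) + (- l)" by (simp add: algebra_simps)
  show ?thesis by (subst e, subst power_int_add[OF disjI1[OF q(2)]], rule mult.assoc[symmetric])
 qed
 finally show ?thesis .
qed

lemma countable_square_in:
 assumes "countable X"
 shows "countable {z::complex. z ^ 2 \<in> X}"
proof -
 have "{z::complex. z ^ 2 \<in> X} \<subseteq> csqrt ` X \<union> (%x. - csqrt x) ` X"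
 proof
  fix z :: complex assume z: "z \<in> {z. z ^ 2 \<in> X}"
  have "(csqrt (z ^ 2)) ^ 2 = z ^ 2" by simp
  hence "z = csqrt (z ^ 2) | z = - csqrt (z ^ 2)" by (metis power2_eq_iff)
  thus "z \<in> csqrt ` X \<union> (%x. - csqrt x) ` X" using z by blast
 qed
 thus ?thesis by (rule countable_subset) (use assms in auto)
qed

lemma countable_theta_square_zeros:
 assumes q: "norm q < 1" "q ~= 0"
 shows "countable {z. z ~= 0 & qtheta (z ^ 2) q = 0}"
proof (rule countable_subset)
 show "{z. z ~= 0 & qtheta (z ^ 2) q = 0} \<subseteq> {z. z ^ 2 \<in> range (%l::int. q powi l)}"
 proof
  fix z :: complex assume z: "z \<in> {z. z ~= 0 & qtheta (z ^ 2) q = 0}"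
  hence "\<exists>l::int. z ^ 2 = q powi l" by (intro qtheta_eq_0[OF q]) auto
  thus "z \<in> {z. z ^ 2 \<in> range (%l::int. q powi l)}" by blast
 qed
 show "countable {z. z ^ 2 \<in> range (%l::int. q powi l)}" by (rule countable_square_in) simp
qed

text \<open>The Weierstrass addition formula: the quotient by \<open>\<theta>(z\<^sup>2; q)\<close> is \<open>q\<close>-periodic without poles, and the
 constant is read off at \<open>z = 1 / c\<close>.\<close>

lemma theta_addition:
 assumes q: "norm q < 1" "q ~= 0" and abc: "a ~= 0" "b ~= 0" "c ~= 0" and z: "z ~= 0"
 shows "theta_product q a b c z - z ^ 2 * theta_product q a b c (1 / z) =
  qtheta (a * b) q * qtheta (a * c) q * qtheta (b * c) q * qtheta (z ^ 2) q"
proof -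
 \<comment> \<open>At z = 1/c the constant can be read off only if \<theta>(c^2; q) is nonzero. The
   excluded values of \<open>c\<close> are countable and are recovered by continuity in
   \<open>c\<close>.\<close>
 have generic: "theta_product q a b c z - z ^ 2 * theta_product q a b c (1 / z) =
   qtheta (a * b) q * qtheta (a * c) q * qtheta (b * c) q * qtheta (z ^ 2) q"
  if c: "c ~= 0" "qtheta (c ^ 2) q ~= 0" for c
 proof -
  define k where "k = theta_product q a b c"
  define D where "D z = k z - z ^ 2 * k (1 / z)" for z
  define f where "f z = D z / qtheta (z ^ 2) q" for z
  define N where "N = {z \<in> -{0}. qtheta (z ^ 2) q \<in> -{0}}"
  note kq = theta_product_int_shift[OF q abc(1,2) c(1), folded k_def]
  have hk: "k holomorphic_on -{0}" unfolding k_def by (rule holomorphic_theta_product[OF q abc(1,2) c(1)])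
  have "k \<circ> (%z. 1 / z) holomorphic_on -{0}"
   by (rule holomorphic_on_compose_gen[OF _ hk]) (auto intro!: holomorphic_intros)
  hence hk': "(%z. k (1 / z)) holomorphic_on -{0}" by (simp add: o_def)
  have hD: "D holomorphic_on -{0}" unfolding D_def by (intro holomorphic_intros hk hk')
  have ht: "(%z. qtheta (z ^ 2) q) holomorphic_on -{0}" by (intro holomorphic_intros q) auto
  have N: "open N" unfolding N_def
   by (rule open_Collect_preimage) (use holomorphic_on_imp_continuous_on[OF ht] in auto)
  have NS: "N \<subseteq> -{0}" by (auto simp: N_def)
  have hf: "f holomorphic_on N" unfolding f_def
   by (intro holomorphic_intros holomorphic_on_subset[OF hD NS] holomorphic_on_subset[OF ht NS]) (auto simp: N_def)
  have "\<exists>g. g holomorphic_on (-{0}) & (\<forall>w\<in>N. g w = f w)"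
  proof (rule holomorphic_extend_discrete[OF _ N NS hf])
   fix w0 :: complex assume w0: "w0 \<in> -{0}" "w0 ~: N"
   hence t0: "qtheta (w0 ^ 2) q = 0" "w0 ~= 0" by (auto simp: N_def)
   obtain l :: int where l: "w0 ^ 2 = q powi l" using qtheta_eq_0[OF q _ t0(1)] t0(2) by auto
   obtain \<psi> where psi: "continuous_on (-{0}) \<psi>" "\<psi> (w0 ^ 2) ~= 0" "!!x. x ~= 0 ==> qtheta x q = (1 - x / w0 ^ 2) * \<psi> x"
    using qtheta_simple_zero[OF q _ t0(1)] t0(2) by auto
   \<comment> \<open>At a zero of \<theta>(z^2; q) one has w0 = q^l (1/w0), and the shift rule makes
     the two terms of \<open>D\<close> equal.\<close>
   have D0: "D w0 = 0"
   proof -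
    have "q powi l * (1 / w0) = w0" using t0(2) by (simp add: l[symmetric] power2_eq_square)
    hence "k w0 = q powi (- (2 * l * l - l)) * (1 / w0) powi (- 4 * l) * k (1 / w0)" using kq[of "1 / w0" l] t0(2) by simp
    also have "(1 / w0) powi (- 4 * l) = (w0 ^ 2) powi (2 * l)"
    proof -
     have "(1 / w0) powi (- 4 * l) = w0 powi (4 * l)" by (simp add: power_int_one_over power_int_minus)
     also have "... = (w0 ^ 2) powi (2 * l)" using power_int_mult[of w0 2 "2 * l"] by simp
     finally show ?thesis .
    qed
    also have "... = q powi (2 * l * l)" unfolding l using power_int_mult[of q l "2 * l"] by (simp add: mult_ac)
    also have "q powi (- (2 * l * l - l)) * q powi (2 * l * l) = q powi l"
     using power_int_add[OF disjI1[OF q(2)], of "- (2 * l * l - l)" "2 * l * l"] by simp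
    finally show ?thesis by (simp add: D_def l)
   qed
   have cont: "isCont h w0" if "continuous_on (-{0}) h" for h :: "complex => complex"
   proof -
    have "open (-{0::complex})" by auto
    from continuous_on_eq_continuous_at[OF this] that t0(2) show ?thesis by blast
   qed
   have cpsi: "isCont (%w. \<psi> (w ^ 2)) w0"
    by (rule cont) (rule continuous_on_compose2[OF psi(1)], auto intro!: continuous_intros)
   have cD: "isCont D w0" by (rule cont[OF holomorphic_on_imp_continuous_on[OF hD]])
   have "isCont (%w. (1 + w / w0) * \<psi> (w ^ 2)) w0"
    by (intro isCont_mult cpsi) (intro continuous_intros, use t0(2) in auto)
   moreover have nz0: "(1 + w0 / w0) * \<psi> (w0 ^ 2) ~= 0" using psi(2) t0(2) by simp
   ultimately have ev: "eventually (%w. (1 + w / w0) * \<psi> (w ^ 2) ~= 0) (at w0)"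
    unfolding isCont_def by (intro tendsto_imp_eventually_ne)
   have ev0: "eventually (%w. w \<in> -{0} - {w0}) (at w0)"
    by (rule eventually_at_in_open) (use t0(2) in auto)
   have fact: "qtheta (w ^ 2) q = (1 - w / w0) * ((1 + w / w0) * \<psi> (w ^ 2))" if "w ~= 0" for w
    using psi(3)[of "w ^ 2"] that t0(2) by (simp add: field_simps power2_eq_square)
   have "eventually (%w. w \<in> N) (at w0)"
    using ev ev0 by eventually_elim (use fact t0(2) in \<open>auto simp: N_def\<close>)
   moreover have "((%w. (w - w0) * f w) \<longlongrightarrow> 0) (at w0)"
   proof (rule Lim_transform_eventually)
    have "isCont (%w. - w0 * D w / ((1 + w / w0) * \<psi> (w ^ 2))) w0"
     by (intro isCont_divide isCont_mult cD \<open>isCont (%w. (1 + w / w0) * \<psi> (w ^ 2)) w0\<close> nz0 continuous_const)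
    thus "((%w. - w0 * D w / ((1 + w / w0) * \<psi> (w ^ 2))) \<longlongrightarrow> 0) (at w0)" unfolding isCont_def D0 by simp
    show "eventually (%w. - w0 * D w / ((1 + w / w0) * \<psi> (w ^ 2)) = (w - w0) * f w) (at w0)"
     using ev ev0
    proof eventually_elim
     case (elim w)
     define X where "X = (1 + w / w0) * \<psi> (w ^ 2)"
     have "w ~= 0" "w ~= w0" using elim by auto
     define Y where "Y = 1 - w / w0"
     have Y: "Y ~= 0" using \<open>w ~= w0\<close> t0(2) by (simp add: Y_def field_simps)
     have "w - w0 = - w0 * Y" using t0(2) by (simp add: Y_def field_simps)
     moreover have "qtheta (w ^ 2) q = Y * X" using fact[OF \<open>w ~= 0\<close>] by (simp only: X_def Y_def)
     ultimately have "(w - w0) * f w = - w0 * D w / X" using Y by (simp add: f_def)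
     thus ?case by (simp add: X_def)
    qed
   qed
   ultimately show "eventually (%w. w \<in> N) (at w0) & ((%w. (w - w0) * f w) \<longlongrightarrow> 0) (at w0)" ..
  qed auto
  then obtain g where g: "g holomorphic_on -{0}" "!!w. w \<in> N ==> g w = f w" by blast
  have cN: "countable (-{0} - N)"
   by (rule countable_subset[OF _ countable_theta_square_zeros[OF q]]) (auto simp: N_def)
  have tq: "qtheta ((q * z) ^ 2) q = qtheta (z ^ 2) q / (q * z ^ 4)" if "z ~= 0" for z
   using qtheta_double_shift[OF q, of "z ^ 2"] that by (simp add: power_mult_distrib)
  have kq1: "k (q * z) = k z / (q * z ^ 4)" if "z ~= 0" for z
   using kq[OF that, of 1] by (simp add: power_int_minus field_simps)
  have Dq: "D (q * z) = D z / (q * z ^ 4)" if "z ~= 0" for z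
  proof -
   have "k (1 / z) = k (1 / (q * z)) / (q * (1 / (q * z)) ^ 4)" using kq1[of "1 / (q * z)"] that q by simp
   hence "k (1 / (q * z)) = k (1 / z) * (q * (1 / (q * z)) ^ 4)" using that q by (simp add: field_simps)
   hence "D (q * z) = k z / (q * z ^ 4) - (q * z) ^ 2 * (k (1 / z) * (q * (1 / (q * z)) ^ 4))"
    using kq1[OF that] by (simp add: D_def)
   also have "... = D z / (q * z ^ 4)" using that q by (simp add: D_def field_simps eval_nat_numeral)
   finally show ?thesis .
  qed
  have "g (q * z) = g z" if "z ~= 0" for z
  proof (rule eq_off_countable[where S = "-{0}" and B = "-{0} - N" and f = "%z. g (q * z)"])
   show "continuous_on (-{0}) (%z. g (q * z))"
    by (rule continuous_on_compose2[OF holomorphic_on_imp_continuous_on[OF g(1)]]) (use q in \<open>auto intro!: continuous_intros\<close>)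
   fix x assume "x \<in> -{0}" "x ~: -{0} - N"
   hence x: "x ~= 0" "x \<in> N" by auto
   hence "q * x \<in> N" using tq[of x] q by (auto simp: N_def)
   thus "g (q * x) = g x" using g(2) x tq[of x] Dq[of x] q by (simp add: f_def)
  qed (use that cN holomorphic_on_imp_continuous_on[OF g(1)] in auto)
  from q_periodic_constant[OF q g(1) this] obtain K where K: "!!z. z ~= 0 ==> g z = K" by blast
  have DK: "D z = K * qtheta (z ^ 2) q" if "z ~= 0" for z
  proof (rule eq_off_countable[where S = "-{0}" and B = "-{0} - N" and f = D])
   show "continuous_on (-{0}) (%z. K * qtheta (z ^ 2) q)"
    by (intro continuous_intros holomorphic_on_imp_continuous_on[OF ht])
   fix x assume "x \<in> -{0}" "x ~: -{0} - N"
   hence x: "x ~= 0" "x \<in> N" by auto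
   thus "D x = K * qtheta (x ^ 2) q" using g(2)[of x] K[of x] by (simp add: f_def N_def field_simps)
  qed (use that cN holomorphic_on_imp_continuous_on[OF hD] in auto)
  have th1: "qtheta 1 q = 0" using qpoch_shift[OF q(1), of 1] by (simp add: qtheta_def)
  have "k (1 / c) = 0" using c by (simp add: k_def theta_product_def th1)
  moreover have "k c = qtheta (a * c) q * qtheta (b * c) q * qtheta (c ^ 2) q * qtheta (a * b) q"
  proof -
   have "qtheta (q * c / (a * b * c)) q = qtheta (a * b) q"
    using qtheta_reflect[of q "a * b"] q abc c by simp
   thus ?thesis by (simp add: k_def theta_product_def power2_eq_square)
  qed
  moreover have "qtheta ((1 / c) ^ 2) q = - qtheta (c ^ 2) q / c ^ 2"
   using qtheta_inverse[OF q(1), of "c ^ 2"] c by (simp add: power_one_over)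
  ultimately have "K * (- qtheta (c ^ 2) q / c ^ 2) = - ((1 / c) ^ 2 * (qtheta (a * c) q * qtheta (b * c) q * qtheta (c ^ 2) q * qtheta (a * b) q))"
   using DK[of "1 / c"] c by (simp add: D_def)
  hence "K = qtheta (a * b) q * qtheta (a * c) q * qtheta (b * c) q" using c by (simp add: field_simps)
  thus ?thesis using DK[OF z] by (simp add: D_def k_def)
 qed
 show ?thesis
 proof (rule eq_off_countable[where S = "-{0}" and B = "{c. c ~= 0 & qtheta (c ^ 2) q = 0}" and x = c and
    f = "%c. theta_product q a b c z - z ^ 2 * theta_product q a b c (1 / z)" and
    g = "%c. qtheta (a * b) q * qtheta (a * c) q * qtheta (b * c) q * qtheta (z ^ 2) q"])
  show "continuous_on (-{0}) (%c. theta_product q a b c z - z ^ 2 * theta_product q a b c (1 / z))"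
   unfolding theta_product_def by (intro continuous_intros q) (use q abc z in auto)
  show "continuous_on (-{0}) (%c. qtheta (a * b) q * qtheta (a * c) q * qtheta (b * c) q * qtheta (z ^ 2) q)"
   by (intro continuous_intros q) (use abc z in auto)
 qed (use generic abc countable_theta_square_zeros[OF q] in auto)
qed

section \<open>The symmetrised integral\<close>

lemma contour_integral_circle_inverse:
 assumes F: "continuous_on (sphere 0 1) F"
 shows "contour_integral (circlepath 0 1) (%z. F (1 / z) / z ^ 2) = contour_integral (circlepath 0 1) F"
proof -
 have an: "inverse analytic_on -{0}" by (subst analytic_on_open) (auto intro!: holomorphic_intros)
 have rev: "inverse \<circ> circlepath 0 1 = reversepath (circlepath 0 1)"
  by (rule ext) (simp add: circlepath reversepath_def o_def algebra_simps exp_diff exp_minus inverse_eq_divide)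
 have "- contour_integral (circlepath 0 1) F = contour_integral (inverse \<circ> circlepath 0 1) F"
  unfolding rev by (rule contour_integral_reversepath[symmetric]) simp
 also have "... = contour_integral (circlepath 0 1) (%w. deriv inverse w * F (inverse w))"
  by (rule contour_integral_comp_analyticW[OF an]) auto
 also have "... = contour_integral (circlepath 0 1) (%w. - (F (1 / w) / w ^ 2))"
 proof (rule contour_integral_cong[OF refl])
  fix w assume "w \<in> path_image (circlepath 0 1 :: real => complex)"
  hence "w ~= 0" by auto
  thus "deriv inverse w * F (inverse w) = - (F (1 / w) / w ^ 2)"
   by (simp add: inverse_eq_divide power2_eq_square)
 qed
 also have "... = - contour_integral (circlepath 0 1) (%w. F (1 / w) / w ^ 2)" by (rule contour_integral_neg)
 finally show ?thesis by simp
qed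

lemma separates_scale:
 assumes s: "separates p q a b gm" and z: "zt ~= 0"
 shows "separates p q (%i. zt * a i) (%i. b i / zt) ((*) zt \<circ> gm)"
proof -
 have vp: "valid_path gm" and cl: "pathfinish gm = pathstart gm" using s by (auto simp: separates_def)
 have an: "(*) zt analytic_on UNIV" by (subst analytic_on_open) (auto intro!: holomorphic_intros)
 have vp': "valid_path ((*) zt \<circ> gm)" by (rule valid_path_compose_analytic[OF vp an]) auto
 have im: "path_image ((*) zt \<circ> gm) = (*) zt ` path_image gm" by (simp add: path_image_compose)
 have mem: "zt * x \<in> path_image ((*) zt \<circ> gm) \<longleftrightarrow> x \<in> path_image gm" for x using z by (auto simp: im)
 have wn: "winding_number ((*) zt \<circ> gm) (zt * x) = winding_number gm x" if x: "x ~: path_image gm" for x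
 proof -
  have "winding_number ((*) zt \<circ> gm) (zt * x) = 1 / (2 * pi * \<i>) * contour_integral ((*) zt \<circ> gm) (%w. 1 / (w - zt * x))"
   by (rule winding_number_valid_path[OF vp']) (use x mem in auto)
  also have "contour_integral ((*) zt \<circ> gm) (%w. 1 / (w - zt * x)) = contour_integral gm (%w. deriv ((*) zt) w * (1 / (zt * w - zt * x)))"
   by (rule contour_integral_comp_analyticW[OF an vp]) auto
  also have "... = contour_integral gm (%w. 1 / (w - x))"
   using z by (intro contour_integral_cong refl) (simp flip: right_diff_distrib)
  also have "1 / (2 * pi * \<i>) * ... = winding_number gm x"
   by (rule winding_number_valid_path[OF vp x, symmetric])
  finally show ?thesis .
 qed
 have inner: "zt * x \<in> inner_region ((*) zt \<circ> gm)" if "x \<in> inner_region gm" for x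
  using that mem wn by (auto simp: inner_region_def)
 have outer: "y / zt \<in> outer_region ((*) zt \<circ> gm)" if y: "y \<in> outer_region gm" for y
 proof (cases "y = 0")
  case False
  have e: "1 / (y / zt) = zt * (1 / y)" by simp
  have "1 / y ~: path_image gm" "winding_number gm (1 / y) = 0" using y False by (auto simp: outer_region_def)
  hence "1 / (y / zt) ~: path_image ((*) zt \<circ> gm) & winding_number ((*) zt \<circ> gm) (1 / (y / zt)) = 0"
   using mem[of "1 / y"] wn[of "1 / y"] by simp
  thus ?thesis by (simp add: outer_region_def)
 qed (simp add: outer_region_def)
 show ?thesis unfolding separates_def
 proof (intro conjI allI vp')
  show "pathfinish ((*) zt \<circ> gm) = pathstart ((*) zt \<circ> gm)" using cl by (simp add: pathfinish_def pathstart_def)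
  show "0 \<in> inner_region ((*) zt \<circ> gm)" using inner[of 0] s by (simp add: separates_def)
  fix i j k
  have "a i * p ^ j * q ^ k \<in> inner_region gm" "b i * p ^ j * q ^ k \<in> outer_region gm" using s by (auto simp: separates_def)
  from inner[OF this(1)] outer[OF this(2)]
  show "zt * a i * p ^ j * q ^ k \<in> inner_region ((*) zt \<circ> gm)" "b i / zt * p ^ j * q ^ k \<in> outer_region ((*) zt \<circ> gm)"
   by (simp_all add: mult.assoc)
 qed
qed

lemma kernel_integral_scale:
 fixes a b c d :: "'n::finite => complex"
 assumes q: "norm q < 1" and p: "norm p < 1" and W: "W holomorphic_on (-{0})" and z: "zt ~= 0" and nr: "nonresonant p q a b"
 shows "kernel_integral p q (%i. zt * a i) (%i. b i / zt) (%i. zt * c i) (%i. d i / zt) W = kernel_integral p q a b c d (%y. W (zt * y))"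
proof -
 obtain gm where "polynomial_function gm" and s: "separates p q a b gm"
  by (rule separates_exists[OF q p nr, of "{}"]) auto
 have vp: "valid_path gm" using s by (simp add: separates_def)
 have an: "(*) zt analytic_on UNIV" by (subst analytic_on_open) (auto intro!: holomorphic_intros)
 have "W \<circ> (%y. zt * y) holomorphic_on -{0}"
  by (rule holomorphic_on_compose_gen[OF _ W]) (use z in \<open>auto intro!: holomorphic_intros\<close>)
 hence W': "(%y. W (zt * y)) holomorphic_on -{0}" by (simp add: o_def)
 have "kernel_integral p q (%i. zt * a i) (%i. b i / zt) (%i. zt * c i) (%i. d i / zt) W =
  contour_integral ((*) zt \<circ> gm) (%z. W z * gamma_quot p q (%i. zt * a i) (%i. b i / zt) (%i. zt * c i) (%i. d i / zt) z / (2 * of_real pi * \<i> * z))"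
  by (rule kernel_integral_eq[OF q p W separates_scale[OF s z]])
 also have "... = contour_integral gm (%w. deriv ((*) zt) w * (W (zt * w) * gamma_quot p q (%i. zt * a i) (%i. b i / zt) (%i. zt * c i) (%i. d i / zt) (zt * w) / (2 * of_real pi * \<i> * (zt * w))))"
  by (rule contour_integral_comp_analyticW[OF an vp]) auto
 also have "... = contour_integral gm (%y. W (zt * y) * gamma_quot p q a b c d y / (2 * of_real pi * \<i> * y))"
  using z by (intro contour_integral_cong refl) (simp add: gamma_quot_def)
 also have "... = kernel_integral p q a b c d (%y. W (zt * y))"
  by (rule kernel_integral_eq[OF q p W' s, symmetric])
 finally show ?thesis .
qed

definition pair_rest :: "complex => complex => 'n => 'n => ('n::finite => complex) => complex" where
 "pair_rest p q i j t = (\<Prod>P\<in>{P::'n set. card P = 2} - {{i, j}}. qpoch2 (\<Prod>r\<in>P. t r) p q)"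

definition shifted :: "complex => 'n => 'n => ('n => complex) => 'n => complex" where
 "shifted p i j t r = (if r = i | r = j then p * t r else t r)"

text \<open>The first two factors form \<theta>(1/z^2; p). \<open>c\<close> is the free parameter of
  the addition formula, and \<open>d\<close> will be t_i t_j c, the product of its three
  parameters.\<close>

definition half_weight :: "complex => complex => complex => complex => complex => complex" where
 "half_weight p q c d z = qpoch (p * z ^ 2) p * qpoch (1 / z ^ 2) p * qtheta (c * z) q * qtheta (q * z / d) q"

lemma holomorphic_half_weight:
 assumes "norm q < 1" "norm p < 1" "q ~= 0" "c ~= 0" "d ~= 0"
 shows "half_weight p q c d holomorphic_on (-{0})"
 unfolding half_weight_def by (intro holomorphic_intros) (use assms in auto)

text \<open>Only the outer poles use \<open>shifted\<close>: the factors \<theta>(t_i z; q) and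
  \<theta>(t_j z; q) cancel the poles coming from (t_i z; q) and (t_j z; q) and leave the inner
  poles alone.\<close>

definition half_integral :: "complex => complex => 'n => 'n => complex => ('n::finite => complex) => complex" where
 "half_integral p q i j c t = kernel_integral p q t (shifted p i j t)
  (%r. p * q / shifted p i j t r) (%r. p * q / t r) (half_weight p q c (t i * t j * c))"

text \<open>By the addition formula the Weyl weight is a multiple of \<open>F(z) + F(1/z)\<close> with \<open>F\<close> containing
 \<open>\<theta>(t\<^sub>i z) \<theta>(t\<^sub>j z)\<close>, and these factors turn \<open>\<Gamma>(t\<^sub>i z)\<close> into \<open>\<Gamma>(p t\<^sub>i z)\<close>.\<close>

lemma beta_value_half_integral:
 fixes t :: "'n::finite => complex"
 assumes q: "norm q < 1" "q ~= 0" and p: "norm p < 1" "p ~= 0" and ij: "i ~= j"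
  and t: "!!r. t r ~= 0" "!!r. norm (t r) < 1" and c: "c ~= 0"
 shows "qpoch (q / (t i * t j)) q * qtheta (t i * c) q * qtheta (t j * c) q * beta_value p q t =
  qpoch2 (p * (t i * t j)) p q * pair_rest p q i j t * qpoch p p * qpoch q q * half_integral p q i j c t"
proof -
 define s where "s = shifted p i j t"
 define W where "W = half_weight p q c (t i * t j * c)"
 define C where "C = (circlepath 0 1 :: real => complex)"
 define G where "G = gamma_quot p q t t (%r. p * q / t r) (%r. p * q / t r)"
 define F where "F z = W z * gamma_quot p q t s (%r. p * q / s r) (%r. p * q / t r) z / (2 * of_real pi * \<i> * z)" for z
 define c0 where "c0 = qtheta (t i * t j) q * qtheta (t i * c) q * qtheta (t j * c) q"
 define k where "k = theta_product q (t i) (t j) c"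
 have s1: "norm (s r) < 1" for r
 proof (cases "r = i | r = j")
  case True
  have "norm (p * t r) < 1 * 1" unfolding norm_mult by (rule mult_strict_mono) (use p t(2) in auto)
  thus ?thesis using True by (simp add: s_def shifted_def)
 qed (use t in \<open>simp add: s_def shifted_def\<close>)
 have st: "separates p q t t C" "separates p q t s C" unfolding C_def
  by (rule separates_circle; use q p t s1 in simp)+
 have W: "W holomorphic_on -{0}" unfolding W_def
  by (rule holomorphic_half_weight) (use q p t c in auto)
 have I: "beta_integral p q t = contour_integral C (%z. weyl_weight p q z * G z / (2 * of_real pi * \<i> * z))"
  unfolding beta_integral_def G_def by (rule kernel_integral_eq[OF q(1) p(1) holomorphic_weyl_weight[OF q(1) p(1)] st(1)])
 have K: "half_integral p q i j c t = contour_integral C F"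
  unfolding half_integral_def F_def s_def[symmetric] W_def[symmetric] by (rule kernel_integral_eq[OF q(1) p(1) W st(2)])
 have img: "path_image C = sphere 0 1" by (simp add: C_def)
 have pf: "sphere 0 1 \<subseteq> pole_free p q t t" "sphere 0 1 \<subseteq> pole_free p q t s"
  using separates_path_image[OF q(1) p(1) st(1)] separates_path_image[OF q(1) p(1) st(2)] img by auto
 have cF: "continuous_on (sphere 0 1) F"
  using holomorphic_on_subset[OF holomorphic_kernel[OF q(1) p(1) W] pf(2)] unfolding F_def
  by (rule holomorphic_on_imp_continuous_on)
 have cI: "continuous_on (sphere 0 1) (%z. weyl_weight p q z * G z / (2 * of_real pi * \<i> * z))"
  using holomorphic_on_subset[OF holomorphic_kernel[OF q(1) p(1) holomorphic_weyl_weight[OF q(1) p(1)]] pf(1)] unfolding G_def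
  by (rule holomorphic_on_imp_continuous_on)
 have Gsym: "G (1 / z) = G z" for z
  unfolding G_def gamma_quot_def by (rule prod.cong) (auto simp: mult_ac)
 have shift: "gamma_quot p q t s (%r. p * q / s r) (%r. p * q / t r) z = G z * (qtheta (t i * z) q * qtheta (t j * z) q)"
  if z: "z \<in> sphere 0 1" for z
 proof -
  have z0: "z ~= 0" using z by auto
  have nz: "qpoch2 (t r / z) p q ~= 0" "qpoch2 (t r * z) p q ~= 0" for r using pf(1) z by (auto simp: pole_free_def)
  define g where "g r = (if r \<in> {i, j} then qtheta (t r * z) q else 1)" for r
  have "gamma_quot p q t s (%r. p * q / s r) (%r. p * q / t r) z = G z * (\<Prod>r\<in>UNIV. g r)"
   unfolding gamma_quot_def G_def prod.distrib[symmetric]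
  proof (rule prod.cong[OF refl])
   fix r
   show "qpoch2 (p * q / s r / z) p q * qpoch2 (p * q / t r * z) p q / (qpoch2 (t r / z) p q * qpoch2 (s r * z) p q) =
    qpoch2 (p * q / t r / z) p q * qpoch2 (p * q / t r * z) p q / (qpoch2 (t r / z) p q * qpoch2 (t r * z) p q) * g r"
   proof (cases "r \<in> {i, j}")
    case True
    hence sr: "s r = p * t r" by (auto simp: s_def shifted_def)
    have e1: "qpoch2 (t r * z) p q = qpoch (t r * z) q * qpoch2 (s r * z) p q"
     using qpoch2_shift_p[OF q(1) p(1), of "t r * z"] by (simp add: sr mult_ac)
    have e2: "qpoch2 (p * q / s r / z) p q = qpoch (q / (t r * z)) q * qpoch2 (p * q / t r / z) p q"
     using qpoch2_shift_p[OF q(1) p(1), of "q / (t r * z)"] p by (simp add: sr mult_ac)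
    have e3: "g r = qpoch (t r * z) q * qpoch (q / (t r * z)) q" using True by (simp add: g_def qtheta_def)
    have n1: "qpoch (t r * z) q ~= 0" "qpoch2 (s r * z) p q ~= 0" using nz(2)[of r] unfolding e1 by auto
    show ?thesis unfolding e1 e2 e3 using n1 nz(1)[of r] by (simp add: field_simps)
   qed (auto simp: g_def s_def shifted_def)
  qed
  also have "(\<Prod>r\<in>UNIV. g r) = (\<Prod>r\<in>{i, j}. qtheta (t r * z) q)"
   unfolding g_def by (subst prod.inter_restrict[symmetric]) auto
  also have "... = qtheta (t i * z) q * qtheta (t j * z) q" using ij by simp
  finally show ?thesis .
 qed
 have F: "F z = qpoch (p * z ^ 2) p * qpoch (1 / z ^ 2) p * k z * G z / (2 * of_real pi * \<i> * z)" if "z \<in> sphere 0 1" for z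
  using shift[OF that] by (simp add: F_def W_def half_weight_def k_def theta_product_def mult_ac)
 have sym: "c0 * (weyl_weight p q z * G z / (2 * of_real pi * \<i> * z)) = F z + F (1 / z) / z ^ 2" if z: "z \<in> sphere 0 1" for z
 proof -
  have z0: "z ~= 0" and z': "1 / z \<in> sphere 0 1" using z by (auto simp: norm_divide)
  define A B where "A = qpoch (p * z ^ 2) p" and "B = qpoch (p / z ^ 2) p"
  have e1: "qpoch (z ^ 2) p = (1 - z ^ 2) * A" using qpoch_shift[OF p(1), of "z ^ 2"] by (simp add: A_def mult_ac)
  have e2: "qpoch (1 / z ^ 2) p = (1 - 1 / z ^ 2) * B" using qpoch_shift[OF p(1), of "1 / z ^ 2"] by (simp add: B_def)
  have e3: "qpoch (1 / z ^ 2) q = (1 - 1 / z ^ 2) * qpoch (q / z ^ 2) q" using qpoch_shift[OF q(1), of "1 / z ^ 2"] by simp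
  have "c0 * weyl_weight p q z = A * B * (1 - 1 / z ^ 2) * (c0 * qtheta (z ^ 2) q)"
   by (simp add: weyl_weight_def e3 A_def B_def qtheta_def mult_ac)
  also have "c0 * qtheta (z ^ 2) q = k z - z ^ 2 * k (1 / z)"
   using theta_addition[OF q t(1)[of i] t(1)[of j] c z0] by (simp add: c0_def k_def)
  finally have w: "c0 * weyl_weight p q z = A * B * (1 - 1 / z ^ 2) * (k z - z ^ 2 * k (1 / z))" .
  have F1: "F z = A * ((1 - 1 / z ^ 2) * B) * k z * G z / (2 * of_real pi * \<i> * z)"
   unfolding F[OF z] e2 A_def ..
  have F2: "F (1 / z) = B * ((1 - z ^ 2) * A) * k (1 / z) * G z / (2 * of_real pi * \<i> * (1 / z))"
   unfolding F[OF z'] Gsym using e1 by (simp add: B_def power_one_over)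
  have "c0 * (weyl_weight p q z * G z / (2 * of_real pi * \<i> * z)) = (c0 * weyl_weight p q z) * G z / (2 * of_real pi * \<i> * z)" by simp
  also have "... = F z + F (1 / z) / z ^ 2"
   unfolding w F1 F2 using z0 by (simp add: field_simps power2_eq_square)
  finally show ?thesis .
 qed
 have cF2: "continuous_on (sphere 0 1) (%z. F (1 / z) / z ^ 2)"
  by (intro continuous_intros continuous_on_compose2[OF cF]) (auto simp: norm_divide)
 have int: "f contour_integrable_on C" if "continuous_on (sphere 0 1) f" for f
  unfolding C_def by (rule contour_integrable_continuous_circlepath) (use that in simp)
 have "c0 * beta_integral p q t = contour_integral C (%z. c0 * (weyl_weight p q z * G z / (2 * of_real pi * \<i> * z)))"
  unfolding I by (rule contour_integral_lmul[symmetric]) (rule int[OF cI])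
 also have "... = contour_integral C (%z. F z + F (1 / z) / z ^ 2)"
  by (rule contour_integral_cong[OF refl]) (use sym img in auto)
 also have "... = contour_integral C F + contour_integral C (%z. F (1 / z) / z ^ 2)"
  by (rule contour_integral_add[OF int[OF cF] int[OF cF2]])
 also have "contour_integral C (%z. F (1 / z) / z ^ 2) = contour_integral C F"
  unfolding C_def by (rule contour_integral_circle_inverse[OF cF])
 finally have c0I: "c0 * beta_integral p q t = 2 * half_integral p q i j c t" by (simp add: K)
 have pre: "pair_prefactor p q t = qpoch2 (t i * t j) p q * pair_rest p q i j t"
  unfolding pair_prefactor_def pair_rest_def
  by (subst prod.remove[of _ "{i, j}"]) (use ij in \<open>auto simp: card_2_iff\<close>)
 \<comment> \<open>(t_i t_j; q) occurs both in the prefactor and in \<open>c0\<close>. It is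
   cancelled here, where it is nonzero, so that the identity can be continued to points where it
   vanishes.\<close>
 have ab: "qpoch (t i * t j) q ~= 0"
 proof
  assume "qpoch (t i * t j) q = 0"
  then obtain n where "t i * t j * q ^ n = 1" using qpoch_eq_0_iff[OF q(1)] by blast
  hence "norm (t i * t j) * norm q ^ n = 1" by (metis norm_mult norm_one norm_power)
  moreover have "norm (t i * t j) < 1 * 1" unfolding norm_mult by (rule mult_strict_mono) (use t in auto)
  moreover have "norm (t i * t j) * norm q ^ n <= norm (t i * t j) * 1"
   by (rule mult_left_mono) (use q in \<open>auto intro: power_le_one\<close>)
  ultimately show False by simp
 qed
 have "c0 * beta_value p q t = pair_prefactor p q t * qpoch p p * qpoch q q / 2 * (c0 * beta_integral p q t)"
  by (simp add: beta_value_def)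
 also have "... = qpoch2 (t i * t j) p q * pair_rest p q i j t * qpoch p p * qpoch q q * half_integral p q i j c t"
  unfolding c0I pre by simp
 also have "qpoch2 (t i * t j) p q = qpoch (t i * t j) q * qpoch2 (p * (t i * t j)) p q" by (rule qpoch2_shift_p[OF q(1) p(1)])
 finally have "qpoch (t i * t j) q * (qpoch (q / (t i * t j)) q * qtheta (t i * c) q * qtheta (t j * c) q * beta_value p q t) =
  qpoch (t i * t j) q * (qpoch2 (p * (t i * t j)) p q * pair_rest p q i j t * qpoch p p * qpoch q q * half_integral p q i j c t)"
  by (simp add: c0_def qtheta_def[of "t i * t j"] mult_ac)
 thus ?thesis using ab by simp
qed

section \<open>The vertices of the polytope\<close>

context elliptic_base
begin

text \<open>Near w_ij the parameters t_i and t_j are large, beyond the reach of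
  \<open>beta_value_half_integral\<close>. Both sides are continued along
  \<open>radial_curve\<close>, the right one wherever the inner poles and the shifted outer poles
  stay apart.\<close>

lemma E_m_half_integral:
 fixes t :: "complex ^ 'n"
 assumes p: "p ~= 0" "norm p < 1" and t: "t \<in> H_m m p q" and ij: "i ~= j" and c: "c ~= 0"
  and nr: "nonresonant p q (vec_nth t) (shifted p i j (vec_nth t))"
 shows "qpoch (q / (t $ i * t $ j)) q * qtheta (t $ i * c) q * qtheta (t $ j * c) q * E_m m p q t =
  qpoch2 (p * (t $ i * t $ j)) p q * pair_rest p q i j (vec_nth t) * qpoch p p * qpoch q q * half_integral p q i j c (vec_nth t)"
proof -
 obtain ta d :: "'n => complex" where ta: "!!r. 0 < norm (ta r) & norm (ta r) < 1" and curve1: "exp_curve ta d 1 = vec_nth t"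
  and H: "!!w. (\<chi> r. exp_curve ta d w r) \<in> H_m m p q"
  and imag: "!!y::real. \<exists>z\<in>utorus. exp_curve ta d (\<i> * y) = vec_nth (pt p ro z)"
  using radial_curve[OF p t] by metis
 define T where "T = exp_curve ta d"
 define be where "be = shifted p i j ta"
 have sT: "exp_curve be d w = shifted p i j (T w)" for w
  by (rule ext) (simp add: be_def T_def exp_curve_def shifted_def)
 have Tnz: "T w r ~= 0" for w r using ta[of r] by (auto simp: T_def exp_curve_def)
 have hT: "(%w. T w r) holomorphic_on U" for U r
  unfolding T_def exp_curve_def by (intro holomorphic_intros)
 have hS: "(%w. shifted p i j (T w) r) holomorphic_on U" for U r
  by (cases "r = i | r = j") (auto simp: shifted_def intro!: holomorphic_intros hT)
 have Snz: "shifted p i j (T w) r ~= 0" for w r using Tnz p by (simp add: shifted_def)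
 define f g where "f = (%w. qpoch (q / (T w i * T w j)) q * qtheta (T w i * c) q * qtheta (T w j * c) q * eseries p (\<chi> r. T w r))"
  and "g = (%w. qpoch2 (p * (T w i * T w j)) p q * pair_rest p q i j (T w) * qpoch p p * qpoch q q * half_integral p q i j c (T w))"
 define N where "N = {w. nonresonant p q (T w) (shifted p i j (T w))}"
 have N: "open N" unfolding N_def
  using open_nonresonant[OF q(1) p(2) open_UNIV, where A = T and B = "%w. shifted p i j (T w)"]
   holomorphic_on_imp_continuous_on[OF hT] holomorphic_on_imp_continuous_on[OF hS] by simp
 have beta1: "norm (be r) < 1" for r
 proof (cases "r = i | r = j")
  case True
  have "norm (p * ta r) < 1 * 1" unfolding norm_mult by (rule mult_strict_mono) (use p ta in auto)
  thus ?thesis using True by (simp add: be_def shifted_def)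
 qed (use ta in \<open>simp add: be_def shifted_def\<close>)
 have "f 1 = g 1"
 proof (rule exp_curve_identity[where f = f and g = g and w = 1 and af = ta and d = d and be = be and e = d, OF q(1) p(2)],
   unfold sT T_def[symmetric] N_def[symmetric])
  have "(%w. eseries p (\<chi> r. T w r)) holomorphic_on N"
   by (rule holomorphic_on_eseries[OF N]) (use hT Tnz in auto)
  thus "f holomorphic_on N" unfolding f_def
   by (intro holomorphic_intros hT q) (use Tnz c in auto)
  have "(%w. half_integral p q i j c (T w)) holomorphic_on N" unfolding half_integral_def
  proof (rule holomorphic_on_kernel_integral[OF q(1) p(2) N])
   show "(%w. T w r) holomorphic_on N" "(%w. shifted p i j (T w) r) holomorphic_on N" for r by (rule hT hS)+
   show "(%w. p * q / shifted p i j (T w) r) holomorphic_on N" "(%w. p * q / T w r) holomorphic_on N" for r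
    using Tnz Snz by (auto intro!: holomorphic_intros hT hS)
   show "nonresonant p q (T w) (shifted p i j (T w))" if "w \<in> N" for w using that by (simp add: N_def)
   show "half_weight p q c (T w i * T w j * c) holomorphic_on -{0}" for w
    by (rule holomorphic_half_weight) (use q p c Tnz in auto)
   have cT: "continuous_on (N \<times> -{0}) (%x. T (fst x) r)" for r
    by (rule continuous_on_fst_compose[OF holomorphic_on_imp_continuous_on[OF hT]])
   show "continuous_on (N \<times> -{0}) (%(w, z). half_weight p q c (T w i * T w j * c) z)"
    unfolding half_weight_def case_prod_unfold by (intro continuous_intros cT q p) (use c q Tnz in auto)
   show "(%w. half_weight p q c (T w i * T w j * c) z) holomorphic_on N" if "z ~= 0" for z
    unfolding half_weight_def by (intro holomorphic_intros hT q p) (use c q Tnz that in auto)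
  qed
  thus "g holomorphic_on N" unfolding g_def pair_rest_def
   by (intro holomorphic_intros hT q p)
  show "ta x * be y * p ^ j * q ^ k ~= 1" for x y j k
   using small_nonresonant[of ta be p] ta beta1 p by (simp add: nonresonant_def)
  show "nonresonant p q (T 1) (shifted p i j (T 1))" using nr curve1 by (simp add: T_def)
  fix y :: real
  obtain z where z: "z \<in> utorus" and e: "T (\<i> * y) = vec_nth (pt p ro z)" using imag unfolding T_def by blast
  have e': "(\<chi> r. T (\<i> * y) r) = pt p ro z" unfolding e by (simp add: vec_eq_iff)
  have T1: "norm (T (\<i> * y) r) < 1" for r
  proof -
   have C: "0 < norm ((p * q) ^ (m + 1))" "norm ((p * q) ^ (m + 1)) <= norm q" using power_Suc_le_q[of p] p q by auto
   show ?thesis unfolding e pt_def using norm_base_point[where sg = ro and ?k0.0 = k0 and s = r and C = "(p * q) ^ (m + 1)", OF z rho_pos]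
    base_moduli_less_1[OF C, of r] by simp
  qed
  have S1: "norm (shifted p i j (T (\<i> * y)) r) < 1" for r
  proof (cases "r = i | r = j")
   case True
   have "norm (p * T (\<i> * y) r) < 1 * 1" unfolding norm_mult by (rule mult_strict_mono) (use p T1 in auto)
   thus ?thesis using True by (simp add: shifted_def)
  qed (use T1 in \<open>simp add: shifted_def\<close>)
  have "f (\<i> * y) = g (\<i> * y)"
   unfolding f_def g_def e' eseries_base[OF p z] unfolding e[symmetric]
   by (rule beta_value_half_integral[OF q p(2,1) ij Tnz T1 c])
  thus "nonresonant p q (T (\<i> * y)) (shifted p i j (T (\<i> * y))) & f (\<i> * y) = g (\<i> * y)"
   using small_nonresonant[OF T1 S1 p(2)] by simp
 qed
 moreover have "T 1 = vec_nth t" using curve1 by (simp add: T_def)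
 moreover have "(\<chi> r. t $ r) = t" by (simp add: vec_eq_iff)
 ultimately show ?thesis unfolding E_m_eq_eseries[OF p t] by (simp add: f_def g_def)
qed

lemma continuous_on_torus_point:
 assumes "!!s. sg s > 0"
 shows "continuous_on (U \<times> utorus) (%x. base_point (q ^ (m + 1)) k0 sg (snd x) $ r)"
 using continuous_on_base_point[where C = "%_. q ^ (m + 1)" and U = U and sg = sg and ?k0.0 = k0 and r = r] assms by simp

text \<open>For r in \<open>S\<close> one has t_r = p u_r and p q / t_r = q / u_r; elsewhere these
  are u_r and p q / u_r. So all data of the integral extend continuously to p = 0.\<close>

lemma good_vS:
 assumes S: "card S = m + 1"
 shows "good (vS S)"
proof (rule good_criterion)
 show v: "(\<Sum>r\<in>UNIV. vS S $ r) = real (m + 1)" using S by (simp add: vS_def sum.If_cases)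
 fix sg :: "'n => real" assume sg: "!!s. sg s > 0" and nr: "rad_nonres 0 (norm q) (um sg) (um sg)"
 define u where "u z = base_point (q ^ (m + 1)) k0 sg z" for z
 define a where "a p z r = (if r \<in> S then p * u z $ r else u z $ r)" for p z r
 define d where "d p z r = (if r \<in> S then q / u z $ r else p * q / u z $ r)" for p z r
 define g where "g p z = pair_prefactor p q (a p z) * qpoch p p * qpoch q q / 2 * kernel_integral p q (a p z) (a p z) (d p z) (d p z) (weyl_weight p q)" for p z
 define af where "af p r = (if r \<in> S then norm p * um sg r else um sg r)" for p :: complex and r
 define U where "U = {p. norm p < 1 & rad_nonres (norm p) (norm q) (af p) (af p)}"
 have unz: "u z $ r ~= 0" if "z \<in> utorus" for z r
  unfolding u_def by (rule base_point_nonzero[OF that]) (use sg q in auto)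
 have na: "norm (a p z r) = af p r" if "z \<in> utorus" for p z r
  using norm_um[where sg = sg, OF that sg] by (simp add: a_def af_def u_def norm_mult)
 have id: "((%p::complex. norm p) \<longlongrightarrow> norm (0::complex)) (nhds 0)" by (rule tendsto_norm) (rule filterlim_ident)
 have al: "((%p. af p r) \<longlongrightarrow> af 0 r) (nhds 0)" for r unfolding af_def
  by (cases "r \<in> S") (use tendsto_mult[OF id tendsto_const, of "um sg r"] in auto)
 have "eventually (%p. rad_nonres (norm p) (norm q) (af p) (af p)) (nhds 0)"
  by (rule eventually_nonresonant_near_0[OF nr um_pos[OF sg] al _ al]) (auto simp: af_def)
 moreover have "eventually (%p::complex. p \<in> ball 0 1) (nhds 0)" by (rule eventually_nhds_in_open) auto
 ultimately have U: "eventually (%p. p \<in> U) (nhds 0)" by eventually_elim (auto simp: U_def)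
 have cu: "continuous_on (U \<times> utorus) (%x. u (snd x) $ r)" for r
  unfolding u_def by (rule continuous_on_torus_point[OF sg])
 have ca: "continuous_on (U \<times> utorus) (%x. a (fst x) (snd x) r)" for r
  unfolding a_def by (cases "r \<in> S") (auto intro!: continuous_intros cu)
 have cd: "continuous_on (U \<times> utorus) (%x. d (fst x) (snd x) r)" for r
  unfolding d_def by (cases "r \<in> S") (auto intro!: continuous_intros cu simp: unz)
 have "continuous_on (U \<times> utorus) (%(p, z). g p z)"
  unfolding g_def case_prod_unfold pair_prefactor_def
 proof (intro continuous_intros q ca)
  show "continuous_on (U \<times> utorus) (%x. kernel_integral (fst x) q (a (fst x) (snd x)) (a (fst x) (snd x)) (d (fst x) (snd x)) (d (fst x) (snd x)) (weyl_weight (fst x) q))"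
  proof (intro continuous_on_kernel_integral q ca cd)
   show "nonresonant (fst x) q (a (fst x) (snd x)) (a (fst x) (snd x))" if "x \<in> U \<times> utorus" for x
    by (rule nonresonant_radial[where af = "af (fst x)" and be = "af (fst x)"]) (use that na in \<open>auto simp: U_def\<close>)
   show "weyl_weight (fst x) q holomorphic_on -{0}" if "x \<in> U \<times> utorus" for x
    by (rule holomorphic_weyl_weight[OF q(1)]) (use that in \<open>auto simp: U_def\<close>)
   show "continuous_on ((U \<times> utorus) \<times> -{0}) (%(x, z). weyl_weight (fst x) q z)"
    unfolding weyl_weight_def case_prod_unfold by (intro continuous_intros q) (auto simp: U_def)
  qed (auto intro!: continuous_intros simp: U_def)
 qed (auto simp: U_def)
 moreover have "E_m m p q (pscale (base_point (q ^ (m + 1)) k0 sg z) p (vS S)) = g p z"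
  if p: "p \<in> U - {0}" "norm p < 1" and z: "z \<in> utorus" for p z
 proof -
  have p0: "p ~= 0" using p by simp
  have t: "vec_nth (pscale (u z) p (vS S)) = a p z"
   by (rule ext) (use p0 in \<open>simp add: pscale_def vS_def a_def powr_def\<close>)
  have H: "pscale (u z) p (vS S) \<in> H_m m p q"
   unfolding u_def by (rule pscale_in_H_m[OF p0 base_point_Htilde[OF sg z] v])
  have nr': "nonresonant p q (a p z) (a p z)"
   by (rule nonresonant_radial[where af = "af p" and be = "af p"]) (use p z na in \<open>auto simp: U_def\<close>)
  have "(%r. p * q / a p z r) = d p z" by (rule ext) (use p0 in \<open>simp add: a_def d_def\<close>)
  hence "beta_value p q (a p z) = g p z" by (simp add: g_def beta_value_def beta_integral_def)
  thus ?thesis using E_m_eq_eseries[OF p0 p(2) H] eseries_eq_beta_value[OF p0 p(2) H] nr' unfolding t by (simp add: u_def)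
 qed
 ultimately show "\<exists>U g. eventually (%p. p \<in> U) (nhds 0) & continuous_on (U \<times> utorus) (%(p, z). g p z) &
   (\<forall>p\<in>U - {0}. \<forall>z\<in>utorus. norm p < 1 --> E_m m p q (pscale (base_point (q ^ (m + 1)) k0 sg z) p (vS S)) = g p z)"
  using U by blast
qed

lemma sum_wij: "(\<Sum>r\<in>UNIV. wij i j $ r) = real (m + 1)" for i j :: 'n
proof -
 have "(\<Sum>r\<in>UNIV. wij i j $ r) = (\<Sum>r\<in>(UNIV::'n set). 1 / 2) - (\<Sum>r\<in>UNIV. axis i 1 $ r) - (\<Sum>r\<in>UNIV. axis j (1::real) $ r)"
  by (simp add: wij_def rho_def sum_subtractf)
 also have "... = real CARD('n) / 2 - 1 - 1" by (simp add: axis_def)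
 finally show ?thesis using card by simp
qed

text \<open>With z = p^(-1/2) y, the inner poles in y come from u_i, u_j and p u_r for the other r.
  After the symmetrisation the outer poles come from all the u_r. Both families and the weight
  extend continuously to p = 0.\<close>

lemma good_wij:
 assumes ij: "i ~= j"
 shows "good (wij i j)"
proof (rule good_criterion)
 have wr: "wij i j $ r = (if r = i | r = j then - 1 / 2 else 1 / 2)" for r
  using ij by (auto simp: wij_def rho_def axis_def)
 show v: "(\<Sum>r\<in>UNIV. wij i j $ r) = real (m + 1)" by (rule sum_wij)
 fix sg :: "'n => real" assume sg: "!!s. sg s > 0" and nr: "rad_nonres 0 (norm q) (um sg) (um sg)"
 define u where "u z = base_point (q ^ (m + 1)) k0 sg z" for z
 have unz: "u z $ r ~= 0" if "z \<in> utorus" for z r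
  unfolding u_def by (rule base_point_nonzero[OF that]) (use sg q in auto)
 have nu: "norm (u z $ r) = um sg r" if "z \<in> utorus" for z r
  unfolding u_def by (rule norm_um[OF that sg])
 have \<mu>: "um sg r > 0" for r by (rule um_pos[OF sg])
 \<comment> \<open>The auxiliary parameter \<open>s\<close> avoids the countably many moduli at
   which \<theta>(u_i s; q) or \<theta>(u_j s; q), both divided by later, could vanish on the
   torus.\<close>
 define X where "X = (\<Union>l::int. {norm q powi l / um sg i, norm q powi l / um sg j})"
 have "countable X" unfolding X_def by simp
 moreover have "uncountable {0<..<1::real}" by (simp add: uncountable_open_interval)
 ultimately have "\<not> {0<..<1} \<subseteq> X" using countable_subset by blast
 then obtain s0 where s0: "0 < s0" "s0 ~: X" by (meson greaterThanLessThan_iff subsetI)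
 define s where "s = complex_of_real s0"
 have s: "s ~= 0" "norm s = s0" using s0 by (auto simp: s_def)
 have thnz: "qtheta (u z $ r * s) q ~= 0" if z: "z \<in> utorus" and r: "r = i | r = j" for z r
 proof
  assume "qtheta (u z $ r * s) q = 0"
  then obtain l :: int where "norm (u z $ r * s) = norm q powi l" using qtheta_eq_0_norm[OF q, of "u z $ r * s"] unz[OF z] s by auto
  hence "s0 = norm q powi l / um sg r" using \<mu>[of r] nu[OF z] s by (simp add: norm_mult field_simps)
  hence "s0 \<in> X" using r unfolding X_def by blast
  thus False using s0 by simp
 qed
 define A where "A p z r = (if r = i | r = j then u z $ r else p * u z $ r)" for p z r
 define B where "B p z = (%r. u z $ r)" for p :: complex and z
 define Cc where "Cc p z r = p * q / u z $ r" for p z r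
 define D where "D p z r = (if r = i | r = j then p * q / u z $ r else q / u z $ r)" for p z r
 define W where "W p z y = qpoch (y ^ 2) p * qpoch (p / y ^ 2) p * qtheta (s * y) q * qtheta (q * y / (u z $ i * u z $ j * s)) q" for p z y
 \<comment> \<open>In a pair meeting {i, j} in one index the powers p^(-1/2) and p^(1/2) cancel; in
   a pair disjoint from {i, j} they give a factor p.\<close>
 define pre where "pre p z = (\<Prod>P\<in>{P::'n set. card P = 2} - {{i, j}}. qpoch2 ((if P \<inter> {i, j} = {} then p else 1) * (\<Prod>r\<in>P. u z $ r)) p q)" for p z
 define den where "den p z = qpoch (q * p / (u z $ i * u z $ j)) q * qtheta (u z $ i * s) q * qtheta (u z $ j * s) q" for p z
 define g where "g p z = qpoch2 (u z $ i * u z $ j) p q * pre p z * qpoch p p * qpoch q q * kernel_integral p q (A p z) (B p z) (Cc p z) (D p z) (W p z) / den p z" for p z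
 define af where "af p r = (if r = i | r = j then um sg r else norm p * um sg r)" for p :: complex and r
 \<comment> \<open>The bound on |p q| keeps the factor (p q / (u_i u_j); q) of \<open>den\<close>
   away from 0.\<close>
 define U where "U = {p. norm p < 1 & norm p * norm q < um sg i * um sg j & rad_nonres (norm p) (norm q) (af p) (um sg)}"
 have nA: "norm (A p z r) = af p r" if "z \<in> utorus" for p z r
  using nu[OF that] by (simp add: A_def af_def norm_mult)
 have id: "((%p::complex. norm p) \<longlongrightarrow> norm (0::complex)) (nhds 0)" by (rule tendsto_norm) (rule filterlim_ident)
 have al: "((%p. af p r) \<longlongrightarrow> af 0 r) (nhds 0)" for r unfolding af_def
  by (cases "r = i | r = j") (use tendsto_mult[OF id tendsto_const, of "um sg r"] in auto)
 have "eventually (%p::complex. rad_nonres (norm p) (norm q) (af p) ((%_. um sg) p)) (nhds 0)"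
  by (rule eventually_nonresonant_near_0[OF nr \<mu> al]) (auto simp: af_def)
 moreover have "eventually (%p::complex. p \<in> ball 0 (min 1 (um sg i * um sg j / norm q))) (nhds 0)"
  by (rule eventually_nhds_in_open) (use \<mu> q in auto)
 ultimately have U: "eventually (%p. p \<in> U) (nhds 0)"
  by eventually_elim (use q in \<open>auto simp: U_def field_simps\<close>)
 have den: "den p z ~= 0" if p: "p \<in> U" and z: "z \<in> utorus" for p z
 proof -
  have "qpoch (q * p / (u z $ i * u z $ j)) q ~= 0"
  proof
   define x where "x = q * p / (u z $ i * u z $ j)"
   assume "qpoch (q * p / (u z $ i * u z $ j)) q = 0"
   then obtain n where "x * q ^ n = 1" using qpoch_eq_0_iff[OF q(1)] unfolding x_def by blast
   hence "norm x * norm q ^ n = 1" by (metis norm_mult norm_one norm_power)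
   moreover have "norm x < 1" using p \<mu>[of i] \<mu>[of j] nu[OF z] by (simp add: x_def U_def norm_mult norm_divide field_simps)
   moreover have "norm x * norm q ^ n <= norm x * 1" by (rule mult_left_mono) (use q in \<open>auto intro: power_le_one\<close>)
   ultimately show False by simp
  qed
  thus ?thesis using thnz[OF z] by (simp add: den_def)
 qed
 have cu: "continuous_on (U \<times> utorus) (%x. u (snd x) $ r)" for r
  unfolding u_def by (rule continuous_on_torus_point[OF sg])
 have cA: "continuous_on (U \<times> utorus) (%x. A (fst x) (snd x) r)" for r
  unfolding A_def by (cases "r = i | r = j") (auto intro!: continuous_intros cu)
 have cD: "continuous_on (U \<times> utorus) (%x. D (fst x) (snd x) r)" for r
  unfolding D_def by (cases "r = i | r = j") (auto intro!: continuous_intros cu simp: unz)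
 have cpre: "continuous_on (U \<times> utorus) (%x. pre (fst x) (snd x))" unfolding pre_def
 proof (intro continuous_on_prod continuous_on_qpoch2 q)
  fix P show "continuous_on (U \<times> utorus) (%x. (if P \<inter> {i, j} = {} then fst x else 1) * (\<Prod>r\<in>P. u (snd x) $ r))"
   by (cases "P \<inter> {i, j} = {}") (auto intro!: continuous_intros cu)
 qed (auto intro!: continuous_intros simp: U_def)
 have cW: "continuous_on ((U \<times> utorus) \<times> -{0}) (%(x, y). W (fst x) (snd x) y)"
  unfolding W_def case_prod_unfold
  by (intro continuous_on_mult continuous_on_qpoch_base continuous_on_qtheta continuous_on_divide continuous_on_power
    continuous_on_const continuous_on_fst continuous_on_snd continuous_on_id continuous_on_fst_compose[OF cu] q)
   (use s q unz in \<open>auto simp: U_def\<close>)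
 have cij: "continuous_on (U \<times> utorus) (%x. u (snd x) $ i * u (snd x) $ j)"
  by (intro continuous_on_mult cu)
 have cij': "continuous_on (U \<times> utorus) (%x. qpoch2 (u (snd x) $ i * u (snd x) $ j) (fst x) q)"
  by (rule continuous_on_qpoch2[OF q(1) cij]) (auto intro!: continuous_intros simp: U_def)
 have cden: "continuous_on (U \<times> utorus) (%x. den (fst x) (snd x))"
  unfolding den_def
  by (intro continuous_on_mult continuous_on_qpoch continuous_on_qtheta continuous_on_divide
    continuous_on_const continuous_on_fst continuous_on_id cu q) (use s unz in auto)
 have "continuous_on (U \<times> utorus) (%(p, z). g p z)"
  unfolding g_def case_prod_unfold
 proof (intro continuous_on_divide continuous_on_mult cij' cpre cden)
  show "continuous_on (U \<times> utorus) (%x. qpoch (fst x) (fst x))" by (intro continuous_intros) (auto simp: U_def)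
  show "continuous_on (U \<times> utorus) (%x. qpoch q q)" by (rule continuous_on_const)
  show "\<forall>x\<in>U \<times> utorus. den (fst x) (snd x) ~= 0" using den by simp
  show "continuous_on (U \<times> utorus) (%x. kernel_integral (fst x) q (A (fst x) (snd x)) (B (fst x) (snd x)) (Cc (fst x) (snd x)) (D (fst x) (snd x)) (W (fst x) (snd x)))"
  proof (rule continuous_on_kernel_integral[OF q(1) _ _ cA _ _ cD _ _ cW])
   show "nonresonant (fst x) q (A (fst x) (snd x)) (B (fst x) (snd x))" if "x \<in> U \<times> utorus" for x
    by (rule nonresonant_radial[where af = "af (fst x)" and be = "um sg"]) (use that nA nu in \<open>auto simp: U_def B_def\<close>)
   show "W (fst x) (snd x) holomorphic_on -{0}" if "x \<in> U \<times> utorus" for x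
    unfolding W_def by (intro holomorphic_intros q) (use that s q unz in \<open>auto simp: U_def\<close>)
   show "continuous_on (U \<times> utorus) (%x. B (fst x) (snd x) r)" for r unfolding B_def by (rule cu)
   show "continuous_on (U \<times> utorus) (%x. Cc (fst x) (snd x) r)" for r
    unfolding Cc_def by (auto intro!: continuous_intros cu simp: unz)
  qed (auto intro!: continuous_intros simp: U_def)
 qed
 moreover have "E_m m p q (pscale (base_point (q ^ (m + 1)) k0 sg z) p (wij i j)) = g p z"
  if p: "p \<in> U - {0}" "norm p < 1" and z: "z \<in> utorus" for p z
 proof -
  have p0: "p ~= 0" and pU: "p \<in> U" using p by auto
  define \<pi> where "\<pi> = exp (Ln p / 2)"
  have pi0: "\<pi> ~= 0" by (simp add: \<pi>_def)
  have pi2: "\<pi> * \<pi> = p" using p0 by (simp add: \<pi>_def flip: exp_add)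
  define t where "t = pscale (u z) p (wij i j)"
  have half: "p powr of_real (1 / 2) = \<pi>" using p0 by (simp add: powr_def \<pi>_def)
  have mhalf: "p powr of_real (- 1 / 2) = 1 / \<pi>" using p0 by (simp add: powr_def \<pi>_def exp_minus inverse_eq_divide)
  have t: "t $ r = (if r = i | r = j then u z $ r / \<pi> else \<pi> * u z $ r)" for r
   unfolding t_def pscale_def using half mhalf by (simp add: wr)
  have H: "t \<in> H_m m p q"
   unfolding t_def u_def by (rule pscale_in_H_m[OF p0 base_point_Htilde[OF sg z] v])
  note unz = unz[OF z]
  define zt where "zt = 1 / \<pi>"
  have z0: "zt ~= 0" using pi0 by (simp add: zt_def)
  \<comment> \<open>Chosen so that t_i c = u_i s and t_j c = u_j s no longer involve p.\<close>
  define c where "c = s * \<pi>"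
  have c0: "c ~= 0" using s pi0 by (simp add: c_def)
  have tA: "vec_nth t = (%r. zt * A p z r)"
   by (rule ext) (use pi0 in \<open>simp add: t A_def zt_def pi2[symmetric]\<close>)
  have tB: "shifted p i j (vec_nth t) = (%r. B p z r / zt)"
   by (rule ext) (use pi0 in \<open>simp add: shifted_def t B_def zt_def pi2[symmetric]\<close>)
  have tC: "(%r. p * q / shifted p i j (vec_nth t) r) = (%r. zt * Cc p z r)"
   unfolding tB by (rule ext) (use pi0 in \<open>simp add: B_def Cc_def zt_def\<close>)
  have tD: "(%r. p * q / t $ r) = (%r. D p z r / zt)"
   by (rule ext) (use pi0 unz in \<open>simp add: t D_def zt_def pi2[symmetric] field_simps\<close>)
  have tij: "t $ i * t $ j = u z $ i * u z $ j / p" using pi0 by (simp add: t pi2[symmetric])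
  have W': "(%y. half_weight p q c (t $ i * t $ j * c) (zt * y)) = W p z"
  proof
   fix y
   have "p * (zt * y) ^ 2 = y ^ 2" "1 / (zt * y) ^ 2 = p / y ^ 2" "c * (zt * y) = s * y"
    using pi0 by (simp_all add: zt_def c_def power2_eq_square pi2[symmetric] field_simps)
   moreover have "q * (zt * y) / (t $ i * t $ j * c) = q * y / (u z $ i * u z $ j * s)"
    unfolding tij using pi0 unz s by (simp add: zt_def c_def pi2[symmetric] field_simps)
   ultimately show "half_weight p q c (t $ i * t $ j * c) (zt * y) = W p z y" unfolding half_weight_def W_def by (simp only:)
  qed
  have nrAB: "nonresonant p q (A p z) (B p z)"
   by (rule nonresonant_radial[where af = "af p" and be = "um sg"]) (use pU z nA nu in \<open>auto simp: U_def B_def\<close>)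
  have nr': "nonresonant p q (vec_nth t) (shifted p i j (vec_nth t))"
  proof -
   have "zt * A p z x * (B p z y / zt) = A p z x * B p z y" for x y using z0 by simp
   thus ?thesis using nrAB unfolding tB unfolding tA nonresonant_def by simp
  qed
  have hw: "half_weight p q c (t $ i * t $ j * c) holomorphic_on -{0}"
   by (rule holomorphic_half_weight) (use q p c0 pi0 p0 unz in \<open>auto simp: tij\<close>)
  have hi: "half_integral p q i j c (vec_nth t) = kernel_integral p q (A p z) (B p z) (Cc p z) (D p z) (W p z)"
   unfolding half_integral_def tC tD unfolding tB W'[symmetric]
   using kernel_integral_scale[OF q(1) p(2) hw z0 nrAB, of "Cc p z" "D p z"] tA by simp
  have pr: "pair_rest p q i j (vec_nth t) = pre p z" unfolding pair_rest_def pre_def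
  proof (rule prod.cong[OF refl])
   fix P assume "P \<in> {P::'n set. card P = 2} - {{i, j}}"
   then obtain x y where P: "P = {x, y}" "x ~= y" "{x, y} ~= {i, j}" by (auto simp: card_2_iff)
   have "(\<Prod>r\<in>P. t $ r) = (if P \<inter> {i, j} = {} then p else 1) * (\<Prod>r\<in>P. u z $ r)"
    using P pi0 ij by (auto simp: t pi2[symmetric] doubleton_eq_iff)
   thus "qpoch2 (\<Prod>r\<in>P. t $ r) p q = qpoch2 ((if P \<inter> {i, j} = {} then p else 1) * (\<Prod>r\<in>P. u z $ r)) p q" by simp
  qed
  have "t $ i * c = u z $ i * s" "t $ j * c = u z $ j * s" using pi0 by (simp_all add: t c_def)
  moreover have "q / (t $ i * t $ j) = q * p / (u z $ i * u z $ j)" "p * (t $ i * t $ j) = u z $ i * u z $ j"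
   unfolding tij using p0 by simp_all
  ultimately have "den p z * E_m m p q t = qpoch2 (u z $ i * u z $ j) p q * pre p z * qpoch p p * qpoch q q * kernel_integral p q (A p z) (B p z) (Cc p z) (D p z) (W p z)"
   using E_m_half_integral[OF p0 p(2) H ij c0 nr'] unfolding hi pr den_def by simp
  hence "E_m m p q t = g p z" using den[OF pU z] by (simp add: g_def field_simps)
  thus ?thesis by (simp add: t_def u_def)
 qed
 ultimately show "\<exists>U g. eventually (%p. p \<in> U) (nhds 0) & continuous_on (U \<times> utorus) (%(p, z). g p z) &
   (\<forall>p\<in>U - {0}. \<forall>z\<in>utorus. norm p < 1 --> E_m m p q (pscale (base_point (q ^ (m + 1)) k0 sg z) p (wij i j)) = g p z)"
  using U by blast
qed

lemma polytope_good: "af \<in> polytope_P m ==> good af"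
proof -
 have "polytope_P m \<subseteq> {af. good af}"
  unfolding polytope_P_def by (rule hull_minimal) (use good_vS good_wij good_convex in auto)
 thus "af \<in> polytope_P m ==> good af" by blast
qed

lemma polytope_sum:
 fixes af :: "real ^ 'n"
 assumes "af \<in> (polytope_P m :: (real ^ 'n) set)"
 shows "(\<Sum>r\<in>UNIV. af $ r) = real (m + 1)"
proof -
 have "polytope_P m \<subseteq> {af :: real ^ 'n. (\<Sum>r\<in>UNIV. af $ r) = real (m + 1)}"
  unfolding polytope_P_def
 proof (rule hull_minimal)
  show "{vS S | S. card S = m + 1} \<union> {wij i j | i j. i ~= j} \<subseteq> {af :: real ^ 'n. (\<Sum>r\<in>UNIV. af $ r) = real (m + 1)}"
   using sum_wij by (auto simp: vS_def sum.If_cases)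
  have lin: "(\<Sum>r\<in>UNIV. ((1 - s) *\<^sub>R x + s *\<^sub>R y) $ r) = (1 - s) * (\<Sum>r\<in>UNIV. x $ r) + s * (\<Sum>r\<in>UNIV. y $ r)" for x y :: "real ^ 'n" and s
   by (simp add: sum.distrib sum_distrib_left)
  show "convex {af :: real ^ 'n. (\<Sum>r\<in>UNIV. af $ r) = real (m + 1)}"
   unfolding convex_alt by (intro ballI allI impI) (simp only: lin mem_Collect_eq, simp add: algebra_simps)
 qed
 thus ?thesis using assms by blast
qed

end

theorem theorem5p2:
 fixes m :: nat and q :: complex
 assumes card: "CARD('n::finite) = 2 * m + 6"
  and q: "q \<noteq> 0" "norm q < 1"
 shows "(\<forall>\<alpha>\<in>(polytope_P m :: (real ^ 'n) set). \<forall>u\<in>(Htilde_m m q :: (complex ^ 'n) set).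
      \<exists>L. ((\<lambda>p. E_m m p q (pscale u p \<alpha>)) \<longlongrightarrow> L) (at 0))
   \<and> (\<forall>\<alpha> \<beta>. \<forall>u\<in>(Htilde_m m q :: (complex ^ 'n) set).
      same_open_face (polytope_P m) \<alpha> \<beta> \<longrightarrow>
      Lim (at 0) (\<lambda>p. E_m m p q (pscale u p \<alpha>)) =
      Lim (at 0) (\<lambda>p. E_m m p q (pscale u p \<beta>)))"
proof -
 \<comment> \<open>Any coordinate may serve as the dependent one, hence
   \<open>undefined\<close>.\<close>
 obtain \<rho> where "elliptic_base m q (undefined :: 'n) \<rho>" using exists_elliptic_base[OF card q(2,1)] by blast
 then interpret elliptic_base m q "undefined :: 'n" \<rho> .
 note limit = good_limit[OF polytope_good polytope_sum]
 show ?thesis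
 proof (intro conjI ballI allI impI)
  fix \<alpha> :: "real ^ 'n" and u :: "complex ^ 'n"
  assume "\<alpha> \<in> polytope_P m" "u \<in> Htilde_m m q"
  from limit[OF this(1) this(1) this(2)]
  show "\<exists>L. ((\<lambda>p. E_m m p q (pscale u p \<alpha>)) \<longlongrightarrow> L) (at 0)" by (rule exI)
 next
  fix \<alpha> \<beta> :: "real ^ 'n" and u :: "complex ^ 'n"
  assume u: "u \<in> Htilde_m m q" and "same_open_face (polytope_P m) \<alpha> \<beta>"
  then obtain F where F: "F face_of polytope_P m" "\<alpha> \<in> rel_interior F" "\<beta> \<in> rel_interior F"
   by (auto simp: same_open_face_def)
  have sub: "F \<subseteq> polytope_P m" using F(1) by (rule face_of_imp_subset)
  have "convex F" using F(1) by (rule face_of_imp_convex)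
  hence eq: "Lim (at 0) (\<lambda>p. wt p \<alpha> \<kappa>) = Lim (at 0) (\<lambda>p. wt p \<beta> \<kappa>)" for \<kappa>
   by (rule face_limits_eq[OF _ polytope_good[OF subsetD[OF sub]] F(2,3)])
  have P: "\<alpha> \<in> polytope_P m" "\<beta> \<in> polytope_P m" using F(2,3) rel_interior_subset sub by blast+
  show "Lim (at 0) (\<lambda>p. E_m m p q (pscale u p \<alpha>)) = Lim (at 0) (\<lambda>p. E_m m p q (pscale u p \<beta>))"
   unfolding tendsto_Lim[OF trivial_limit_at limit[OF P(1) P(1) u]] tendsto_Lim[OF trivial_limit_at limit[OF P(2) P(2) u]] eq ..
 qed
qed

end
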